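(* Let $p$ be an odd prime and let $H$ be a non-abelian metacyclic $p$-group. Let $\Gamma$ be a finite, connected, simple, undirected cubic (3-valent) edge-transitive graph which is a bi-Cayley graph over $H$. Then $p=3$, and either $\Gamma$ is isomorphic to the Gray graph, or $\Gamma$ is a normal bi-Cayley graph over $H$.
   Context: A graph $\Gamma$ is a bi-Cayley graph over a group $H$ if $\mathrm{Aut}(\Gamma)$ contains a subgroup isomorphic to $H$ acting semiregularly (all point stabilizers trivial) on $V(\Gamma)$ with exactly two orbits. Equivalently $\Gamma\cong \mathrm{BiCay}(H,R,L,S)$ for subsets $R=R^{-1}$, $L=L^{-1}$, $S$ of $H$ with $1\notin R\cup L$: vertex set $H_0\cup H_1$ with $H_i=\{h_i: h\in H\}$, edges $\{h_0,g_0\}$ for $gh^{-1}\in R$, $\{h_1,g_1\}$ for $gh^{-1}\in L$, and $\{h_0,g_1\}$ for $gh^{-1}\in S$; here $H$ acts by $R(g): h_i\mapsto (hg)_i$, giving a semiregular subgroup $R(H)\cong H$ of $\mathrm{Aut}(\Gamma)$ with orbits $H_0,H_1$. The bi-Cayley graph is called normal over $H$ if $R(H)$ is a normal subgroup of $\mathrm{Aut}(\Gamma)$. A group is metacyclic if it has a cyclic normal subgroup with cyclic quotient. A graph is edge-transitive if its automorphism group is transitive on its edges. The Gray graph is the cubic semisymmetric graph on 54 vertices (the smallest cubic semisymmetric graph). *)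

theory Defs
  imports
    "Graph_Theory.Graph_Theory"
    "HOL-Algebra.Elementary_Groups"
    "HOL-Algebra.Group_Action"
    "HOL-Computational_Algebra.Primes"
    "HOL-Library.Numeral_Type"
begin

text \<open>
  Finite simple undirected graphs are the \<^locale>\<open>pair_graph\<close>s of the AFP entry Graph\_Theory:
  finite symmetric loopless relations, an edge \<open>{u, v}\<close> being the pair of arcs \<open>(u, v)\<close>, \<open>(v, u)\<close>.
  Graph isomorphism is \<^const>\<open>digraph_iso\<close>.
\<close>

section \<open>Groups\<close>

definition p_group :: "nat \<Rightarrow> ('h, 'm) monoid_scheme \<Rightarrow> bool" where
  "p_group p H \<longleftrightarrow> group H \<and> (\<exists>n. order H = p ^ n)"

definition metacyclic :: "('h, 'm) monoid_scheme \<Rightarrow> bool" where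
  "metacyclic H \<longleftrightarrow>
    (\<exists>N. N \<lhd> H \<and> cyclic_group (H\<lparr>carrier := N\<rparr>) \<and> cyclic_group (H Mod N))"


section \<open>Automorphisms and symmetry of graphs\<close>

definition graph_aut :: "'v pair_pre_digraph \<Rightarrow> ('v \<Rightarrow> 'v) set" where
  "graph_aut G = {f \<in> Bij (pverts G).
     \<forall>u\<in>pverts G. \<forall>v\<in>pverts G. (u, v) \<in> parcs G \<longleftrightarrow> (f u, f v) \<in> parcs G}"

definition aut_group :: "'v pair_pre_digraph \<Rightarrow> ('v \<Rightarrow> 'v) monoid" where
  "aut_group G = BijGroup (pverts G)\<lparr>carrier := graph_aut G\<rparr>"

definition cubic :: "'v pair_pre_digraph \<Rightarrow> bool" where
  "cubic G \<longleftrightarrow> (\<forall>v\<in>pverts G. out_degree (with_proj G) v = 3)"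

definition vertex_transitive :: "'v pair_pre_digraph \<Rightarrow> bool" where
  "vertex_transitive G \<longleftrightarrow> (\<forall>u\<in>pverts G. \<forall>v\<in>pverts G. \<exists>f\<in>graph_aut G. f u = v)"

text \<open>Transitivity on undirected edges; an automorphism may reverse the chosen orientation.\<close>

definition edge_transitive :: "'v pair_pre_digraph \<Rightarrow> bool" where
  "edge_transitive G \<longleftrightarrow>
    (\<forall>(u, v)\<in>parcs G. \<forall>(x, y)\<in>parcs G. \<exists>f\<in>graph_aut G. {f u, f v} = {x, y})"


section \<open>Bi-Cayley graphs\<close>

definition semiregular_two_orbits :: "'v pair_pre_digraph \<Rightarrow> ('v \<Rightarrow> 'v) set \<Rightarrow> bool" where
  "semiregular_two_orbits G K \<longleftrightarrow>
    (\<forall>v\<in>pverts G. stabilizer (aut_group G\<lparr>carrier := K\<rparr>) (\<lambda>f. f) v = {\<one>\<^bsub>aut_group G\<^esub>}) \<and>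
    card (orbits (aut_group G\<lparr>carrier := K\<rparr>) (pverts G) (\<lambda>f. f)) = 2"

definition bi_cayley_graph :: "('h, 'm) monoid_scheme \<Rightarrow> 'v pair_pre_digraph \<Rightarrow> bool" where
  "bi_cayley_graph H G \<longleftrightarrow>
    (\<exists>K. subgroup K (aut_group G) \<and> aut_group G\<lparr>carrier := K\<rparr> \<cong> H \<and> semiregular_two_orbits G K)"

definition bicay_data :: "('h, 'm) monoid_scheme \<Rightarrow> 'h set \<Rightarrow> 'h set \<Rightarrow> 'h set \<Rightarrow> bool" where
  "bicay_data H R L S \<longleftrightarrow>
    R \<subseteq> carrier H \<and> L \<subseteq> carrier H \<and> S \<subseteq> carrier H \<and>
    (\<lambda>x. inv\<^bsub>H\<^esub> x) ` R = R \<and> (\<lambda>x. inv\<^bsub>H\<^esub> x) ` L = L \<and> \<one>\<^bsub>H\<^esub> \<notin> R \<union> L"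

text \<open>The vertices \<open>h\<^sub>0\<close> and \<open>h\<^sub>1\<close> are \<open>Inl h\<close> and \<open>Inr h\<close>.\<close>

definition BiCay ::
  "('h, 'm) monoid_scheme \<Rightarrow> 'h set \<Rightarrow> 'h set \<Rightarrow> 'h set \<Rightarrow> ('h + 'h) pair_pre_digraph" where
  "BiCay H R L S = \<lparr>
     pverts = carrier H <+> carrier H,
     parcs =
       {(Inl h, Inl g) | h g. h \<in> carrier H \<and> g \<in> carrier H \<and> g \<otimes>\<^bsub>H\<^esub> inv\<^bsub>H\<^esub> h \<in> R} \<union>
       {(Inr h, Inr g) | h g. h \<in> carrier H \<and> g \<in> carrier H \<and> g \<otimes>\<^bsub>H\<^esub> inv\<^bsub>H\<^esub> h \<in> L} \<union>
       {(Inl h, Inr g) | h g. h \<in> carrier H \<and> g \<in> carrier H \<and> g \<otimes>\<^bsub>H\<^esub> inv\<^bsub>H\<^esub> h \<in> S} \<union>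
       {(Inr g, Inl h) | h g. h \<in> carrier H \<and> g \<in> carrier H \<and> g \<otimes>\<^bsub>H\<^esub> inv\<^bsub>H\<^esub> h \<in> S}\<rparr>"

text \<open>
  The group usually written \<open>R(H)\<close>, as a set of permutations (extensional functions, as in
  \<^const>\<open>Bij\<close>) of the vertex set.
\<close>

definition right_translation :: "('h, 'm) monoid_scheme \<Rightarrow> 'h \<Rightarrow> 'h + 'h \<Rightarrow> 'h + 'h" where
  "right_translation H g =
    restrict (map_sum (\<lambda>h. h \<otimes>\<^bsub>H\<^esub> g) (\<lambda>h. h \<otimes>\<^bsub>H\<^esub> g)) (carrier H <+> carrier H)"

definition right_translations :: "('h, 'm) monoid_scheme \<Rightarrow> ('h + 'h \<Rightarrow> 'h + 'h) set" where
  "right_translations H = right_translation H ` carrier H"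

definition normal_BiCay ::
  "('h, 'm) monoid_scheme \<Rightarrow> 'h set \<Rightarrow> 'h set \<Rightarrow> 'h set \<Rightarrow> bool" where
  "normal_BiCay H R L S \<longleftrightarrow> right_translations H \<lhd> aut_group (BiCay H R L S)"

text \<open>
  Normality refers to the presentation of the graph as \<open>BiCay(H, R, L, S)\<close>.  For an abstract graph
  we ask for it in every presentation over \<open>H\<close> (and that there is one), so that the notion does not
  depend on a choice.
\<close>

definition normal_bi_cayley_graph :: "('h, 'm) monoid_scheme \<Rightarrow> 'v pair_pre_digraph \<Rightarrow> bool" where
  "normal_bi_cayley_graph H G \<longleftrightarrow>
    (\<exists>R L S. bicay_data H R L S \<and> digraph_iso (with_proj G) (with_proj (BiCay H R L S))) \<and>
    (\<forall>R L S. bicay_data H R L S \<and> digraph_iso (with_proj G) (with_proj (BiCay H R L S)) \<longrightarrow>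
       normal_BiCay H R L S)"


section \<open>The Gray graph\<close>

text \<open>
  The point-line incidence graph of the Gray configuration: the 27 points of a \<open>3 \<times> 3 \<times> 3\<close> grid and
  the 27 lines parallel to the coordinate axes.  The theorem \<open>gray_graph_semisymmetric\<close>
  below shows that it is a connected cubic semisymmetric graph on 54 vertices.
\<close>

type_synonym gray_point = "3 \<times> 3 \<times> 3"

definition lineX :: "3 \<Rightarrow> 3 \<Rightarrow> gray_point set" where "lineX y z = {(t, y, z) | t. True}"
definition lineY :: "3 \<Rightarrow> 3 \<Rightarrow> gray_point set" where "lineY x z = {(x, t, z) | t. True}"
definition lineZ :: "3 \<Rightarrow> 3 \<Rightarrow> gray_point set" where "lineZ x y = {(x, y, t) | t. True}"

definition gray_lines :: "gray_point set set" where
  "gray_lines = {lineX y z | y z. True} \<union> {lineY x z | x z. True} \<union> {lineZ x y | x y. True}"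

definition gray_graph :: "(gray_point + gray_point set) pair_pre_digraph" where
  "gray_graph = \<lparr>
     pverts = UNIV <+> gray_lines,
     parcs = {(Inl P, Inr l) | P l. l \<in> gray_lines \<and> P \<in> l} \<union>
             {(Inr l, Inl P) | P l. l \<in> gray_lines \<and> P \<in> l}\<rparr>"


lemma mem_line [simp]:
  "(a, b, c) \<in> lineX y z \<longleftrightarrow> b = y \<and> c = z"
  "(a, b, c) \<in> lineY x z \<longleftrightarrow> a = x \<and> c = z"
  "(a, b, c) \<in> lineZ x y \<longleftrightarrow> a = x \<and> b = y"
  by (auto simp: lineX_def lineY_def lineZ_def)

lemma line_eq [simp]:
  "lineX y z = lineX y' z' \<longleftrightarrow> y = y' \<and> z = z'"
  "lineY x z = lineY x' z' \<longleftrightarrow> x = x' \<and> z = z'"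
  "lineZ x y = lineZ x' y' \<longleftrightarrow> x = x' \<and> y = y'"
  "lineX y z \<noteq> lineY x z'" "lineX y z \<noteq> lineZ x y'" "lineY x z \<noteq> lineZ x' y"
  "lineY x z' \<noteq> lineX y z" "lineZ x y' \<noteq> lineX y z" "lineZ x' y \<noteq> lineY x z"
  by (simp_all add: set_eq_iff; metis zero_neq_one[where 'a = 3])+

lemma gray_linesE:
  assumes "l \<in> gray_lines"
  obtains y z where "l = lineX y z" | x z where "l = lineY x z" | x y where "l = lineZ x y"
  using assms unfolding gray_lines_def by blast

lemma line_in [simp]: "lineX y z \<in> gray_lines" "lineY x z \<in> gray_lines" "lineZ x y \<in> gray_lines"
  by (auto simp: gray_lines_def)

lemma gray_lines_conv:
  "gray_lines = case_prod lineX ` UNIV \<union> case_prod lineY ` UNIV \<union> case_prod lineZ ` UNIV"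
  by (auto simp: gray_lines_def)

lemma card_gray_lines: "card gray_lines = 27"
proof -
  have i: "inj (case_prod lineX)" "inj (case_prod lineY)" "inj (case_prod lineZ)"
    by (auto simp: inj_on_def)
  have "card (case_prod lineX ` UNIV) = 9" "card (case_prod lineY ` UNIV) = 9"
    "card (case_prod lineZ ` UNIV) = 9"
    using i by (simp_all add: card_image)
  moreover have "card gray_lines = card (case_prod lineX ` UNIV) + card (case_prod lineY ` UNIV)
      + card (case_prod lineZ ` UNIV)"
    unfolding gray_lines_conv
    by (subst card_Un_disjoint; (subst card_Un_disjoint)?) auto
  ultimately show ?thesis by simp
qed

lemma card_gray_verts: "card (pverts gray_graph) = 54"
  by (simp add: gray_graph_def card_Plus card_gray_lines)

lemma gray_arc_iff [simp]:
  "(Inl P, Inr l) \<in> parcs gray_graph \<longleftrightarrow> l \<in> gray_lines \<and> P \<in> l"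
  "(Inr l, Inl P) \<in> parcs gray_graph \<longleftrightarrow> l \<in> gray_lines \<and> P \<in> l"
  "(Inl P, Inl Q) \<notin> parcs gray_graph" "(Inr l, Inr m) \<notin> parcs gray_graph"
  by (auto simp: gray_graph_def simp del: split_paired_Ex)

lemma gray_vert_iff [simp]:
  "Inl P \<in> pverts gray_graph" "Inr l \<in> pverts gray_graph \<longleftrightarrow> l \<in> gray_lines"
  by (auto simp: gray_graph_def)

lemma finite_gray: "finite (pverts gray_graph)" "finite (parcs gray_graph)"
proof -
  show f: "finite (pverts gray_graph)" using card_gray_verts card.infinite by fastforce
  have "parcs gray_graph \<subseteq> pverts gray_graph \<times> pverts gray_graph"
    by (auto simp: gray_graph_def)
  then show "finite (parcs gray_graph)" using f finite_subset by blast
qed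

lemma pair_graph_gray: "pair_graph gray_graph"
  by unfold_locales
    (auto simp: finite_gray Digraph.symmetric_def sym_def, auto simp: gray_graph_def)

lemma cubic_gray: "cubic gray_graph"
proof -
  have "out_degree (with_proj gray_graph) v = 3" if v: "v \<in> pverts gray_graph" for v
  proof (cases v)
    case (Inl P)
    obtain a b c where P: "P = (a, b, c)" by (cases P)
    have "out_arcs (with_proj gray_graph) v =
        Pair v ` Inr ` {lineX b c, lineY a c, lineZ a b}"
      by (auto simp: out_arcs_def Inl P gray_graph_def elim!: gray_linesE)
    then show ?thesis by (simp add: out_degree_def card_image inj_on_def)
  next
    case (Inr l)
    then have l: "l \<in> gray_lines" using v by simp
    have "out_arcs (with_proj gray_graph) v = Pair v ` Inl ` l"
      using l by (auto simp: out_arcs_def Inr gray_graph_def)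
    then have "out_degree (with_proj gray_graph) v = card l"
      by (simp add: out_degree_def card_image inj_on_def)
    also have "card l = 3"
    proof -
      have "lineX y z = (\<lambda>t. (t, y, z)) ` UNIV" "lineY y z = (\<lambda>t. (y, t, z)) ` UNIV"
        "lineZ y z = (\<lambda>t. (y, z, t)) ` UNIV" for y z
        by (auto simp: lineX_def lineY_def lineZ_def)
      then show ?thesis using l by (auto simp: card_image inj_on_def elim!: gray_linesE)
    qed
    finally show ?thesis .
  qed
  then show ?thesis by (simp add: cubic_def)
qed

lemma connected_gray: "Digraph_Component.connected (with_proj gray_graph)"
proof -
  interpret pair_graph gray_graph by (rule pair_graph_gray)
  have step: "u \<rightarrow>\<^sup>*\<^bsub>with_proj gray_graph\<^esub> v" if "(u, v) \<in> parcs gray_graph" for u v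
    using that by (intro reachable_adjI) simp
  have pt: "Inl P \<rightarrow>\<^sup>*\<^bsub>with_proj gray_graph\<^esub> Inl Q" if "l \<in> gray_lines" "P \<in> l" "Q \<in> l" for P Q l
    by (rule reachable_trans[OF step[of "Inl P" "Inr l"] step[of "Inr l" "Inl Q"]]) (use that in simp_all)
  have pp: "Inl P \<rightarrow>\<^sup>*\<^bsub>with_proj gray_graph\<^esub> Inl Q" for P Q
  proof -
    obtain a b c x y z where P: "P = (a, b, c)" "Q = (x, y, z)" by (cases P, cases Q)
    show ?thesis unfolding P
      using pt[of "lineX b c" "(a,b,c)" "(x,b,c)"] pt[of "lineY x c" "(x,b,c)" "(x,y,c)"]
        pt[of "lineZ x y" "(x,y,c)" "(x,y,z)"] by (auto intro: reachable_trans)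
  qed
  have ne: "\<exists>P. P \<in> l" if "l \<in> gray_lines" for l
    using that by (auto simp: gray_lines_def lineX_def lineY_def lineZ_def)
  have "u \<rightarrow>\<^sup>*\<^bsub>with_proj gray_graph\<^esub> v" if uv: "u \<in> pverts gray_graph" "v \<in> pverts gray_graph" for u v
  proof -
    have "\<exists>P. u \<rightarrow>\<^sup>*\<^bsub>with_proj gray_graph\<^esub> Inl P"
    proof (cases u)
      case (Inl P) then show ?thesis using pp by blast
    next
      case (Inr l)
      then obtain P where "(u, Inl P) \<in> parcs gray_graph" using uv(1) ne[of l] by (auto simp del: split_paired_Ex)
      then show ?thesis using step by blast
    qed
    then obtain P where 1: "u \<rightarrow>\<^sup>*\<^bsub>with_proj gray_graph\<^esub> Inl P" by blast
    have "\<exists>Q. Inl Q \<rightarrow>\<^sup>*\<^bsub>with_proj gray_graph\<^esub> v"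
    proof (cases v)
      case (Inl P) then show ?thesis using pp by blast
    next
      case (Inr l)
      then obtain P where "(Inl P, v) \<in> parcs gray_graph" using uv(2) ne[of l] by (auto simp del: split_paired_Ex)
      then show ?thesis using step by blast
    qed
    then obtain Q where 2: "Inl Q \<rightarrow>\<^sup>*\<^bsub>with_proj gray_graph\<^esub> v" by blast
    show ?thesis using 1 2 pp reachable_trans by metis
  qed
  moreover have "pverts gray_graph \<noteq> {}" by (auto simp: gray_graph_def)
  ultimately have "strongly_connected (with_proj gray_graph)"
    by (auto simp: strongly_connected_def)
  then show ?thesis
    using reachable_mk_symmetric_eq[OF pair_sym_arcs]
    by (simp add: connected_def strongly_connected_def)
qed

definition grid_sym :: "(gray_point \<Rightarrow> gray_point) \<Rightarrow> bool" where
  "grid_sym \<phi> \<longleftrightarrow> bij \<phi> \<and> (\<lambda>l. \<phi> ` l) ` gray_lines = gray_lines"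

lemma grid_symI:
  assumes "inj \<phi>" "\<And>l. l \<in> gray_lines \<Longrightarrow> \<phi> ` l \<in> gray_lines"
  shows "grid_sym \<phi>"
proof -
  have "bij \<phi>" using assms(1) by (simp add: bij_def finite_UNIV_inj_surj)
  moreover have "finite gray_lines" using card_gray_lines card.infinite by fastforce
  then have "(\<lambda>l. \<phi> ` l) ` gray_lines = gray_lines"
    using assms by (intro endo_inj_surj) (auto simp: inj_on_def inj_image_eq_iff)
  ultimately show ?thesis by (simp add: grid_sym_def)
qed

lemma grid_sym_inv: "grid_sym \<phi> \<Longrightarrow> grid_sym (inv_into UNIV \<phi>)"
  unfolding grid_sym_def
  by (metis (no_types, lifting) bij_imp_bij_inv bij_is_inj image_inv_f_f image_cong image_image image_ident)

lemma grid_sym_comp: "grid_sym \<phi> \<Longrightarrow> grid_sym \<psi> \<Longrightarrow> grid_sym (\<phi> \<circ> \<psi>)"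
  unfolding grid_sym_def
  by (metis (no_types, lifting) bij_comp image_comp image_cong image_image)

lemma grid_sym_graph_aut:
  assumes "grid_sym \<phi>"
  shows "restrict (map_sum \<phi> (image \<phi>)) (pverts gray_graph) \<in> graph_aut gray_graph"
proof -
  have b: "bij \<phi>" and l: "image \<phi> ` gray_lines = gray_lines"
    using assms by (auto simp: grid_sym_def)
  have inj: "inj_on (map_sum \<phi> (image \<phi>)) (pverts gray_graph)"
    using b by (auto simp: inj_on_def gray_graph_def bij_def inj_image_eq_iff)
  have im: "map_sum \<phi> (image \<phi>) ` pverts gray_graph = pverts gray_graph"
  proof -
    have "map_sum \<phi> (image \<phi>) ` pverts gray_graph = range \<phi> <+> image \<phi> ` gray_lines"
      by (auto simp: gray_graph_def image_Un Plus_def image_image)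
    then show ?thesis using b l by (simp add: gray_graph_def bij_def)
  qed
  have "\<phi> ` m \<in> gray_lines" if "m \<in> gray_lines" for m using l that by blast
  moreover have "\<phi> P \<in> \<phi> ` m \<longleftrightarrow> P \<in> m" for P m using b by (simp add: bij_def inj_image_mem_iff)
  ultimately have "(u, v) \<in> parcs gray_graph \<longleftrightarrow>
      (map_sum \<phi> (image \<phi>) u, map_sum \<phi> (image \<phi>) v) \<in> parcs gray_graph"
    if "u \<in> pverts gray_graph" "v \<in> pverts gray_graph" for u v
    using that by (cases u; cases v) auto
  then show ?thesis using inj im
    by (auto simp: graph_aut_def Bij_def bij_betw_def inj_on_restrict_eq)
qed

lemma grid_sym_flag:
  assumes "l \<in> gray_lines" "P \<in> l"
  obtains \<phi> where "grid_sym \<phi>" "\<phi> (0, 0, 0) = P" "\<phi> ` lineX 0 0 = l"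
proof -
  obtain a b c where P: "P = (a, b, c)" by (cases P)
  let ?f = "\<lambda>(x, y, z). (x + a, y + b, z + c)"
  let ?r = "\<lambda>(x, y, z). (z, x, y) :: gray_point"
  have img: "?f ` A = {(x, y, z). (x - a, y - b, z - c) \<in> A}" for A
    by (force simp: image_iff)
  have imr: "?r ` A = {(x, y, z). (y, z, x) \<in> A}" for A
    by (force simp: image_iff)
  have f: "grid_sym ?f"
  proof (rule grid_symI)
    fix l assume "l \<in> gray_lines"
    moreover have "?f ` lineX y z = lineX (y + b) (z + c)" "?f ` lineY x z = lineY (x + a) (z + c)"
      "?f ` lineZ x y = lineZ (x + a) (y + b)" for x y z
      unfolding img by (auto simp: algebra_simps)
    ultimately show "?f ` l \<in> gray_lines" by (auto elim!: gray_linesE)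
  qed (auto simp: inj_on_def)
  have imrl: "?r ` lineX y z = lineY z y" "?r ` lineY x z = lineZ z x"
      "?r ` lineZ x y = lineX x y" for x y z
    unfolding imr by auto
  have r: "grid_sym ?r"
    by (rule grid_symI) (auto simp: inj_on_def imrl elim!: gray_linesE)
  show ?thesis using assms(1)
  proof (cases rule: gray_linesE)
    case (1 y z)
    then have "?f ` lineX 0 0 = l" using assms(2) P unfolding img by (auto simp: algebra_simps)
    then show ?thesis using f P by (intro that[of ?f]) auto
  next
    case (2 x z)
    have "(?f \<circ> ?r) ` lineX 0 0 = l" using assms(2) P 2
      unfolding image_comp[symmetric] imrl img by (auto simp: algebra_simps)
    then show ?thesis using grid_sym_comp[OF f r] P by (intro that[of "?f \<circ> ?r"]) auto
  next
    case (3 x y)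
    have "(?f \<circ> (?r \<circ> ?r)) ` lineX 0 0 = l" using assms(2) P 3
      unfolding image_comp[symmetric] imrl img by (auto simp: algebra_simps)
    then show ?thesis using grid_sym_comp[OF f grid_sym_comp[OF r r]] P
      by (intro that[of "?f \<circ> (?r \<circ> ?r)"]) auto
  qed
qed

lemma edge_transitive_gray: "edge_transitive gray_graph"
proof -
  have main: "\<exists>f\<in>graph_aut gray_graph. f (Inl P) = Inl Q \<and> f (Inr l) = Inr m"
    if flags: "l \<in> gray_lines" "P \<in> l" "m \<in> gray_lines" "Q \<in> m" for P Q l m
  proof -
    obtain \<phi> where p: "grid_sym \<phi>" "\<phi> (0, 0, 0) = P" "\<phi> ` lineX 0 0 = l"
      by (rule grid_sym_flag[OF flags(1,2)])
    obtain \<psi> where q: "grid_sym \<psi>" "\<psi> (0, 0, 0) = Q" "\<psi> ` lineX 0 0 = m"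
      by (rule grid_sym_flag[OF flags(3,4)])
    let ?c = "\<psi> \<circ> inv_into UNIV \<phi>"
    have c: "grid_sym ?c" using p q grid_sym_inv grid_sym_comp by blast
    have "inj \<phi>" using p(1) by (auto simp: grid_sym_def bij_def)
    then have "inv_into UNIV \<phi> P = (0, 0, 0)" "inv_into UNIV \<phi> ` l = lineX 0 0"
      using p(2,3) inv_f_f[of \<phi> "(0, 0, 0)"] image_inv_f_f[of \<phi> "lineX 0 0"] by auto
    then have "?c P = Q" "?c ` l = m"
      using q by (simp_all only: image_comp[symmetric] o_apply)
    then show ?thesis using grid_sym_graph_aut[OF c] flags(1)
      by (intro bexI[of _ "restrict (map_sum ?c (image ?c)) (pverts gray_graph)"]) auto
  qed
  have arc: "\<exists>P l. l \<in> gray_lines \<and> P \<in> l \<and> {u, v} = {Inl P, Inr l}"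
    if "(u, v) \<in> parcs gray_graph" for u v
  proof (cases u)
    case (Inl P)
    with that obtain l where "v = Inr l" by (cases v) auto
    with that Inl show ?thesis by (intro exI[of _ P] exI[of _ l]) simp
  next
    case (Inr l)
    with that obtain P where "v = Inl P" by (cases v) (simp_all del: split_paired_All split_paired_all)
    with that Inr show ?thesis by (intro exI[of _ P] exI[of _ l]) (simp add: insert_commute)
  qed
  show ?thesis unfolding edge_transitive_def
  proof (clarify)
    fix u v x y assume uv: "(u, v) \<in> parcs gray_graph" and xy: "(x, y) \<in> parcs gray_graph"
    obtain P l where Pl: "l \<in> gray_lines" "P \<in> l" "{u, v} = {Inl P, Inr l}"
      using arc[OF uv] by blast
    obtain Q m where Qm: "m \<in> gray_lines" "Q \<in> m" "{x, y} = {Inl Q, Inr m}"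
      using arc[OF xy] by blast
    obtain f where f: "f \<in> graph_aut gray_graph" "f (Inl P) = Inl Q" "f (Inr l) = Inr m"
      using main[OF Pl(1,2) Qm(1,2)] by blast
    have "{f u, f v} = f ` {u, v}" by simp
    also have "\<dots> = {x, y}" unfolding Pl(3) Qm(3) using f by simp
    finally show "\<exists>f\<in>graph_aut gray_graph. {f u, f v} = {x, y}" using f(1) by blast
  qed
qed

text \<open>
  An invariant separating lines from points: two coplanar parallel lines meet three common lines,
  whereas two non-collinear points are collinear with at most two common points.
\<close>

definition common_neighbour :: "'v pair_pre_digraph \<Rightarrow> 'v \<Rightarrow> 'v \<Rightarrow> bool" where
  "common_neighbour G u v \<longleftrightarrow> (\<exists>w\<in>pverts G. (u, w) \<in> parcs G \<and> (w, v) \<in> parcs G)"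

definition three_common :: "'v pair_pre_digraph \<Rightarrow> 'v \<Rightarrow> bool" where
  "three_common G v \<longleftrightarrow> (\<exists>w\<in>pverts G. \<exists>a\<in>pverts G. \<exists>b\<in>pverts G. \<exists>c\<in>pverts G.
     \<not> common_neighbour G v w \<and> a \<noteq> b \<and> a \<noteq> c \<and> b \<noteq> c \<and>
     common_neighbour G v a \<and> common_neighbour G v b \<and> common_neighbour G v c \<and> common_neighbour G w a \<and> common_neighbour G w b \<and> common_neighbour G w c)"

lemma common_neighbour_aut:
  assumes "f \<in> graph_aut G" "u \<in> pverts G" "v \<in> pverts G"
  shows "common_neighbour G (f u) (f v) \<longleftrightarrow> common_neighbour G u v"
proof -
  have im: "f ` pverts G = pverts G" using assms(1) by (auto simp: graph_aut_def Bij_def bij_betw_def)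
  have "common_neighbour G (f u) (f v) \<longleftrightarrow> (\<exists>w\<in>f ` pverts G. (f u, w) \<in> parcs G \<and> (w, f v) \<in> parcs G)"
    by (simp add: common_neighbour_def im)
  also have "\<dots> \<longleftrightarrow> common_neighbour G u v"
    using assms by (auto simp: common_neighbour_def graph_aut_def)
  finally show ?thesis .
qed

lemma three_common_aut:
  assumes f: "f \<in> graph_aut G" and v: "v \<in> pverts G" and w: "three_common G v"
  shows "three_common G (f v)"
proof -
  have b: "inj_on f (pverts G)" "\<And>x. x \<in> pverts G \<Longrightarrow> f x \<in> pverts G"
    using f by (auto simp: graph_aut_def Bij_def bij_betw_def)
  obtain w a b c where *: "w \<in> pverts G" "a \<in> pverts G" "b \<in> pverts G" "c \<in> pverts G"
     "\<not> common_neighbour G v w" "a \<noteq> b" "a \<noteq> c" "b \<noteq> c"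
     "common_neighbour G v a" "common_neighbour G v b" "common_neighbour G v c"
     "common_neighbour G w a" "common_neighbour G w b" "common_neighbour G w c"
    using w unfolding three_common_def by blast
  show ?thesis unfolding three_common_def
    by (rule bexI[of _ "f w"], rule bexI[of _ "f a"], rule bexI[of _ "f b"], rule bexI[of _ "f c"])
       (use * b v in \<open>auto simp: common_neighbour_aut[OF f] inj_on_eq_iff\<close>)
qed

lemma gray_common_points:
  "common_neighbour gray_graph (Inl (a, b, c)) u \<longleftrightarrow>
     (\<exists>x y z. u = Inl (x, y, z) \<and> (b = y \<and> c = z \<or> a = x \<and> c = z \<or> a = x \<and> b = y))"
proof
  assume "common_neighbour gray_graph (Inl (a, b, c)) u"
  then obtain w where w: "(Inl (a, b, c), w) \<in> parcs gray_graph" "(w, u) \<in> parcs gray_graph"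
    by (auto simp: common_neighbour_def)
  then obtain l P where l: "l \<in> gray_lines" "(a, b, c) \<in> l" "u = Inl P" "P \<in> l"
    by (cases w; cases u) auto
  obtain x y z where "P = (x, y, z)" by (cases P)
  then show "\<exists>x y z. u = Inl (x, y, z) \<and> (b = y \<and> c = z \<or> a = x \<and> c = z \<or> a = x \<and> b = y)"
    using l by (auto elim!: gray_linesE)
next
  assume "\<exists>x y z. u = Inl (x, y, z) \<and> (b = y \<and> c = z \<or> a = x \<and> c = z \<or> a = x \<and> b = y)"
  then obtain x y z where u: "u = Inl (x, y, z)"
    and *: "b = y \<and> c = z \<or> a = x \<and> c = z \<or> a = x \<and> b = y" by blast
  then have "\<exists>l\<in>gray_lines. (a, b, c) \<in> l \<and> (x, y, z) \<in> l"
    by (metis line_in mem_line)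
  then show "common_neighbour gray_graph (Inl (a, b, c)) u"
    unfolding common_neighbour_def u by (metis gray_arc_iff(1,2) gray_vert_iff(2))
qed

lemma gray_common_lines:
  "common_neighbour gray_graph (Inr (lineX y z)) (Inr (lineY x z')) \<longleftrightarrow> z = z'"
  "common_neighbour gray_graph (Inr (lineX y z)) (Inr (lineX y' z')) \<longleftrightarrow> y = y' \<and> z = z'"
  by (auto simp: common_neighbour_def gray_graph_def)

lemma not_vertex_transitive_gray: "\<not> vertex_transitive gray_graph"
proof
  assume vt: "vertex_transitive gray_graph"
  have "three_common gray_graph (Inr (lineX 0 0))"
    unfolding three_common_def
    by (rule bexI[of _ "Inr (lineX 1 0)"], rule bexI[of _ "Inr (lineY 0 0)"],
        rule bexI[of _ "Inr (lineY 1 0)"], rule bexI[of _ "Inr (lineY 2 0)"])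
       (auto simp: gray_common_lines)
  moreover have "\<not> three_common gray_graph (Inl (0, 0, 0))"
  proof
    assume "three_common gray_graph (Inl (0, 0, 0))"
    then obtain w a b c where w: "w \<in> pverts gray_graph"
      and not_coll: "\<not> common_neighbour gray_graph (Inl (0, 0, 0)) w"
      and dist: "a \<noteq> b" "a \<noteq> c" "b \<noteq> c"
      and coll0: "common_neighbour gray_graph (Inl (0, 0, 0)) a"
        "common_neighbour gray_graph (Inl (0, 0, 0)) b"
        "common_neighbour gray_graph (Inl (0, 0, 0)) c"
      and collw: "common_neighbour gray_graph w a" "common_neighbour gray_graph w b"
        "common_neighbour gray_graph w c"
      unfolding three_common_def by blast
    have "\<exists>W. w = Inl W"
      using coll0(1) collw(1) by (cases w) (auto simp: common_neighbour_def gray_graph_def)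
    then obtain x y z where W: "w = Inl (x, y, z)" by auto
    have nz: "\<not> (y = 0 \<and> z = 0)" "\<not> (x = 0 \<and> z = 0)" "\<not> (x = 0 \<and> y = 0)"
      using not_coll by (auto simp: W gray_common_points)
    have "\<exists>p q. \<forall>u. common_neighbour gray_graph (Inl (0, 0, 0)) u \<and>
        common_neighbour gray_graph w u \<longrightarrow> u = p \<or> u = q"
    proof -
      consider "x = 0" | "y = 0" | "x \<noteq> 0" "y \<noteq> 0" by blast
      then show ?thesis
      proof cases
        case 1
        have "u = Inl (0, y, 0) \<or> u = Inl (0, 0, z)"
          if "common_neighbour gray_graph (Inl (0, 0, 0)) u" "common_neighbour gray_graph w u" for u
          using that nz 1 by (cases u) (auto simp: W gray_common_points)
        then show ?thesis by blast
      next
        case 2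
        have "u = Inl (x, 0, 0) \<or> u = Inl (0, 0, z)"
          if "common_neighbour gray_graph (Inl (0, 0, 0)) u" "common_neighbour gray_graph w u" for u
          using that nz 2 by (cases u) (auto simp: W gray_common_points)
        then show ?thesis by blast
      next
        case 3
        have "u = Inl (x, 0, 0) \<or> u = Inl (0, y, 0)"
          if "common_neighbour gray_graph (Inl (0, 0, 0)) u" "common_neighbour gray_graph w u" for u
          using that nz 3 by (cases u) (auto simp: W gray_common_points)
        then show ?thesis by blast
      qed
    qed
    then obtain p q where "\<And>u. common_neighbour gray_graph (Inl (0, 0, 0)) u \<Longrightarrow>
        common_neighbour gray_graph w u \<Longrightarrow> u = p \<or> u = q" by blast
    then show False using dist coll0 collw by metis
  qed
  ultimately show False
    using vt three_common_aut unfolding vertex_transitive_def by (metis gray_vert_iff line_in(1))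
qed

theorem gray_graph_semisymmetric:
  "pair_graph gray_graph" "card (pverts gray_graph) = 54"
  "Digraph_Component.connected (with_proj gray_graph)" "cubic gray_graph"
  "edge_transitive gray_graph" "\<not> vertex_transitive gray_graph"
  by (fact pair_graph_gray card_gray_verts connected_gray cubic_gray edge_transitive_gray
      not_vertex_transitive_gray)+

end

theory Submission
  imports
    Defs
    "HOL-Algebra.Sylow"
    "HOL-Number_Theory.Residues"
begin

text \<open>
  Let \<open>A\<close> be the automorphism group; as \<open>\<Gamma>\<close> is cubic and edge-transitive, every vertex stabiliser in \<open>A\<close>
  is transitive on the three neighbours, and an automorphism of prime order \<open>p\<close>
  fixes no vertex if \<open>p \<ge> 5\<close> and no arc if \<open>p = 3\<close>.

  If \<open>p \<ge> 5\<close>, the translation group \<open>R(H)\<close> is a Sylow \<open>p\<close>-subgroup of \<open>A\<close>. Transfer, with fusion controlled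
  along the chain of normalisers of the subgroups of the cyclic group \<open>H'\<close>, shows that a finite group with
  a non-abelian metacyclic Sylow \<open>p\<close>-subgroup, \<open>p\<close> odd, has a quotient of order \<open>p\<close>. The kernel contains all
  vertex stabilisers, and these generate a subgroup with at most two orbits: a contradiction.

  If \<open>p = 3\<close>, the normaliser of \<open>R(H)\<close> contains an element of order 3 fixing \<open>1\<^sub>0\<close>. Hence \<open>R\<close> and \<open>L\<close> are empty,
  \<open>S = {s0, s1, s2}\<close>, and \<open>H\<close> is generated by \<open>a = s0\<^sup>-\<^sup>1 s1\<close> and \<open>b = s0\<^sup>-\<^sup>1 s2\<close>, which an automorphism of \<open>H\<close> sends
  to \<open>a\<^sup>-\<^sup>1 b\<close> and \<open>a\<^sup>-\<^sup>1\<close>. Being metacyclic, \<open>H\<close> has class 2 with \<open>k = [a, b]\<close> of order 3, and the pairs \<open>(m, n)\<close>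
  with \<open>a\<^sup>m b\<^sup>n \<in> \<langle>k\<rangle>\<close> form an ideal \<open>3 I\<close> of the Eisenstein integers. For \<open>I = (1)\<close> the group has order 27 and
  the graph is the Gray graph. Otherwise the number of closed walks of length 12 through a path of
  length 3 tells whether the first and the last edge of the path belong to the same element of \<open>S\<close>. So
  automorphisms permute the three edge classes, and \<open>R(H)\<close>, the group preserving all edge classes and both
  halves, is normal.
\<close>

section \<open>Orbit counting and Sylow subgroups\<close>

text \<open>No bound on the order of \<open>A\<close> is available, so only local transitivity can
  be exploited. For \<open>p \<ge> 5\<close> a functional on \<open>P\<close> modulo
  \<open>p\<close> survives the transfer only if conjugation in \<open>A\<close> respects its value.
  The normaliser of \<open>P\<close> would guarantee this if the powers \<open>c [^] (p ^ j)\<close>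
  of a generator of \<open>P'\<close> were central in \<open>P\<close>; they are so only modulo the
  next power. Hence the climb through one normaliser at a time, with a weak closure argument at each
  stage. For \<open>p = 3\<close> the translations need not be Sylow, since 3 divides the
  stabilisers; it is this very factor 3 that forces the rotation normalising \<open>R(H)\<close>.
  The length 12 has a geometric origin. Modulo \<open>k\<close> the graph is a quotient of the
  hexagonal tiling by its three edge classes, and going round one hexagon multiplies by
  \<open>k\<close> or its inverse. So a walk that closes in the tiling closes in the graph iff the
  signed number of enclosed hexagons is divisible by 3, and three hexagons around a vertex have a
  boundary of length 12.\<close>

lemma (in group) card_fixed_points_cong:
  fixes \<phi> :: "'a \<Rightarrow> 'x \<Rightarrow> 'x"
  assumes p: "Factorial_Ring.prime (p::nat)" and ord: "order G = p ^ n" and X: "finite X"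
    and closed: "\<And>g x. g \<in> carrier G \<Longrightarrow> x \<in> X \<Longrightarrow> \<phi> g x \<in> X"
    and one: "\<And>x. x \<in> X \<Longrightarrow> \<phi> \<one> x = x"
    and mult: "\<And>g h x. g \<in> carrier G \<Longrightarrow> h \<in> carrier G \<Longrightarrow> x \<in> X \<Longrightarrow> \<phi> (g \<otimes> h) x = \<phi> g (\<phi> h x)"
  shows "[card {x \<in> X. \<forall>g\<in>carrier G. \<phi> g x = x} = card X] (mod p)"
proof -
  \<comment> \<open>\<open>BijGroup X\<close> consists of extensional functions, so the action is
    cut down to \<open>X\<close> before orbits and stabilisers can be formed.\<close>
  define \<psi> where "\<psi> = (\<lambda>g. restrict (\<phi> g) X)"
  have bij: "\<psi> g \<in> Bij X" if g: "g \<in> carrier G" for g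
  proof -
    have "bij_betw (\<psi> g) X X"
    proof (rule bij_betwI[where g = "\<psi> (inv g)"])
      show "\<psi> g \<in> X \<rightarrow> X" "\<psi> (inv g) \<in> X \<rightarrow> X" using g closed by (auto simp: \<psi>_def)
      fix x assume x: "x \<in> X"
      show "\<psi> (inv g) (\<psi> g x) = x" "\<psi> g (\<psi> (inv g) x) = x"
        using g x closed mult[of "inv g" g x] mult[of g "inv g" x] one[OF x]
        by (simp_all add: \<psi>_def)
    qed
    then show ?thesis by (simp add: Bij_def \<psi>_def)
  qed
  have hom: "\<psi> \<in> hom G (BijGroup X)"
  proof (rule homI)
    fix g h assume gh: "g \<in> carrier G" "h \<in> carrier G"
    show "\<psi> (g \<otimes> h) = \<psi> g \<otimes>\<^bsub>BijGroup X\<^esub> \<psi> h"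
      using gh bij closed mult by (auto simp: BijGroup_def \<psi>_def compose_def)
  qed (use bij in \<open>simp add: BijGroup_def\<close>)
  interpret A: group_action G X \<psi>
    using hom by (simp add: group_action_def group_hom_def group_hom_axioms_def group_BijGroup is_group)
  have fin_orb: "finite (orbits G X \<psi>)"
    by (rule finite_UnionD) (simp add: X A.orbits_coverture)
    let ?F = "{x \<in> X. \<forall>g\<in>carrier G. \<phi> g x = x}"
  let ?one = "{O' \<in> orbits G X \<psi>. card O' = 1}"
  have sing: "orbit G \<psi> x = {x}" if "x \<in> ?F" for x
    using that by (auto simp: orbit_def \<psi>_def intro!: exI[of _ \<one>])
  have single: "?one = (\<lambda>x. {x}) ` ?F"
  proof (intro equalityI subsetI)
    fix O' assume "O' \<in> ?one"
    then obtain x where x: "x \<in> X" "O' = orbit G \<psi> x" "card O' = 1" by (auto simp: orbits_def)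
    have "x \<in> O'" using x A.orbit_refl by simp
    then have "O' = {x}" using x(3) unfolding One_nat_def[symmetric] by (elim card_1_singletonE) simp
    then have "\<phi> g x = x" if "g \<in> carrier G" for g
    proof -
      have "\<psi> g x \<in> orbit G \<psi> x" using that by (auto simp: orbit_def)
      then show ?thesis using \<open>O' = {x}\<close> x(1,2) by (simp add: \<psi>_def)
    qed
    then show "O' \<in> (\<lambda>x. {x}) ` ?F" using x(1) \<open>O' = {x}\<close> by blast
  next
    fix O' assume "O' \<in> (\<lambda>x. {x}) ` ?F"
    then obtain x where x: "x \<in> ?F" "O' = {x}" by blast
    then have "O' = orbit G \<psi> x" using sing by simp
    moreover have "O' \<in> orbits G X \<psi>" using x(1) \<open>O' = orbit G \<psi> x\<close> unfolding orbits_def by blast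
    moreover have "card O' = 1" unfolding x(2) by simp
    ultimately show "O' \<in> ?one" by blast
  qed
  have cardF: "card ?one = card ?F"
    unfolding single by (rule card_image) (simp add: inj_on_def)
  have div: "p dvd card O'" if O': "O' \<in> orbits G X \<psi> - ?one" for O'
  proof -
    obtain x where x: "x \<in> X" "O' = orbit G \<psi> x" using O' unfolding orbits_def by blast
    have "p ^ n = card O' * card (stabilizer G \<psi> x)" using A.orbit_stabilizer_theorem[OF x(1)] x(2) ord by simp
    then have "card O' dvd p ^ n" by (rule dvdI)
    then obtain k where "card O' = p ^ k" using divides_primepow_nat[OF p] by blast
    moreover have "card O' \<noteq> 1" using O' by blast
    ultimately have "k \<noteq> 0" by (intro notI) simp
    then show ?thesis using \<open>card O' = p ^ k\<close> by simp
  qed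
  have "card X = (\<Sum>O'\<in>orbits G X \<psi>. card O')"
    using A.disjoint_sum[OF X, of "\<lambda>_. 1::nat"] by simp
  also have "\<dots> = (\<Sum>O'\<in>?one. card O') + (\<Sum>O'\<in>orbits G X \<psi> - ?one. card O')"
    using sum.subset_diff[of ?one "orbits G X \<psi>" card] fin_orb by (simp only: add.commute) blast
  also have "(\<Sum>O'\<in>?one. card O') = card ?F" unfolding cardF[symmetric] by simp
  finally have "card X = card ?F + (\<Sum>O'\<in>orbits G X \<psi> - ?one. card O')" .
  moreover have "p dvd (\<Sum>O'\<in>orbits G X \<psi> - ?one. card O')" using div by (rule dvd_sum)
  ultimately have "card X mod p = card ?F mod p" by (elim dvdE) simp
  then show ?thesis by (simp add: cong_def)
qed

section \<open>Cosets and conjugacy of Sylow subgroups\<close>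

lemma (in group) m_inv_cancel [simp]:
  assumes "x \<in> carrier G" "y \<in> carrier G"
  shows "x \<otimes> (inv x \<otimes> y) = y" "inv x \<otimes> (x \<otimes> y) = y"
  using assms by (simp_all add: m_assoc[symmetric])

text \<open>Maximality is expressed by the index, so no exponent of \<open>p\<close> in the order of
  \<open>G\<close> has to be carried along when passing to subgroups and quotients.\<close>

definition sylow_sub :: "nat \<Rightarrow> ('a, 'b) monoid_scheme \<Rightarrow> 'a set \<Rightarrow> bool" where
  "sylow_sub p G P \<longleftrightarrow> subgroup P G \<and> (\<exists>a. card P = p ^ a) \<and> \<not> p dvd order G div card P"

lemma (in group) card_subgroup_dvd:
  assumes "finite (carrier G)" "subgroup P G" "subgroup C G" "P \<subseteq> C"
  shows "card P dvd card C" and "card ((\<lambda>g. P #> g) ` C) * card P = card C"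
proof -
  interpret C: group "G\<lparr>carrier := C\<rparr>" using assms(3) subgroup.subgroup_is_group is_group by blast
  have P: "subgroup P (G\<lparr>carrier := C\<rparr>)" using assms subgroup_incl by blast
  have "rcosets\<^bsub>G\<lparr>carrier := C\<rparr>\<^esub> P = (\<lambda>g. P #> g) ` C" by (auto simp: RCOSETS_def)
  then show *: "card ((\<lambda>g. P #> g) ` C) * card P = card C"
    using C.lagrange[OF P] by (simp add: order_def)
  show "card P dvd card C" using * by (metis dvd_triv_right)
qed

lemma (in group) subgroup_finite:
  "finite (carrier G) \<Longrightarrow> subgroup P G \<Longrightarrow> finite P"
  using subgroup.subset finite_subset by blast

lemma (in group) subgroup_card_pos:
  assumes "finite (carrier G)" "subgroup P G" shows "0 < card P"
  using assms subgroup_finite subgroup.one_closed card_gt_0_iff by blast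

lemma (in group) sylow_sub_index:
  assumes "finite (carrier G)" "sylow_sub p G P" "subgroup C G" "P \<subseteq> C"
  shows "\<not> p dvd card ((\<lambda>g. P #> g) ` C)"
proof
  assume *: "p dvd card ((\<lambda>g. P #> g) ` C)"
  have P: "subgroup P G" using assms(2) by (simp add: sylow_sub_def)
  obtain k where k: "order G = card C * k"
    using card_subgroup_dvd(1)[OF assms(1,3) subgroup_self subgroup.subset[OF assms(3)]] by (auto simp: order_def)
  have "order G = card ((\<lambda>g. P #> g) ` C) * k * card P"
    using k card_subgroup_dvd(2)[OF assms(1) P assms(3,4)] by simp
  then have "order G div card P = card ((\<lambda>g. P #> g) ` C) * k"
    using subgroup_card_pos[OF assms(1) P] by simp
  then show False using * assms(2) by (simp add: sylow_sub_def)
qed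

lemma (in group) rcos_eq_iff:
  assumes "subgroup P G" "x \<in> carrier G" "y \<in> carrier G"
  shows "P #> x = P #> y \<longleftrightarrow> x \<otimes> inv y \<in> P"
proof
  assume "P #> x = P #> y"
  then have "x \<in> P #> y" using rcos_self[OF assms(2,1)] by simp
  then obtain h where "h \<in> P" "x = h \<otimes> y" by (auto simp: r_coset_def)
  then show "x \<otimes> inv y \<in> P" using assms by (simp add: m_assoc subgroup.mem_carrier[OF assms(1)])
next
  assume "x \<otimes> inv y \<in> P"
  moreover have "x = (x \<otimes> inv y) \<otimes> y" using assms by (simp add: m_assoc)
  ultimately have "x \<in> P #> y" by (auto simp: r_coset_def)
  then show "P #> x = P #> y" using repr_independence[of x P y] assms by simp
qed

text \<open>\<open>Q\<close> acts on the cosets of \<open>P\<close> in \<open>C\<close>, whose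
  number is prime to \<open>p\<close>, so it fixes one; a fixed coset \<open>P #> g\<close> means
  that \<open>g\<close> conjugates \<open>Q\<close> into \<open>P\<close>. The point is that
  \<open>g\<close> is found inside \<open>C\<close>: all fusion arguments below take for
  \<open>C\<close> the group of elements preserving whatever must not be disturbed.\<close>

lemma (in group) sylow_conj:
  assumes fin: "finite (carrier G)" and p: "Factorial_Ring.prime p" and P: "sylow_sub p G P"
    and C: "subgroup C G" "P \<subseteq> C" and Q: "subgroup Q G" "Q \<subseteq> C" "card Q = p ^ b"
  shows "\<exists>g\<in>C. \<forall>q\<in>Q. g \<otimes> q \<otimes> inv g \<in> P"
proof -
  have sP: "subgroup P G" using P by (simp add: sylow_sub_def)
  note Pc = subgroup.mem_carrier[OF sP] and Cc = subgroup.mem_carrier[OF C(1)] and Qc = subgroup.mem_carrier[OF Q(1)]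
  interpret Q: group "G\<lparr>carrier := Q\<rparr>" using Q(1) subgroup.subgroup_is_group is_group by blast
  let ?X = "(\<lambda>g. P #> g) ` C"
  \<comment> \<open>The inverse turns right multiplication into an action from the left.\<close>
  let ?f = "\<lambda>q X. X #> inv q"
  have sub: "P #> g \<subseteq> carrier G" if "g \<in> C" for g
    using that sP Cc by (simp add: r_coset_subset_G subgroup.subset)
  have fin_X: "finite ?X" using fin C(1) by (simp add: subgroup_finite)
  have "[card {X \<in> ?X. \<forall>q\<in>carrier (G\<lparr>carrier := Q\<rparr>). ?f q X = X} = card ?X] (mod p)"
  proof (rule Q.card_fixed_points_cong[OF p _ fin_X])
    show "order (G\<lparr>carrier := Q\<rparr>) = p ^ b" using Q(3) by (simp add: order_def)
    fix X assume "X \<in> ?X"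
    then obtain g where g: "g \<in> C" "X = P #> g" by blast
    show "?f (\<one>\<^bsub>G\<lparr>carrier := Q\<rparr>\<^esub>) X = X" using g sub by simp
    fix q assume q: "q \<in> carrier (G\<lparr>carrier := Q\<rparr>)"
    have "g \<otimes> inv q \<in> C" using q Q(2) g C(1) by (auto intro: subgroup.m_closed subgroup.m_inv_closed)
    moreover have "?f q X = P #> (g \<otimes> inv q)"
      using g q sP Cc Qc by (simp add: coset_mult_assoc subgroup.subset)
    ultimately show "?f q X \<in> ?X" by blast
    fix r assume r: "r \<in> carrier (G\<lparr>carrier := Q\<rparr>)"
    show "?f (q \<otimes>\<^bsub>G\<lparr>carrier := Q\<rparr>\<^esub> r) X = ?f q (?f r X)"
      using g q r sP Cc Qc sub by (simp add: coset_mult_assoc subgroup.subset inv_mult_group m_assoc)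
  qed
  moreover have "\<not> p dvd card ?X" by (rule sylow_sub_index[OF fin P C])
  ultimately have "\<not> p dvd card {X \<in> ?X. \<forall>q\<in>carrier (G\<lparr>carrier := Q\<rparr>). ?f q X = X}"
    using cong_dvd_iff by blast
  then have "{X \<in> ?X. \<forall>q\<in>carrier (G\<lparr>carrier := Q\<rparr>). ?f q X = X} \<noteq> {}" by (metis card.empty dvd_0_right)
  then obtain X where X: "X \<in> ?X" "\<And>q. q \<in> Q \<Longrightarrow> ?f q X = X" by auto
  then obtain g where g: "g \<in> C" "X = P #> g" by blast
  have "g \<otimes> q \<otimes> inv g \<in> P" if q: "q \<in> Q" for q
  proof -
    have "inv q \<in> Q" using q Q(1) by (simp add: subgroup.m_inv_closed)
    from X(2)[OF this] have "P #> (g \<otimes> q) = P #> g"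
      using g q sP Cc Qc by (simp add: coset_mult_assoc subgroup.subset)
    then show ?thesis using rcos_eq_iff[OF sP] g(1) q Cc Qc by simp
  qed
  then show ?thesis using g(1) by blast
qed

lemma (in group) conj_subgroup:
  assumes "subgroup P G" "g \<in> carrier G"
  shows "subgroup ((\<lambda>x. g \<otimes> x \<otimes> inv g) ` P) G"
proof (rule subgroupI)
  note Pc = subgroup.mem_carrier[OF assms(1)]
  show "(\<lambda>x. g \<otimes> x \<otimes> inv g) ` P \<subseteq> carrier G" using Pc assms(2) by auto
  show "(\<lambda>x. g \<otimes> x \<otimes> inv g) ` P \<noteq> {}" using subgroup.one_closed[OF assms(1)] by blast
  fix a assume "a \<in> (\<lambda>x. g \<otimes> x \<otimes> inv g) ` P"
  then obtain x where x: "x \<in> P" "a = g \<otimes> x \<otimes> inv g" by blast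
  have "inv a = g \<otimes> inv x \<otimes> inv g" using x Pc assms(2) by (simp add: inv_mult_group m_assoc)
  then show "inv a \<in> (\<lambda>x. g \<otimes> x \<otimes> inv g) ` P" using x subgroup.m_inv_closed[OF assms(1)] by blast
  fix b assume "b \<in> (\<lambda>x. g \<otimes> x \<otimes> inv g) ` P"
  then obtain y where y: "y \<in> P" "b = g \<otimes> y \<otimes> inv g" by blast
  have "a \<otimes> b = g \<otimes> (x \<otimes> y) \<otimes> inv g" using x y Pc assms(2) by (simp add: m_assoc)
  then show "a \<otimes> b \<in> (\<lambda>x. g \<otimes> x \<otimes> inv g) ` P" using x y subgroup.m_closed[OF assms(1)] by blast
qed

lemma (in group) conj_inj:
  assumes "g \<in> carrier G" shows "inj_on (\<lambda>x. g \<otimes> x \<otimes> inv g) (carrier G)"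
  using assms by (simp add: inj_on_def)

lemma (in group) card_conj:
  assumes "subgroup P G" "g \<in> carrier G"
  shows "card ((\<lambda>x. g \<otimes> x \<otimes> inv g) ` P) = card P"
  using conj_inj[OF assms(2)] subgroup.subset[OF assms(1)] by (meson card_image inj_on_subset)

lemma (in group) sylow_sub_conj:
  assumes "sylow_sub p G P" "g \<in> carrier G"
  shows "sylow_sub p G ((\<lambda>x. g \<otimes> x \<otimes> inv g) ` P)"
  using assms conj_subgroup card_conj by (simp add: sylow_sub_def)

lemma (in group) finite_subgroupI:
  assumes "finite (carrier G)" "S \<subseteq> carrier G" "S \<noteq> {}" "\<And>x y. x \<in> S \<Longrightarrow> y \<in> S \<Longrightarrow> x \<otimes> y \<in> S"
  shows "subgroup S G"
proof (rule subgroupI)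
  fix a assume a: "a \<in> S"
  then have ac: "a \<in> carrier G" using assms(2) by blast
  have pw: "a [^] Suc n \<in> S" for n using a by (induction n) (use assms(2,4) in auto)
  have "0 < order G" using assms(1) order_gt_0_iff_finite by blast
  \<comment> \<open>The exponent is \<open>2 * order G - 1\<close> rather than
    \<open>order G - 1\<close> because it has to be positive in the trivial group as well.\<close>
  then have "inv a = a [^] (2 * order G - 1)"
  proof -
    have "a [^] (2 * order G - 1) \<otimes> a = a [^] (2 * order G)"
      using \<open>0 < order G\<close> ac nat_pow_Suc[of a "2 * order G - 1"] by simp
    also have "\<dots> = (a [^] order G) [^] (2::nat)" using ac by (simp add: nat_pow_pow mult.commute)
    also have "\<dots> = \<one>" using ac by (simp add: pow_order_eq_1)
    finally show ?thesis using ac by (simp add: inv_equality)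
  qed
  moreover have "2 * order G - 1 = Suc (2 * order G - 2)" using \<open>0 < order G\<close> by simp
  ultimately show "inv a \<in> S" using pw[of "2 * order G - 2"] by (simp only:)
qed (use assms in auto)

section \<open>Transfer modulo a prime\<close>

lemma funpow_mem: "\<sigma> ` S \<subseteq> S \<Longrightarrow> x \<in> S \<Longrightarrow> (\<sigma> ^^ n) x \<in> S"
  by (induction n) auto

text \<open>The cycle of one point is removed and the rest is handled by induction on the size of
  \<open>S\<close>. The cycle length is supplied by the caller: the transfer evaluation uses the
  least period, the extension argument the prime \<open>p\<close>.\<close>

lemma sum_cycles_cong:
  fixes f :: "'x \<Rightarrow> int"
  assumes "finite S" "bij_betw \<sigma> S S"
    and "\<And>x. x \<in> S \<Longrightarrow> \<exists>L>0. (\<sigma> ^^ L) x = x \<and> (\<forall>j. 0 < j \<and> j < L \<longrightarrow> (\<sigma> ^^ j) x \<noteq> x) \<and>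
      [(\<Sum>j<L. f ((\<sigma> ^^ j) x)) = 0] (mod m)"
  shows "[(\<Sum>x\<in>S. f x) = 0] (mod m)"
  using assms
proof (induction "card S" arbitrary: S rule: less_induct)
  case (less S)
  show ?case
  proof (cases "S = {}")
    case False
    then obtain x where x: "x \<in> S" by blast
    obtain L where L: "L > 0" "(\<sigma> ^^ L) x = x" "\<And>j. 0 < j \<Longrightarrow> j < L \<Longrightarrow> (\<sigma> ^^ j) x \<noteq> x"
      "[(\<Sum>j<L. f ((\<sigma> ^^ j) x)) = 0] (mod m)" using less.prems(3)[OF x] by blast
    have into: "\<sigma> ` S \<subseteq> S" and inj: "inj_on \<sigma> S" using less.prems(2) by (auto simp: bij_betw_def)
    let ?c = "\<lambda>j. (\<sigma> ^^ j) x"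
    let ?O = "?c ` {..<L}"
    have cS: "?c j \<in> S" for j using funpow_mem[OF into x] .
    have inj_pow: "inj_on (\<sigma> ^^ n) S" for n
    proof (induction n)
      case (Suc n)
      show ?case
      proof (rule inj_onI)
        fix a b assume ab: "a \<in> S" "b \<in> S" "(\<sigma> ^^ Suc n) a = (\<sigma> ^^ Suc n) b"
        then have "(\<sigma> ^^ n) a = (\<sigma> ^^ n) b"
          using inj funpow_mem[OF into] by (simp add: inj_on_eq_iff)
        then show "a = b" using Suc ab by (simp add: inj_on_eq_iff)
      qed
    qed auto
    have injc: "inj_on ?c {..<L}"
    proof (rule linorder_inj_onI)
      fix i j :: nat assume ij: "i < j" "i \<in> {..<L}" "j \<in> {..<L}"
      have "?c j = (\<sigma> ^^ i) (?c (j - i))" using ij(1) funpow_add[of i "j - i" \<sigma>] by simp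
      moreover have "?c (j - i) \<noteq> x" using L(3)[of "j - i"] ij by simp
      ultimately show "?c i \<noteq> ?c j"
        using inj_on_eq_iff[OF inj_pow[of i] cS[of "j - i"] x] by simp
    qed auto
    have O: "?O \<subseteq> S" using cS by blast
    have stepO: "\<sigma> ` ?O = ?O"
    proof
      have "\<sigma> (?c j) \<in> ?O" if "j < L" for j
      proof (cases "Suc j = L")
        case True
        then have "\<sigma> (?c j) = ?c 0" using L(2) by auto
        then show ?thesis using L(1) by blast
      next
        case F: False
        have "\<sigma> (?c j) = ?c (Suc j)" by simp
        moreover have "Suc j \<in> {..<L}" using F that by simp
        ultimately show ?thesis by (rule image_eqI)
      qed
      then show *: "\<sigma> ` ?O \<subseteq> ?O" by blast
      have "card (\<sigma> ` ?O) = card ?O" using inj O by (meson card_image inj_on_subset)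
      then show "?O \<subseteq> \<sigma> ` ?O" using card_subset_eq[OF _ *] by simp
    qed
    let ?R = "S - ?O"
    have "\<sigma> ` ?R = \<sigma> ` S - \<sigma> ` ?O" using inj O by (meson inj_on_image_set_diff Diff_subset)
    then have "bij_betw \<sigma> ?R ?R"
      using less.prems(2) stepO inj by (auto simp: bij_betw_def intro: inj_on_subset)
    moreover have "card ?R < card S"
      using x L(1) less.prems(1) by (intro psubset_card_mono) force+
    ultimately have "[(\<Sum>x\<in>?R. f x) = 0] (mod m)"
      using less.hyps[of ?R] less.prems(1,3) by simp
    moreover have "(\<Sum>x\<in>?O. f x) = (\<Sum>j<L. f (?c j))" using sum.reindex[OF injc, of f] by simp
    moreover have "(\<Sum>x\<in>S. f x) = (\<Sum>x\<in>?R. f x) + (\<Sum>x\<in>?O. f x)"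
      by (rule sum.subset_diff[OF O less.prems(1)])
    ultimately show ?thesis using L(4) cong_add[of _ 0 m _ 0] by simp
  qed simp
qed

lemma least_period:
  fixes \<sigma> :: "'x \<Rightarrow> 'x"
  assumes "(\<sigma> ^^ n) x = x" "0 < n"
  shows "\<exists>L>0. (\<sigma> ^^ L) x = x \<and> (\<forall>j. 0 < j \<and> j < L \<longrightarrow> (\<sigma> ^^ j) x \<noteq> x) \<and> L dvd n"
proof -
  define L where "L = (LEAST L. 0 < L \<and> (\<sigma> ^^ L) x = x)"
  have L: "0 < L \<and> (\<sigma> ^^ L) x = x" unfolding L_def by (rule LeastI[of _ n]) (use assms in simp)
  have least: "(\<sigma> ^^ j) x \<noteq> x" if "0 < j" "j < L" for j
    using not_less_Least[of j "\<lambda>L. 0 < L \<and> (\<sigma> ^^ L) x = x"] that by (auto simp: L_def)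
  have "(\<sigma> ^^ (n mod L)) x = x"
  proof -
    have "(\<sigma> ^^ (L * q)) x = x" for q
      by (induction q) (simp_all add: L funpow_add)
    from this[of "n div L"] have "(\<sigma> ^^ (n mod L + L * (n div L))) x = (\<sigma> ^^ (n mod L)) x"
      by (simp only: funpow_add comp_apply)
    then show ?thesis using assms(1) by (simp only: mod_mult_div_eq)
  qed
  then have "n mod L = 0" using least[of "n mod L"] L by (metis mod_less_divisor not_gr_zero)
  then have "L dvd n" by (rule mod_0_imp_dvd)
  then show ?thesis using L least by (intro exI[of _ L]) simp
qed

lemma period_prime_cases:
  fixes \<sigma> :: "'x \<Rightarrow> 'x"
  assumes "Factorial_Ring.prime (p::nat)" "(\<sigma> ^^ p) x = x"
  shows "\<sigma> x = x \<or> (\<forall>j. 0 < j \<and> j < p \<longrightarrow> (\<sigma> ^^ j) x \<noteq> x)"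
proof -
  obtain L where L: "0 < L" "(\<sigma> ^^ L) x = x" "\<And>j. 0 < j \<Longrightarrow> j < L \<Longrightarrow> (\<sigma> ^^ j) x \<noteq> x" "L dvd p"
    using least_period[OF assms(2) prime_gt_0_nat[OF assms(1)]] by auto
  then have "L = 1 \<or> L = p" using assms(1) prime_nat_iff by blast
  then show ?thesis
  proof
    assume "L = 1" then show ?thesis using L(2) by simp
  next
    assume "L = p" then show ?thesis using L(3) by blast
  qed
qed

text \<open>Every moved point lies in a cycle of exactly \<open>p\<close> points. This is applied to
  the three neighbours of a fixed vertex and, with \<open>p = 2\<close>, to inversion on the
  connection set \<open>R\<close>.\<close>

lemma card_fixed_order_prime_cong:
  assumes p: "Factorial_Ring.prime (p::nat)" and S: "finite S" "bij_betw \<sigma> S S" and per: "\<And>x. x \<in> S \<Longrightarrow> (\<sigma> ^^ p) x = x"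
  shows "p dvd card {x \<in> S. \<sigma> x \<noteq> x}"
proof -
  have "[(\<Sum>x\<in>S. if \<sigma> x \<noteq> x then 1 else 0) = 0] (mod int p)"
  proof (rule sum_cycles_cong[OF S])
    fix x assume x: "x \<in> S"
    have inj: "inj_on \<sigma> S" "\<sigma> ` S \<subseteq> S" using S(2) by (auto simp: bij_betw_def)
    show "\<exists>L>0. (\<sigma> ^^ L) x = x \<and> (\<forall>j. 0 < j \<and> j < L \<longrightarrow> (\<sigma> ^^ j) x \<noteq> x) \<and>
         [(\<Sum>j<L. if \<sigma> ((\<sigma> ^^ j) x) \<noteq> (\<sigma> ^^ j) x then 1 else 0) = 0] (mod int p)"
    proof (cases "\<sigma> x = x")
      case True then show ?thesis by (intro exI[of _ 1]) auto
    next
      case False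
      have "\<sigma> ((\<sigma> ^^ j) x) \<noteq> (\<sigma> ^^ j) x" for j
      proof (induction j)
        case (Suc j)
        then show ?case
          using inj_on_eq_iff[OF inj(1) funpow_mem[OF inj(2) x, of "Suc j"] funpow_mem[OF inj(2) x, of j]] by simp
      qed (use False in simp)
      then have "(\<Sum>j<p. if \<sigma> ((\<sigma> ^^ j) x) \<noteq> (\<sigma> ^^ j) x then 1 else 0) = int p" by simp
      then have "[(\<Sum>j<p. if \<sigma> ((\<sigma> ^^ j) x) \<noteq> (\<sigma> ^^ j) x then 1 else 0) = 0] (mod int p)"
        by (simp only: cong_0_iff dvd_refl)
      then show ?thesis using period_prime_cases[OF p per[OF x]] False per[OF x] prime_gt_0_nat[OF p]
        by (intro exI[of _ p] conjI) blast+
    qed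
  qed
  moreover have "(\<Sum>x\<in>S. if \<sigma> x \<noteq> x then 1 else 0) = int (card {x \<in> S. \<sigma> x \<noteq> x})"
    using S(1) by (simp add: sum.If_cases Int_def)
  ultimately show ?thesis by (simp add: cong_0_iff)
qed

text \<open>Homomorphisms into the integers modulo \<open>p\<close> are kept as integer valued
  functions with congruences, so that they can be summed freely.\<close>

definition mod_hom :: "nat \<Rightarrow> ('a, 'b) monoid_scheme \<Rightarrow> 'a set \<Rightarrow> ('a \<Rightarrow> int) \<Rightarrow> bool" where
  "mod_hom p G N f \<longleftrightarrow> (\<forall>x\<in>N. \<forall>y\<in>N. [f (x \<otimes>\<^bsub>G\<^esub> y) = f x + f y] (mod int p))"

text \<open>With \<open>\<tau>\<close> choosing coset representatives, this is the element
  \<open>d\<close> with \<open>\<tau> X g = d \<tau> (X g)\<close>.\<close>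

definition transfer_factor :: "('a, 'b) monoid_scheme \<Rightarrow> ('a set \<Rightarrow> 'a) \<Rightarrow> 'a set \<Rightarrow> 'a \<Rightarrow> 'a" where
  "transfer_factor G \<tau> X g = \<tau> X \<otimes>\<^bsub>G\<^esub> g \<otimes>\<^bsub>G\<^esub> inv\<^bsub>G\<^esub> (\<tau> (X #>\<^bsub>G\<^esub> g))"

text \<open>The classical transfer multiplies the factors in the abelianisation of \<open>N\<close>.
  Applying \<open>f\<close> to each factor turns the product into a sum of integers, and no abelian
  quotient has to be formed.\<close>

definition transfer_map :: "('a, 'b) monoid_scheme \<Rightarrow> 'a set \<Rightarrow> ('a set \<Rightarrow> 'a) \<Rightarrow> ('a \<Rightarrow> int) \<Rightarrow> 'a \<Rightarrow> int" where
  "transfer_map G N \<tau> f g = (\<Sum>X\<in>rcosets\<^bsub>G\<^esub> N. f (transfer_factor G \<tau> X g))"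

locale transfer_setup = group G for G (structure) +
  fixes N \<tau>
  assumes fin: "finite (carrier G)" and N: "subgroup N G"
    and tau: "\<And>X. X \<in> rcosets N \<Longrightarrow> \<tau> X \<in> X"
begin

lemma coset_carrier: "X \<in> rcosets N \<Longrightarrow> X \<subseteq> carrier G"
  using rcosets_part_G[OF N] by blast

lemma tau_carrier [simp]: "X \<in> rcosets N \<Longrightarrow> \<tau> X \<in> carrier G"
  using tau coset_carrier by blast

lemma tau_coset: "X \<in> rcosets N \<Longrightarrow> N #> \<tau> X = X"
proof -
  assume X: "X \<in> rcosets N"
  then obtain g where g: "g \<in> carrier G" "X = N #> g" by (auto simp: RCOSETS_def)
  then show ?thesis using repr_independence[OF _ g(1) N] tau[OF X] by simp
qed

lemma coset_mult [simp]: "X \<in> rcosets N \<Longrightarrow> g \<in> carrier G \<Longrightarrow> X #> g \<in> rcosets N"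
  using N by (auto simp: RCOSETS_def coset_mult_assoc subgroup.subset)

lemma coset_mult_mult: "X \<in> rcosets N \<Longrightarrow> g \<in> carrier G \<Longrightarrow> h \<in> carrier G \<Longrightarrow> X #> (g \<otimes> h) = X #> g #> h"
  using coset_carrier by (simp add: coset_mult_assoc)

lemma coset_mult_eq_tau: "X \<in> rcosets N \<Longrightarrow> g \<in> carrier G \<Longrightarrow> X #> g = N #> (\<tau> X \<otimes> g)"
  using coset_mult_assoc[of N "\<tau> X" g] tau_coset[of X] N by (simp add: subgroup.subset)

lemma factor_mem:
  assumes "X \<in> rcosets N" "g \<in> carrier G" shows "transfer_factor G \<tau> X g \<in> N"
proof -
  have "N #> (\<tau> X \<otimes> g) = N #> \<tau> (X #> g)"
    by (simp only: coset_mult_eq_tau[OF assms, symmetric] tau_coset[OF coset_mult[OF assms]])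
  then show ?thesis using rcos_eq_iff[OF N] assms by (simp add: transfer_factor_def)
qed

lemma factor_mult:
  assumes "X \<in> rcosets N" "g \<in> carrier G" "h \<in> carrier G"
  shows "transfer_factor G \<tau> X (g \<otimes> h) = transfer_factor G \<tau> X g \<otimes> transfer_factor G \<tau> (X #> g) h"
  using assms by (simp add: transfer_factor_def coset_mult_mult m_assoc)

lemma coset_bij:
  assumes g: "g \<in> carrier G" shows "bij_betw (\<lambda>X. X #> g) (rcosets N) (rcosets N)"
proof (rule bij_betwI[where g = "\<lambda>X. X #> inv g"])
  fix X assume X: "X \<in> rcosets N"
  show "X #> g #> inv g = X" "X #> inv g #> g = X"
    using X g coset_carrier by (simp_all add: coset_mult_assoc)
qed (use g in auto)

lemma finite_cosets: "finite (rcosets N)"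
  by (rule finite_UnionD) (simp add: fin rcosets_part_G[OF N])

text \<open>The factors satisfy a cocycle identity, and right multiplication by \<open>g\<close>
  permutes the cosets, so the shifted sum is again the transfer of \<open>h\<close>.\<close>

lemma transfer_mod_hom:
  assumes f: "mod_hom p G N f"
  shows "mod_hom p G (carrier G) (transfer_map G N \<tau> f)"
  unfolding mod_hom_def
proof (intro ballI)
  fix g h assume gh: "g \<in> carrier G" "h \<in> carrier G"
  let ?D = "transfer_factor G \<tau>"
  have "transfer_map G N \<tau> f (g \<otimes> h) = (\<Sum>X\<in>rcosets N. f (?D X g \<otimes> ?D (X #> g) h))"
    unfolding transfer_map_def by (rule sum.cong) (simp_all add: factor_mult gh)
  also have "[\<dots> = (\<Sum>X\<in>rcosets N. f (?D X g) + f (?D (X #> g) h))] (mod int p)"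
    by (rule cong_sum) (use f gh factor_mem in \<open>simp add: mod_hom_def\<close>)
  also have "(\<Sum>X\<in>rcosets N. f (?D X g) + f (?D (X #> g) h)) =
      transfer_map G N \<tau> f g + (\<Sum>X\<in>rcosets N. f (?D (X #> g) h))"
    by (simp add: transfer_map_def sum.distrib)
  also have "(\<Sum>X\<in>rcosets N. f (?D (X #> g) h)) = transfer_map G N \<tau> f h"
    unfolding transfer_map_def by (rule sum.reindex_bij_betw[OF coset_bij[OF gh(1)]])
  finally show "[transfer_map G N \<tau> f (g \<otimes> h) = transfer_map G N \<tau> f g + transfer_map G N \<tau> f h] (mod int p)" .
qed

end

lemma mod_homD:
  "mod_hom p G N f \<Longrightarrow> x \<in> N \<Longrightarrow> y \<in> N \<Longrightarrow> [f (x \<otimes>\<^bsub>G\<^esub> y) = f x + f y] (mod int p)"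
  by (simp add: mod_hom_def)

lemma (in group) mod_hom_one:
  assumes "subgroup N G" "mod_hom p G N f"
  shows "[f \<one> = 0] (mod int p)"
proof -
  have "[f (\<one> \<otimes> \<one>) = f \<one> + f \<one>] (mod int p)"
    by (rule mod_homD[OF assms(2)]) (simp_all add: subgroup.one_closed[OF assms(1)])
  then show ?thesis by (simp add: cong_iff_dvd_diff)
qed

lemma (in group) subgroup_nat_pow_closed:
  assumes "subgroup N G" "x \<in> N" shows "x [^] (n::nat) \<in> N"
  by (induction n) (simp_all add: assms subgroup.one_closed subgroup.m_closed)

lemma (in group) mod_hom_pow:
  assumes N: "subgroup N G" and f: "mod_hom p G N f" and x: "x \<in> N"
  shows "[f (x [^] (n::nat)) = int n * f x] (mod int p)"
proof (induction n)
  case 0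
  then show ?case using mod_hom_one[OF N f] by simp
next
  case (Suc n)
  have "[f (x [^] n \<otimes> x) = f (x [^] n) + f x] (mod int p)"
    using mod_homD[OF f] subgroup_nat_pow_closed[OF N x] x by simp
  also have "[f (x [^] n) + f x = int n * f x + f x] (mod int p)" using Suc by (simp add: cong_add)
  finally show ?case by (simp add: algebra_simps)
qed

context transfer_setup
begin

lemma funpow_coset: "X \<in> rcosets N \<Longrightarrow> y \<in> carrier G \<Longrightarrow> ((\<lambda>X. X #> y) ^^ j) X = X #> (y [^] j)"
  by (induction j) (use coset_carrier in \<open>simp_all add: coset_mult_mult\<close>)

text \<open>The cocycle identity telescopes along the orbit of \<open>X\<close> under
  \<open>y\<close>.\<close>

lemma sum_factor_pow:
  fixes L :: nat
  assumes f: "mod_hom p G N f" and X: "X \<in> rcosets N" and y: "y \<in> carrier G"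
  shows "[(\<Sum>j<L. f (transfer_factor G \<tau> (X #> (y [^] j)) y)) = f (transfer_factor G \<tau> X (y [^] L))] (mod int p)"
proof (induction L)
  case 0
  have "[f \<one> = 0] (mod int p)" by (rule mod_hom_one[OF N f])
  moreover have "transfer_factor G \<tau> X \<one> = \<one>" using X coset_carrier by (simp add: transfer_factor_def)
  ultimately show ?case by (simp add: cong_sym)
next
  case (Suc L)
  have "[(\<Sum>j<Suc L. f (transfer_factor G \<tau> (X #> (y [^] j)) y)) =
      f (transfer_factor G \<tau> X (y [^] L)) + f (transfer_factor G \<tau> (X #> (y [^] L)) y)] (mod int p)"
    using Suc by (simp add: cong_add)
  also have "[f (transfer_factor G \<tau> X (y [^] L)) + f (transfer_factor G \<tau> (X #> (y [^] L)) y) =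
      f (transfer_factor G \<tau> X (y [^] L \<otimes> y))] (mod int p)"
    using mod_homD[OF f factor_mem[OF X, of "y [^] L"] factor_mem[OF coset_mult[OF X, of "y [^] L"] y]] y
    by (simp add: factor_mult[OF X _ y] cong_sym)
  finally show ?case by simp
qed

text \<open>On a cycle of length \<open>L\<close> the factors multiply to a conjugate of
  \<open>y [^] L\<close> in \<open>N\<close>, to which the fusion hypothesis assigns
  \<open>L\<close> times \<open>f y\<close>; the lengths add up to the index. Subtracting
  \<open>f y\<close> from every summand makes each cycle sum vanish, as
  \<open>sum_cycles_cong\<close> requires.\<close>

lemma transfer_eval:
  assumes f: "mod_hom p G N f" and y: "y \<in> carrier G"
    and fus: "\<And>t m. t \<in> carrier G \<Longrightarrow> t \<otimes> y [^] (m::nat) \<otimes> inv t \<in> N \<Longrightarrow>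
      [f (t \<otimes> y [^] m \<otimes> inv t) = int m * f y] (mod int p)"
  shows "[transfer_map G N \<tau> f y = int (card (rcosets N)) * f y] (mod int p)"
proof -
  let ?F = "\<lambda>X. f (transfer_factor G \<tau> X y) - f y"
  have "[(\<Sum>X\<in>rcosets N. ?F X) = 0] (mod int p)"
  proof (rule sum_cycles_cong[OF finite_cosets coset_bij[OF y]])
    fix X assume X: "X \<in> rcosets N"
    have "((\<lambda>X. X #> y) ^^ order G) X = X"
      unfolding funpow_coset[OF X y] using y coset_carrier[OF X] by (simp add: pow_order_eq_1)
    moreover have "0 < order G" using fin order_gt_0_iff_finite by blast
    ultimately obtain L where L: "L > 0" "((\<lambda>X. X #> y) ^^ L) X = X"
      "\<forall>j. 0 < j \<and> j < L \<longrightarrow> ((\<lambda>X. X #> y) ^^ j) X \<noteq> X"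
      using least_period[of "order G" "\<lambda>X. X #> y" X] by auto
    have "(\<Sum>j<L. ?F (((\<lambda>X. X #> y) ^^ j) X)) =
        (\<Sum>j<L. f (transfer_factor G \<tau> (X #> (y [^] j)) y)) - int L * f y"
      by (simp add: funpow_coset[OF X y] sum_subtractf)
    also have "[\<dots> = f (transfer_factor G \<tau> X (y [^] L)) - int L * f y] (mod int p)"
      by (rule cong_diff[OF sum_factor_pow[OF f X y] cong_refl])
    also have "transfer_factor G \<tau> X (y [^] L) = \<tau> X \<otimes> y [^] L \<otimes> inv (\<tau> X)"
      using L(2) unfolding funpow_coset[OF X y] by (simp add: transfer_factor_def)
    also have "[f (\<tau> X \<otimes> y [^] L \<otimes> inv (\<tau> X)) - int L * f y = int L * f y - int L * f y] (mod int p)"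
    proof (rule cong_diff[OF fus cong_refl])
      show "\<tau> X \<in> carrier G" using X by simp
      show "\<tau> X \<otimes> y [^] L \<otimes> inv (\<tau> X) \<in> N"
        using factor_mem[OF X, of "y [^] L"] y L(2) unfolding funpow_coset[OF X y] by (simp add: transfer_factor_def)
    qed
    finally show "\<exists>L>0. ((\<lambda>X. X #> y) ^^ L) X = X \<and> (\<forall>j. 0 < j \<and> j < L \<longrightarrow> ((\<lambda>X. X #> y) ^^ j) X \<noteq> X) \<and>
       [(\<Sum>j<L. ?F (((\<lambda>X. X #> y) ^^ j) X)) = 0] (mod int p)"
      using L by (intro exI[of _ L]) simp
  qed
  then have "[transfer_map G N \<tau> f y - int (card (rcosets N)) * f y = 0] (mod int p)"
    by (simp add: transfer_map_def sum_subtractf)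
  then show ?thesis by (simp add: cong_iff_dvd_diff)
qed

end

lemma (in group) normal_conj:
  "Y \<lhd> G \<Longrightarrow> t \<in> carrier G \<Longrightarrow> y \<in> Y \<Longrightarrow> t \<otimes> y \<otimes> inv t \<in> Y"
  by (simp add: normal.inv_op_closed2)

lemma (in group) conj_mult:
  assumes "t \<in> carrier G" "x \<in> carrier G" "y \<in> carrier G"
  shows "t \<otimes> (x \<otimes> y) \<otimes> inv t = (t \<otimes> x \<otimes> inv t) \<otimes> (t \<otimes> y \<otimes> inv t)"
  using assms by (simp add: m_assoc)

lemma (in group) conj_int_pow:
  assumes "t \<in> carrier G" "x \<in> carrier G"
  shows "t \<otimes> x [^] (n::int) \<otimes> inv t = (t \<otimes> x \<otimes> inv t) [^] n"
proof -
  have "(\<lambda>x. t \<otimes> x \<otimes> inv t) \<in> hom G G" using assms(1) by (intro homI) (simp_all add: m_assoc)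
  then interpret h: group_hom G G "\<lambda>x. t \<otimes> x \<otimes> inv t" by unfold_locales
  show ?thesis using h.hom_int_pow[OF assms(2)] .
qed

lemma (in group) conj_nat_pow:
  assumes "t \<in> carrier G" "x \<in> carrier G"
  shows "t \<otimes> x [^] (n::nat) \<otimes> inv t = (t \<otimes> x \<otimes> inv t) [^] n"
  using conj_int_pow[OF assms, of "int n"] by (simp add: int_pow_int)

lemma (in group) subgroup_int_pow_mem:
  assumes "subgroup N G" "x \<in> N" shows "x [^] (n::int) \<in> N"
  using assms by (simp add: subgroup_int_pow_closed)

text \<open>The coset \<open>N\<close> is the only one fixed by \<open>z\<close>; choosing representatives compatibly with \<open>z\<close>
  makes the transfer factors constant on the remaining \<open>z\<close>-orbits, which have length \<open>p\<close>.\<close>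

lemma (in group) mod_hom_extension:
  assumes fin: "finite (carrier G)" and p: "Factorial_Ring.prime p" and N: "subgroup N G"
    and f: "mod_hom p G N f" and P: "subgroup P G" "P \<subseteq> N"
    and Y: "Y \<lhd> G" "Y \<subseteq> N" and fY: "\<And>y. y \<in> Y \<Longrightarrow> [f y = 0] (mod int p)"
    and z: "z \<in> P" "z [^] p \<in> Y" and comm: "\<And>g. g \<in> P \<Longrightarrow> \<exists>y\<in>Y. z \<otimes> g = g \<otimes> z \<otimes> y"
    and fixed: "\<And>t. t \<in> carrier G \<Longrightarrow> t \<otimes> z \<otimes> inv t \<in> N \<Longrightarrow> t \<in> N"
  shows "\<exists>V. mod_hom p G (carrier G) V \<and> (\<forall>g\<in>P. [V g = f g] (mod int p))"
proof -
  have sY: "subgroup Y G" using Y(1) by (simp add: normal_imp_subgroup)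
  note Yc [simp] = subgroup.mem_carrier[OF sY] and Nc = subgroup.mem_carrier[OF N] and Pc = subgroup.mem_carrier[OF P(1)]
  have zc [simp]: "z \<in> carrier G" using z(1) Pc by blast
  have zN: "z \<in> N" using z(1) P(2) by blast
  have cc: "X \<subseteq> carrier G" if "X \<in> rcosets N" for X using that rcosets_part_G[OF N] by blast
  have cm [simp]: "X #> g \<in> rcosets N" if "X \<in> rcosets N" "g \<in> carrier G" for X g
    using that N by (auto simp: RCOSETS_def coset_mult_assoc subgroup.subset)
  have cmm: "X #> g #> h = X #> (g \<otimes> h)" if "X \<in> rcosets N" "g \<in> carrier G" "h \<in> carrier G" for X g h
    using that cc by (simp add: coset_mult_assoc)
  have N1: "N \<in> rcosets N" using N subgroup.subgroup_in_rcosets is_group by blast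
  have Nmult: "N #> g = N" if "g \<in> N" for g using that N Nc by (simp add: coset_join2)
  have NeqD: "g \<in> N" if "N #> g = N" "g \<in> carrier G" for g
    using that rcos_self[OF that(2) N] by simp
  \<comment> \<open>\<open>Y\<close> is normal in the whole group and contained in \<open>N\<close>,
    so it fixes every coset; in particular the action of \<open>z\<close> on the cosets has order
    dividing \<open>p\<close>.\<close>
  have Yfix: "X #> y = X" if X: "X \<in> rcosets N" and y: "y \<in> Y" for X y
  proof -
    obtain x where x: "x \<in> carrier G" "X = N #> x" using X by (auto simp: RCOSETS_def)
    have "x \<otimes> y \<otimes> inv x \<in> N" using normal_conj[OF Y(1) x(1) y] Y(2) by blast
    then have "N #> (x \<otimes> y) = N #> x" using rcos_eq_iff[OF N] x(1) y by simp
    then show ?thesis using x y N by (simp add: coset_mult_assoc subgroup.subset)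
  qed
  \<comment> \<open>The base coset \<open>b X\<close> is chosen from the orbit as a set, so it
    depends only on the orbit. The exponent \<open>idx X\<close> leading from it to \<open>X\<close>
    is determined only up to the period.\<close>
  define O' where "O' = (\<lambda>X. range (\<lambda>i::int. X #> z [^] i))"
  define b where "b = (\<lambda>X. SOME B. B \<in> O' X)"
  define idx where "idx = (\<lambda>X. SOME i::int. X = b X #> z [^] i)"
  define tt where "tt = (\<lambda>B::'a set. SOME t. t \<in> B)"
  define \<tau> where "\<tau> = (\<lambda>X. if X = N then \<one> else tt (b X) \<otimes> z [^] idx X)"
  have bO: "b X \<in> O' X" for X unfolding b_def O'_def by (rule someI[of _ "X #> z [^] (0::int)"]) (rule rangeI)
  have b: "b X \<in> rcosets N" "X = b X #> z [^] idx X" if X: "X \<in> rcosets N" for X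
  proof -
    obtain i :: int where i: "b X = X #> z [^] i" using bO by (auto simp: O'_def)
    then show "b X \<in> rcosets N" using X by simp
    have "b X #> z [^] (-i) = X" using i X cc by (simp add: cmm int_pow_neg)
    then have "X = b X #> z [^] (-i)" by simp
    then show "X = b X #> z [^] idx X" unfolding idx_def by (rule someI)
  qed
  have tt: "tt B \<in> B" "tt B \<in> carrier G" "N #> tt B = B" if B: "B \<in> rcosets N" for B
  proof -
    obtain x where x: "x \<in> carrier G" "B = N #> x" using B by (auto simp: RCOSETS_def)
    show 1: "tt B \<in> B" unfolding tt_def by (rule someI[of _ x]) (simp add: x rcos_self[OF x(1) N])
    show "tt B \<in> carrier G" using 1 cc[OF B] by blast
    show "N #> tt B = B" using repr_independence[OF _ x(1) N] 1 x(2) by simp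
  qed
  have tau: "\<tau> X \<in> X" if X: "X \<in> rcosets N" for X
  proof (cases "X = N")
    case True then show ?thesis by (simp add: \<tau>_def subgroup.one_closed[OF N])
  next
    case False
    have "tt (b X) \<otimes> z [^] idx X \<in> b X #> z [^] idx X"
      using tt(1)[OF b(1)[OF X]] by (auto simp: r_coset_def)
    then show ?thesis using b(2)[OF X] False by (simp add: \<tau>_def)
  qed
  interpret T: transfer_setup G N \<tau> by (intro transfer_setup.intro transfer_setup_axioms.intro is_group fin N tau)
  \<comment> \<open>The exponents chosen for \<open>X\<close> and \<open>X #> z\<close> match only
    modulo \<open>p\<close>; as \<open>z [^] p\<close> lies in \<open>Y\<close>, the representatives
    are compatible up to a factor in \<open>Y\<close>.\<close>
  have shift: "\<exists>y\<in>Y. \<tau> (X #> z) = \<tau> X \<otimes> z \<otimes> y" if X: "X \<in> rcosets N" and XN: "X \<noteq> N" for X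
  proof -
    have Xz: "X #> z \<in> rcosets N" using X by simp
    have XzN: "X #> z \<noteq> N"
    proof
      assume "X #> z = N"
      then have "X #> z #> inv z = N #> inv z" by simp
      then show False using X XN cc Nmult subgroup.m_inv_closed[OF N zN] by (simp add: cmm)
    qed
    have O_eq: "O' (X #> z) = O' X"
    proof -
      have "X #> z #> z [^] i = X #> z [^] (1 + i)" for i :: int
        using X by (simp add: cmm int_pow_mult)
      then have "O' (X #> z) = (\<lambda>i::int. X #> z [^] i) ` range ((+) 1)" by (simp only: O'_def image_image)
      also have "range ((+) (1::int)) = UNIV" by (rule surj_plus)
      finally show ?thesis by (simp add: O'_def)
    qed
    then have b_eq: "b (X #> z) = b X" by (simp add: b_def)
    define w where "w = tt (b X)"
    have w: "w \<in> carrier G" "N #> w = b X" using tt b(1)[OF X] by (auto simp: w_def)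
    define i i' where "i = idx X" and "i' = idx (X #> z)"
    define d where "d = i' - (i + 1)"
    have "N #> (w \<otimes> z [^] i') = b X #> z [^] i'" using w N by (simp add: coset_mult_assoc[symmetric] subgroup.subset)
    also have "\<dots> = X #> z" using b(2)[OF Xz] b_eq by (simp add: i'_def)
    also have "\<dots> = b X #> z [^] i #> z" using b(2)[OF X] by (simp add: i_def)
    also have "\<dots> = N #> (w \<otimes> (z [^] i \<otimes> z))"
      using w N b(1)[OF X] by (simp add: cmm) (simp add: coset_mult_assoc[symmetric] subgroup.subset)
    also have "z [^] i \<otimes> z = z [^] (i + 1)" by (simp add: int_pow_mult)
    finally have "w \<otimes> z [^] i' \<otimes> inv (w \<otimes> z [^] (i + 1)) \<in> N" using rcos_eq_iff[OF N] w by simp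
    moreover have "w \<otimes> z [^] i' \<otimes> inv (w \<otimes> z [^] (i + 1)) = w \<otimes> (z [^] i' \<otimes> inv (z [^] (i + 1))) \<otimes> inv w"
      using w by (simp add: inv_mult_group m_assoc)
    moreover have "z [^] i' \<otimes> inv (z [^] (i + 1)) = z [^] d" by (simp add: d_def int_pow_diff)
    ultimately have wd: "w \<otimes> z [^] d \<otimes> inv w \<in> N" by simp
    have wN: "w \<notin> N"
    proof
      assume "w \<in> N"
      then have "b X = N" using w Nmult by simp
      then have "X = N" using b(2)[OF X] Nmult subgroup_int_pow_mem[OF N zN] by simp
      then show False using XN by simp
    qed
    \<comment> \<open>Otherwise \<open>z\<close> is a product of powers of \<open>z [^] p\<close>
      and \<open>z [^] d\<close>. Both are conjugated into \<open>N\<close> by \<open>w\<close>,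
      hence so is \<open>z\<close>, and \<open>fixed\<close> puts \<open>w\<close> into
      \<open>N\<close>.\<close>
    have "int p dvd d"
    proof (rule ccontr)
      assume "\<not> int p dvd d"
      then have "coprime (int p) d" using p by (simp add: prime_imp_coprime)
      then obtain u v where uv: "u * int p + v * d = 1" using bezout_int[of "int p" d] by (auto simp: coprime_iff_gcd_eq_1)
      have "z [^] (int p) \<in> Y" using z(2) by (simp add: int_pow_int)
      then have 1: "w \<otimes> z [^] int p \<otimes> inv w \<in> N" using normal_conj[OF Y(1) w(1)] Y(2) by blast
      have "w \<otimes> z \<otimes> inv w = w \<otimes> z [^] (int p * u + d * v) \<otimes> inv w" using uv by (simp add: mult.commute)
      also have "\<dots> = (w \<otimes> z [^] int p \<otimes> inv w) [^] u \<otimes> (w \<otimes> z [^] d \<otimes> inv w) [^] v"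
        using w by (simp only: int_pow_mult conj_mult int_pow_closed zc conj_int_pow[symmetric] int_pow_pow)
      also have "\<dots> \<in> N" using 1 wd by (simp add: subgroup_int_pow_mem[OF N] subgroup.m_closed[OF N])
      finally show False using fixed w(1) wN by blast
    qed
    then obtain q where q: "d = int p * q" by blast
    have "z [^] d = (z [^] p) [^] q" by (simp add: q int_pow_pow[symmetric] int_pow_int)
    then have zd: "z [^] d \<in> Y" using subgroup_int_pow_mem[OF sY z(2)] by simp
    have "\<tau> (X #> z) = w \<otimes> z [^] i'" using XzN by (simp add: \<tau>_def b_eq w_def i'_def)
    also have "i' = i + 1 + d" by (simp add: d_def)
    also have "w \<otimes> z [^] (i + 1 + d) = \<tau> X \<otimes> z \<otimes> z [^] d"
      using XN w by (simp add: \<tau>_def int_pow_mult m_assoc w_def i_def)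
    finally show ?thesis using zd by blast
  qed
  let ?D = "transfer_factor G \<tau>"
  \<comment> \<open>Moving \<open>z\<close> past \<open>g\<close> costs an element of
    \<open>Y\<close>, and so does each of the two changes of representative. Normality of
    \<open>Y\<close> collects the three into one factor \<open>e'\<close> on the right, on which
    \<open>f\<close> vanishes.\<close>
  have step: "[f (?D (X #> z) g) = f (?D X g)] (mod int p)" if X: "X \<in> rcosets N" and XN: "X \<noteq> N" and g: "g \<in> P" for X g
  proof -
    have gc [simp]: "g \<in> carrier G" and gN: "g \<in> N" using g Pc P(2) by auto
    have Xg: "X #> g \<in> rcosets N" using X by simp
    have XgN: "X #> g \<noteq> N"
    proof
      assume "X #> g = N"
      then have "X #> g #> inv g = N #> inv g" by simp
      then show False using X XN cc Nmult subgroup.m_inv_closed[OF N gN] by (simp add: cmm)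
    qed
    obtain y where y: "y \<in> Y" "\<tau> (X #> z) = \<tau> X \<otimes> z \<otimes> y" using shift[OF X XN] by blast
    obtain y' where y': "y' \<in> Y" "\<tau> (X #> g #> z) = \<tau> (X #> g) \<otimes> z \<otimes> y'" using shift[OF Xg XgN] by blast
    obtain y0 where y0: "y0 \<in> Y" "z \<otimes> g = g \<otimes> z \<otimes> y0" using comm[OF g] by blast
    have tc [simp]: "\<tau> X \<in> carrier G" "\<tau> (X #> g) \<in> carrier G" using X Xg by auto
    have "X #> z #> g = X #> (g \<otimes> z \<otimes> y0)" using X y0 by (simp add: cmm)
    also have "\<dots> = X #> g #> z #> y0" using X y0 by (simp add: cmm m_assoc)
    also have "\<dots> = X #> g #> z" using Yfix X y0(1) by simp
    finally have Xzg: "X #> z #> g = X #> g #> z" .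
    define e where "e = z \<otimes> (y0 \<otimes> (inv g \<otimes> y \<otimes> g) \<otimes> inv y') \<otimes> inv z"
    have "inv g \<otimes> y \<otimes> g \<in> Y" using normal_conj[OF Y(1), of "inv g" y] y by simp
    then have e: "e \<in> Y" unfolding e_def
      using normal_conj[OF Y(1) zc] y0 y' sY by (simp add: subgroup.m_closed subgroup.m_inv_closed)
    define e' where "e' = \<tau> (X #> g) \<otimes> e \<otimes> inv (\<tau> (X #> g))"
    have e': "e' \<in> Y" unfolding e'_def by (rule normal_conj[OF Y(1) tc(2) e])
    have zg: "g \<otimes> (z \<otimes> (y0 \<otimes> w)) = z \<otimes> (g \<otimes> w)" if "w \<in> carrier G" for w
      using that y0 by (simp add: m_assoc[symmetric])
    have "?D X g \<otimes> e' = \<tau> X \<otimes> (g \<otimes> (z \<otimes> (y0 \<otimes> (inv g \<otimes> (y \<otimes> (g \<otimes> (inv y' \<otimes> (inv z \<otimes> inv (\<tau> (X #> g))))))))))"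
      using y y' y0 by (simp add: transfer_factor_def e'_def e_def m_assoc)
    also have "\<dots> = ?D (X #> z) g"
      using y y' y0 by (simp add: zg transfer_factor_def Xzg inv_mult_group m_assoc)
    finally have "?D (X #> z) g = ?D X g \<otimes> e'" by simp
    have "[f (?D X g \<otimes> e') = f (?D X g) + f e'] (mod int p)"
      using mod_homD[OF f] T.factor_mem[OF X gc] e' Y(2) by blast
    moreover have "[f (?D X g) + f e' = f (?D X g) + 0] (mod int p)" by (rule cong_add[OF cong_refl fY[OF e']])
    ultimately have "[f (?D X g \<otimes> e') = f (?D X g) + 0] (mod int p)" by (rule cong_trans)
    then show ?thesis using \<open>?D (X #> z) g = ?D X g \<otimes> e'\<close> by simp
  qed
  have zfix: "X = N" if X: "X \<in> rcosets N" and eq: "X #> z = X" for X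
  proof -
    obtain x where x: "x \<in> carrier G" "X = N #> x" using X by (auto simp: RCOSETS_def)
    have "N #> (x \<otimes> z) = N #> x" using eq x N by (simp add: coset_mult_assoc subgroup.subset)
    then have "x \<otimes> z \<otimes> inv x \<in> N" using rcos_eq_iff[OF N] x by simp
    then have "x \<in> N" by (rule fixed[OF x(1)])
    then show ?thesis using x(2) Nmult by simp
  qed
  let ?S = "rcosets N - {N}"
  have bijS: "bij_betw (\<lambda>X. X #> z) ?S ?S"
    by (rule bij_betw_DiffI[OF T.coset_bij[OF zc]]) (simp_all add: bij_betw_def Nmult[OF zN] N1)
  have eval: "[transfer_map G N \<tau> f g = f g] (mod int p)" if g: "g \<in> P" for g
  proof -
    have gc [simp]: "g \<in> carrier G" and gN: "g \<in> N" using g Pc P(2) by auto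
    have "[(\<Sum>X\<in>?S. f (?D X g)) = 0] (mod int p)"
    proof (rule sum_cycles_cong[OF _ bijS])
      show "finite ?S" using T.finite_cosets by simp
      fix X assume X: "X \<in> ?S"
      then have X': "X \<in> rcosets N" "X \<noteq> N" by auto
      have inS: "((\<lambda>X. X #> z) ^^ j) X \<in> ?S" for j
        using funpow_mem[of "\<lambda>X. X #> z" ?S X j] bijS X by (auto simp: bij_betw_def)
      have per: "((\<lambda>X. X #> z) ^^ p) X = X"
        unfolding T.funpow_coset[OF X'(1) zc] using Yfix[OF X'(1) z(2)] .
      have const: "[f (?D (((\<lambda>X. X #> z) ^^ j) X) g) = f (?D X g)] (mod int p)" for j
      proof (induction j)
        case (Suc j)
        have "[f (?D (((\<lambda>X. X #> z) ^^ j) X #> z) g) = f (?D (((\<lambda>X. X #> z) ^^ j) X) g)] (mod int p)"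
          using step[OF _ _ g] inS[of j] by blast
        from cong_trans[OF this Suc] show ?case by simp
      qed simp
      have "[(\<Sum>j<p. f (?D (((\<lambda>X. X #> z) ^^ j) X) g)) = (\<Sum>j<p. f (?D X g))] (mod int p)"
        by (rule cong_sum) (rule const)
      also have "[(\<Sum>j<p. f (?D X g)) = 0] (mod int p)" by (simp add: cong_0_iff)
      finally have "[(\<Sum>j<p. f (?D (((\<lambda>X. X #> z) ^^ j) X) g)) = 0] (mod int p)" .
      moreover have "X #> z \<noteq> X" using zfix X' by blast
      ultimately show "\<exists>L>0. ((\<lambda>X. X #> z) ^^ L) X = X \<and> (\<forall>j. 0 < j \<and> j < L \<longrightarrow> ((\<lambda>X. X #> z) ^^ j) X \<noteq> X) \<and>
          [(\<Sum>j<L. f (?D (((\<lambda>X. X #> z) ^^ j) X) g)) = 0] (mod int p)"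
        using period_prime_cases[OF p per] per prime_gt_0_nat[OF p] by (intro exI[of _ p] conjI) blast+
    qed
    moreover have "transfer_map G N \<tau> f g = f (?D N g) + (\<Sum>X\<in>?S. f (?D X g))"
      unfolding transfer_map_def using sum.remove[OF T.finite_cosets N1] .
    moreover have "?D N g = g" by (simp add: transfer_factor_def Nmult[OF gN] \<tau>_def)
    ultimately show ?thesis using cong_add[OF cong_refl[of "f g"], of _ 0] by simp
  qed
  show ?thesis using T.transfer_mod_hom[OF f] eval by blast
qed

section \<open>Metacyclic \<open>p\<close>-groups\<close>

text \<open>\<open>S\<close> is the ideal generated by some \<open>p ^ b\<close>, and
  \<open>m\<close> is \<open>p ^ (b - 1)\<close>, or 0 if \<open>S\<close> is everything. The
  typical \<open>S\<close> are the exponents that kill \<open>n\<close> and those that send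
  \<open>g\<close> into the cyclic normal subgroup.\<close>

lemma int_subgroup_prime_power:
  fixes S :: "int set"
  assumes p: "Factorial_Ring.prime (p::nat)" and S: "\<And>x y. x \<in> S \<Longrightarrow> y \<in> S \<Longrightarrow> x - y \<in> S" "int p ^ a \<in> S"
  obtains m where "int p * m \<in> S" "1 \<in> S \<or> m \<notin> S"
    "\<And>i. int p * i \<in> S \<Longrightarrow> \<exists>k<p. i - m * int k \<in> S"
proof -
  have zero: "0 \<in> S" using S(1)[OF S(2) S(2)] by simp
  have neg: "- x \<in> S" if "x \<in> S" for x using S(1)[OF zero that] by simp
  have add: "x + y \<in> S" if "x \<in> S" "y \<in> S" for x y using S(1)[OF that(1) neg[OF that(2)]] by simp
  have mul: "x * k \<in> S" if x: "x \<in> S" for x k :: int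
  proof (induction k rule: int_induct[of _ 0])
    case (step1 i) then show ?case using add[OF step1(2) x] by (simp add: algebra_simps)
  next
    case (step2 i) then show ?case using S(1)[OF step2(2) x] by (simp add: algebra_simps)
  qed (use zero in simp)
  have p1: "1 < p" using p prime_gt_1_nat by blast
  define b where "b = (LEAST b. int p ^ b \<in> S)"
  have b: "int p ^ b \<in> S" unfolding b_def using S(2) by (rule LeastI)
  have iff: "i \<in> S \<longleftrightarrow> int p ^ b dvd i" for i
  proof
    assume i: "i \<in> S"
    have "gcd (int p ^ b) i \<in> S"
      using bezout_int[of "int p ^ b" i] add mul b i by (metis mult.commute)
    moreover obtain c where c: "gcd (int p ^ b) i = int p ^ c" "c \<le> b"
    proof -
      have "nat (gcd (int p ^ b) i) dvd p ^ b" by (metis gcd_dvd1 gcd_ge_0_int int_dvd_int_iff int_nat_eq of_nat_power)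
      then obtain c where c: "c \<le> b" "nat (gcd (int p ^ b) i) = p ^ c" using divides_primepow_nat[OF p] by blast
      have "gcd (int p ^ b) i = int (nat (gcd (int p ^ b) i))" by simp
      then show ?thesis using c that by simp
    qed
    ultimately have "b \<le> c" unfolding b_def by (intro Least_le) simp
    then have "gcd (int p ^ b) i = int p ^ b" using c by simp
    then show "int p ^ b dvd i" by (metis gcd_dvd2)
  next
    assume "int p ^ b dvd i" then show "i \<in> S" using mul[OF b] by (auto elim!: dvdE)
  qed
  show thesis
  proof (cases b)
    case 0
    then have "i \<in> S" for i using iff by simp
    then show thesis using that[of 0] p1 by auto
  next
    case (Suc b')
    show thesis
    proof (rule that[of "int p ^ b'"])
      show "int p * int p ^ b' \<in> S" using b Suc by simp
      have "\<not> int p ^ Suc b' dvd int p ^ b'" using p1 by (intro notI) (auto dest!: zdvd_imp_le)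
      then show "1 \<in> S \<or> int p ^ b' \<notin> S" using iff Suc by simp
      fix i assume "int p * i \<in> S"
      then have "int p ^ b' dvd i" using iff Suc p1 by simp
      then obtain q where q: "i = int p ^ b' * q" by blast
      have "i - int p ^ b' * int (nat (q mod int p)) = int p ^ b' * (q - q mod int p)"
        using q p1 by (simp add: algebra_simps)
      also have "\<dots> = int p ^ b * (q div int p)" using Suc by (simp add: minus_mod_eq_mult_div)
      finally have "i - int p ^ b' * int (nat (q mod int p)) \<in> S" using iff by simp
      moreover have "nat (q mod int p) < p" using p1 by (simp add: nat_less_iff)
      ultimately show "\<exists>k<p. i - int p ^ b' * int k \<in> S" by blast
    qed
  qed
qed

text \<open>For \<open>s = 1 + p k\<close> the sum is \<open>p + p k (0 + 1 + ... + (p - 1))\<close>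
  modulo the square of \<open>p\<close>, and for odd \<open>p\<close> the inner sum is a multiple of
  \<open>p\<close>. This is why \<open>p\<close>-th powers behave regularly in the metacyclic groups
  considered here.\<close>

lemma geometric_sum_mod_prime_square:
  fixes s :: int
  assumes "odd p" "[s = 1] (mod int p)"
  obtains u where "(\<Sum>r<p. s ^ r) = int p * u" "[u = 1] (mod int p)"
proof -
  have "[1 = s] (mod int p)" using assms(2) by (rule cong_sym)
  then obtain k where k: "s = 1 + int p * k" by (auto simp: cong_iff_lin)
  have pw: "[s ^ r = 1 + int r * (int p * k)] (mod int p * int p)" for r
  proof (induction r)
    case (Suc r)
    have "[s ^ Suc r = s * (1 + int r * (int p * k))] (mod int p * int p)" using cong_mult[OF cong_refl Suc] by simp
    also have "s * (1 + int r * (int p * k)) = 1 + int (Suc r) * (int p * k) + int p * int p * (int r * k * k)"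
      by (simp add: k algebra_simps)
    finally have "[s ^ Suc r = 1 + int (Suc r) * (int p * k) + int p * int p * (int r * k * k)] (mod int p * int p)" .
    moreover have "[1 + int (Suc r) * (int p * k) + int p * int p * (int r * k * k) = 1 + int (Suc r) * (int p * k)] (mod int p * int p)"
      by (simp only: cong_def mod_mult_self2)
    ultimately show ?case by (rule cong_trans)
  qed simp
  obtain h where h: "p = Suc (2 * h)" using assms(1) by (auto elim: oddE)
  have "[(\<Sum>r<p. s ^ r) = (\<Sum>r<p. 1 + int r * (int p * k))] (mod int p * int p)"
    by (rule cong_sum) (rule pw)
  also have "(\<Sum>r<p. 1 + int r * (int p * k)) = int p + (\<Sum>r<p. int r) * (int p * k)"
    by (simp add: sum.distrib sum_distrib_right)
  also have "(\<Sum>r<p. int r) = int p * int h"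
  proof -
    have "2 * (\<Sum>r<n. int r) = int n * (int n - 1)" for n by (induction n) (simp_all add: algebra_simps)
    from this[of p] show ?thesis by (simp add: h algebra_simps)
  qed
  finally have "[(\<Sum>r<p. s ^ r) = int p + int p * int p * (int h * k)] (mod int p * int p)" by (simp add: mult_ac)
  from cong_sym[OF this] obtain q' where "(\<Sum>r<p. s ^ r) = int p + int p * int p * (int h * k) + int p * int p * q'"
    by (auto simp: cong_iff_lin)
  then obtain q where "(\<Sum>r<p. s ^ r) = int p + int p * int p * q"
    by (metis add.assoc distrib_left)
  then have "(\<Sum>r<p. s ^ r) = int p * (1 + int p * q)" by (simp add: algebra_simps)
  moreover have "[1 + int p * q = 1] (mod int p)" by (simp add: cong_iff_dvd_diff)
  ultimately show ?thesis by (rule that)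
qed

lemma fermat_int:
  fixes s :: int
  assumes p: "Factorial_Ring.prime p" shows "[s ^ p = s] (mod int p)"
proof -
  define b where "b = nat (s mod int p)"
  have sb: "[s = int b] (mod int p)" using prime_gt_0_nat[OF p] by (simp add: b_def cong_def)
  have "[b ^ p = b] (mod p)"
  proof (cases "p dvd b")
    case True
    then have "p dvd b ^ p" using prime_gt_0_nat[OF p] by (simp add: dvd_power_iff dvd_trans dvd_power)
    then show ?thesis using True by (simp add: cong_def mod_eq_0_iff_dvd[symmetric])
  next
    case False
    have "[b ^ (p - 1) * b = 1 * b] (mod p)" by (rule cong_mult[OF fermat_theorem[OF p False] cong_refl])
    moreover have "b ^ (p - 1) * b = b ^ p" using prime_gt_0_nat[OF p] by (simp flip: power_Suc2)
    ultimately show ?thesis by simp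
  qed
  then have 1: "[int b ^ p = int b] (mod int p)" by (simp flip: of_nat_power add: cong_int_iff)
  have "[s ^ p = int b ^ p] (mod int p)" by (rule cong_pow[OF sb])
  then show ?thesis using 1 sb cong_trans cong_sym by blast
qed

text \<open>The powers of \<open>n\<close> form the cyclic normal subgroup and \<open>g\<close>
  generates the quotient. Stated with elements, the structure passes directly to homomorphic
  images.\<close>

definition metacyclic_gens :: "('a, 'b) monoid_scheme \<Rightarrow> 'a \<Rightarrow> 'a \<Rightarrow> bool" where
  "metacyclic_gens G n g \<longleftrightarrow> n \<in> carrier G \<and> g \<in> carrier G \<and>
     (\<forall>x\<in>carrier G. \<exists>k::int. inv\<^bsub>G\<^esub> x \<otimes>\<^bsub>G\<^esub> n \<otimes>\<^bsub>G\<^esub> x = n [^]\<^bsub>G\<^esub> k) \<and>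
     (\<forall>x\<in>carrier G. \<exists>(i::int) (j::int). x = g [^]\<^bsub>G\<^esub> i \<otimes>\<^bsub>G\<^esub> n [^]\<^bsub>G\<^esub> j)"

locale metacyclic_p_group = group G for G (structure) +
  fixes p a :: nat and n g
  assumes p: "Factorial_Ring.prime p" and odd: "odd p" and ord: "order G = p ^ a"
    and gens: "metacyclic_gens G n g"
begin

lemma fin: "finite (carrier G)"
  using ord p prime_gt_0_nat order_gt_0_iff_finite by (metis zero_less_power)

lemma n [simp]: "n \<in> carrier G" and g [simp]: "g \<in> carrier G"
  using gens by (simp_all add: metacyclic_gens_def)

lemma pow_card: "x \<in> carrier G \<Longrightarrow> x [^] (p ^ a) = \<one>"
  using pow_order_eq_1 ord by simp

lemma pow_coprime_mem:
  assumes "x \<in> carrier G" "\<not> int p dvd l" obtains k :: int where "x [^] (l * k) = x"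
proof -
  have "coprime (int p ^ a) l" using p assms(2) by (simp add: prime_imp_coprime coprime_power_left_iff)
  then obtain u v where uv: "u * int p ^ a + v * l = 1"
    using bezout_int[of "int p ^ a" l] by (auto simp: coprime_iff_gcd_eq_1)
  have "x [^] (int p ^ a) = \<one>" using pow_card[OF assms(1)] by (simp flip: int_pow_int)
  then have "x [^] (int p ^ a * u) = \<one>" using assms(1) by (simp flip: int_pow_pow)
  moreover have "x [^] (int p ^ a * u + l * v) = x" using uv assms(1) by (simp add: mult.commute)
  ultimately have "x [^] (l * v) = x" using assms(1) by (simp add: int_pow_mult)
  then show ?thesis by (rule that)
qed

text \<open>Conjugating \<open>p ^ a\<close> times by \<open>x\<close> is trivial, so
  \<open>s ^ (p ^ a)\<close> is 1 modulo the order of \<open>n\<close>, hence modulo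
  \<open>p\<close> unless \<open>n\<close> is trivial; Fermat's theorem then replaces the power by
  \<open>s\<close>.\<close>

lemma conj_exponent:
  assumes x: "x \<in> carrier G"
  obtains s where "n \<otimes> x = x \<otimes> n [^] (s::int)" "[s = 1] (mod int p)"
proof (cases "n = \<one>")
  case True
  then show ?thesis using that[of 1] x by simp
next
  case False
  obtain s :: int where s: "inv x \<otimes> n \<otimes> x = n [^] s" using gens x by (auto simp: metacyclic_gens_def)
  have nx: "n \<otimes> x = x \<otimes> n [^] s" using x by (simp add: s[symmetric] m_assoc)
  have pw: "inv (x [^] r) \<otimes> n \<otimes> x [^] r = n [^] (s ^ r)" for r :: nat
  proof (induction r)
    case (Suc r)
    have "inv (x [^] Suc r) \<otimes> n \<otimes> x [^] Suc r = inv x \<otimes> (inv (x [^] r) \<otimes> n \<otimes> x [^] r) \<otimes> x"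
      using x by (simp add: inv_mult_group m_assoc)
    also have "\<dots> = inv x \<otimes> n [^] (s ^ r) \<otimes> x" by (simp only: Suc)
    also have "\<dots> = (inv x \<otimes> n \<otimes> x) [^] (s ^ r)" using conj_int_pow[of "inv x" n] x by simp
    also have "\<dots> = n [^] (s ^ Suc r)" by (simp add: s int_pow_pow)
    finally show ?case .
  qed (use x in simp)
  have "n = n [^] (s ^ (p ^ a))" using pw[of "p ^ a"] pow_card[OF x] by simp
  then have "n [^] (s ^ (p ^ a) - 1) = \<one>" by (simp add: int_pow_diff)
  have "int p dvd s ^ (p ^ a) - 1"
  proof (rule ccontr)
    assume "\<not> int p dvd s ^ (p ^ a) - 1"
    then obtain k where "n [^] ((s ^ (p ^ a) - 1) * k) = n" using pow_coprime_mem n by blast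
    then have "n = (n [^] (s ^ (p ^ a) - 1)) [^] k" by (simp add: int_pow_pow)
    then show False using \<open>n [^] (s ^ (p ^ a) - 1) = \<one>\<close> False by simp
  qed
  moreover have "[s ^ (p ^ r) = s] (mod int p)" for r
  proof (induction r)
    case (Suc r)
    have "[(s ^ (p ^ r)) ^ p = s ^ p] (mod int p)" by (rule cong_pow[OF Suc])
    moreover have "[s ^ p = s] (mod int p)" by (rule fermat_int[OF p])
    ultimately show ?case by (simp add: power_mult[symmetric] mult.commute) (metis cong_trans)
  qed simp
  ultimately have "[s = 1] (mod int p)" by (metis cong_iff_dvd_diff cong_sym cong_trans)
  then show ?thesis using nx that by blast
qed

text \<open>Moving all powers of \<open>n\<close> to the right produces a geometric sum in the
  exponent of the conjugation. The factor \<open>u\<close> is the same for all \<open>j\<close> and,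
  being prime to \<open>p\<close>, can be inverted in exponents.\<close>

lemma pow_times_n:
  assumes x: "x \<in> carrier G"
  obtains u where "\<And>j::int. (x \<otimes> n [^] j) [^] p = x [^] p \<otimes> n [^] (j * (int p * u))" "[u = 1] (mod int p)"
proof -
  obtain s where s: "n \<otimes> x = x \<otimes> n [^] (s::int)" "[s = 1] (mod int p)" using conj_exponent[OF x] .
  have sw: "n [^] i \<otimes> x = x \<otimes> n [^] (s * i)" for i :: int
  proof -
    have "inv x \<otimes> n [^] i \<otimes> x = (inv x \<otimes> n \<otimes> x) [^] i" using conj_int_pow[of "inv x" n i] x by simp
    also have "inv x \<otimes> n \<otimes> x = n [^] s" using s(1) x by (simp add: m_assoc)
    finally have "inv x \<otimes> n [^] i \<otimes> x = n [^] (s * i)" by (simp add: int_pow_pow)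
    then have "x \<otimes> (inv x \<otimes> n [^] i \<otimes> x) = x \<otimes> n [^] (s * i)" by simp
    then show ?thesis using x by (simp add: m_assoc)
  qed
  have pw: "(x \<otimes> n [^] j) [^] r = x [^] r \<otimes> n [^] (j * (\<Sum>i<r. s ^ i))" for r :: nat and j :: int
  proof (induction r)
    case (Suc r)
    have "(x \<otimes> n [^] j) [^] Suc r = x [^] r \<otimes> n [^] (j * (\<Sum>i<r. s ^ i)) \<otimes> (x \<otimes> n [^] j)" using Suc by simp
    also have "\<dots> = x [^] r \<otimes> (n [^] (j * (\<Sum>i<r. s ^ i)) \<otimes> x) \<otimes> n [^] j" using x by (simp add: m_assoc)
    also have "\<dots> = x [^] Suc r \<otimes> n [^] (s * (j * (\<Sum>i<r. s ^ i)) + j)"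
      using x by (simp add: sw m_assoc int_pow_mult)
    also have "s * (j * (\<Sum>i<r. s ^ i)) + j = j * (\<Sum>i<Suc r. s ^ i)"
      by (subst sum.lessThan_Suc_shift) (simp add: sum_distrib_left algebra_simps)
    finally show ?case .
  qed simp
  obtain u where u: "(\<Sum>r<p. s ^ r) = int p * u" "[u = 1] (mod int p)"
    using geometric_sum_mod_prime_square[OF odd s(2)] .
  show ?thesis by (rule that[OF _ u(2)]) (simp add: pw u(1))
qed

definition N where "N = range (\<lambda>j::int. n [^] j)"

lemma N: "subgroup N G" unfolding N_def by (rule subgroup_of_powers) simp

lemma not_dvd_unit: "[u = 1] (mod int p) \<Longrightarrow> \<not> int p dvd u"
  using p by (metis cong_dvd_iff int_dvd_int_iff not_prime_unit of_nat_1)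

lemma N_conj: "x \<in> carrier G \<Longrightarrow> y \<in> N \<Longrightarrow> x \<otimes> y \<otimes> inv x \<in> N"
proof -
  assume x: "x \<in> carrier G" and "y \<in> N"
  then obtain j :: int where j: "y = n [^] j" by (auto simp: N_def)
  obtain k :: int where "inv (inv x) \<otimes> n \<otimes> inv x = n [^] k" using gens x inv_closed unfolding metacyclic_gens_def by blast
  then have "x \<otimes> y \<otimes> inv x = n [^] (k * j)" using x j by (simp add: conj_int_pow int_pow_pow)
  then show ?thesis by (simp add: N_def)
qed

lemma g_pow_in_N:
  "\<exists>m::int. g [^] (int p * m) \<in> N \<and> (carrier G = N \<or> g [^] m \<notin> N) \<and>
    (\<forall>i::int. g [^] (int p * i) \<in> N \<longrightarrow> (\<exists>k<p. g [^] (i - m * int k) \<in> N))"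
proof -
  let ?S = "{i::int. g [^] i \<in> N}"
  have 1: "x - y \<in> ?S" if "x \<in> ?S" "y \<in> ?S" for x y
    using that N by (simp add: int_pow_diff subgroup.m_closed subgroup.m_inv_closed)
  have 2: "int p ^ a \<in> ?S" using pow_card[OF g] subgroup.one_closed[OF N] by (simp flip: int_pow_int)
  obtain m where m: "int p * m \<in> ?S" "1 \<in> ?S \<or> m \<notin> ?S" "\<And>i. int p * i \<in> ?S \<Longrightarrow> \<exists>k<p. i - m * int k \<in> ?S"
    using int_subgroup_prime_power[OF p 1 2] by blast
  have "carrier G = N" if "g \<in> N"
  proof
    show "carrier G \<subseteq> N"
    proof
      fix x assume "x \<in> carrier G"
      then obtain i j :: int where "x = g [^] i \<otimes> n [^] j" using gens unfolding metacyclic_gens_def by blast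
      moreover have "n [^] j \<in> N" by (simp add: N_def)
      ultimately show "x \<in> N" using subgroup.m_closed[OF N subgroup_int_pow_mem[OF N that]] by simp
    qed
  qed (rule subgroup.subset[OF N])
  then have "1 \<in> ?S \<Longrightarrow> carrier G = N" by simp
  then show ?thesis using m by (intro exI[of _ m]) blast
qed

text \<open>At most \<open>p\<close> cosets of \<open>N\<close> contain such an element, because the
  \<open>p\<close>-th power of \<open>g [^] i\<close> has to fall into \<open>N\<close>. Inside one
  coset two of them differ by an element of the cyclic group \<open>N\<close> with trivial
  \<open>p\<close>-th power, and there are at most \<open>p\<close> of these.\<close>

lemma card_exponent_p: "card {x \<in> carrier G. x [^] p = \<one>} \<le> p\<^sup>2"
proof -
  let ?X = "{x \<in> carrier G. x [^] p = \<one>}"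
  let ?S = "{j::int. n [^] j = \<one>}"
  have 1: "x - y \<in> ?S" if "x \<in> ?S" "y \<in> ?S" for x y using that by (simp add: int_pow_diff)
  have 2: "int p ^ a \<in> ?S" using pow_card[OF n] by (simp flip: int_pow_int)
  obtain m where m: "\<And>i. int p * i \<in> ?S \<Longrightarrow> \<exists>k<p. i - m * int k \<in> ?S"
    using int_subgroup_prime_power[OF p 1 2] by blast
  obtain q :: int where q: "\<And>i::int. g [^] (int p * i) \<in> N \<Longrightarrow> \<exists>k<p. g [^] (i - q * int k) \<in> N"
    using g_pow_in_N by auto
  \<comment> \<open>One solution is chosen per coset; for a coset without solutions the value is
    arbitrary, which can only enlarge the covering set.\<close>
  define r where "r = (\<lambda>k::nat. SOME x. x \<in> ?X \<and> inv (g [^] (q * int k)) \<otimes> x \<in> N)"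
  have sub: "?X \<subseteq> (\<lambda>(k, l). r k \<otimes> n [^] (m * int l)) ` ({..<p} \<times> {..<p})"
  proof
    fix x assume x: "x \<in> ?X"
    then have xc: "x \<in> carrier G" and xp: "x [^] p = \<one>" by auto
    obtain i j :: int where ij: "x = g [^] i \<otimes> n [^] j" using gens xc unfolding metacyclic_gens_def by blast
    obtain u where u: "(g [^] i \<otimes> n [^] j) [^] p = (g [^] i) [^] p \<otimes> n [^] (j * (int p * u))"
      using pow_times_n[of "g [^] i"] by (metis g int_pow_closed)
    have "g [^] (int p * i) \<in> N"
    proof -
      have "(g [^] i) [^] p \<otimes> n [^] (j * (int p * u)) = \<one>" using u xp ij by simp
      then have "(g [^] i) [^] p = inv (n [^] (j * (int p * u)))" by (intro inv_equality[symmetric]) simp_all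
      also have "\<dots> \<in> N" using N by (simp add: N_def subgroup.m_inv_closed flip: int_pow_neg)
      finally show ?thesis by (simp add: int_pow_pow mult.commute flip: int_pow_int)
    qed
    then obtain k where k: "k < p" "g [^] (i - q * int k) \<in> N" using q by blast
    have "inv (g [^] (q * int k)) \<otimes> x = g [^] (i - q * int k) \<otimes> n [^] j"
      by (simp add: ij m_assoc[symmetric] flip: int_pow_mult int_pow_neg)
    also have "\<dots> \<in> N" using k(2) N by (auto intro: subgroup.m_closed simp: N_def)
    finally have xk: "inv (g [^] (q * int k)) \<otimes> x \<in> N" .
    have rk: "r k \<in> ?X \<and> inv (g [^] (q * int k)) \<otimes> r k \<in> N" unfolding r_def
      by (rule someI[of _ x]) (use x xk in simp)
    then have rc: "r k \<in> carrier G" and rp: "r k [^] p = \<one>" by auto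
    have "inv (inv (g [^] (q * int k)) \<otimes> r k) \<otimes> (inv (g [^] (q * int k)) \<otimes> x) \<in> N"
      using rk xk N by (simp add: subgroup.m_closed subgroup.m_inv_closed)
    then have "inv (r k) \<otimes> x \<in> N" using rc xc by (simp add: inv_mult_group m_assoc)
    then obtain t :: int where t: "inv (r k) \<otimes> x = n [^] t" by (auto simp: N_def)
    then have xt: "x = r k \<otimes> n [^] t" using rc xc by (metis m_inv_cancel(1))
    obtain w where w: "(r k \<otimes> n [^] t) [^] p = r k [^] p \<otimes> n [^] (t * (int p * w))" "[w = 1] (mod int p)"
      using pow_times_n[OF rc] by blast
    have "n [^] (t * (int p * w)) = \<one>" using w(1) xp xt rp by simp
    then have 3: "(n [^] (int p * t)) [^] w = \<one>" by (simp add: int_pow_pow mult_ac)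
    obtain v where "(n [^] (int p * t)) [^] (w * v) = n [^] (int p * t)"
      using pow_coprime_mem[of "n [^] (int p * t)" w] not_dvd_unit[OF w(2)] by (metis n int_pow_closed)
    then have "n [^] (int p * t) = \<one>" using 3 by (metis int_pow_closed int_pow_one int_pow_pow n)
    then have "int p * t \<in> ?S" by simp
    then obtain l where l: "l < p" "n [^] (t - m * int l) = \<one>" using m by blast
    then have "n [^] t = n [^] (m * int l)" by (simp add: int_pow_diff) (metis inv_equality inv_inv int_pow_closed inv_closed n)
    then have "x = r k \<otimes> n [^] (m * int l)" using xt by simp
    then show "x \<in> (\<lambda>(k, l). r k \<otimes> n [^] (m * int l)) ` ({..<p} \<times> {..<p})" using k(1) l(1) by (intro image_eqI[of _ _ "(k, l)"]) simp_all
  qed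
  have "card ?X \<le> card ((\<lambda>(k, l). r k \<otimes> n [^] (m * int l)) ` ({..<p} \<times> {..<p}))"
    by (rule card_mono[OF _ sub]) simp
  also have "\<dots> \<le> card ({..<p} \<times> {..<p})" by (rule card_image_le) simp
  finally show ?thesis by (simp add: card_cartesian_product power2_eq_square)
qed

text \<open>Take \<open>g [^] m\<close> outside \<open>N\<close> with its \<open>p\<close>-th power
  \<open>n [^] l\<close> inside. Here \<open>p\<close> divides \<open>l\<close>, since otherwise
  \<open>n\<close> would be a power of \<open>g\<close> and the group cyclic; so a suitable power of
  \<open>n\<close> cancels the \<open>p\<close>-th power.\<close>

lemma exponent_p_outside:
  assumes "\<not> comm_group G"
  obtains e where "e \<in> carrier G" "e [^] p = \<one>" "e \<notin> N"
proof -
  obtain m :: int where m: "g [^] (int p * m) \<in> N" "carrier G = N \<or> g [^] m \<notin> N" using g_pow_in_N by auto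
  have notN: "carrier G \<noteq> N"
  proof
    assume "carrier G = N"
    then have "cyclic_group G" using cyclic_group n by (metis N_def)
    then show False using assms cyclic_imp_abelian_group by blast
  qed
  obtain l :: int where l: "g [^] (int p * m) = n [^] l" using m(1) by (auto simp: N_def)
  have "int p dvd l"
  proof (rule ccontr)
    assume "\<not> int p dvd l"
    then obtain k where "n [^] (l * k) = n" using pow_coprime_mem n by blast
    then have n_eq: "n = g [^] (int p * m * k)" by (simp add: l int_pow_pow[symmetric] del: int_pow_pow)
    have "carrier G = range (\<lambda>i::int. g [^] i)"
    proof
      show "carrier G \<subseteq> range (\<lambda>i::int. g [^] i)"
      proof
        fix x assume "x \<in> carrier G"
        then obtain i j :: int where "x = g [^] i \<otimes> n [^] j" using gens unfolding metacyclic_gens_def by blast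
        then have "x = g [^] (i + int p * m * k * j)" by (subst (asm) n_eq) (simp add: int_pow_pow int_pow_mult)
        then show "x \<in> range (\<lambda>i::int. g [^] i)" by blast
      qed
    qed auto
    then have "cyclic_group G" using cyclic_group g by blast
    then show False using assms cyclic_imp_abelian_group by blast
  qed
  then obtain l' where l': "l = int p * l'" by blast
  obtain u where u: "\<And>j::int. (g [^] m \<otimes> n [^] j) [^] p = (g [^] m) [^] p \<otimes> n [^] (j * (int p * u))" "[u = 1] (mod int p)"
    using pow_times_n[of "g [^] m"] by (metis g int_pow_closed)
  have "n [^] (int p * l') \<in> carrier G" by simp
  then obtain k where k: "(n [^] (int p * l')) [^] (u * k) = n [^] (int p * l')"
    using pow_coprime_mem not_dvd_unit[OF u(2)] by blast
  have "(g [^] m \<otimes> n [^] (- l' * k)) [^] p = (g [^] m) [^] p \<otimes> n [^] (- (int p * l' * (u * k)))"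
    by (simp add: u(1) algebra_simps)
  also have "(g [^] m) [^] p = n [^] (int p * l')" using l l' by (simp add: int_pow_pow mult.commute flip: int_pow_int)
  also have "n [^] (- (int p * l' * (u * k))) = inv (n [^] (int p * l'))" using k by (simp add: int_pow_neg int_pow_pow)
  finally have "(g [^] m \<otimes> n [^] (- l' * k)) [^] p = \<one>" by simp
  moreover have "g [^] m \<otimes> n [^] (- l' * k) \<notin> N"
  proof
    assume "g [^] m \<otimes> n [^] (- l' * k) \<in> N"
    moreover have "inv (n [^] (- l' * k)) \<in> N" using N by (auto simp: N_def intro: subgroup.m_inv_closed)
    ultimately have "g [^] m \<otimes> n [^] (- l' * k) \<otimes> inv (n [^] (- l' * k)) \<in> N" by (rule subgroup.m_closed[OF N])
    then show False using m(2) notN by (simp add: m_assoc)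
  qed
  ultimately show ?thesis by (intro that) simp_all
qed

end

section \<open>Conjugation and weak closure\<close>

definition cj :: "('a, 'b) monoid_scheme \<Rightarrow> 'a \<Rightarrow> 'a \<Rightarrow> 'a" where
  "cj G g x = g \<otimes>\<^bsub>G\<^esub> x \<otimes>\<^bsub>G\<^esub> inv\<^bsub>G\<^esub> g"

section \<open>Conjugation and exponents\<close>

context group
begin

lemma cj_closed [simp]: "g \<in> carrier G \<Longrightarrow> x \<in> carrier G \<Longrightarrow> cj G g x \<in> carrier G"
  by (simp add: cj_def)

lemma cj_mult: "g \<in> carrier G \<Longrightarrow> x \<in> carrier G \<Longrightarrow> y \<in> carrier G \<Longrightarrow> cj G g (x \<otimes> y) = cj G g x \<otimes> cj G g y"
  by (simp add: cj_def m_assoc)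

lemma cj_inv: "g \<in> carrier G \<Longrightarrow> x \<in> carrier G \<Longrightarrow> cj G g (inv x) = inv (cj G g x)"
  by (simp add: cj_def m_assoc inv_mult_group)

lemma cj_one [simp]: "g \<in> carrier G \<Longrightarrow> cj G g \<one> = \<one>"
  by (simp add: cj_def)

lemma cj_by_one [simp]: "x \<in> carrier G \<Longrightarrow> cj G \<one> x = x"
  by (simp add: cj_def)

lemma cj_int_pow: "g \<in> carrier G \<Longrightarrow> x \<in> carrier G \<Longrightarrow> cj G g (x [^] (k::int)) = cj G g x [^] k"
  by (simp add: cj_def conj_int_pow)

lemma cj_nat_pow: "g \<in> carrier G \<Longrightarrow> x \<in> carrier G \<Longrightarrow> cj G g (x [^] (k::nat)) = cj G g x [^] k"
  by (simp add: cj_def conj_nat_pow)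

lemma cj_comp: "g \<in> carrier G \<Longrightarrow> h \<in> carrier G \<Longrightarrow> x \<in> carrier G \<Longrightarrow> cj G (g \<otimes> h) x = cj G g (cj G h x)"
  by (simp add: cj_def m_assoc inv_mult_group)

lemma cj_inv_cancel [simp]:
  "g \<in> carrier G \<Longrightarrow> x \<in> carrier G \<Longrightarrow> cj G (inv g) (cj G g x) = x"
  "g \<in> carrier G \<Longrightarrow> x \<in> carrier G \<Longrightarrow> cj G g (cj G (inv g) x) = x"
  by (simp_all add: cj_def m_assoc)

lemma cj_inject: "g \<in> carrier G \<Longrightarrow> x \<in> carrier G \<Longrightarrow> y \<in> carrier G \<Longrightarrow> cj G g x = cj G g y \<longleftrightarrow> x = y"
  by (simp add: cj_def)

lemma cj_eq_self_iff: "g \<in> carrier G \<Longrightarrow> x \<in> carrier G \<Longrightarrow> cj G g x = x \<longleftrightarrow> g \<otimes> x = x \<otimes> g"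
  unfolding cj_def by (metis inv_solve_right' m_closed)

lemma cj_eq_self_sym: "g \<in> carrier G \<Longrightarrow> x \<in> carrier G \<Longrightarrow> cj G g x = x \<longleftrightarrow> cj G x g = g"
  by (auto simp: cj_eq_self_iff)

lemma order_p_power:
  fixes p :: nat
  assumes x: "x \<in> carrier G" "x [^] (p ^ a) = \<one>" "x \<noteq> \<one>"
  obtains k :: nat where "x [^] (p ^ k) \<noteq> \<one>" "(x [^] (p ^ k)) [^] p = \<one>"
proof -
  define k where "k = (LEAST k. x [^] (p ^ k) = \<one>)"
  have k: "x [^] (p ^ k) = \<one>" unfolding k_def by (rule LeastI) (rule x(2))
  then have "k \<noteq> 0" using x by (intro notI) (simp flip: One_nat_def add: nat_pow_eone)
  then obtain m where m: "k = Suc m" using not0_implies_Suc by blast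
  have "x [^] (p ^ m) \<noteq> \<one>" using not_less_Least[of m "\<lambda>k. x [^] (p ^ k) = \<one>"] m by (simp add: k_def[symmetric])
  moreover have "(x [^] (p ^ m)) [^] p = \<one>" using k nat_pow_pow[OF x(1), of "p ^ m" p] by (simp add: m mult.commute)
  ultimately show ?thesis by (rule that)
qed

lemma pow_cong_exponent:
  assumes "z \<in> carrier G" "z [^] p = \<one>" "[i = j] (mod int p)"
  shows "z [^] i = z [^] j"
proof -
  obtain q where q: "j = i + int p * q" using assms(3) by (auto simp: cong_iff_lin)
  have "z [^] (int p * q) = (z [^] int p) [^] q" using assms(1) by (simp add: int_pow_pow)
  then have "z [^] (int p * q) = \<one>" using assms(2) by (simp add: int_pow_int)
  then show ?thesis using assms(1) by (simp add: q int_pow_mult)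
qed

lemma pow_eq_one_prime:
  assumes "Factorial_Ring.prime p" "z \<in> carrier G" "z [^] p = \<one>" "z \<noteq> \<one>"
  shows "z [^] (i::int) = \<one> \<longleftrightarrow> int p dvd i"
proof
  assume i: "z [^] i = \<one>"
  show "int p dvd i"
  proof (rule ccontr)
    assume "\<not> int p dvd i"
    then have "coprime (int p) i" using assms(1) by (simp add: prime_imp_coprime)
    then obtain u v where uv: "u * int p + v * i = 1" using bezout_int[of "int p" i] by (auto simp: coprime_iff_gcd_eq_1)
    have "z = z [^] (int p * u + i * v)" using uv assms(2) by (simp add: mult.commute)
    also have "\<dots> = (z [^] int p) [^] u \<otimes> (z [^] i) [^] v" using assms(2) by (simp add: int_pow_mult int_pow_pow)
    also have "\<dots> = \<one>" using i assms(3) by (simp add: int_pow_int)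
    finally show False using assms(4) by simp
  qed
next
  assume "int p dvd i"
  then have "[i = 0] (mod int p)" by (simp add: cong_0_iff)
  from pow_cong_exponent[OF assms(2,3) this] show "z [^] i = \<one>" by simp
qed

end

lemma invert_mod_prime:
  assumes "Factorial_Ring.prime p" "\<not> int p dvd i"
  obtains k where "[k * i = 1] (mod int p)"
proof -
  have "coprime i (int p)" using assms prime_imp_coprime[of "int p" i] by (simp add: coprime_commute)
  then obtain k where "[i * k = 1] (mod int p)" using cong_solve_coprime_int by blast
  then show ?thesis using that by (simp add: mult.commute)
qed

lemma power_prime_power_cong:
  fixes j :: int
  assumes p: "Factorial_Ring.prime p" shows "[j ^ (p ^ r) = j] (mod int p)"
proof (induction r)
  case (Suc r)
  have "[(j ^ (p ^ r)) ^ p = j ^ p] (mod int p)" by (rule cong_pow[OF Suc])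
  from cong_trans[OF this fermat_int[OF p]] show ?case by (simp add: power_mult[symmetric] mult.commute)
qed simp

text \<open>If \<open>z'\<close> is a conjugate of \<open>z\<close> in \<open>P\<close> outside \<open>\<langle>z\<rangle>\<close>, then \<open>E = \<langle>z, z'\<rangle>\<close> contains every
  element of exponent \<open>p\<close> of \<open>P\<close>, and two Sylow subgroups induce opposite transvection groups on \<open>E\<close>.
  These generate an element acting as \<open>-1\<close>; Sylow's theorem makes it normalise \<open>P\<close>, where it then has no
  fixed points although it acts trivially on \<open>P / C\<^sub>P(E)\<close>.\<close>

lemma (in group) weak_closure:
  assumes fin: "finite (carrier G)" and p: "Factorial_Ring.prime p" and odd: "odd p"
    and P: "sylow_sub p G P" and z: "z \<in> P" "z \<noteq> \<one>" "z [^] p = \<one>"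
    and central: "\<And>g. g \<in> P \<Longrightarrow> cj G g z = z"
    and cardE: "card {x \<in> P. x [^] p = \<one>} \<le> p\<^sup>2"
    and invariant: "\<And>h. h \<in> carrier G \<Longrightarrow> (\<And>x. x \<in> P \<Longrightarrow> cj G h x \<in> P) \<Longrightarrow> cj G h z \<in> range (\<lambda>k::int. z [^] k)"
    and t: "t \<in> carrier G" "cj G t z \<in> P"
  shows "cj G t z \<in> range (\<lambda>k::int. z [^] k)"
proof (rule ccontr)
  assume not: "cj G t z \<notin> range (\<lambda>k::int. z [^] k)"
  define z' where "z' = cj G t z"
  have sP: "subgroup P G" and "\<exists>a. card P = p ^ a" using P by (auto simp: sylow_sub_def)
  then obtain a where a: "card P = p ^ a" by blast
  note Pc [simp] = subgroup.mem_carrier[OF sP]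
  have finP: "finite P" using subgroup_finite[OF fin sP] .
  have zc [simp]: "z \<in> carrier G" using z(1) by simp
  have z'P: "z' \<in> P" using t(2) by (simp add: z'_def)
  then have z'c [simp]: "z' \<in> carrier G" by simp
  have z'p: "z' [^] p = \<one>" using cj_nat_pow[OF t(1) zc, of p] z(3) t(1) by (simp add: z'_def)
  have z'1: "z' \<noteq> \<one>" using cj_inject[OF t(1) zc one_closed] z(2) t(1) by (simp add: z'_def)
  have notz: "z' \<noteq> z [^] (k::int)" for k using not by (auto simp: z'_def)
  have p1: "1 < p" using p prime_gt_1_nat by blast
  have zz': "z \<otimes> z' = z' \<otimes> z" using central[OF z'P] by (simp add: cj_eq_self_iff)
  have comm_pow: "z [^] i \<otimes> z' [^] j = z' [^] j \<otimes> z [^] i" for i j :: int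
  proof -
    have "cj G z z' = z'" using zz' by (simp add: cj_eq_self_iff)
    then have "cj G z (z' [^] j) = z' [^] j" by (simp add: cj_int_pow)
    then have "cj G (z' [^] j) z = z" by (simp add: cj_eq_self_sym)
    then have "cj G (z' [^] j) (z [^] i) = z [^] i" by (simp add: cj_int_pow)
    then show ?thesis by (simp add: cj_eq_self_iff)
  qed
  \<comment> \<open>Additively, \<open>z\<close> and \<open>z'\<close> are linearly independent over
    the field with \<open>p\<close> elements.\<close>
  have indep: "int p dvd i \<and> int p dvd j" if eq: "z [^] i \<otimes> z' [^] j = \<one>" for i j :: int
  proof -
    have j: "int p dvd j"
    proof (rule ccontr)
      assume "\<not> int p dvd j"
      then obtain k where k: "[k * j = 1] (mod int p)" by (rule invert_mod_prime[OF p])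
      have "z' [^] j \<otimes> z [^] i = \<one>" using eq comm_pow by simp
      then have "z' [^] j = z [^] (-i)" using inv_equality[of "z' [^] j" "z [^] i"] by (simp add: int_pow_neg)
      then have "z' [^] (j * k) = z [^] (- i * k)" by (metis int_pow_pow z'c zc)
      moreover have "z' [^] (j * k) = z'" using pow_cong_exponent[OF z'c z'p k] by (simp add: mult.commute)
      ultimately show False using notz by metis
    qed
    then have "z' [^] j = \<one>" using pow_eq_one_prime[OF p z'c z'p z'1] by simp
    then have "z [^] i = \<one>" using eq by simp
    then show ?thesis using j pow_eq_one_prime[OF p zc z(3,2)] by simp
  qed
  define E where "E = {x \<in> P. x [^] p = \<one>}"
  have zw_eq: "z [^] i \<otimes> z' [^] j \<otimes> (z [^] k \<otimes> z' [^] l) = z [^] (i + k) \<otimes> z' [^] (j + l)" for i j k l :: int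
  proof -
    have "z [^] i \<otimes> z' [^] j \<otimes> (z [^] k \<otimes> z' [^] l) = z [^] i \<otimes> (z' [^] j \<otimes> z [^] k) \<otimes> z' [^] l" by (simp add: m_assoc)
    also have "z' [^] j \<otimes> z [^] k = z [^] k \<otimes> z' [^] j" by (rule comm_pow[symmetric])
    finally show ?thesis by (simp add: m_assoc int_pow_mult)
  qed
  have E_sub: "z [^] i \<otimes> z' [^] j \<in> E" for i j :: int
  proof -
    have pw: "(z [^] i \<otimes> z' [^] j) [^] (n::nat) = z [^] (int n * i) \<otimes> z' [^] (int n * j)" for n
      by (induction n) (simp_all add: zw_eq algebra_simps)
    have "z [^] (int p * i) = \<one>" "z' [^] (int p * j) = \<one>"
      using pow_eq_one_prime[OF p z'c z'p z'1, of "int p * j"] pow_eq_one_prime[OF p zc z(3,2), of "int p * i"] by simp_all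
    then have "(z [^] i \<otimes> z' [^] j) [^] p = \<one>" by (simp add: pw)
    moreover have "z [^] i \<otimes> z' [^] j \<in> P"
      using sP z(1) z'P by (simp add: subgroup.m_closed subgroup_int_pow_mem)
    ultimately show ?thesis by (simp add: E_def)
  qed
  \<comment> \<open>By independence the products take \<open>p\<^sup>2\<close> values, as many as
    the bound on elements of exponent \<open>p\<close> allows.\<close>
  have E_eq: "\<exists>(i::int) (j::int). e = z [^] i \<otimes> z' [^] j" if e: "e \<in> E" for e
  proof -
    let ?f = "\<lambda>(i, j). z [^] int i \<otimes> z' [^] int j"
    have "inj_on ?f ({..<p} \<times> {..<p})"
    proof (rule inj_onI, clarify)
      fix i j k l assume b: "i < p" "j < p" "k < p" "l < p"
        and eq: "z [^] int i \<otimes> z' [^] int j = z [^] int k \<otimes> z' [^] int l"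
      have "z [^] int i \<otimes> z' [^] int j \<otimes> (z [^] (- int k) \<otimes> z' [^] (- int l)) = \<one>"
        unfolding eq by (simp only: zw_eq) simp
      then have "int p dvd int i - int k \<and> int p dvd int j - int l"
        using indep[of "int i - int k" "int j - int l"] by (simp only: zw_eq) simp
      then have "[int i = int k] (mod int p)" "[int j = int l] (mod int p)" by (simp_all add: cong_iff_dvd_diff)
      then show "i = k \<and> j = l" using b by (simp add: cong_int_iff cong_less_modulus_unique_nat)
    qed
    then have "card (?f ` ({..<p} \<times> {..<p})) = p\<^sup>2"
      by (simp add: card_image card_cartesian_product power2_eq_square)
    moreover have "?f ` ({..<p} \<times> {..<p}) \<subseteq> E" using E_sub by auto
    moreover have "finite E" using finP by (simp add: E_def)
    moreover have "card E \<le> p\<^sup>2" using cardE by (simp add: E_def)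
    ultimately have "?f ` ({..<p} \<times> {..<p}) = E" by (intro card_seteq) simp_all
    then obtain i j :: nat where "e = z [^] int i \<otimes> z' [^] int j" using e by auto
    then show ?thesis by (intro exI[of _ "int i"] exI[of _ "int j"])
  qed
  have zE: "z \<in> E" and z'E: "z' \<in> E" using z z'P z'p by (auto simp: E_def)
  have Ec [simp]: "e \<in> carrier G" if "e \<in> E" for e using that by (simp add: E_def)
  \<comment> \<open>This is the centraliser of \<open>E\<close> in \<open>P\<close>, since
    \<open>z\<close> is central in \<open>P\<close>.\<close>
  define Q where "Q = {g \<in> P. cj G g z' = z'}"
  have sQ: "subgroup Q G"
  proof (rule finite_subgroupI[OF fin])
    show "Q \<noteq> {}" using subgroup.one_closed[OF sP] by (auto simp: Q_def)
    fix x y assume "x \<in> Q" "y \<in> Q"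
    then show "x \<otimes> y \<in> Q" using sP by (simp add: Q_def subgroup.m_closed cj_comp)
  qed (auto simp: Q_def)
  have QP: "Q \<subseteq> P" by (auto simp: Q_def)
  obtain b where b: "card Q = p ^ b"
    using card_subgroup_dvd(1)[OF fin sQ sP QP] a divides_primepow_nat[OF p] by auto
  define C' where "C' = {g \<in> carrier G. cj G g z' = z'}"
  have sC': "subgroup C' G"
    by (rule finite_subgroupI[OF fin]) (auto simp: C'_def cj_comp intro!: exI[of _ \<one>])
  define Pt where "Pt = (\<lambda>x. t \<otimes> x \<otimes> inv t) ` P"
  have "cj G (cj G t x) z' = z'" if "x \<in> P" for x
  proof -
    have "cj G (cj G t x) (cj G t z) = cj G t (cj G x z)" using that t(1) by (simp add: cj_def m_assoc inv_mult_group)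
    then show ?thesis using central[OF that] by (simp add: z'_def)
  qed
  then have PtC: "Pt \<subseteq> C'" using t(1) by (auto simp: Pt_def C'_def cj_def)
  have QC': "Q \<subseteq> C'" by (auto simp: Q_def C'_def)
  \<comment> \<open>\<open>Q\<close> and the conjugate of \<open>P\<close> by \<open>t\<close> both
    lie in the centraliser of \<open>z'\<close>, and the latter is Sylow there. The corrected
    element \<open>t1\<close> still sends \<open>z\<close> to \<open>z'\<close>, and its inverse
    conjugates all of \<open>Q\<close> into \<open>P\<close>; since \<open>Q\<close> contains
    \<open>E\<close>, it follows that \<open>t1\<close> normalises \<open>E\<close>.\<close>
  obtain c where c: "c \<in> C'" "\<And>q. q \<in> Q \<Longrightarrow> c \<otimes> q \<otimes> inv c \<in> Pt"
    using sylow_conj[OF fin p sylow_sub_conj[OF P t(1)] sC' PtC[unfolded Pt_def] sQ QC' b] unfolding Pt_def by blast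
  have cc [simp]: "c \<in> carrier G" and cz': "cj G c z' = z'" using c(1) by (auto simp: C'_def)
  define t1 where "t1 = inv c \<otimes> t"
  have t1c [simp]: "t1 \<in> carrier G" using t(1) by (simp add: t1_def)
  have t1z: "cj G t1 z = z'"
    using t(1) cz' cj_inv_cancel(1)[OF cc z'c] by (simp add: t1_def cj_comp z'_def[symmetric])
  have Qt1: "cj G (inv t1) q \<in> P" if q: "q \<in> Q" for q
  proof -
    obtain x where x: "x \<in> P" "c \<otimes> q \<otimes> inv c = t \<otimes> x \<otimes> inv t" using c(2)[OF q] by (auto simp: Pt_def)
    have qc: "q \<in> carrier G" using q QP by auto
    have "cj G (inv t1) q = inv t \<otimes> (c \<otimes> q \<otimes> inv c) \<otimes> t"
      using t(1) qc by (simp add: t1_def cj_def inv_mult_group m_assoc)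
    also have "\<dots> = x" using x t(1) by (simp add: m_assoc)
    finally show ?thesis using x(1) by simp
  qed
  have EQ: "E \<subseteq> Q"
  proof
    fix e assume e: "e \<in> E"
    then obtain i j :: int where ij: "e = z [^] i \<otimes> z' [^] j" using E_eq by blast
    have "cj G z' z' = z'" by (simp add: cj_eq_self_iff)
    then have "cj G z' e = e" using central[OF z'P] by (simp add: ij cj_mult cj_int_pow)
    then have "cj G e z' = z'" using cj_eq_self_sym[OF z'c Ec[OF e]] by simp
    then show "e \<in> Q" using e by (simp add: Q_def E_def)
  qed
  have t1inv: "cj G (inv t1) e \<in> E" if e: "e \<in> E" for e
  proof -
    have "cj G (inv t1) e [^] p = \<one>" using e cj_nat_pow[of "inv t1" e p] by (simp add: E_def)
    then show ?thesis using Qt1[of e] e EQ by (auto simp: E_def)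
  qed
  have t1E: "cj G t1 e \<in> E" if e: "e \<in> E" for e
  proof -
    have "inj_on (cj G (inv t1)) E" by (rule inj_onI) (simp add: cj_inject)
    moreover have "finite E" using finP by (simp add: E_def)
    ultimately have "cj G (inv t1) ` E = E" using t1inv by (intro endo_inj_surj) auto
    then obtain f where "f \<in> E" "e = cj G (inv t1) f" using e by blast
    then show ?thesis by simp
  qed
  have powP: "x [^] (p ^ a) = \<one>" if x: "x \<in> P" for x
  proof -
    interpret P: group "G\<lparr>carrier := P\<rparr>" using sP subgroup.subgroup_is_group is_group by blast
    have "x [^]\<^bsub>G\<lparr>carrier := P\<rparr>\<^esub> order (G\<lparr>carrier := P\<rparr>) = \<one>" using P.pow_order_eq_1 x by simp
    then show ?thesis by (simp add: order_def a nat_pow_consistent[symmetric])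
  qed
  \<comment> \<open>An element of \<open>P\<close> acts on \<open>E\<close> by a triangular matrix
    with diagonal entries 1 and \<open>j\<close>. Its order is a power of \<open>p\<close>, so
    \<open>j\<close> is 1 modulo \<open>p\<close>.\<close>
  have P_act: "\<exists>k::int. cj G x z' = z [^] k \<otimes> z'" if x: "x \<in> P" for x
  proof -
    have "cj G x z' \<in> E" using x z'P sP cj_nat_pow[of x z' p] z'p
      by (simp add: E_def cj_def subgroup.m_closed subgroup.m_inv_closed)
    then obtain b j :: int where bj: "cj G x z' = z [^] b \<otimes> z' [^] j" using E_eq by blast
    have xz: "cj G x z = z" using central x by simp
    have "\<exists>i::int. cj G (x [^] r) z' = z [^] i \<otimes> z' [^] (j ^ r)" for r :: nat
    proof (induction r)
      case 0 then show ?case by (intro exI[of _ 0]) simp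
    next
      case (Suc r)
      then obtain i :: int where i: "cj G (x [^] r) z' = z [^] i \<otimes> z' [^] (j ^ r)" by blast
      have "x [^] Suc r = x \<otimes> x [^] r" using x nat_pow_Suc2 by simp
      then have "cj G (x [^] Suc r) z' = cj G x (z [^] i \<otimes> z' [^] (j ^ r))" using x i by (simp add: cj_comp)
      also have "\<dots> = z [^] i \<otimes> (z [^] b \<otimes> z' [^] j) [^] (j ^ r)" using x by (simp add: cj_mult cj_int_pow xz bj)
      also have "(z [^] b \<otimes> z' [^] j) [^] (j ^ r) = z [^] (b * j ^ r) \<otimes> z' [^] (j * j ^ r)"
        by (subst int_pow_mult_distrib) (simp_all add: comm_pow int_pow_pow)
      finally show ?case by (intro exI[of _ "i + b * j ^ r"]) (simp add: int_pow_mult m_assoc)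
    qed
    then obtain i :: int where i: "cj G (x [^] (p ^ a)) z' = z [^] i \<otimes> z' [^] (j ^ (p ^ a))" by blast
    then have "z [^] i \<otimes> z' [^] (j ^ (p ^ a)) \<otimes> (z [^] (0::int) \<otimes> z' [^] (-1::int)) = \<one>" using i powP[OF x] by (simp add: int_pow_neg)
    then have "int p dvd j ^ (p ^ a) - 1" using indep[of i "j ^ (p ^ a) - 1"] by (simp only: zw_eq) simp
    then have "[j ^ (p ^ a) = 1] (mod int p)" by (simp add: cong_iff_dvd_diff)
    then have j1: "[j = 1] (mod int p)" using power_prime_power_cong[OF p, of j a] cong_sym cong_trans by blast
    show ?thesis using bj pow_cong_exponent[OF z'c z'p j1] by auto
  qed
  show False
  proof (cases "Q = P")
    case True
    \<comment> \<open>If \<open>P\<close> centralises \<open>E\<close>, then so does its conjugate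
      by \<open>t1\<close>. Matching the two inside the centraliser of \<open>E\<close> gives an
      element that normalises \<open>P\<close> and still moves \<open>z\<close> to
      \<open>z'\<close>, against \<open>invariant\<close>.\<close>
    define C where "C = {g \<in> carrier G. cj G g z = z \<and> cj G g z' = z'}"
    have sC: "subgroup C G"
      by (rule finite_subgroupI[OF fin]) (auto simp: C_def cj_comp intro!: exI[of _ \<one>])
    have PC: "P \<subseteq> C" using True central by (auto simp: C_def Q_def)
    have "cj G t1 x \<in> C" if x: "x \<in> P" for x
    proof -
      have "cj G (cj G t1 x) e = e" if e: "e \<in> E" for e
      proof -
        obtain i j :: int where ij: "cj G (inv t1) e = z [^] i \<otimes> z' [^] j" using E_eq t1inv[OF e] by blast
        have "x \<in> Q" using x True by simp
        then have "cj G x z' = z'" by (simp add: Q_def)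
        then have "cj G x (cj G (inv t1) e) = cj G (inv t1) e"
          using x central by (simp add: ij cj_mult cj_int_pow)
        moreover have "cj G (cj G t1 x) e = cj G t1 (cj G x (cj G (inv t1) e))"
          using x e by (simp add: cj_def m_assoc inv_mult_group)
        ultimately show ?thesis using e by simp
      qed
      then show ?thesis using x zE z'E by (simp add: C_def)
    qed
    then have sub: "(\<lambda>x. t1 \<otimes> x \<otimes> inv t1) ` P \<subseteq> C" by (auto simp: cj_def)
    obtain k where k: "k \<in> C" "\<And>x. x \<in> P \<Longrightarrow> k \<otimes> (t1 \<otimes> x \<otimes> inv t1) \<otimes> inv k \<in> P"
      using sylow_conj[OF fin p P sC PC conj_subgroup[OF sP t1c] sub card_conj[OF sP t1c, unfolded a]] by blast
    have kc [simp]: "k \<in> carrier G" using k(1) by (simp add: C_def)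
    have "cj G (k \<otimes> t1) x \<in> P" if "x \<in> P" for x
      using k(2)[OF that] that by (simp add: cj_def m_assoc inv_mult_group)
    then have "cj G (k \<otimes> t1) z \<in> range (\<lambda>k::int. z [^] k)" by (intro invariant) simp_all
    moreover have "cj G (k \<otimes> t1) z = z'" using k(1) by (simp add: cj_comp t1z C_def)
    ultimately show False using notz by auto
  next
    case False
    \<comment> \<open>Some element of \<open>P\<close> acts on \<open>E\<close> as a nontrivial
      transvection; its power \<open>s\<close> is normalised to send \<open>z'\<close> to
      \<open>z \<otimes> z'\<close>.\<close>
    then obtain s0 where s0: "s0 \<in> P" "cj G s0 z' \<noteq> z'" by (auto simp: Q_def)
    obtain b :: int where s0z': "cj G s0 z' = z [^] b \<otimes> z'" using P_act[OF s0(1)] by blast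
    have s0z: "cj G s0 z = z" using central s0 by simp
    have nb: "\<not> int p dvd b" using s0(2) s0z' pow_eq_one_prime[OF p zc z(3,2)] by auto
    obtain \<beta> where \<beta>: "[\<beta> * b = 1] (mod int p)" by (rule invert_mod_prime[OF p nb])
    define s where "s = s0 [^] nat (\<beta> mod int p)"
    have sPm: "s \<in> P" using subgroup_nat_pow_closed[OF sP s0(1)] by (simp add: s_def)
    then have sc [simp]: "s \<in> carrier G" by simp
    have sz: "cj G s z = z" using central sPm by simp
    have "cj G (s0 [^] r) z' = z [^] (int r * b) \<otimes> z'" for r :: nat
    proof (induction r)
      case (Suc r)
      have "s0 [^] Suc r = s0 \<otimes> s0 [^] r" using s0 nat_pow_Suc2 by simp
      then show ?case using s0 Suc by (simp add: cj_comp cj_mult cj_int_pow s0z s0z' m_assoc[symmetric] flip: int_pow_mult) (simp add: algebra_simps)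
    qed simp
    then have "cj G s z' = z [^] (int (nat (\<beta> mod int p)) * b) \<otimes> z'" by (simp add: s_def)
    also have "z [^] (int (nat (\<beta> mod int p)) * b) = z [^] (1::int)"
      by (rule pow_cong_exponent[OF zc z(3)]) (use \<beta> p1 in \<open>simp add: cong_def mod_mult_left_eq\<close>)
    finally have sz': "cj G s z' = z \<otimes> z'" by simp
    \<comment> \<open>A transvection fixing \<open>z'\<close> instead of \<open>z\<close>.\<close>
    define r0 where "r0 = cj G t1 s"
    have r0c [simp]: "r0 \<in> carrier G" by (simp add: r0_def)
    have r0_cj: "cj G r0 (cj G t1 e) = cj G t1 (cj G s e)" if "e \<in> carrier G" for e
      using that by (simp add: r0_def cj_def m_assoc inv_mult_group)
    have r0z': "cj G r0 z' = z'" using r0_cj[OF zc] by (simp add: sz t1z)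
    obtain i j :: int where ij: "cj G t1 z' = z [^] i \<otimes> z' [^] j" using E_eq t1E[OF z'E] by blast
    have r0z'': "cj G r0 (z [^] i \<otimes> z' [^] j) = z' \<otimes> (z [^] i \<otimes> z' [^] j)"
      using r0_cj[OF z'c] by (simp add: ij sz' cj_mult t1z)
    \<comment> \<open>\<open>t1\<close> already maps the powers of \<open>z\<close> to those of
      \<open>z'\<close>, and conjugation is injective.\<close>
    have ni: "\<not> int p dvd i"
    proof
      assume "int p dvd i"
      then have "cj G t1 z' = z' [^] j" using pow_eq_one_prime[OF p zc z(3,2)] by (simp add: ij)
      also have "\<dots> = cj G t1 (z [^] j)" by (simp add: cj_int_pow t1z)
      finally show False using notz by (simp add: cj_inject)
    qed
    have "cj G r0 z [^] i \<otimes> z' [^] j = z' \<otimes> z [^] i \<otimes> z' [^] j"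
      using r0z'' by (simp add: cj_mult cj_int_pow r0z' m_assoc)
    then have r0zi: "cj G r0 z [^] i = z' \<otimes> z [^] i" by simp
    obtain \<kappa> where \<kappa>: "[\<kappa> * i = 1] (mod int p)" by (rule invert_mod_prime[OF p ni])
    have z'z_pow: "(z' \<otimes> z [^] l) [^] m = z' [^] m \<otimes> z [^] (l * m)" for l m :: int
    proof -
      have "z' \<otimes> z [^] l = z [^] l \<otimes> z'" using comm_pow[of l 1] by simp
      then show ?thesis using int_pow_mult_distrib[of z' "z [^] l" m] by (simp add: int_pow_pow)
    qed
    have r0zp: "cj G r0 z [^] p = \<one>" using cj_nat_pow[OF r0c zc, of p] z(3) by simp
    have "cj G r0 z = cj G r0 z [^] (\<kappa> * i)" using pow_cong_exponent[OF cj_closed[OF r0c zc] r0zp \<kappa>] by simp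
    also have "\<dots> = (z' \<otimes> z [^] i) [^] \<kappa>" by (simp add: r0zi[symmetric] int_pow_pow mult.commute)
    also have "\<dots> = z' [^] \<kappa> \<otimes> z [^] (\<kappa> * i)" by (simp add: z'z_pow mult.commute)
    also have "z [^] (\<kappa> * i) = z" using pow_cong_exponent[OF zc z(3) \<kappa>] by simp
    finally have r0z: "cj G r0 z = z' [^] \<kappa> \<otimes> z" .
    have nk: "\<not> int p dvd \<kappa>"
    proof
      assume "int p dvd \<kappa>"
      then have "int p dvd \<kappa> * i" by simp
      then have "int p dvd 1" using cong_dvd_iff[OF \<kappa>] by simp
      then show False using p1 by simp
    qed
    obtain \<gamma> where \<gamma>: "[\<gamma> * \<kappa> = 1] (mod int p)" by (rule invert_mod_prime[OF p nk])
    \<comment> \<open>Normalised to send \<open>z\<close> to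
      \<open>inv z' \<otimes> z\<close>.\<close>
    define r where "r = r0 [^] (- \<gamma>)"
    have rc [simp]: "r \<in> carrier G" by (simp add: r_def)
    have rz': "cj G r z' = z'"
    proof -
      have "cj G z' r0 = r0" using r0z' by (simp add: cj_eq_self_sym)
      then have "cj G z' r = r" by (simp add: r_def cj_int_pow)
      then show ?thesis by (simp add: cj_eq_self_sym)
    qed
    have rnat: "cj G (r0 [^] (l::nat)) z = z' [^] (int l * \<kappa>) \<otimes> z" for l
    proof (induction l)
      case (Suc l)
      have "r0 [^] Suc l = r0 \<otimes> r0 [^] l" using nat_pow_Suc2 by simp
      then show ?case using Suc by (simp add: cj_comp cj_mult cj_int_pow r0z' r0z m_assoc[symmetric] flip: int_pow_mult) (simp add: algebra_simps)
    qed simp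
    have rz_gen: "cj G (r0 [^] (l::int)) z = z' [^] (l * \<kappa>) \<otimes> z" for l
    proof (cases l)
      case (nonneg m) then show ?thesis using rnat[of m] by (simp add: int_pow_int)
    next
      case (neg m')
      define m where "m = Suc m'"
      have l: "l = - int m" using neg by (simp add: m_def)
      have fz': "cj G (r0 [^] m) z' = z'"
      proof -
        have "cj G z' r0 = r0" using r0z' by (simp add: cj_eq_self_sym)
        then have "cj G z' (r0 [^] m) = r0 [^] m" using cj_nat_pow[OF z'c r0c, of m] by simp
        then show ?thesis by (simp add: cj_eq_self_sym)
      qed
      have "cj G (r0 [^] m) (z' [^] (- (int m * \<kappa>)) \<otimes> z) = z' [^] (- (int m * \<kappa>)) \<otimes> (z' [^] (int m * \<kappa>) \<otimes> z)"
        by (simp add: cj_mult cj_int_pow fz' rnat)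
      also have "\<dots> = z" by (simp add: m_assoc[symmetric] flip: int_pow_mult)
      finally have "cj G (inv (r0 [^] m)) z = z' [^] (- (int m * \<kappa>)) \<otimes> z"
        using cj_inv_cancel(1)[of "r0 [^] m" "z' [^] (- (int m * \<kappa>)) \<otimes> z"] by simp
      moreover have "r0 [^] l = inv (r0 [^] m)" using int_pow_neg_int[OF r0c, of m] by (simp add: l)
      ultimately show ?thesis by (simp add: l)
    qed
    have "z' [^] (- \<gamma> * \<kappa>) = z' [^] (-1 :: int)"
      by (rule pow_cong_exponent[OF z'c z'p]) (use \<gamma> in \<open>simp add: cong_minus_minus_iff\<close>)
    then have rz: "cj G r z = inv z' \<otimes> z" using rz_gen[of "- \<gamma>"] by (simp add: r_def int_pow_neg)
    \<comment> \<open>The usual product of three transvections that gives the Weyl element of SL(2);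
      its square acts on \<open>E\<close> as -1.\<close>
    define w where "w = s \<otimes> r \<otimes> s"
    have wc [simp]: "w \<in> carrier G" by (simp add: w_def)
    have wz: "cj G w z = inv z'"
      by (simp add: w_def cj_comp sz rz cj_mult cj_inv sz' inv_mult_group m_assoc)
    have wz': "cj G w z' = z"
    proof -
      have "cj G r (z \<otimes> z') = inv z' \<otimes> (z \<otimes> z')" by (simp add: cj_mult rz rz' m_assoc)
      also have "\<dots> = inv z' \<otimes> (z' \<otimes> z)" by (simp only: zz')
      finally have "cj G r (z \<otimes> z') = z" by simp
      then show ?thesis by (simp add: w_def cj_comp sz' sz)
    qed
    define d where "d = w \<otimes> w"
    have dc [simp]: "d \<in> carrier G" by (simp add: d_def)
    have dz: "cj G d z = inv z" by (simp add: d_def cj_comp wz cj_inv wz')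
    have dz': "cj G d z' = inv z'" by (simp add: d_def cj_comp wz wz')
    \<comment> \<open>The elements acting on \<open>E\<close> as transvections that fix
      \<open>z\<close>. Since -1 commutes with every matrix, \<open>U\<close> contains the conjugate
      of \<open>P\<close> by \<open>d\<close> along with \<open>P\<close>.\<close>
    define U where "U = {g \<in> carrier G. cj G g z = z \<and> (\<exists>k::int. cj G g z' = z [^] k \<otimes> z')}"
    have sU: "subgroup U G"
    proof (rule finite_subgroupI[OF fin])
      show "U \<noteq> {}" using one_closed by (auto simp: U_def intro!: exI[of _ \<one>] exI[of _ "0::int"])
      fix x y assume "x \<in> U" "y \<in> U"
      then obtain k l :: int where xy: "x \<in> carrier G" "y \<in> carrier G" "cj G x z = z" "cj G y z = z"
        "cj G x z' = z [^] k \<otimes> z'" "cj G y z' = z [^] l \<otimes> z'" by (auto simp: U_def)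
      have "cj G (x \<otimes> y) z' = z [^] (l + k) \<otimes> z'"
        using xy by (simp add: cj_comp cj_mult cj_int_pow int_pow_mult m_assoc)
      then show "x \<otimes> y \<in> U" using xy by (auto simp: U_def cj_comp)
    qed (auto simp: U_def)
    have PU: "P \<subseteq> U" using P_act central by (auto simp: U_def)
    have inv_zw: "inv (z [^] i \<otimes> z' [^] j) = z [^] (- i) \<otimes> z' [^] (- j)" for i j :: int
      by (rule inv_equality) (simp_all add: zw_eq)
    have pow_zw: "(z [^] i \<otimes> z' [^] j) [^] l = z [^] (i * l) \<otimes> z' [^] (j * l)" for i j l :: int
      by (subst int_pow_mult_distrib) (simp_all add: comm_pow int_pow_pow)
    have cj_zw: "cj G h (z [^] i \<otimes> z' [^] j) = (cj G h z) [^] i \<otimes> (cj G h z') [^] j"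
      if "h \<in> carrier G" for h and i j :: int
      using that by (simp add: cj_mult cj_int_pow)
    have zw1: "z = z [^] (1::int) \<otimes> z' [^] (0::int)" "z' = z [^] (0::int) \<otimes> z' [^] (1::int)" by simp_all
    \<comment> \<open>The hypotheses on \<open>h\<close> allow a power of \<open>z\<close> in the
      image of \<open>z'\<close>, because the fact is needed for \<open>d\<close> and again for the
      corrected element \<open>k \<otimes> d\<close>.\<close>
    have dx: "cj G (cj G h x) z' = z [^] m \<otimes> z'"
      if h: "h \<in> carrier G" "cj G h z = inv z" "cj G h z' = inv (z [^] k \<otimes> z')"
        and x: "x \<in> carrier G" "cj G x z = z" "cj G x z' = z [^] m \<otimes> z'" for h x and k m :: int
    proof -
      have hz: "cj G h z = z [^] (-1::int) \<otimes> z' [^] (0::int)" using h by (simp add: int_pow_neg)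
      have hz': "cj G h z' = z [^] (- k) \<otimes> z' [^] (-1::int)" using h inv_zw[of k 1] by simp
      have h_act: "cj G h (z [^] i \<otimes> z' [^] j) = z [^] (- i - k * j) \<otimes> z' [^] (- j)" for i j :: int
        unfolding cj_zw[OF h(1)] hz hz' pow_zw zw_eq by (simp add: algebra_simps)
      have x_act: "cj G x (z [^] i \<otimes> z' [^] j) = z [^] (i + m * j) \<otimes> z' [^] j" for i j :: int
        using zw_eq[of i 0 "m * j" j] pow_zw[of m 1 j] unfolding cj_zw[OF x(1)] x(2,3) by simp
      have "cj G h (z [^] k \<otimes> z' [^] (-1::int)) = z'" unfolding h_act by simp
      then have hi: "cj G (inv h) z' = z [^] k \<otimes> z' [^] (-1::int)"
        using cj_inv_cancel(1)[OF h(1), of "z [^] k \<otimes> z' [^] (-1::int)"] by simp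
      have "cj G (cj G h x) z' = cj G h (cj G x (cj G (inv h) z'))"
        using h(1) x(1) by (simp add: cj_def m_assoc inv_mult_group)
      also have "\<dots> = z [^] m \<otimes> z'" unfolding hi x_act h_act by simp
      finally show ?thesis .
    qed
    have dxz: "cj G (cj G h x) z = z" if h: "h \<in> carrier G" "cj G h z = inv z" and x: "x \<in> carrier G" "cj G x z = z" for h x
    proof -
      have "cj G h (inv z) = z" using h by (simp add: cj_inv)
      then have hi: "cj G (inv h) z = inv z" using cj_inv_cancel(1)[OF h(1), of "inv z"] by simp
      have "cj G (cj G h x) z = cj G h (cj G x (cj G (inv h) z))"
        using h(1) x(1) by (simp add: cj_def m_assoc inv_mult_group)
      then show ?thesis unfolding hi using x h by (simp add: cj_inv)
    qed
    have "cj G d x \<in> U" if x: "x \<in> P" for x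
    proof -
      obtain m :: int where m: "cj G x z' = z [^] m \<otimes> z'" using P_act[OF x] by blast
      have "cj G d z' = inv (z [^] (0::int) \<otimes> z')" using dz' by simp
      from dx[OF dc dz this Pc[OF x] central[OF x] m] dxz[OF dc dz Pc[OF x] central[OF x]]
      show ?thesis using x by (auto simp: U_def)
    qed
    then have sub: "(\<lambda>x. d \<otimes> x \<otimes> inv d) ` P \<subseteq> U" by (auto simp: cj_def)
    obtain k where k: "k \<in> U" "\<And>x. x \<in> P \<Longrightarrow> k \<otimes> (d \<otimes> x \<otimes> inv d) \<otimes> inv k \<in> P"
      using sylow_conj[OF fin p P sU PU conj_subgroup[OF sP dc] sub card_conj[OF sP dc, unfolded a]] by blast
    have kc [simp]: "k \<in> carrier G" and kz: "cj G k z = z" using k(1) by (auto simp: U_def)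
    obtain m0 :: int where kz': "cj G k z' = z [^] m0 \<otimes> z'" using k(1) by (auto simp: U_def)
    define h where "h = k \<otimes> d"
    have hc [simp]: "h \<in> carrier G" by (simp add: h_def)
    have hP: "cj G h x \<in> P" if "x \<in> P" for x
      using k(2)[OF that] that by (simp add: h_def cj_def m_assoc inv_mult_group)
    have hz: "cj G h z = inv z" by (simp add: h_def cj_comp dz cj_inv kz)
    have hz': "cj G h z' = inv (z [^] m0 \<otimes> z')" by (simp add: h_def cj_comp dz' cj_inv kz')
    \<comment> \<open>On \<open>E\<close>, an element of \<open>P\<close> and its conjugate by
      \<open>h\<close> act alike, so \<open>\<phi>\<close> takes values in \<open>Q\<close>; without
      fixed points of \<open>h\<close> in \<open>P\<close> it is injective. So \<open>P\<close>
      would be no larger than \<open>Q\<close>.\<close>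
    define \<phi> where "\<phi> = (\<lambda>x. inv x \<otimes> cj G h x)"
    have \<phi>Q: "\<phi> x \<in> Q" if x: "x \<in> P" for x
    proof -
      obtain m :: int where m: "cj G x z' = z [^] m \<otimes> z'" using P_act[OF x] by blast
      have "cj G (\<phi> x) z' = cj G (inv x) (cj G (cj G h x) z')" using x by (simp add: \<phi>_def cj_comp)
      also have "cj G (cj G h x) z' = cj G x z'" using dx[OF hc hz hz' Pc[OF x] central[OF x] m] m by simp
      also have "cj G (inv x) (cj G x z') = z'" using x by simp
      finally show ?thesis using x hP[OF x] sP by (simp add: Q_def \<phi>_def subgroup.m_closed subgroup.m_inv_closed)
    qed
    \<comment> \<open>A nontrivial fixed point has a power of order \<open>p\<close>, again fixed
      and contained in \<open>E\<close>; there \<open>h\<close> has only the eigenvalue -1, which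
      differs from 1 as \<open>p\<close> is odd.\<close>
    have nofix: "x = \<one>" if x: "x \<in> P" "cj G h x = x" for x
    proof (rule ccontr)
      assume "x \<noteq> \<one>"
      moreover have "x [^] (p ^ a) = \<one>" using powP[OF x(1)] .
      ultimately obtain l :: nat where l: "x [^] (p ^ l) \<noteq> \<one>" "(x [^] (p ^ l)) [^] p = \<one>"
        using order_p_power[of x p a] x(1) by auto
      define e where "e = x [^] (p ^ l)"
      have "e \<in> E" using l subgroup_nat_pow_closed[OF sP x(1)] by (simp add: E_def e_def)
      then obtain i j :: int where ij: "e = z [^] i \<otimes> z' [^] j" using E_eq by blast
      have he: "cj G h e = e" using x by (simp add: e_def cj_nat_pow)
      have hz1: "cj G h z = z [^] (-1::int) \<otimes> z' [^] (0::int)" using hz by (simp add: int_pow_neg)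
      have hz1': "cj G h z' = z [^] (- m0) \<otimes> z' [^] (-1::int)" using hz' inv_zw[of m0 1] by simp
      have "z [^] (- i - m0 * j) \<otimes> z' [^] (- j) = z [^] i \<otimes> z' [^] j"
        using he unfolding ij cj_zw[OF hc] hz1 hz1' pow_zw zw_eq by (simp add: algebra_simps)
      then have "z [^] i \<otimes> z' [^] j \<otimes> inv (z [^] (- i - m0 * j) \<otimes> z' [^] (- j)) = \<one>" by simp
      then have "z [^] (2 * i + m0 * j) \<otimes> z' [^] (2 * j) = \<one>"
        unfolding inv_zw zw_eq by (simp add: algebra_simps)
      then have dv: "int p dvd 2 * i + m0 * j \<and> int p dvd 2 * j" by (rule indep)
      have two: "coprime (int p) 2" using odd by simp
      have "int p dvd j" using dv two coprime_dvd_mult_right_iff by blast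
      moreover have "int p dvd i"
      proof -
        have "int p dvd 2 * i" using dv \<open>int p dvd j\<close> dvd_add_left_iff[of "int p" "m0 * j" "2 * i"] by simp
        then show ?thesis using two coprime_dvd_mult_right_iff by blast
      qed
      ultimately have "e = \<one>"
        using pow_eq_one_prime[OF p z'c z'p z'1, of j] pow_eq_one_prime[OF p zc z(3,2), of i] by (simp add: ij)
      then show False using l by (simp add: e_def)
    qed
    have "inj_on \<phi> P"
    proof (rule inj_onI)
      fix x y assume xy: "x \<in> P" "y \<in> P" "\<phi> x = \<phi> y"
      have hx: "cj G h x = x \<otimes> \<phi> x" using xy(1) by (simp add: \<phi>_def)
      have "cj G h y = y \<otimes> \<phi> y" using xy(2) by (simp add: \<phi>_def)
      then have hy: "cj G h y = y \<otimes> \<phi> x" by (simp only: xy(3))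
      have fc: "\<phi> x \<in> carrier G" using xy by (simp add: \<phi>_def)
      have "cj G h (y \<otimes> inv x) = y \<otimes> inv x" using xy fc by (simp add: cj_mult cj_inv hx hy inv_mult_group m_assoc)
      then have "y \<otimes> inv x = \<one>" using nofix[of "y \<otimes> inv x"] xy sP by (simp add: subgroup.m_closed subgroup.m_inv_closed)
      then show "x = y" using xy inv_equality[of y "inv x"] by simp
    qed
    then have "card P \<le> card Q" using \<phi>Q finP QP by (intro card_inj_on_le[of \<phi>]) (auto intro: finite_subset)
    moreover have "card Q < card P" using False QP finP by (intro psubset_card_mono) auto
    ultimately show False by simp
  qed
qed

section \<open>Commutators\<close>

definition cmt :: "('a, 'b) monoid_scheme \<Rightarrow> 'a \<Rightarrow> 'a \<Rightarrow> 'a" where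
  "cmt G x y = x \<otimes>\<^bsub>G\<^esub> y \<otimes>\<^bsub>G\<^esub> inv\<^bsub>G\<^esub> x \<otimes>\<^bsub>G\<^esub> inv\<^bsub>G\<^esub> y"

context group
begin

lemma cmt_closed [simp]: "x \<in> carrier G \<Longrightarrow> y \<in> carrier G \<Longrightarrow> cmt G x y \<in> carrier G"
  by (simp add: cmt_def)

lemma cmt_self [simp]: "x \<in> carrier G \<Longrightarrow> cmt G x x = \<one>"
  by (simp add: cmt_def m_assoc)

lemma cmt_inv: "x \<in> carrier G \<Longrightarrow> y \<in> carrier G \<Longrightarrow> inv (cmt G x y) = cmt G y x"
  by (simp add: cmt_def m_assoc inv_mult_group)

lemma cmt_swap: "x \<in> carrier G \<Longrightarrow> y \<in> carrier G \<Longrightarrow> cmt G x y \<otimes> (y \<otimes> x) = x \<otimes> y"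
  by (simp add: cmt_def m_assoc)

lemma cmt_eq_one_iff: "x \<in> carrier G \<Longrightarrow> y \<in> carrier G \<Longrightarrow> cmt G x y = \<one> \<longleftrightarrow> x \<otimes> y = y \<otimes> x"
proof
  assume xy: "x \<in> carrier G" "y \<in> carrier G" and "cmt G x y = \<one>"
  then show "x \<otimes> y = y \<otimes> x" using cmt_swap[OF xy] by simp
next
  assume "x \<in> carrier G" "y \<in> carrier G" "x \<otimes> y = y \<otimes> x"
  then show "cmt G x y = \<one>" by (simp add: cmt_def m_assoc)
qed

lemma cmt_mult_left:
  "x \<in> carrier G \<Longrightarrow> y \<in> carrier G \<Longrightarrow> u \<in> carrier G \<Longrightarrow> cmt G (x \<otimes> y) u = cj G x (cmt G y u) \<otimes> cmt G x u"
  by (simp add: cmt_def cj_def m_assoc inv_mult_group)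

lemma cj_cmt: "h \<in> carrier G \<Longrightarrow> x \<in> carrier G \<Longrightarrow> y \<in> carrier G \<Longrightarrow> cj G h (cmt G x y) = cmt G (cj G h x) (cj G h y)"
  by (simp add: cmt_def cj_mult cj_inv)

lemma cmt_eq_cj: "x \<in> carrier G \<Longrightarrow> y \<in> carrier G \<Longrightarrow> cmt G x y = cj G x y \<otimes> inv y"
  by (simp add: cmt_def cj_def)

text \<open>Modulo \<open>C\<close> this is the centraliser of \<open>u\<close>.\<close>

lemma subgroup_cmt_mem:
  assumes fin: "finite (carrier G)" and C: "C \<lhd> G" and u: "u \<in> carrier G"
  shows "subgroup {x \<in> carrier G. cmt G x u \<in> C} G"
proof (rule finite_subgroupI[OF fin])
  have sC: "subgroup C G" using C by (rule normal_imp_subgroup)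
  have "cmt G u u \<in> C" using u subgroup.one_closed[OF sC] by simp
  then show "{x \<in> carrier G. cmt G x u \<in> C} \<noteq> {}" using u by blast
  fix x y assume xy: "x \<in> {x \<in> carrier G. cmt G x u \<in> C}" "y \<in> {x \<in> carrier G. cmt G x u \<in> C}"
  then have "cj G x (cmt G y u) \<in> C" using normal_conj[OF C, of x "cmt G y u"] by (simp add: cj_def)
  then show "x \<otimes> y \<in> {x \<in> carrier G. cmt G x u \<in> C}"
    using xy u sC by (simp add: cmt_mult_left subgroup.m_closed)
qed auto

text \<open>The generators commute modulo \<open>C\<close>, so the group is abelian modulo
  \<open>C\<close>. The centralisers modulo \<open>C\<close> of the two generators contain both
  generators, hence are everything; therefore so is the centraliser of any \<open>v\<close>.\<close>

lemma cmt_in_normal: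
  assumes fin: "finite (carrier G)" and C: "C \<lhd> G" and ab: "x \<in> carrier G" "y \<in> carrier G"
    and gen: "\<And>K. subgroup K G \<Longrightarrow> x \<in> K \<Longrightarrow> y \<in> K \<Longrightarrow> carrier G \<subseteq> K" and xy: "cmt G x y \<in> C"
    and uv: "u \<in> carrier G" "v \<in> carrier G"
  shows "cmt G u v \<in> C"
proof -
  have sC: "subgroup C G" using C by (rule normal_imp_subgroup)
  have swap: "cmt G v u \<in> C" if "cmt G u v \<in> C" "u \<in> carrier G" "v \<in> carrier G" for u v
    using subgroup.m_inv_closed[OF sC that(1)] that cmt_inv by simp
  have one: "\<one> \<in> C" by (rule subgroup.one_closed[OF sC])
  have 1: "cmt G u x \<in> C" if "u \<in> carrier G" for u
    using gen[OF subgroup_cmt_mem[OF fin C ab(1)]] that ab swap[OF xy] one by auto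
  have 2: "cmt G u y \<in> C" if "u \<in> carrier G" for u
    using gen[OF subgroup_cmt_mem[OF fin C ab(2)]] that ab xy one by auto
  show ?thesis
    using gen[OF subgroup_cmt_mem[OF fin C uv(2)]] uv ab swap[OF 1[OF uv(2)]] swap[OF 2[OF uv(2)]] by auto
qed

lemma comm_groupI_cmt:
  assumes "\<And>x y. x \<in> carrier G \<Longrightarrow> y \<in> carrier G \<Longrightarrow> cmt G x y = \<one>"
  shows "comm_group G"
  by (rule group_comm_groupI) (use assms cmt_eq_one_iff in blast)

lemma mod_hom_inv:
  assumes "subgroup N G" "mod_hom p G N f" "x \<in> N"
  shows "[f (inv x) = - f x] (mod int p)"
proof -
  have "[f (x \<otimes> inv x) = f x + f (inv x)] (mod int p)"
    using mod_homD[OF assms(2,3) subgroup.m_inv_closed[OF assms(1,3)]] .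
  then have "[f \<one> = f x + f (inv x)] (mod int p)" using subgroup.mem_carrier[OF assms(1,3)] by simp
  from cong_trans[OF cong_sym[OF this] mod_hom_one[OF assms(1,2)]]
  show ?thesis by (simp add: cong_iff_dvd_diff add.commute)
qed

lemma mod_hom_cmt:
  assumes N: "subgroup N G" and f: "mod_hom p G N f" and xy: "x \<in> N" "y \<in> N"
  shows "[f (cmt G x y) = 0] (mod int p)"
proof -
  have c: "x \<in> carrier G" "y \<in> carrier G" using xy subgroup.mem_carrier[OF N] by auto
  have m: "cmt G x y \<in> N" "y \<otimes> x \<in> N" "x \<otimes> y \<in> N"
    using xy N by (simp_all add: cmt_def subgroup.m_closed subgroup.m_inv_closed)
  have "[f (cmt G x y \<otimes> (y \<otimes> x)) = f (cmt G x y) + f (y \<otimes> x)] (mod int p)" by (rule mod_homD[OF f m(1,2)])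
  then have "[f (x \<otimes> y) = f (cmt G x y) + f (y \<otimes> x)] (mod int p)" by (simp only: cmt_swap[OF c])
  moreover have "[f (x \<otimes> y) = f x + f y] (mod int p)" by (rule mod_homD[OF f xy])
  moreover have "[f (y \<otimes> x) = f y + f x] (mod int p)" by (rule mod_homD[OF f xy(2,1)])
  ultimately have d: "int p dvd f (x \<otimes> y) - (f (cmt G x y) + f (y \<otimes> x))" "int p dvd f (x \<otimes> y) - (f x + f y)"
    "int p dvd f (y \<otimes> x) - (f y + f x)" unfolding cong_iff_dvd_diff by blast+
  have "int p dvd (f (x \<otimes> y) - (f x + f y)) - (f (x \<otimes> y) - (f (cmt G x y) + f (y \<otimes> x))) - (f (y \<otimes> x) - (f y + f x))"
    by (rule dvd_diff[OF dvd_diff[OF d(2,1)] d(3)])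
  then show ?thesis by (simp add: cong_iff_dvd_diff)
qed

lemma mod_hom_int_pow:
  assumes N: "subgroup N G" and f: "mod_hom p G N f" and x: "x \<in> N"
  shows "[f (x [^] (k::int)) = k * f x] (mod int p)"
proof (cases k)
  case (nonneg m) then show ?thesis using mod_hom_pow[OF N f x, of m] by (simp add: int_pow_int)
next
  case (neg m)
  have 3: "x [^] k = inv (x [^] Suc m)" using neg int_pow_neg_int[of x "Suc m"] subgroup.mem_carrier[OF N x] by simp
  have 1: "[f (inv (x [^] Suc m)) = - f (x [^] Suc m)] (mod int p)"
    by (rule mod_hom_inv[OF N f subgroup_nat_pow_closed[OF N x]])
  have 2: "[- f (x [^] Suc m) = - (int (Suc m) * f x)] (mod int p)"
    using mod_hom_pow[OF N f x, of "Suc m"] by (simp only: cong_minus_minus_iff)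
  have "- (int (Suc m) * f x) = k * f x" unfolding neg by (rule minus_mult_left)
  then show ?thesis using cong_trans[OF 1 2] by (simp only: 3)
qed

end

section \<open>The derived subgroup of a metacyclic p-group\<close>

context metacyclic_p_group
begin

lemma gen_subgroup: "subgroup K G \<Longrightarrow> g \<in> K \<Longrightarrow> n \<in> K \<Longrightarrow> carrier G \<subseteq> K"
proof
  fix x assume K: "subgroup K G" "g \<in> K" "n \<in> K" and "x \<in> carrier G"
  then obtain i j :: int where "x = g [^] i \<otimes> n [^] j" using gens unfolding metacyclic_gens_def by blast
  then show "x \<in> K" using K by (simp add: subgroup.m_closed subgroup_int_pow_mem)
qed

definition c where "c = cmt G g n"

lemma c_closed [simp]: "c \<in> carrier G" by (simp add: c_def)

text \<open>A commutator with \<open>n\<close> raises \<open>n\<close> to a conjugation exponent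
  minus 1, and conjugation exponents are 1 modulo \<open>p\<close>.\<close>

lemma c_pow: "\<exists>l::int. c = n [^] (int p * l)"
proof -
  obtain s where s: "n \<otimes> inv g = inv g \<otimes> n [^] (s::int)" "[s = 1] (mod int p)" using conj_exponent[of "inv g"] by auto
  have "c = g \<otimes> (n \<otimes> inv g) \<otimes> inv n" by (simp add: c_def cmt_def m_assoc)
  also have "\<dots> = n [^] s \<otimes> inv n" by (simp add: s(1) m_assoc)
  also have "\<dots> = n [^] (s - 1)" by (simp add: int_pow_diff)
  finally show ?thesis using s(2) by (auto simp: cong_iff_dvd_diff dvd_def)
qed

lemma c_conj:
  assumes x: "x \<in> carrier G"
  shows "\<exists>s. cj G x c = c [^] (s::int) \<and> [s = 1] (mod int p)"
proof -
  obtain l :: int where l: "c = n [^] (int p * l)" using c_pow by blast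
  obtain s where s: "n \<otimes> inv x = inv x \<otimes> n [^] (s::int)" "[s = 1] (mod int p)" using conj_exponent[of "inv x"] x by auto
  have "cj G x n = x \<otimes> (n \<otimes> inv x)" using x by (simp add: cj_def m_assoc)
  also have "\<dots> = n [^] s" using x by (simp add: s(1))
  finally have "cj G x c = c [^] s" using x by (simp add: l cj_int_pow int_pow_pow mult.commute)
  then show ?thesis using s(2) by blast
qed

text \<open>The derived subgroup, as \<open>cmt_in_C\<close> shows.\<close>

definition C where "C = range (\<lambda>k::int. c [^] k)"

lemma C_subgroup: "subgroup C G" unfolding C_def by (rule subgroup_of_powers) simp

lemma C_normal: "C \<lhd> G"
proof -
  have "x \<otimes> y \<otimes> inv x \<in> C" if x: "x \<in> carrier G" and "y \<in> C" for x y
  proof -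
    obtain k :: int where k: "y = c [^] k" using \<open>y \<in> C\<close> by (auto simp: C_def)
    obtain s where "cj G x c = c [^] (s::int)" using c_conj[OF x] by blast
    then have "cj G x y = c [^] (s * k)" using x by (simp add: k cj_int_pow int_pow_pow)
    then show ?thesis by (simp add: cj_def C_def)
  qed
  then show ?thesis using C_subgroup by (simp add: normal_inv_iff)
qed

lemma cmt_in_C: "x \<in> carrier G \<Longrightarrow> y \<in> carrier G \<Longrightarrow> cmt G x y \<in> C"
proof -
  have "cmt G g n \<in> C" unfolding C_def c_def[symmetric] by (rule range_eqI[of _ _ 1]) simp
  then show "x \<in> carrier G \<Longrightarrow> y \<in> carrier G \<Longrightarrow> cmt G x y \<in> C"
    using cmt_in_normal[OF fin C_normal g n gen_subgroup] by blast
qed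

text \<open>The derived subgroup is fully invariant.\<close>

lemma hom_c:
  assumes h: "h \<in> hom G G" shows "\<exists>k::int. h c = c [^] k"
proof -
  interpret h: group_hom G G h using h by unfold_locales
  have "h c = cmt G (h g) (h n)" by (simp add: c_def cmt_def)
  then show ?thesis using cmt_in_C[of "h g" "h n"] by (auto simp: C_def)
qed

lemma metacyclic_image:
  assumes h: "h \<in> hom G K" and K: "group K" and surj: "carrier K = h ` carrier G"
  shows "\<exists>b. metacyclic_p_group K p b (h n) (h g)"
proof -
  interpret h: group_hom G K h using h K is_group by (simp add: group_hom_def group_hom_axioms_def)
  have "card (kernel G K h) * card (rcosets (kernel G K h)) = order G"
    using lagrange[OF h.subgroup_kernel] by (simp add: mult.commute)
  moreover have "card (rcosets (kernel G K h)) = card (carrier K)"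
  proof -
    have "(\<lambda>X. the_elem (h ` X)) \<in> iso (G Mod kernel G K h) K" using h.FactGroup_iso_set surj by simp
    from iso_same_card[OF is_isoI[OF this]] show ?thesis by (simp add: FactGroup_def)
  qed
  ultimately have "card (carrier K) dvd p ^ a" using ord by (metis dvd_triv_right)
  then obtain b where b: "order K = p ^ b" using divides_primepow_nat[OF p] by (auto simp: order_def)
  have "metacyclic_gens K (h n) (h g)"
    unfolding metacyclic_gens_def
  proof (intro conjI ballI)
    fix x assume "x \<in> carrier K"
    then obtain y where y: "y \<in> carrier G" "x = h y" using surj by blast
    obtain k :: int where "inv y \<otimes> n \<otimes> y = n [^] k" using gens y(1) unfolding metacyclic_gens_def by blast
    then have "h (inv y \<otimes> n \<otimes> y) = h (n [^] k)" by simp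
    then show "\<exists>k::int. inv\<^bsub>K\<^esub> x \<otimes>\<^bsub>K\<^esub> h n \<otimes>\<^bsub>K\<^esub> x = h n [^]\<^bsub>K\<^esub> k"
      using y by (auto simp: h.hom_int_pow)
    obtain i j :: int where "y = g [^] i \<otimes> n [^] j" using gens y(1) unfolding metacyclic_gens_def by blast
    then show "\<exists>(i::int) (j::int). x = h g [^]\<^bsub>K\<^esub> i \<otimes>\<^bsub>K\<^esub> h n [^]\<^bsub>K\<^esub> j"
      using y by (auto simp: h.hom_int_pow)
  qed simp_all
  then show ?thesis using K p odd b by (auto simp: metacyclic_p_group_def metacyclic_p_group_axioms_def)
qed

end

section \<open>Functionals invariant under automorphisms\<close>

text \<open>Cramer's rule over the field with \<open>p\<close> elements.\<close>

lemma solve_mod_prime_2: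
  fixes i1 i2 j1 j2 x1 x2 :: int
  assumes "Factorial_Ring.prime p" "\<not> int p dvd i1 * j2 - i2 * j1"
  obtains \<alpha> \<beta> where "[\<alpha> * i1 + \<beta> * j1 = x1] (mod int p)" "[\<alpha> * i2 + \<beta> * j2 = x2] (mod int p)"
proof -
  obtain k where k: "[k * (i1 * j2 - i2 * j1) = 1] (mod int p)" by (rule invert_mod_prime[OF assms])
  have e: "k * (x1 * j2 - x2 * j1) * i1 + k * (i1 * x2 - i2 * x1) * j1 = k * (i1 * j2 - i2 * j1) * x1"
    "k * (x1 * j2 - x2 * j1) * i2 + k * (i1 * x2 - i2 * x1) * j2 = k * (i1 * j2 - i2 * j1) * x2"
    by (simp_all add: algebra_simps)
  have "[k * (i1 * j2 - i2 * j1) * x = 1 * x] (mod int p)" for x by (rule cong_mult[OF k cong_refl])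
  from this[of x1] this[of x2] show ?thesis
    by (intro that[of "k * (x1 * j2 - x2 * j1)" "k * (i1 * x2 - i2 * x1)"]) (simp_all only: e mult_1)
qed

text \<open>The derived subgroup has order \<open>p\<close> and is therefore central: the commutator
  becomes an alternating bilinear form modulo \<open>p\<close>, and for odd \<open>p\<close> the
  \<open>p\<close>-th power map is a homomorphism. The general case is brought into this form by
  factoring out the \<open>p\<close>-th powers of the derived subgroup.\<close>

locale metacyclic_class_two = metacyclic_p_group +
  assumes c_ne: "c \<noteq> \<one>" and c_p: "c [^] p = \<one>"
begin

lemma p1: "1 < p" using p prime_gt_1_nat by blast

lemma c_pow_cong: "[i = j] (mod int p) \<Longrightarrow> c [^] i = c [^] j"
  by (rule pow_cong_exponent[OF c_closed c_p])

lemma c_pow_eq_iff: "c [^] i = c [^] j \<longleftrightarrow> [i = j] (mod int p)"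
proof
  assume "c [^] i = c [^] j"
  then have "c [^] (i - j) = \<one>" by (simp add: int_pow_diff)
  then show "[i = j] (mod int p)" using pow_eq_one_prime[OF p c_closed c_p c_ne] by (simp add: cong_iff_dvd_diff)
qed (rule c_pow_cong)

lemma c_central: "x \<in> carrier G \<Longrightarrow> cj G x c = c"
  using c_conj[of x] c_pow_cong[of _ 1] by fastforce

lemma c_pow_comm: "x \<in> carrier G \<Longrightarrow> c [^] (k::int) \<otimes> x = x \<otimes> c [^] k"
proof -
  assume x: "x \<in> carrier G"
  have "cj G x (c [^] k) = c [^] k" using x by (simp add: cj_int_pow c_central)
  then show ?thesis using x by (simp add: cj_eq_self_iff)
qed

text \<open>The exponent is determined only modulo \<open>p\<close>, hence the congruences in all
  that follows.\<close>

definition \<kappa> where "\<kappa> x y = (SOME k::int. cmt G x y = c [^] k)"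

lemma cmt_\<kappa>: "x \<in> carrier G \<Longrightarrow> y \<in> carrier G \<Longrightarrow> cmt G x y = c [^] \<kappa> x y"
  unfolding \<kappa>_def by (rule someI_ex) (use cmt_in_C in \<open>auto simp: C_def\<close>)

lemma \<kappa>_eqI: "x \<in> carrier G \<Longrightarrow> y \<in> carrier G \<Longrightarrow> cmt G x y = c [^] k \<Longrightarrow> [\<kappa> x y = k] (mod int p)"
  using cmt_\<kappa> c_pow_eq_iff by simp

lemma \<kappa>_swap: "x \<in> carrier G \<Longrightarrow> y \<in> carrier G \<Longrightarrow> [\<kappa> x y = - \<kappa> y x] (mod int p)"
  by (rule \<kappa>_eqI) (simp_all add: int_pow_neg cmt_\<kappa>[symmetric] cmt_inv)

lemma \<kappa>_add_left:
  assumes "x \<in> carrier G" "y \<in> carrier G" "u \<in> carrier G"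
  shows "[\<kappa> (x \<otimes> y) u = \<kappa> x u + \<kappa> y u] (mod int p)"
proof (rule \<kappa>_eqI)
  have "cmt G (x \<otimes> y) u = cj G x (cmt G y u) \<otimes> cmt G x u" using assms by (rule cmt_mult_left)
  also have "\<dots> = c [^] \<kappa> y u \<otimes> c [^] \<kappa> x u" using assms by (simp add: cmt_\<kappa> cj_int_pow c_central)
  finally show "cmt G (x \<otimes> y) u = c [^] (\<kappa> x u + \<kappa> y u)" by (simp add: int_pow_mult[symmetric] add.commute)
qed (use assms in simp_all)

lemma \<kappa>_mod_hom_left: "u \<in> carrier G \<Longrightarrow> mod_hom p G (carrier G) (\<lambda>x. \<kappa> x u)"
  using \<kappa>_add_left by (simp add: mod_hom_def)

lemma \<kappa>_add_right:
  assumes "x \<in> carrier G" "y \<in> carrier G" "u \<in> carrier G"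
  shows "[\<kappa> u (x \<otimes> y) = \<kappa> u x + \<kappa> u y] (mod int p)"
proof -
  have "[\<kappa> u (x \<otimes> y) = - \<kappa> (x \<otimes> y) u] (mod int p)" using assms by (intro \<kappa>_swap) simp_all
  moreover have "[- \<kappa> (x \<otimes> y) u = - (\<kappa> x u + \<kappa> y u)] (mod int p)"
    using \<kappa>_add_left[OF assms] by (simp only: cong_minus_minus_iff)
  moreover have "- (\<kappa> x u + \<kappa> y u) = (- \<kappa> x u) + (- \<kappa> y u)" by simp
  moreover have "[(- \<kappa> x u) + (- \<kappa> y u) = \<kappa> u x + \<kappa> u y] (mod int p)"
    using assms by (intro cong_add) (simp_all add: \<kappa>_swap cong_sym)
  ultimately show ?thesis by (metis cong_trans)
qed

lemma \<kappa>_mod_hom_right: "u \<in> carrier G \<Longrightarrow> mod_hom p G (carrier G) (\<kappa> u)"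
  using \<kappa>_add_right by (simp add: mod_hom_def)

lemma \<kappa>_zero_iff: "x \<in> carrier G \<Longrightarrow> y \<in> carrier G \<Longrightarrow> int p dvd \<kappa> x y \<longleftrightarrow> x \<otimes> y = y \<otimes> x"
  using cmt_\<kappa>[of x y] pow_eq_one_prime[OF p c_closed c_p c_ne, of "\<kappa> x y"] cmt_eq_one_iff[of x y] by simp

text \<open>A new factor \<open>x\<close> has to pass all \<open>y\<close> collected so far,
  producing one commutator for each of them.\<close>

lemma pow_mult_class_two:
  assumes x: "x \<in> carrier G" and y: "y \<in> carrier G"
  shows "(x \<otimes> y) [^] (m::nat) = x [^] m \<otimes> y [^] m \<otimes> c [^] (\<kappa> y x * (\<Sum>i<m. int i))"
proof (induction m)
  case (Suc m)
  let ?s = "\<Sum>i<m. int i"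
  have "cmt G (y [^] m) x = c [^] (int m * \<kappa> y x)"
  proof -
    have "[\<kappa> (y [^] m) x = int m * \<kappa> y x] (mod int p)" using mod_hom_pow[OF subgroup_self \<kappa>_mod_hom_left[OF x] y] .
    then show ?thesis using x y by (simp add: cmt_\<kappa> c_pow_cong)
  qed
  then have yx: "y [^] m \<otimes> x = c [^] (int m * \<kappa> y x) \<otimes> (x \<otimes> y [^] m)" using cmt_swap[of "y [^] m" x] x y by simp
  have "(x \<otimes> y) [^] Suc m = x [^] m \<otimes> y [^] m \<otimes> c [^] (\<kappa> y x * ?s) \<otimes> (x \<otimes> y)" using Suc by simp
  also have "\<dots> = x [^] m \<otimes> (y [^] m \<otimes> (c [^] (\<kappa> y x * ?s) \<otimes> (x \<otimes> y)))" using x y by (simp add: m_assoc)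
  also have "c [^] (\<kappa> y x * ?s) \<otimes> (x \<otimes> y) = x \<otimes> y \<otimes> c [^] (\<kappa> y x * ?s)" using x y by (simp add: c_pow_comm)
  also have "x [^] m \<otimes> (y [^] m \<otimes> (x \<otimes> y \<otimes> c [^] (\<kappa> y x * ?s))) = x [^] m \<otimes> ((y [^] m \<otimes> x) \<otimes> (y \<otimes> c [^] (\<kappa> y x * ?s)))"
    using x y by (simp add: m_assoc)
  also have "(y [^] m \<otimes> x) \<otimes> (y \<otimes> c [^] (\<kappa> y x * ?s)) = x \<otimes> y [^] m \<otimes> c [^] (int m * \<kappa> y x) \<otimes> (y \<otimes> c [^] (\<kappa> y x * ?s))"
    unfolding yx using x y by (simp add: c_pow_comm)
  also have "\<dots> = x \<otimes> y [^] m \<otimes> (c [^] (int m * \<kappa> y x) \<otimes> y \<otimes> c [^] (\<kappa> y x * ?s))" using x y by (simp add: m_assoc)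
  also have "c [^] (int m * \<kappa> y x) \<otimes> y = y \<otimes> c [^] (int m * \<kappa> y x)" using y by (rule c_pow_comm)
  finally have "(x \<otimes> y) [^] Suc m = x [^] Suc m \<otimes> y [^] Suc m \<otimes> (c [^] (int m * \<kappa> y x) \<otimes> c [^] (\<kappa> y x * ?s))"
    using x y by (simp add: m_assoc)
  also have "c [^] (int m * \<kappa> y x) \<otimes> c [^] (\<kappa> y x * ?s) = c [^] (\<kappa> y x * (\<Sum>i<Suc m. int i))"
    by (simp add: int_pow_mult[symmetric] algebra_simps)
  finally show ?case .
qed simp

lemma pow_p_mult:
  assumes x: "x \<in> carrier G" and y: "y \<in> carrier G"
  shows "(x \<otimes> y) [^] p = x [^] p \<otimes> y [^] p"
proof -
  obtain h where h: "p = Suc (2 * h)" using odd by (auto elim: oddE)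
  have "2 * (\<Sum>i<m. int i) = int m * (int m - 1)" for m by (induction m) (simp_all add: algebra_simps)
  from this[of p] have "(\<Sum>i<p. int i) = int p * int h" by (simp add: h algebra_simps)
  then have "[\<kappa> y x * (\<Sum>i<p. int i) = 0] (mod int p)" by (simp add: cong_0_iff)
  from c_pow_cong[OF this] show ?thesis using pow_mult_class_two[OF x y, of p] x y by simp
qed

lemma pow_pk_mult:
  assumes x: "x \<in> carrier G" and y: "y \<in> carrier G"
  shows "(x \<otimes> y) [^] (p ^ k) = x [^] (p ^ k) \<otimes> y [^] (p ^ k)"
proof (induction k)
  case (Suc k)
  have "(x \<otimes> y) [^] (p ^ Suc k) = ((x \<otimes> y) [^] (p ^ k)) [^] p" using x y by (simp add: nat_pow_pow mult.commute)
  also have "\<dots> = (x [^] (p ^ k)) [^] p \<otimes> (y [^] (p ^ k)) [^] p" using x y by (simp add: Suc pow_p_mult)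
  finally show ?case using x y by (simp add: nat_pow_pow mult.commute)
qed (use x y in simp)

text \<open>\<open>F1\<close> and \<open>F2\<close> are the coordinates with respect to
  \<open>g\<close> and \<open>n\<close> modulo the centre.\<close>

definition F1 where "F1 x = \<kappa> x n"
definition F2 where "F2 x = \<kappa> g x"

lemma F_hom: "mod_hom p G (carrier G) F1" "mod_hom p G (carrier G) F2"
  using \<kappa>_mod_hom_left[OF n] \<kappa>_mod_hom_right[OF g] by (simp_all add: F1_def[abs_def] F2_def[abs_def])

lemma F_gens: "[F1 g = 1] (mod int p)" "[F1 n = 0] (mod int p)" "[F2 g = 0] (mod int p)" "[F2 n = 1] (mod int p)"
  unfolding F1_def F2_def by (rule \<kappa>_eqI; simp add: c_def[symmetric])+

lemma \<kappa>_formula: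
  assumes x: "x \<in> carrier G" and y: "y \<in> carrier G"
  shows "[\<kappa> x y = F1 x * F2 y - F2 x * F1 y] (mod int p)"
proof -
  obtain i j :: int where ij: "x = g [^] i \<otimes> n [^] j" using gens x unfolding metacyclic_gens_def by blast
  have lin: "[f x = i * f g + j * f n] (mod int p)" if "mod_hom p G (carrier G) f" for f
  proof -
    have "[f x = f (g [^] i) + f (n [^] j)] (mod int p)" unfolding ij by (rule mod_homD[OF that]) simp_all
    moreover have "[f (g [^] i) + f (n [^] j) = i * f g + j * f n] (mod int p)"
      by (intro cong_add mod_hom_int_pow[OF subgroup_self that]) simp_all
    ultimately show ?thesis by (rule cong_trans)
  qed
  have 1: "[F1 x = i * 1 + j * 0] (mod int p)"
    by (rule cong_trans[OF lin[OF F_hom(1)]]) (intro cong_add cong_mult cong_refl F_gens)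
  have 2: "[F2 x = i * 0 + j * 1] (mod int p)"
    by (rule cong_trans[OF lin[OF F_hom(2)]]) (intro cong_add cong_mult cong_refl F_gens)
  have 3: "[\<kappa> n y = - F1 y] (mod int p)" unfolding F1_def by (rule \<kappa>_swap) (simp_all add: y)
  have "[\<kappa> x y = i * F2 y + j * \<kappa> n y] (mod int p)" using lin[OF \<kappa>_mod_hom_left[OF y]] by (simp add: F2_def)
  also have "[i * F2 y + j * \<kappa> n y = i * F2 y + j * (- F1 y)] (mod int p)" by (intro cong_add cong_mult cong_refl 3)
  also have "[i * F2 y + j * (- F1 y) = F1 x * F2 y + F2 x * (- F1 y)] (mod int p)"
    using 1 2 by (intro cong_add cong_mult cong_refl) (simp_all add: cong_sym)
  finally show ?thesis by simp
qed

lemma central_iff: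
  assumes x: "x \<in> carrier G"
  shows "(\<forall>y\<in>carrier G. x \<otimes> y = y \<otimes> x) \<longleftrightarrow> int p dvd F1 x \<and> int p dvd F2 x"
proof
  assume "\<forall>y\<in>carrier G. x \<otimes> y = y \<otimes> x"
  then have "x \<otimes> n = n \<otimes> x" "g \<otimes> x = x \<otimes> g" by (metis n, metis g)
  then show "int p dvd F1 x \<and> int p dvd F2 x" using x by (simp add: F1_def F2_def \<kappa>_zero_iff)
next
  assume d: "int p dvd F1 x \<and> int p dvd F2 x"
  show "\<forall>y\<in>carrier G. x \<otimes> y = y \<otimes> x"
  proof
    fix y assume y: "y \<in> carrier G"
    have "int p dvd F1 x * F2 y - F2 x * F1 y" using d by (intro dvd_diff dvd_mult2) simp_all
    then have "int p dvd \<kappa> x y" using cong_dvd_iff[OF \<kappa>_formula[OF x y]] by simp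
    then show "x \<otimes> y = y \<otimes> x" using \<kappa>_zero_iff[OF x y] by simp
  qed
qed

text \<open>Both subgroups have index \<open>p\<^sup>2\<close>: the centre because \<open>x \<mapsto> (F1 x, F2 x)\<close> is onto modulo \<open>p\<close>,
  the \<open>p\<close>-th powers because at most \<open>p\<^sup>2\<close> elements have exponent \<open>p\<close>.\<close>

lemma central_is_pth_power:
  assumes x: "x \<in> carrier G" and central: "int p dvd F1 x" "int p dvd F2 x"
  shows "\<exists>v\<in>carrier G. x = v [^] p"
proof -
  define Z where "Z = {x \<in> carrier G. int p dvd F1 x \<and> int p dvd F2 x}"
  define U where "U = (\<lambda>v. v [^] p) ` carrier G"
  have UZ: "U \<subseteq> Z"
    using mod_hom_pow[OF subgroup_self F_hom(1), of _ p] mod_hom_pow[OF subgroup_self F_hom(2), of _ p]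
    by (auto simp: U_def Z_def) (metis cong_dvd_iff dvd_triv_left)+
  have homp: "(\<lambda>v. v [^] p) \<in> hom G G" by (rule homI) (simp_all add: pow_p_mult)
  interpret h: group_hom G G "\<lambda>v. v [^] p" using homp is_group by (simp add: group_hom_def group_hom_axioms_def)
  let ?K = "kernel G G (\<lambda>v. v [^] p)"
  have "card ?K \<le> p\<^sup>2" using card_exponent_p by (simp add: kernel_def)
  moreover have "order G \<le> card U * card ?K"
  proof -
    have "card (rcosets ?K) * card ?K = order G" using lagrange[OF h.subgroup_kernel] .
    moreover have "card (rcosets ?K) \<le> card U"
    proof (rule card_inj_on_le[of "\<lambda>X. the_elem ((\<lambda>v. v [^] p) ` X)"])
      show "inj_on (\<lambda>X. the_elem ((\<lambda>v. v [^] p) ` X)) (rcosets ?K)" using h.FactGroup_inj_on by (simp add: FactGroup_def)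
      show "(\<lambda>X. the_elem ((\<lambda>v. v [^] p) ` X)) ` (rcosets ?K) \<subseteq> U"
      proof
        fix y assume "y \<in> (\<lambda>X. the_elem ((\<lambda>v. v [^] p) ` X)) ` (rcosets ?K)"
        then obtain X where X: "X \<in> rcosets ?K" "y = the_elem ((\<lambda>v. v [^] p) ` X)" by blast
        then have XM: "X \<in> carrier (G Mod ?K)" by (simp add: FactGroup_def)
        obtain w where w: "w \<in> X" using h.FactGroup_nonempty[OF XM] by blast
        have Xc: "X \<subseteq> carrier G" using X(1) rcosets_part_G[OF h.subgroup_kernel] by blast
        have "(\<lambda>v. v [^] p) ` X = {w [^] p}"
        proof -
          obtain r where r: "r \<in> carrier G" "X = ?K #> r" using X(1) by (auto simp: RCOSETS_def)
          have "v [^] p = r [^] p" if "v \<in> X" for v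
            using that r by (auto simp: r_coset_def kernel_def pow_p_mult)
          then show ?thesis using w by force
        qed
        then show "y \<in> U" using X(2) w Xc by (auto simp: U_def)
      qed
      show "finite U" using fin by (simp add: U_def)
    qed
    ultimately show ?thesis by (metis mult_le_mono1)
  qed
  ultimately have 1: "order G \<le> card U * p\<^sup>2" by (meson le_trans mult_le_mono2)
  have sZ: "Z \<subseteq> carrier G" by (auto simp: Z_def)
  have finZ: "finite Z" using fin sZ finite_subset by blast
  have 2: "p\<^sup>2 * card Z \<le> order G"
  proof -
    let ?f = "\<lambda>(i, j, x). g [^] int i \<otimes> n [^] int j \<otimes> x"
    have val: "[F1 (g [^] int i \<otimes> n [^] int j \<otimes> x) = int i] (mod int p)" "[F2 (g [^] int i \<otimes> n [^] int j \<otimes> x) = int j] (mod int p)"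
      if x: "x \<in> Z" for i j x
    proof -
      have xc: "x \<in> carrier G" and d: "[F1 x = 0] (mod int p)" "[F2 x = 0] (mod int p)" using x by (auto simp: Z_def cong_0_iff)
      have gen: "[f (g [^] int i \<otimes> n [^] int j \<otimes> x) = int i * f g + int j * f n + f x] (mod int p)"
        if f: "mod_hom p G (carrier G) f" for f
      proof -
        have "[f (g [^] int i \<otimes> n [^] int j \<otimes> x) = f (g [^] int i \<otimes> n [^] int j) + f x] (mod int p)"
          by (rule mod_homD[OF f]) (simp_all add: xc)
        moreover have "[f (g [^] int i \<otimes> n [^] int j) + f x = f (g [^] int i) + f (n [^] int j) + f x] (mod int p)"
          by (intro cong_add cong_refl mod_homD[OF f]) simp_all
        moreover have "[f (g [^] int i) + f (n [^] int j) + f x = int i * f g + int j * f n + f x] (mod int p)"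
          by (intro cong_add cong_refl mod_hom_int_pow[OF subgroup_self f]) simp_all
        ultimately show ?thesis using cong_trans by blast
      qed
      have "[int i * F1 g + int j * F1 n + F1 x = int i * 1 + int j * 0 + 0] (mod int p)"
        by (intro cong_add cong_mult cong_refl F_gens d)
      then show "[F1 (g [^] int i \<otimes> n [^] int j \<otimes> x) = int i] (mod int p)" using cong_trans[OF gen[OF F_hom(1)]] by simp
      have "[int i * F2 g + int j * F2 n + F2 x = int i * 0 + int j * 1 + 0] (mod int p)"
        by (intro cong_add cong_mult cong_refl F_gens d)
      then show "[F2 (g [^] int i \<otimes> n [^] int j \<otimes> x) = int j] (mod int p)" using cong_trans[OF gen[OF F_hom(2)]] by simp
    qed
    have "inj_on ?f ({..<p} \<times> {..<p} \<times> Z)"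
    proof (rule inj_onI)
      fix s t assume s: "s \<in> {..<p} \<times> {..<p} \<times> Z" and t: "t \<in> {..<p} \<times> {..<p} \<times> Z" and st: "?f s = ?f t"
      obtain i j x i' j' x' where s': "s = (i, j, x)" and t': "t = (i', j', x')" by (cases s, cases t) auto
      have b: "i < p" "j < p" "i' < p" "j' < p" and x: "x \<in> Z" "x' \<in> Z"
        and eq: "g [^] int i \<otimes> n [^] int j \<otimes> x = g [^] int i' \<otimes> n [^] int j' \<otimes> x'"
        using s t st by (simp_all add: s' t')
      have "[int i = int i'] (mod int p)" using val(1)[OF x(1), of i j] val(1)[OF x(2), of i' j'] eq cong_sym cong_trans by metis
      moreover have "[int j = int j'] (mod int p)" using val(2)[OF x(1), of i j] val(2)[OF x(2), of i' j'] eq cong_sym cong_trans by metis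
      ultimately have "i = i'" "j = j'" using b by (simp_all add: cong_int_iff cong_less_modulus_unique_nat)
      moreover have "x \<in> carrier G" "x' \<in> carrier G" using x sZ by auto
      ultimately show "s = t" using eq by (simp add: s' t')
    qed
    then have "card ({..<p} \<times> {..<p} \<times> Z) \<le> card (carrier G)"
      by (rule card_inj_on_le) (use sZ fin in auto)
    then show ?thesis by (simp add: card_cartesian_product order_def power2_eq_square)
  qed
  have "p\<^sup>2 * card Z \<le> p\<^sup>2 * card U" using le_trans[OF 2 1] by (simp only: mult.commute)
  then have "card Z \<le> card U" using p1 by simp
  then have "U = Z" using UZ finZ by (simp add: card_seteq)
  then show ?thesis using x central by (auto simp: U_def Z_def)
qed

end

lemma (in group) mod_hom_pow_prod:
  assumes f: "mod_hom p G (carrier G) f" and "x \<in> carrier G" "y \<in> carrier G"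
  shows "[f (x [^] (i::int) \<otimes> y [^] (j::int)) = i * f x + j * f y] (mod int p)"
proof -
  have "[f (x [^] i \<otimes> y [^] j) = f (x [^] i) + f (y [^] j)] (mod int p)" by (rule mod_homD[OF f]) (use assms in simp_all)
  moreover have "[f (x [^] i) + f (y [^] j) = i * f x + j * f y] (mod int p)"
    by (intro cong_add mod_hom_int_pow[OF subgroup_self f]) (use assms in simp_all)
  ultimately show ?thesis by (rule cong_trans)
qed

context metacyclic_class_two
begin

text \<open>Modulo \<open>p\<close>, the pairing \<open>\<kappa>\<close> is the determinant of the coordinates \<open>(F1, F2)\<close>.\<close>

lemma decompose:
  assumes v: "v1 \<in> carrier G" "v2 \<in> carrier G" "\<not> int p dvd \<kappa> v1 v2" and x: "x \<in> carrier G"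
  shows "\<exists>(\<alpha>::int) (\<beta>::int) u. u \<in> carrier G \<and> x = v1 [^] \<alpha> \<otimes> v2 [^] \<beta> \<otimes> u [^] p"
proof -
  have "\<not> int p dvd F1 v1 * F2 v2 - F2 v1 * F1 v2"
    using v(3) cong_dvd_iff[OF \<kappa>_formula[OF v(1,2)]] by simp
  then obtain \<alpha> \<beta> where ab: "[\<alpha> * F1 v1 + \<beta> * F1 v2 = F1 x] (mod int p)" "[\<alpha> * F2 v1 + \<beta> * F2 v2 = F2 x] (mod int p)"
    by (rule solve_mod_prime_2[OF p])
  define w where "w = v1 [^] \<alpha> \<otimes> v2 [^] \<beta>"
  have wc: "w \<in> carrier G" using v by (simp add: w_def)
  have d: "int p dvd f (inv w \<otimes> x)" if f: "mod_hom p G (carrier G) f" and eq: "[\<alpha> * f v1 + \<beta> * f v2 = f x] (mod int p)" for f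
  proof -
    have "[f w = \<alpha> * f v1 + \<beta> * f v2] (mod int p)" unfolding w_def by (rule mod_hom_pow_prod[OF f v(1,2)])
    from cong_trans[OF this eq] have 1: "[f w = f x] (mod int p)" .
    have "x = w \<otimes> (inv w \<otimes> x)" using wc x by simp
    then have "[f x = f w + f (inv w \<otimes> x)] (mod int p)" using mod_homD[OF f, of w "inv w \<otimes> x"] wc x by simp
    then have "int p dvd f x - (f w + f (inv w \<otimes> x))" by (simp add: cong_iff_dvd_diff)
    moreover have "int p dvd f w - f x" using 1 by (simp add: cong_iff_dvd_diff)
    ultimately have "int p dvd f x - (f w + f (inv w \<otimes> x)) + (f w - f x)" by (rule dvd_add)
    then show ?thesis by simp
  qed
  obtain u where u: "u \<in> carrier G" "inv w \<otimes> x = u [^] p"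
    using central_is_pth_power[of "inv w \<otimes> x"] d[OF F_hom(1) ab(1)] d[OF F_hom(2) ab(2)] wc x by auto
  have "x = w \<otimes> u [^] p" using wc x by (simp add: u(2)[symmetric])
  then show ?thesis using u(1) unfolding w_def by blast
qed

text \<open>A vanishing determinant makes the coordinates of \<open>u\<close> a multiple of those of
  \<open>w\<close>; what remains is central and thus a \<open>p\<close>-th power.\<close>

lemma proportional:
  assumes w: "w \<in> carrier G" "\<not> (int p dvd F1 w \<and> int p dvd F2 w)" and u: "u \<in> carrier G" "int p dvd \<kappa> w u"
  shows "\<exists>(\<beta>::int) v. v \<in> carrier G \<and> u = w [^] \<beta> \<otimes> v [^] p"
proof -
  have det: "int p dvd F1 w * F2 u - F2 w * F1 u" using u(2) cong_dvd_iff[OF \<kappa>_formula[OF w(1) u(1)]] by simp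
  obtain \<beta> where b: "int p dvd F1 u - \<beta> * F1 w" "int p dvd F2 u - \<beta> * F2 w"
  proof (cases "int p dvd F1 w")
    case False
    obtain k where "[k * F1 w = 1] (mod int p)" by (rule invert_mod_prime[OF p False])
    then have k: "int p dvd k * F1 w - 1" by (simp add: cong_iff_dvd_diff)
    have "int p dvd (k * F1 w - 1) * (- F1 u)" using k by (rule dvd_mult2)
    then have 1: "int p dvd F1 u - k * F1 u * F1 w" by (simp add: algebra_simps)
    have "int p dvd k * (F1 w * F2 u - F2 w * F1 u) + (k * F1 w - 1) * (- F2 u)"
      using det k by (intro dvd_add dvd_mult dvd_mult2)
    then have "int p dvd F2 u - k * F1 u * F2 w" by (simp add: algebra_simps)
    then show ?thesis using 1 that by blast
  next
    case True
    then have "\<not> int p dvd F2 w" using w(2) by simp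
    then obtain k where "[k * F2 w = 1] (mod int p)" by (rule invert_mod_prime[OF p])
    then have k: "int p dvd k * F2 w - 1" by (simp add: cong_iff_dvd_diff)
    have "int p dvd (k * F2 w - 1) * (- F2 u)" using k by (rule dvd_mult2)
    then have 1: "int p dvd F2 u - k * F2 u * F2 w" by (simp add: algebra_simps)
    have "int p dvd (- k) * (F1 w * F2 u - F2 w * F1 u) + (k * F2 w - 1) * (- F1 u)"
      using det k by (intro dvd_add dvd_mult dvd_mult2)
    then have "int p dvd F1 u - k * F2 u * F1 w" by (simp add: algebra_simps)
    then show ?thesis using 1 that by blast
  qed
  have d: "int p dvd f (inv (w [^] \<beta>) \<otimes> u)" if f: "mod_hom p G (carrier G) f" and eq: "int p dvd f u - \<beta> * f w" for f
  proof -
    have "[f (w [^] (- \<beta>) \<otimes> u [^] (1::int)) = (- \<beta>) * f w + 1 * f u] (mod int p)" by (rule mod_hom_pow_prod[OF f w(1) u(1)])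
    then have "[f (inv (w [^] \<beta>) \<otimes> u) = f u - \<beta> * f w] (mod int p)" using w(1) u(1) by (simp add: int_pow_neg)
    then show ?thesis using eq cong_dvd_iff by blast
  qed
  obtain v where v: "v \<in> carrier G" "inv (w [^] \<beta>) \<otimes> u = v [^] p"
    using central_is_pth_power[of "inv (w [^] \<beta>) \<otimes> u"] d[OF F_hom(1) b(1)] d[OF F_hom(2) b(2)] w(1) u(1) by auto
  have "u = w [^] \<beta> \<otimes> v [^] p" using w(1) u(1) by (simp add: v(2)[symmetric])
  then show ?thesis using v(1) by blast
qed

text \<open>Let \<open>I\<close> be maximal such that \<open>c\<close> is a \<open>p ^ I\<close>-th
  power, say of \<open>w\<close>, and let \<open>\<mu>\<close> be the commutator form with
  \<open>w\<close>. If \<open>\<phi> c = c [^] \<chi>\<close>, then \<open>\<phi> w\<close> is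
  \<open>w [^] \<chi>\<close> times an error \<open>V \<phi> \<chi>\<close> killed by
  \<open>p ^ I\<close>. When the errors are always central, \<open>\<mu>\<close> is invariant on the
  whole group and any \<open>y\<close> not commuting with \<open>w\<close> will do. Otherwise a
  noncentral error serves as \<open>y\<close>: elements killed by \<open>p ^ I\<close> commute with
  each other, so the error terms vanish on the images of \<open>y\<close>, while by maximality of
  \<open>I\<close> a noncentral one does not commute with \<open>w\<close>.\<close>

lemma invariant_functional:
  obtains y \<mu> where "y \<in> carrier G" "mod_hom p G (carrier G) \<mu>" "\<not> int p dvd \<mu> y"
    "\<And>\<phi>. \<phi> \<in> hom G G \<Longrightarrow> \<phi> c \<noteq> \<one> \<Longrightarrow> [\<mu> (\<phi> y) = \<mu> y] (mod int p)"
proof -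
  define S where "S = {i. \<exists>w\<in>carrier G. w [^] (p ^ i) = c}"
  have S_bound: "i < a" if iS: "i \<in> S" for i
  proof (rule ccontr)
    assume "\<not> i < a"
    obtain w where w: "w \<in> carrier G" "w [^] (p ^ i) = c" using iS by (auto simp: S_def)
    have "w [^] (p ^ i) = (w [^] (p ^ a)) [^] (p ^ (i - a))"
      using w(1) \<open>\<not> i < a\<close> by (simp add: nat_pow_pow power_add[symmetric])
    then show False using w c_ne pow_card[OF w(1)] by simp
  qed
  have "1 \<in> S"
  proof -
    obtain l :: int where l: "c = n [^] (int p * l)" using c_pow by blast
    have "(n [^] l) [^] p = n [^] (l * int p)" by (simp add: int_pow_pow flip: int_pow_int)
    then have "(n [^] l) [^] (p ^ 1) = c" by (simp add: l mult.commute)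
    moreover have "n [^] l \<in> carrier G" by simp
    ultimately show ?thesis unfolding S_def by (intro CollectI bexI)
  qed
  define I where "I = Max S"
  have finS: "finite S" using S_bound by (intro finite_subset[of S "{..<a}"]) auto
  have IS: "I \<in> S" unfolding I_def using finS \<open>1 \<in> S\<close> by (intro Max_in) auto
  have notSuc: "Suc I \<notin> S" using Max_ge[OF finS, of "Suc I"] by (auto simp: I_def)
  obtain w where w: "w \<in> carrier G" "w [^] (p ^ I) = c" using IS by (auto simp: S_def)
  \<comment> \<open>If \<open>t\<close> were prime to \<open>p\<close>, then \<open>c\<close>, being
    a power of \<open>c [^] t\<close>, would be a \<open>p ^ (I + 1)\<close>-th power, against the
    choice of \<open>I\<close>.\<close>
  have noroot: "int p dvd t" if v: "v \<in> carrier G" "(v [^] p) [^] (p ^ I) = c [^] t" for v and t :: int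
  proof (rule ccontr)
    assume "\<not> int p dvd t"
    then obtain k where k: "[k * t = 1] (mod int p)" by (rule invert_mod_prime[OF p])
    have "(v [^] k) [^] (p ^ Suc I) = v [^] (int (p ^ Suc I) * k)"
      using v(1) by (simp add: int_pow_pow mult.commute flip: int_pow_int)
    also have "\<dots> = (v [^] (p ^ Suc I)) [^] k" using v(1) by (simp add: int_pow_pow flip: int_pow_int)
    also have "v [^] (p ^ Suc I) = c [^] t" using v by (simp add: nat_pow_pow)
    also have "(c [^] t) [^] k = c [^] (k * t)" by (simp add: int_pow_pow mult.commute)
    also have "\<dots> = c" using c_pow_cong[OF k] by simp
    finally have "Suc I \<in> S" using v(1) unfolding S_def by (auto intro!: bexI[of _ "v [^] k"])
    then show False using notSuc by simp
  qed
  have one_pow: "(x [^] (\<alpha>::int)) [^] (p ^ I) = (x [^] (p ^ I)) [^] \<alpha>" if "x \<in> carrier G" for x \<alpha>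
    using that by (simp add: int_pow_pow mult.commute flip: int_pow_int)
  \<comment> \<open>Two elements that do not commute generate the group modulo \<open>p\<close>-th
    powers. Expressing \<open>w\<close> by them would leave \<open>c\<close> as the
    \<open>p ^ I\<close>-th power of a \<open>p\<close>-th power.\<close>
  have isotropic: "int p dvd \<kappa> v1 v2"
    if v: "v1 \<in> carrier G" "v2 \<in> carrier G" "v1 [^] (p ^ I) = \<one>" "v2 [^] (p ^ I) = \<one>" for v1 v2
  proof (rule ccontr)
    assume "\<not> int p dvd \<kappa> v1 v2"
    then obtain \<alpha> \<beta> :: int and u where u: "u \<in> carrier G" "w = v1 [^] \<alpha> \<otimes> v2 [^] \<beta> \<otimes> u [^] p"
      using decompose[OF v(1,2) _ w(1)] by blast
    have "(u [^] p) [^] (p ^ I) = c" using u(1) v w(2) unfolding u(2) by (simp add: pow_pk_mult one_pow)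
    then have "(u [^] p) [^] (p ^ I) = c [^] (1::int)" by simp
    from noroot[OF u(1) this] have "int p dvd 1" .
    then show False using p1 by simp
  qed
  have wF: "\<not> (int p dvd F1 w \<and> int p dvd F2 w)"
  proof
    assume "int p dvd F1 w \<and> int p dvd F2 w"
    then obtain v where "v \<in> carrier G" "w = v [^] p" using central_is_pth_power[OF w(1)] by blast
    then have "int p dvd 1" using noroot[of v 1] w(2) by simp
    then show False using p1 by simp
  qed
  have outside: "int p dvd F1 u \<and> int p dvd F2 u"
    if u: "u \<in> carrier G" "u [^] (p ^ I) = \<one>" "int p dvd \<kappa> w u" for u
  proof -
    obtain \<beta> :: int and v where v: "v \<in> carrier G" "u = w [^] \<beta> \<otimes> v [^] p"
      using proportional[OF w(1) wF u(1,3)] by blast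
    have "c [^] \<beta> \<otimes> (v [^] p) [^] (p ^ I) = \<one>"
      using u(2) v(1) w unfolding v(2) by (simp add: pow_pk_mult one_pow)
    then have "inv ((v [^] p) [^] (p ^ I)) = c [^] \<beta>" using v(1) by (intro inv_equality) simp_all
    from this[symmetric] have "(v [^] p) [^] (p ^ I) = c [^] (- \<beta>)" using v(1) by (simp add: int_pow_neg)
    then have "int p dvd - \<beta>" by (rule noroot[OF v(1)])
    then have d: "int p dvd \<beta>" by simp
    have "int p dvd f u" if f: "mod_hom p G (carrier G) f" for f
    proof -
      have "[f (w [^] \<beta> \<otimes> v [^] (int p)) = \<beta> * f w + int p * f v] (mod int p)" by (rule mod_hom_pow_prod[OF f w(1) v(1)])
      moreover have "int p dvd \<beta> * f w + int p * f v" using d by simp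
      ultimately show ?thesis using cong_dvd_iff v(2) by (simp add: int_pow_int) blast
    qed
    then show ?thesis using F_hom by blast
  qed
  define \<mu> where "\<mu> = \<kappa> w"
  have \<mu>: "mod_hom p G (carrier G) \<mu>" unfolding \<mu>_def by (rule \<kappa>_mod_hom_right[OF w(1)])
  define V where "V = (\<lambda>\<phi> (\<chi>::int). inv (w [^] \<chi>) \<otimes> \<phi> w)"
  have hom_facts: "\<exists>\<chi>::int. \<not> int p dvd \<chi> \<and> \<phi> c = c [^] \<chi> \<and> V \<phi> \<chi> \<in> carrier G \<and> V \<phi> \<chi> [^] (p ^ I) = \<one> \<and>
      (\<forall>x\<in>carrier G. [\<chi> * \<kappa> w x = \<chi> * \<kappa> w (\<phi> x) + \<kappa> (V \<phi> \<chi>) (\<phi> x)] (mod int p))"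
    if \<phi>: "\<phi> \<in> hom G G" "\<phi> c \<noteq> \<one>" for \<phi>
  proof -
    interpret \<phi>: group_hom G G \<phi> using \<phi>(1) is_group by (simp add: group_hom_def group_hom_axioms_def)
    obtain \<chi> :: int where \<chi>: "\<phi> c = c [^] \<chi>" using hom_c[OF \<phi>(1)] by blast
    have n\<chi>: "\<not> int p dvd \<chi>" using \<phi>(2) \<chi> pow_eq_one_prime[OF p c_closed c_p c_ne] by simp
    let ?u = "V \<phi> \<chi>"
    have uc: "?u \<in> carrier G" using w(1) by (simp add: V_def)
    have \<phi>w: "\<phi> w = w [^] \<chi> \<otimes> ?u" using w(1) by (simp add: V_def)
    have "(\<phi> w) [^] (p ^ I) = c [^] \<chi>" using w \<chi> \<phi>.hom_nat_pow[OF w(1), of "p ^ I"] by simp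
    then have "c [^] \<chi> \<otimes> ?u [^] (p ^ I) = c [^] \<chi>" unfolding \<phi>w using w uc by (simp add: pow_pk_mult one_pow)
    then have up: "?u [^] (p ^ I) = \<one>" using uc by simp
    have "[\<chi> * \<kappa> w x = \<chi> * \<kappa> w (\<phi> x) + \<kappa> ?u (\<phi> x)] (mod int p)" if x: "x \<in> carrier G" for x
    proof -
      have "\<phi> (cmt G w x) = cmt G (\<phi> w) (\<phi> x)" using w(1) x by (simp add: cmt_def)
      then have "cmt G (\<phi> w) (\<phi> x) = c [^] (\<chi> * \<kappa> w x)"
        using w(1) x by (simp add: cmt_\<kappa> \<phi>.hom_int_pow \<chi> int_pow_pow)
      then have 1: "[\<kappa> (\<phi> w) (\<phi> x) = \<chi> * \<kappa> w x] (mod int p)" using w(1) x by (intro \<kappa>_eqI) simp_all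
      have 2: "[\<kappa> (\<phi> w) (\<phi> x) = \<chi> * \<kappa> w (\<phi> x) + 1 * \<kappa> ?u (\<phi> x)] (mod int p)"
        using mod_hom_pow_prod[OF \<kappa>_mod_hom_left[of "\<phi> x"] w(1) uc, of \<chi> 1] x uc \<phi>w by simp
      from cong_trans[OF cong_sym[OF 1] 2] show ?thesis by simp
    qed
    then show ?thesis using n\<chi> \<chi> uc up by blast
  qed
  show thesis
  proof (cases "\<exists>\<phi> \<chi>. \<phi> \<in> hom G G \<and> \<phi> c \<noteq> \<one> \<and> V \<phi> \<chi> \<in> carrier G \<and> V \<phi> \<chi> [^] (p ^ I) = \<one> \<and> \<not> (int p dvd F1 (V \<phi> \<chi>) \<and> int p dvd F2 (V \<phi> \<chi>))")
    case True
    then obtain u where u: "u \<in> carrier G" "u [^] (p ^ I) = \<one>" "\<not> (int p dvd F1 u \<and> int p dvd F2 u)" by blast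
    show thesis
    proof (rule that[OF u(1) \<mu>])
      show "\<not> int p dvd \<mu> u" using outside[OF u(1,2)] u(3) by (auto simp: \<mu>_def)
      fix \<phi> assume \<phi>: "\<phi> \<in> hom G G" "\<phi> c \<noteq> \<one>"
      interpret \<phi>: group_hom G G \<phi> using \<phi>(1) is_group by (simp add: group_hom_def group_hom_axioms_def)
      obtain \<chi> :: int where \<chi>: "\<not> int p dvd \<chi>" "V \<phi> \<chi> \<in> carrier G" "V \<phi> \<chi> [^] (p ^ I) = \<one>"
        "[\<chi> * \<kappa> w u = \<chi> * \<kappa> w (\<phi> u) + \<kappa> (V \<phi> \<chi>) (\<phi> u)] (mod int p)" using hom_facts[OF \<phi>] u(1) by blast
      have "(\<phi> u) [^] (p ^ I) = \<one>" using \<phi>.hom_nat_pow[OF u(1), of "p ^ I"] u(2) by simp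
      then have "int p dvd \<kappa> (V \<phi> \<chi>) (\<phi> u)" using \<chi> u(1) by (intro isotropic) simp_all
      moreover have "int p dvd \<chi> * \<kappa> w u - (\<chi> * \<kappa> w (\<phi> u) + \<kappa> (V \<phi> \<chi>) (\<phi> u))" using \<chi>(4) by (simp add: cong_iff_dvd_diff)
      ultimately have "int p dvd \<kappa> (V \<phi> \<chi>) (\<phi> u) + (\<chi> * \<kappa> w u - (\<chi> * \<kappa> w (\<phi> u) + \<kappa> (V \<phi> \<chi>) (\<phi> u)))" by (rule dvd_add)
      then have "int p dvd \<chi> * (\<kappa> w u - \<kappa> w (\<phi> u))" by (simp add: algebra_simps)
      then have "int p dvd \<kappa> w u - \<kappa> w (\<phi> u)" using \<chi>(1) p prime_dvd_mult_iff[of "int p"] by simp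
      then show "[\<mu> (\<phi> u) = \<mu> u] (mod int p)" unfolding \<mu>_def by (simp add: cong_iff_dvd_diff dvd_diff_commute)
    qed
  next
    case False
    obtain y where y: "y \<in> carrier G" "\<not> int p dvd \<kappa> w y"
      using wF central_iff[OF w(1)] \<kappa>_zero_iff[OF w(1)] by blast
    show thesis
    proof (rule that[OF y(1) \<mu>])
      show "\<not> int p dvd \<mu> y" using y(2) by (simp add: \<mu>_def)
      fix \<phi> assume \<phi>: "\<phi> \<in> hom G G" "\<phi> c \<noteq> \<one>"
      interpret \<phi>: group_hom G G \<phi> using \<phi>(1) is_group by (simp add: group_hom_def group_hom_axioms_def)
      obtain \<chi> :: int where \<chi>: "\<not> int p dvd \<chi>" "V \<phi> \<chi> \<in> carrier G" "V \<phi> \<chi> [^] (p ^ I) = \<one>"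
        "[\<chi> * \<kappa> w y = \<chi> * \<kappa> w (\<phi> y) + \<kappa> (V \<phi> \<chi>) (\<phi> y)] (mod int p)" using hom_facts[OF \<phi>] y(1) by blast
      have "int p dvd F1 (V \<phi> \<chi>) \<and> int p dvd F2 (V \<phi> \<chi>)" using False \<phi> \<chi>(2,3) by blast
      then have "int p dvd \<kappa> (V \<phi> \<chi>) (\<phi> y)" using central_iff[OF \<chi>(2)] \<kappa>_zero_iff[OF \<chi>(2)] y(1) by simp
      moreover have "int p dvd \<chi> * \<kappa> w y - (\<chi> * \<kappa> w (\<phi> y) + \<kappa> (V \<phi> \<chi>) (\<phi> y))" using \<chi>(4) by (simp add: cong_iff_dvd_diff)
      ultimately have "int p dvd \<kappa> (V \<phi> \<chi>) (\<phi> y) + (\<chi> * \<kappa> w y - (\<chi> * \<kappa> w (\<phi> y) + \<kappa> (V \<phi> \<chi>) (\<phi> y)))" by (rule dvd_add)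
      then have "int p dvd \<chi> * (\<kappa> w y - \<kappa> w (\<phi> y))" by (simp add: algebra_simps)
      then have "int p dvd \<kappa> w y - \<kappa> w (\<phi> y)" using \<chi>(1) p prime_dvd_mult_iff[of "int p"] by simp
      then show "[\<mu> (\<phi> y) = \<mu> y] (mod int p)" unfolding \<mu>_def by (simp add: cong_iff_dvd_diff dvd_diff_commute)
    qed
  qed
qed

end

section \<open>Quotients of order \<open>p\<close>\<close>

lemma (in group) subgroup_restrict:
  assumes "subgroup M G"
  shows "group (G\<lparr>carrier := M\<rparr>)"
    and "x \<in> M \<Longrightarrow> x [^]\<^bsub>G\<lparr>carrier := M\<rparr>\<^esub> (k::int) = x [^] k"
    and "x [^]\<^bsub>G\<lparr>carrier := M\<rparr>\<^esub> (i::nat) = x [^] i"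
    and "x \<in> M \<Longrightarrow> inv\<^bsub>G\<lparr>carrier := M\<rparr>\<^esub> x = inv x"
    and "x \<in> M \<Longrightarrow> cj (G\<lparr>carrier := M\<rparr>) x y = cj G x y"
    and "x \<in> M \<Longrightarrow> y \<in> M \<Longrightarrow> cmt (G\<lparr>carrier := M\<rparr>) x y = cmt G x y"
  using assms
  by (simp_all add: subgroup.subgroup_is_group is_group int_pow_consistent nat_pow_consistent[symmetric] m_inv_consistent cj_def cmt_def)

lemma (in group) sylow_sub_restrict:
  assumes fin: "finite (carrier G)" and P: "sylow_sub p G P" and M: "subgroup M G" "P \<subseteq> M"
  shows "sylow_sub p (G\<lparr>carrier := M\<rparr>) P"
proof -
  have sP: "subgroup P G" using P by (simp add: sylow_sub_def)
  have "card M div card P = card ((\<lambda>g. P #> g) ` M)"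
    using card_subgroup_dvd(2)[OF fin sP M] subgroup_card_pos[OF fin sP] by (metis div_mult_self_is_m)
  then have "\<not> p dvd order (G\<lparr>carrier := M\<rparr>) div card P" using sylow_sub_index[OF fin P M] by (simp add: order_def)
  then show ?thesis using P subgroup_incl[OF sP M] by (simp add: sylow_sub_def)
qed

lemma (in group) coprime_power_one:
  fixes p :: nat
  assumes p: "Factorial_Ring.prime p" and x: "x \<in> carrier G" "x [^] (p ^ a) = \<one>" and l: "\<not> int p dvd l" "x [^] (l::int) = \<one>"
  shows "x = \<one>"
proof -
  have "coprime (int p ^ a) l" using p l(1) by (simp add: prime_imp_coprime coprime_power_left_iff)
  then obtain u v where uv: "u * int p ^ a + v * l = 1"
    using bezout_int[of "int p ^ a" l] by (auto simp: coprime_iff_gcd_eq_1)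
  have xp: "x [^] (int p ^ a) = \<one>" using x(2) by (simp flip: int_pow_int)
  have "x = x [^] (int p ^ a * u + l * v)" using uv x(1) by (simp add: mult.commute)
  also have "\<dots> = (x [^] (int p ^ a)) [^] u \<otimes> (x [^] l) [^] v" using x(1) by (simp add: int_pow_mult int_pow_pow)
  finally show ?thesis using xp l(2) by simp
qed

locale metacyclic_sylow = group G for G (structure) +
  fixes p a :: nat and P n g
  assumes fin: "finite (carrier G)" and P: "sylow_sub p G P"
    and metacyclic: "metacyclic_p_group (G\<lparr>carrier := P\<rparr>) p a n g"
begin

sublocale MP: metacyclic_p_group "G\<lparr>carrier := P\<rparr>" p a n g
  by (rule metacyclic)

lemmas p = MP.p and odd = MP.odd

lemma P_sub: "subgroup P G" using P by (simp add: sylow_sub_def)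

lemma P_carrier [simp]: "x \<in> P \<Longrightarrow> x \<in> carrier G"
  by (rule subgroup.mem_carrier[OF P_sub])

lemmas P_closed [simp] = subgroup.m_closed[OF P_sub] subgroup.m_inv_closed[OF P_sub] subgroup.one_closed[OF P_sub]
  subgroup_int_pow_mem[OF P_sub] subgroup_nat_pow_closed[OF P_sub]

lemmas P_restrict = subgroup_restrict[OF P_sub]

definition c where "c = cmt G g n"

lemma gn [simp]: "g \<in> P" "n \<in> P" using MP.g MP.n by simp_all

lemma c_P [simp]: "c \<in> P" by (simp add: c_def cmt_def)

lemma MP_c: "MP.c = c" by (simp add: MP.c_def c_def P_restrict)

lemma c_pa: "c [^] (p ^ a) = \<one>" using MP.pow_card[of c] by (simp add: P_restrict)

lemma c_conj: "x \<in> P \<Longrightarrow> \<exists>s::int. cj G x c = c [^] s \<and> [s = 1] (mod int p)"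
  using MP.c_conj[of x] by (simp add: MP_c P_restrict)

lemma cmt_c: "x \<in> P \<Longrightarrow> y \<in> P \<Longrightarrow> \<exists>k::int. cmt G x y = c [^] k"
  using MP.cmt_in_C[of x y] by (auto simp: MP.C_def MP_c P_restrict)

lemma invariant:
  assumes h: "h \<in> carrier G" "\<And>x. x \<in> P \<Longrightarrow> cj G h x \<in> P"
  shows "\<exists>k::int. cj G h c = c [^] k"
  using cmt_c[OF h(2) h(2), of g n] h(1) by (simp add: c_def cj_cmt)

lemma c_power_pa: "(c [^] (i::nat)) [^] (p ^ a) = \<one>"
proof -
  have "(c [^] i) [^] (p ^ a) = (c [^] (p ^ a)) [^] i" by (simp add: nat_pow_pow mult.commute)
  then show ?thesis by (simp add: c_pa)
qed

text \<open>Modulo \<open>Y\<close> the element \<open>z\<close> is central of order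
  \<open>p\<close> in the Sylow subgroup, so weak closure applies in the quotient: whatever
  conjugates \<open>z\<close> into \<open>P\<close> normalises the subgroup generated by
  \<open>z\<close>. This yields the hypothesis \<open>fixed\<close> of the extension lemma for the
  normaliser \<open>N\<close>.\<close>

lemma step_up:
  fixes j :: nat
  defines "z \<equiv> c [^] (p ^ j)"
  defines "N \<equiv> {h \<in> carrier G. cj G h z \<in> range (\<lambda>k::int. z [^] k)}"
  assumes z1: "z \<noteq> \<one>" and Y: "range (\<lambda>k::int. (z [^] p) [^] k) \<lhd> G" (is "?Y \<lhd> G")
    and f: "mod_hom p G N f"
  shows "\<exists>V. mod_hom p G (carrier G) V \<and> (\<forall>x\<in>P. [V x = f x] (mod int p))"
proof -
  define Y where "Y = ?Y"
  have nY: "Y \<lhd> G" using Y by (simp add: Y_def)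
  have sY: "subgroup Y G" using nY by (rule normal_imp_subgroup)
  have zP: "z \<in> P" by (simp add: z_def)
  then have zc [simp]: "z \<in> carrier G" by simp
  have YP: "Y \<subseteq> P" using zP by (auto simp: Y_def)
  note Yc = subgroup.mem_carrier[OF sY]
  have z_conj: "\<exists>s::int. cj G x z = z [^] s \<and> [s = 1] (mod int p)" if xP: "x \<in> P" for x
  proof -
    obtain s :: int where s: "cj G x c = c [^] s" "[s = 1] (mod int p)" using c_conj[OF xP] by blast
    have "cj G x z = (c [^] s) [^] (p ^ j)" using xP by (simp add: z_def cj_nat_pow s(1))
    also have "\<dots> = z [^] s" by (simp add: z_def int_pow_pow mult.commute flip: int_pow_int)
    finally show ?thesis using s(2) by blast
  qed
  have zY: "z [^] p \<in> Y" unfolding Y_def by (rule range_eqI[of _ _ 1]) simp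
  have pow_Y: "z [^] (i::int) \<in> Y" if "int p dvd i" for i
  proof -
    obtain q where "i = int p * q" using \<open>int p dvd i\<close> by blast
    then have "z [^] i = (z [^] p) [^] q" by (simp add: int_pow_pow flip: int_pow_int)
    then show ?thesis by (simp add: Y_def)
  qed
  have z_notY: "z \<notin> Y"
  proof
    assume "z \<in> Y"
    then obtain k :: int where "z = (z [^] p) [^] k" by (auto simp: Y_def)
    then have "z = z [^] (int p * k)" by (simp add: int_pow_pow flip: int_pow_int)
    then have "z [^] (int p * k - 1) = \<one>" by (simp add: int_pow_diff)
    moreover have "\<not> int p dvd int p * k - 1"
      using prime_gt_1_nat[OF p] dvd_diff_right_iff[of "int p" "int p * k" 1] by simp
    ultimately show False
      using coprime_power_one[OF p zc, of a "int p * k - 1"] c_power_pa[of "p ^ j"] z1 by (simp add: z_def)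
  qed
  have sN: "subgroup N G"
  proof (rule finite_subgroupI[OF fin])
    have "cj G \<one> z \<in> range (\<lambda>k::int. z [^] k)" by (rule range_eqI[of _ _ 1]) simp
    then show "N \<noteq> {}" unfolding N_def by blast
    fix x y assume "x \<in> N" "y \<in> N"
    then obtain k l :: int where "x \<in> carrier G" "y \<in> carrier G" "cj G x z = z [^] k" "cj G y z = z [^] l"
      by (auto simp: N_def)
    then show "x \<otimes> y \<in> N" by (simp add: N_def cj_comp cj_int_pow int_pow_pow)
  qed (simp add: N_def)
  have PN: "P \<subseteq> N"
  proof
    fix x assume x: "x \<in> P"
    then obtain s :: int where "cj G x z = z [^] s" using z_conj by blast
    then show "x \<in> N" using x by (simp add: N_def)
  qed
  have Qgroup: "group (G Mod Y)" by (rule normal.factorgroup_is_group[OF nY])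
  interpret Q: group "G Mod Y" by (rule Qgroup)
  let ?q = "\<lambda>x. Y #> x"
  have q_hom: "?q \<in> hom G (G Mod Y)" by (rule normal.r_coset_hom_Mod[OF nY])
  interpret q: group_hom G "G Mod Y" ?q using q_hom Qgroup is_group by (simp add: group_hom_def group_hom_axioms_def)
  have q_eq: "?q x = ?q y \<longleftrightarrow> x \<otimes> inv y \<in> Y" if "x \<in> carrier G" "y \<in> carrier G" for x y
    using rcos_eq_iff[OF sY that] .
  have q_one: "?q x = \<one>\<^bsub>G Mod Y\<^esub> \<longleftrightarrow> x \<in> Y" if "x \<in> carrier G" for x
    using q_eq[OF that one_closed] that Yc subgroup.subset[OF sY] by simp
  have q_surj: "carrier (G Mod Y) = ?q ` carrier G" by (rule carrier_FactGroup)
  have q_cj: "cj (G Mod Y) (?q h) (?q x) = ?q (cj G h x)" if "h \<in> carrier G" "x \<in> carrier G" for h x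
    using that by (simp add: cj_def)
  let ?P = "?q ` P"
  have sylowQ: "sylow_sub p (G Mod Y) ?P"
  proof -
    have 1: "subgroup ?P (G Mod Y)" using q.subgroup_img_is_subgroup[OF P_sub] .
    have card_img: "card ((\<lambda>x. Y #> x) ` K) * card Y = card K" if "subgroup K G" "Y \<subseteq> K" for K
      by (rule card_subgroup_dvd(2)[OF fin sY that])
    have Ypos: "0 < card Y" by (rule subgroup_card_pos[OF fin sY])
    obtain b where b: "card P = p ^ b" using P by (auto simp: sylow_sub_def)
    have "card ?P dvd p ^ b" using card_img[OF P_sub YP] b by (metis dvd_triv_left)
    then have 2: "\<exists>b. card ?P = p ^ b" using divides_primepow_nat[OF p] by blast
    have 3: "order (G Mod Y) * card Y = order G"
      using card_img[OF subgroup_self subgroup.subset[OF sY]] q_surj by (simp add: order_def)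
    have "order G div card P = order (G Mod Y) div card ?P"
      using 3 card_img[OF P_sub YP] Ypos by (metis div_mult2_eq div_mult_self_is_m mult.commute)
    then show ?thesis using 1 2 P by (simp add: sylow_sub_def)
  qed
  have closure: "t \<in> N" if t: "t \<in> carrier G" "cj G t z \<in> P" for t
  proof -
    have "cj (G Mod Y) (?q t) (?q z) \<in> range (\<lambda>k::int. ?q z [^]\<^bsub>G Mod Y\<^esub> k)"
    proof (rule Q.weak_closure[OF _ p odd sylowQ])
      show "finite (carrier (G Mod Y))" using fin q_surj by simp
      show "?q z \<in> ?P" using zP by simp
      show "?q z \<noteq> \<one>\<^bsub>G Mod Y\<^esub>" using q_one[OF zc] z_notY by simp
      show "?q z [^]\<^bsub>G Mod Y\<^esub> p = \<one>\<^bsub>G Mod Y\<^esub>"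
        using q.hom_nat_pow[OF zc, of p] q_one[of "z [^] p"] zY by simp
      show "cj (G Mod Y) x (?q z) = ?q z" if xP: "x \<in> ?P" for x
      proof -
        obtain x' where x': "x' \<in> P" "x = ?q x'" using xP by blast
        obtain s :: int where s: "cj G x' z = z [^] s" "[s = 1] (mod int p)" using z_conj[OF x'(1)] by blast
        have "cj G x' z \<otimes> inv z = z [^] (s - 1)" by (simp add: s(1) int_pow_diff)
        then have "cj G x' z \<otimes> inv z \<in> Y" using pow_Y s(2) by (simp add: cong_iff_dvd_diff)
        then show ?thesis using x' q_cj[of x' z] q_eq[of "cj G x' z" z] by simp
      qed
      show "card {x \<in> ?P. x [^]\<^bsub>G Mod Y\<^esub> p = \<one>\<^bsub>G Mod Y\<^esub>} \<le> p\<^sup>2"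
      proof -
        have sPQ: "subgroup ?P (G Mod Y)" using sylowQ by (simp add: sylow_sub_def)
        have "?q \<in> hom (G\<lparr>carrier := P\<rparr>) ((G Mod Y)\<lparr>carrier := ?P\<rparr>)"
          using q_hom by (auto simp: hom_def)
        then obtain b where "metacyclic_p_group ((G Mod Y)\<lparr>carrier := ?P\<rparr>) p b (?q n) (?q g)"
          using MP.metacyclic_image[of ?q "(G Mod Y)\<lparr>carrier := ?P\<rparr>"] Q.subgroup_restrict(1)[OF sPQ] by auto
        then interpret MQ: metacyclic_p_group "(G Mod Y)\<lparr>carrier := ?P\<rparr>" p b "?q n" "?q g" .
        show ?thesis using MQ.card_exponent_p by (simp add: Q.subgroup_restrict[OF sPQ] del: one_FactGroup)
      qed
      show "?q t \<in> carrier (G Mod Y)" using t(1) by simp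
      show "cj (G Mod Y) (?q t) (?q z) \<in> ?P" using t q_cj[OF t(1) zc] by simp
      fix h assume h: "h \<in> carrier (G Mod Y)" "\<And>x. x \<in> ?P \<Longrightarrow> cj (G Mod Y) h x \<in> ?P"
      obtain h' where h': "h' \<in> carrier G" "h = ?q h'" using h(1) q_surj by blast
      have "cj G h' x \<in> P" if x: "x \<in> P" for x
      proof -
        have "?q (cj G h' x) \<in> ?P" using h(2)[of "?q x"] x h' q_cj[of h' x] by simp
        then obtain x' where x': "x' \<in> P" "?q (cj G h' x) = ?q x'" by blast
        then have "cj G h' x \<otimes> inv x' \<in> Y" using q_eq[of "cj G h' x" x'] h'(1) x by simp
        then have "cj G h' x \<otimes> inv x' \<in> P" using YP by blast
        then have "cj G h' x \<otimes> inv x' \<otimes> x' \<in> P" using x'(1) by simp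
        then show ?thesis using h'(1) x x'(1) by (simp add: m_assoc)
      qed
      then obtain k :: int where k: "cj G h' c = c [^] k" using invariant[OF h'(1)] by blast
      have "cj G h' z = (c [^] k) [^] (p ^ j)" using h'(1) by (simp add: z_def cj_nat_pow k)
      also have "\<dots> = z [^] k" by (simp add: z_def int_pow_pow mult.commute flip: int_pow_int)
      finally have "cj (G Mod Y) h (?q z) = ?q z [^]\<^bsub>G Mod Y\<^esub> k" using h' q_cj[of h' z] by (simp add: q.hom_int_pow)
      then show "cj (G Mod Y) h (?q z) \<in> range (\<lambda>k::int. ?q z [^]\<^bsub>G Mod Y\<^esub> k)" by blast
    qed
    then obtain k :: int where "?q (cj G t z) = ?q (z [^] k)" using q_cj[OF t(1) zc] by (auto simp: q.hom_int_pow)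
    then have "cj G t z \<otimes> inv (z [^] k) \<in> Y" using q_eq[of "cj G t z" "z [^] k"] t(1) by simp
    then obtain l :: int where l: "cj G t z \<otimes> inv (z [^] k) = (z [^] p) [^] l" by (auto simp: Y_def)
    have "cj G t z = cj G t z \<otimes> inv (z [^] k) \<otimes> z [^] k" using t(1) by (simp add: m_assoc)
    also have "\<dots> = z [^] (int p * l + k)" by (simp add: l int_pow_pow int_pow_mult flip: int_pow_int)
    finally show ?thesis using t(1) by (simp add: N_def)
  qed
  show ?thesis
  proof (rule mod_hom_extension[OF fin p sN f P_sub PN nY])
    show "Y \<subseteq> N" using YP PN by blast
    show "[f y = 0] (mod int p)" if y: "y \<in> Y" for y
    proof -
      have fP: "mod_hom p G P f" using f PN unfolding mod_hom_def by blast
      obtain k :: int where "y = (z [^] p) [^] k" using y by (auto simp: Y_def)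
      then have "y = c [^] (int (p ^ j * p) * k)" by (simp add: z_def nat_pow_pow int_pow_pow flip: int_pow_int)
      then have 1: "[f y = int (p ^ j * p) * k * f c] (mod int p)" using mod_hom_int_pow[OF P_sub fP c_P] by simp
      have "[f c = 0] (mod int p)" unfolding c_def by (rule mod_hom_cmt[OF P_sub fP]) simp_all
      then have "[int (p ^ j * p) * k * f c = int (p ^ j * p) * k * 0] (mod int p)" by (rule cong_mult[OF cong_refl])
      then show ?thesis using cong_trans[OF 1] by simp
    qed
    show "z \<in> P" "z [^] p \<in> Y" by (rule zP, rule zY)
    show "\<exists>y\<in>Y. z \<otimes> x = x \<otimes> z \<otimes> y" if x: "x \<in> P" for x
    proof -
      obtain s :: int where s: "cj G (inv x) z = z [^] s" "[s = 1] (mod int p)" using z_conj[of "inv x"] x by auto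
      have "z \<otimes> x = x \<otimes> cj G (inv x) z" using x by (simp add: cj_def m_assoc)
      also have "\<dots> = x \<otimes> z [^] s" by (simp only: s(1))
      also have "z [^] s = z \<otimes> z [^] (s - 1)" using int_pow_mult[OF zc, of 1 "s - 1"] by simp
      finally have "z \<otimes> x = x \<otimes> z \<otimes> z [^] (s - 1)" using x by (simp add: m_assoc)
      moreover have "z [^] (s - 1) \<in> Y" using pow_Y s(2) by (simp add: cong_iff_dvd_diff)
      ultimately show ?thesis by blast
    qed
    \<comment> \<open>The conjugate of \<open>z\<close> is only known to lie in \<open>N\<close>. A
      further conjugation inside \<open>N\<close> brings it into \<open>P\<close>, and
      \<open>closure\<close> applies to the product of the two elements.\<close>
    show "t \<in> N" if t: "t \<in> carrier G" "t \<otimes> z \<otimes> inv t \<in> N" for t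
    proof -
      define w where "w = cj G t z"
      have w: "w \<in> N" "w \<in> carrier G" using t by (simp_all add: w_def cj_def)
      have "subgroup (range (\<lambda>k::int. w [^] k)) G" using w(2) by (rule subgroup_of_powers)
      moreover have "range (\<lambda>k::int. w [^] k) \<subseteq> N" using subgroup_int_pow_mem[OF sN w(1)] by auto
      moreover obtain b where "card (range (\<lambda>k::int. w [^] k)) = p ^ b"
      proof -
        have "w [^] (p ^ a) = \<one>" using c_power_pa[of "p ^ j"] cj_nat_pow[OF t(1) zc, of "p ^ a"] t(1) by (simp add: w_def z_def)
        then have "ord w dvd p ^ a" using w(2) by (simp add: pow_eq_id)
        then obtain b where "ord w = p ^ b" using divides_primepow_nat[OF p] by blast
        moreover have "range (\<lambda>k::int. w [^] k) = generate G {w}" using generate_pow[OF w(2)] by auto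
        ultimately show ?thesis using generate_pow_card[OF w(2)] that by simp
      qed
      ultimately obtain h where h: "h \<in> N" "\<forall>q\<in>range (\<lambda>k::int. w [^] k). h \<otimes> q \<otimes> inv h \<in> P"
        using sylow_conj[OF fin p P sN PN] by blast
      have hc: "h \<in> carrier G" using h(1) by (simp add: N_def)
      have "w \<in> range (\<lambda>k::int. w [^] k)" by (rule range_eqI[of _ _ 1]) (simp add: w(2))
      from bspec[OF h(2) this] have "cj G h w \<in> P" by (simp add: cj_def)
      then have "cj G (h \<otimes> t) z \<in> P" using hc t(1) by (simp add: cj_comp w_def)
      then have "h \<otimes> t \<in> N" using closure[of "h \<otimes> t"] hc t(1) by simp
      then have "inv h \<otimes> (h \<otimes> t) \<in> N" using h(1) by (simp add: subgroup.m_closed[OF sN] subgroup.m_inv_closed[OF sN])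
      then show ?thesis using hc t(1) by simp
    qed
  qed
qed

end

lemma (in group_hom) hom_cmt:
  "x \<in> carrier G \<Longrightarrow> y \<in> carrier G \<Longrightarrow> h (cmt G x y) = cmt H (h x) (h y)"
  by (simp add: cmt_def)

context metacyclic_sylow
begin

text \<open>When the derived subgroup of \<open>P\<close> is normal in the whole group, the
  normaliser of \<open>P\<close> realises all fusion in \<open>P\<close> up to factors from the
  derived subgroup. Functionals vanish on these factors, so a functional value invariant under the
  normaliser is detected by the transfer. Such a value is found in \<open>P\<close> modulo the
  \<open>p\<close>-th powers of the derived subgroup, where the commutator form is
  available.\<close>

lemma base_case:
  assumes c1: "c \<noteq> \<one>" and nC: "range (\<lambda>k::int. c [^] k) \<lhd> G" (is "?C \<lhd> G")
  shows "\<exists>V y. mod_hom p G (carrier G) V \<and> y \<in> P \<and> \<not> int p dvd V y"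
proof -
  have cc [simp]: "c \<in> carrier G" by simp
  have sC: "subgroup ?C G" using nC by (rule normal_imp_subgroup)
  define Y where "Y = range (\<lambda>k::int. (c [^] p) [^] k)"
  have sY: "subgroup Y G" unfolding Y_def by (rule subgroup_of_powers) simp
  have YP: "Y \<subseteq> P" by (auto simp: Y_def)
  have c_cj: "\<exists>s::int. cj G h c = c [^] s" if "h \<in> carrier G" for h
  proof -
    have "c \<in> ?C" by (rule range_eqI[of _ _ 1]) simp
    from normal_conj[OF nC that this] show ?thesis by (auto simp: cj_def)
  qed
  have Y_cj: "cj G h y \<in> Y" if h: "h \<in> carrier G" and y: "y \<in> Y" for h y
  proof -
    obtain s :: int where s: "cj G h c = c [^] s" using c_cj[OF h] by blast
    obtain k :: int where "y = (c [^] p) [^] k" using y by (auto simp: Y_def)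
    then have "cj G h y = ((c [^] s) [^] p) [^] k" using h by (simp add: cj_int_pow cj_nat_pow s)
    also have "\<dots> = (c [^] p) [^] (s * k)" by (simp add: int_pow_pow mult_ac flip: int_pow_int)
    finally show ?thesis by (simp add: Y_def)
  qed
  have c_notY: "c \<notin> Y"
  proof
    assume "c \<in> Y"
    then obtain k :: int where "c = (c [^] p) [^] k" by (auto simp: Y_def)
    then have "c = c [^] (int p * k)" by (simp add: int_pow_pow flip: int_pow_int)
    then have "c [^] (int p * k - 1) = \<one>" by (simp add: int_pow_diff)
    moreover have "\<not> int p dvd int p * k - 1"
      using prime_gt_1_nat[OF p] dvd_diff_right_iff[of "int p" "int p * k" 1] by simp
    ultimately show False using coprime_power_one[OF p cc, of a "int p * k - 1"] c_pa c1 by simp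
  qed
  let ?GP = "G\<lparr>carrier := P\<rparr>"
  have sYP: "subgroup Y ?GP" by (rule subgroup_incl[OF sY P_sub YP])
  have nYP: "Y \<lhd> ?GP"
    using sYP Y_cj by (auto simp: MP.normal_inv_iff P_restrict cj_def)
  define K where "K = ?GP Mod Y"
  let ?q = "\<lambda>x. Y #> x"
  have gK: "group K" unfolding K_def by (rule normal.factorgroup_is_group[OF nYP])
  have q_hom: "?q \<in> hom ?GP K" using normal.r_coset_hom_Mod[OF nYP] by (simp add: K_def)
  have q_surj: "carrier K = ?q ` P" by (simp add: K_def carrier_FactGroup)
  interpret q: group_hom ?GP K ?q using q_hom gK MP.is_group by (simp add: group_hom_def group_hom_axioms_def)
  obtain b where "metacyclic_p_group K p b (?q n) (?q g)"
    using MP.metacyclic_image[OF q_hom gK] q_surj by auto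
  then interpret K: metacyclic_p_group K p b "?q n" "?q g" .
  have q_one: "?q x = \<one>\<^bsub>K\<^esub> \<longleftrightarrow> x \<in> Y" if "x \<in> P" for x
    using rcos_eq_iff[OF sY, of x \<one>] that subgroup.subset[OF sY] by (simp add: K_def)
  have Kc: "K.c = ?q c"
  proof -
    have "?q (cmt ?GP g n) = cmt K (?q g) (?q n)" by (rule q.hom_cmt) simp_all
    then show ?thesis by (simp add: K.c_def c_def P_restrict)
  qed
  have "metacyclic_class_two K p b (?q n) (?q g)"
  proof (intro metacyclic_class_two.intro K.metacyclic_p_group_axioms metacyclic_class_two_axioms.intro)
    show "K.c \<noteq> \<one>\<^bsub>K\<^esub>" using Kc q_one[OF c_P] c_notY by simp
    have "c [^] p \<in> Y" unfolding Y_def by (rule range_eqI[of _ _ 1]) simp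
    then show "K.c [^]\<^bsub>K\<^esub> p = \<one>\<^bsub>K\<^esub>"
      using q.hom_nat_pow[of c p] q_one[of "c [^] p"] by (simp add: Kc P_restrict)
  qed
  then interpret K: metacyclic_class_two K p b "?q n" "?q g" .
  obtain y' \<mu>' where y': "y' \<in> carrier K" "mod_hom p K (carrier K) \<mu>'" "\<not> int p dvd \<mu>' y'"
    "\<And>\<phi>. \<phi> \<in> hom K K \<Longrightarrow> \<phi> K.c \<noteq> \<one>\<^bsub>K\<^esub> \<Longrightarrow> [\<mu>' (\<phi> y') = \<mu>' y'] (mod int p)"
    using K.invariant_functional by blast
  obtain y where y: "y \<in> P" "y' = ?q y" using y'(1) q_surj by blast
  define \<mu> where "\<mu> x = \<mu>' (?q x)" for x
  have \<mu>: "mod_hom p G P \<mu>"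
    unfolding mod_hom_def \<mu>_def
  proof (intro ballI)
    fix x z assume xz: "x \<in> P" "z \<in> P"
    have "?q (x \<otimes> z) = ?q x \<otimes>\<^bsub>K\<^esub> ?q z" using q.hom_mult[of x z] xz by simp
    then show "[\<mu>' (?q (x \<otimes> z)) = \<mu>' (?q x) + \<mu>' (?q z)] (mod int p)"
      using mod_homD[OF y'(2), of "?q x" "?q z"] xz q_surj by simp
  qed
  have \<mu>_inv: "[\<mu> (cj G h y) = \<mu> y] (mod int p)" if h: "h \<in> carrier G" "\<And>x. x \<in> P \<Longrightarrow> cj G h x \<in> P" for h
  proof -
    \<comment> \<open>Conjugation by \<open>h\<close> on \<open>P\<close> modulo \<open>Y\<close>,
      computed with arbitrary representatives; this is legitimate because conjugation preserves
      \<open>Y\<close>.\<close>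
    define \<phi> where "\<phi> X = ?q (cj G h (SOME x. x \<in> X))" for X
    have \<phi>q: "\<phi> (?q x) = ?q (cj G h x)" if x: "x \<in> P" for x
    proof -
      have "(SOME w. w \<in> ?q x) \<in> ?q x" by (rule someI[of _ x]) (rule rcos_self[OF P_carrier[OF x] sY])
      then obtain w where w: "w \<in> Y" "(SOME w. w \<in> ?q x) = w \<otimes> x" by (auto simp: r_coset_def)
      have wc: "w \<in> carrier G" using w(1) YP by auto
      have "cj G h (w \<otimes> x) \<otimes> inv (cj G h x) = cj G h w" using h(1) x wc by (simp add: cj_mult m_assoc)
      then have "?q (cj G h (w \<otimes> x)) = ?q (cj G h x)"
        using rcos_eq_iff[OF sY, of "cj G h (w \<otimes> x)" "cj G h x"] Y_cj[OF h(1) w(1)] h(1) x wc by simp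
      then show ?thesis by (simp add: \<phi>_def w(2))
    qed
    have "\<phi> \<in> hom K K"
    proof (rule homI)
      fix X assume "X \<in> carrier K"
      then obtain x where "x \<in> P" "X = ?q x" using q_surj by blast
      then show "\<phi> X \<in> carrier K" using \<phi>q h(2) q_surj by simp
      fix Z assume "Z \<in> carrier K"
      then obtain z where z: "z \<in> P" "Z = ?q z" using q_surj by blast
      have "X \<otimes>\<^bsub>K\<^esub> Z = ?q (x \<otimes> z)" using q.hom_mult[of x z] \<open>x \<in> P\<close> \<open>X = ?q x\<close> z by simp
      moreover have "?q (cj G h x \<otimes> cj G h z) = ?q (cj G h x) \<otimes>\<^bsub>K\<^esub> ?q (cj G h z)"
        using q.hom_mult[of "cj G h x" "cj G h z"] \<open>x \<in> P\<close> z h(2) by simp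
      ultimately show "\<phi> (X \<otimes>\<^bsub>K\<^esub> Z) = \<phi> X \<otimes>\<^bsub>K\<^esub> \<phi> Z"
        using \<open>x \<in> P\<close> \<open>X = ?q x\<close> z h(1) by (simp add: \<phi>q cj_mult)
    qed
    moreover have "\<phi> K.c \<noteq> \<one>\<^bsub>K\<^esub>"
    proof
      assume "\<phi> K.c = \<one>\<^bsub>K\<^esub>"
      then have "cj G h c \<in> Y" using \<phi>q[OF c_P] q_one[OF h(2)[OF c_P]] Kc by simp
      from Y_cj[OF inv_closed[OF h(1)] this] have "cj G (inv h) (cj G h c) \<in> Y" .
      then show False using c_notY h(1) by simp
    qed
    ultimately have "[\<mu>' (\<phi> y') = \<mu>' y'] (mod int p)" by (rule y'(4))
    then show ?thesis using \<phi>q[OF y(1)] y(2) by (simp add: \<mu>_def)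
  qed
  define \<tau> where "\<tau> X = (SOME x. x \<in> X)" for X :: "'a set"
  have \<tau>: "\<tau> X \<in> X" if X: "X \<in> rcosets P" for X
  proof -
    obtain x where x: "x \<in> carrier G" "X = P #> x" using X by (auto simp: RCOSETS_def)
    show ?thesis unfolding \<tau>_def x(2) by (rule someI[of _ x]) (rule rcos_self[OF x(1) P_sub])
  qed
  interpret T: transfer_setup G P \<tau>
    by (intro transfer_setup.intro transfer_setup_axioms.intro is_group fin P_sub \<tau>)
  obtain d where d: "card P = p ^ d" using P by (auto simp: sylow_sub_def)
  have "[transfer_map G P \<tau> \<mu> y = int (card (rcosets P)) * \<mu> y] (mod int p)"
  proof (rule T.transfer_eval[OF \<mu> P_carrier[OF y(1)]])
    fix t and m :: nat assume t: "t \<in> carrier G" "t \<otimes> y [^] m \<otimes> inv t \<in> P"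
    define w where "w = cj G t (y [^] m)"
    have wP: "w \<in> P" using t by (simp add: w_def cj_def)
    \<comment> \<open>The centraliser of \<open>w\<close> modulo the derived subgroup of
      \<open>P\<close>. It contains both \<open>P\<close> and the conjugate of \<open>P\<close> by
      \<open>t\<close>, so an element \<open>k\<close> of it makes \<open>k \<otimes> t\<close>
      normalise \<open>P\<close>, at the cost of a power of \<open>c\<close>.\<close>
    define C' where "C' = {h \<in> carrier G. cj G h w \<otimes> inv w \<in> ?C}"
    have C'_iff: "h \<in> C' \<longleftrightarrow> (\<exists>k::int. cj G h w = c [^] k \<otimes> w)" if "h \<in> carrier G" for h
    proof
      assume "h \<in> C'"
      then obtain k :: int where "cj G h w \<otimes> inv w = c [^] k" by (auto simp: C'_def)
      then have "cj G h w = c [^] k \<otimes> w" using that wP by (metis P_carrier cc cj_closed int_pow_closed inv_solve_right')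
      then show "\<exists>k::int. cj G h w = c [^] k \<otimes> w" by blast
    next
      assume "\<exists>k::int. cj G h w = c [^] k \<otimes> w"
      then show "h \<in> C'" using that wP by (auto simp: C'_def m_assoc)
    qed
    have sC': "subgroup C' G"
    proof (rule finite_subgroupI[OF fin])
      have "\<one> \<in> C'" using C'_iff[OF one_closed] wP by (auto intro!: exI[of _ "0::int"])
      then show "C' \<noteq> {}" by blast
      show "C' \<subseteq> carrier G" by (auto simp: C'_def)
      fix x z assume xz: "x \<in> C'" "z \<in> C'"
      then have xzc: "x \<in> carrier G" "z \<in> carrier G" by (auto simp: C'_def)
      obtain k l :: int where kl: "cj G x w = c [^] k \<otimes> w" "cj G z w = c [^] l \<otimes> w" using xz C'_iff xzc by blast
      obtain s :: int where s: "cj G x c = c [^] s" using c_cj[OF xzc(1)] by blast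
      have "cj G (x \<otimes> z) w = c [^] (s * l + k) \<otimes> w"
        using xzc wP kl s by (simp add: cj_comp cj_mult cj_int_pow int_pow_pow int_pow_mult m_assoc)
      then show "x \<otimes> z \<in> C'" using C'_iff xzc by blast
    qed
    have PC': "P \<subseteq> C'"
    proof
      fix x assume x: "x \<in> P"
      obtain k :: int where "cmt G x w = c [^] k" using cmt_c[OF x wP] by blast
      then show "x \<in> C'" using x wP by (simp add: C'_def cmt_eq_cj)
    qed
    have sub: "(\<lambda>x. t \<otimes> x \<otimes> inv t) ` P \<subseteq> C'"
    proof
      fix u assume "u \<in> (\<lambda>x. t \<otimes> x \<otimes> inv t) ` P"
      then obtain x where x: "x \<in> P" "u = cj G t x" by (auto simp: cj_def)
      obtain k :: int where "cmt G x (y [^] m) = c [^] k" using cmt_c[OF x(1), of "y [^] m"] y(1) by auto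
      then have k: "cj G x (y [^] m) = c [^] k \<otimes> y [^] m" using x(1) y(1) by (simp add: cmt_eq_cj) (metis P_carrier cc cj_closed int_pow_closed inv_solve_right' nat_pow_closed)
      obtain s :: int where s: "cj G t c = c [^] s" using c_cj[OF t(1)] by blast
      have "cj G u w = cj G t (cj G x (y [^] m))"
        using t(1) x y(1) by (simp add: w_def cj_def m_assoc inv_mult_group)
      also have "\<dots> = c [^] (s * k) \<otimes> w" using t(1) y(1) by (simp add: k cj_mult cj_int_pow s int_pow_pow w_def)
      finally show "u \<in> C'" using C'_iff x t(1) by auto
    qed
    obtain k where k: "k \<in> C'" "\<And>x. x \<in> P \<Longrightarrow> k \<otimes> (t \<otimes> x \<otimes> inv t) \<otimes> inv k \<in> P"
      using sylow_conj[OF fin p P sC' PC' conj_subgroup[OF P_sub t(1)] sub card_conj[OF P_sub t(1), unfolded d]] by blast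
    have kc: "k \<in> carrier G" using k(1) by (simp add: C'_def)
    define h where "h = k \<otimes> t"
    have h: "h \<in> carrier G" "\<And>x. x \<in> P \<Longrightarrow> cj G h x \<in> P"
      using k(2) kc t(1) by (simp_all add: h_def cj_def m_assoc inv_mult_group)
    obtain l :: int where l: "cj G k w = c [^] l \<otimes> w" using C'_iff[OF kc] k(1) by blast
    have "cj G h y [^] m = c [^] l \<otimes> w" using kc t(1) y(1) l by (simp add: h_def cj_comp w_def cj_nat_pow)
    moreover have "[\<mu> (cj G h y [^] m) = int m * \<mu> (cj G h y)] (mod int p)" by (rule mod_hom_pow[OF P_sub \<mu> h(2)[OF y(1)]])
    moreover have "[int m * \<mu> (cj G h y) = int m * \<mu> y] (mod int p)" by (rule cong_mult[OF cong_refl \<mu>_inv[OF h]])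
    ultimately have 1: "[\<mu> (c [^] l \<otimes> w) = int m * \<mu> y] (mod int p)" using cong_trans by simp
    have 2: "[\<mu> (c [^] l \<otimes> w) = \<mu> (c [^] l) + \<mu> w] (mod int p)" by (rule mod_homD[OF \<mu>]) (simp_all add: wP)
    have "[\<mu> c = 0] (mod int p)" unfolding c_def by (rule mod_hom_cmt[OF P_sub \<mu>]) simp_all
    then have "[l * \<mu> c = l * 0] (mod int p)" by (rule cong_mult[OF cong_refl])
    with mod_hom_int_pow[OF P_sub \<mu> c_P, of l] have "[\<mu> (c [^] l) = l * 0] (mod int p)" by (rule cong_trans)
    then have "[\<mu> (c [^] l) + \<mu> w = l * 0 + \<mu> w] (mod int p)" by (rule cong_add[OF _ cong_refl])
    from cong_trans[OF 2 this] have "[\<mu> (c [^] l \<otimes> w) = \<mu> w] (mod int p)" by simp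
    from cong_trans[OF cong_sym[OF this] 1] show "[\<mu> (t \<otimes> y [^] m \<otimes> inv t) = int m * \<mu> y] (mod int p)"
      by (simp add: w_def cj_def)
  qed
  moreover have "\<not> int p dvd int (card (rcosets P)) * \<mu> y"
  proof -
    have "\<not> p dvd card (rcosets P)"
      using P lagrange[OF P_sub] subgroup_card_pos[OF fin P_sub] by (simp add: sylow_sub_def) (metis div_mult_self_is_m)
    moreover have "\<not> int p dvd \<mu> y" using y'(3) y(2) by (simp add: \<mu>_def)
    ultimately show ?thesis using p by (simp add: prime_dvd_mult_iff)
  qed
  ultimately have "\<not> int p dvd transfer_map G P \<tau> \<mu> y" using cong_dvd_iff by blast
  then show ?thesis using T.transfer_mod_hom[OF \<mu>] y(1) by blast
qed

lemma metacyclic_sylow_restrict: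
  assumes M: "subgroup M G" "P \<subseteq> M" shows "metacyclic_sylow (G\<lparr>carrier := M\<rparr>) p a P n g"
  using subgroup_restrict(1)[OF M(1)] sylow_sub_restrict[OF fin P M] metacyclic subgroup_finite[OF fin M(1)]
  by (simp add: metacyclic_sylow_def metacyclic_sylow_axioms_def)

lemma restrict_c:
  assumes M: "subgroup M G" "P \<subseteq> M" shows "metacyclic_sylow.c (G\<lparr>carrier := M\<rparr>) n g = c"
  using gn M subgroup_restrict(6)[OF M(1), of g n] by (simp add: metacyclic_sylow.c_def[OF metacyclic_sylow_restrict[OF M]] c_def subset_iff)

text \<open>Climbing from the normaliser of \<open>P'\<close> through the normalisers of the subgroups \<open>\<langle>c [^] p ^ j\<rangle>\<close>
  of the cyclic group \<open>P'\<close> up to the whole group.\<close>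

theorem p_quotient:
  assumes c1: "c \<noteq> \<one>"
  shows "\<exists>V y. mod_hom p G (carrier G) V \<and> y \<in> P \<and> \<not> int p dvd V y"
proof -
  define z where "z j = c [^] (p ^ j)" for j :: nat
  define M where "M j = {h \<in> carrier G. cj G h (z j) \<in> range (\<lambda>k::int. z j [^] k)}" for j
  have zc [simp]: "z j \<in> P" for j by (simp add: z_def)
  have z_Suc: "z (Suc j) = z j [^] p" for j by (simp add: z_def nat_pow_pow mult.commute)
  have sM: "subgroup (M j) G" for j
  proof (rule finite_subgroupI[OF fin])
    have "cj G \<one> (z j) \<in> range (\<lambda>k::int. z j [^] k)" by (rule range_eqI[of _ _ 1]) simp
    then show "M j \<noteq> {}" unfolding M_def by blast
    fix x y assume "x \<in> M j" "y \<in> M j"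
    then obtain k l :: int where "x \<in> carrier G" "y \<in> carrier G" "cj G x (z j) = z j [^] k" "cj G y (z j) = z j [^] l"
      by (auto simp: M_def)
    then show "x \<otimes> y \<in> M j" by (simp add: M_def cj_comp cj_int_pow int_pow_pow)
  qed (auto simp: M_def)
  have PM: "P \<subseteq> M j" for j
  proof
    fix x assume x: "x \<in> P"
    obtain s :: int where s: "cj G x c = c [^] s" using c_conj[OF x] by blast
    have "cj G x (z j) = (c [^] s) [^] (p ^ j)" using x by (simp add: z_def cj_nat_pow s)
    also have "\<dots> = z j [^] s" by (simp add: z_def int_pow_pow mult.commute flip: int_pow_int)
    finally show "x \<in> M j" using x by (simp add: M_def)
  qed
  have normal: "range (\<lambda>k::int. z j [^] k) \<lhd> G\<lparr>carrier := M j\<rparr>" for j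
  proof -
    interpret R: group "G\<lparr>carrier := M j\<rparr>" by (rule subgroup_restrict(1)[OF sM])
    have "range (\<lambda>k::int. z j [^] k) \<subseteq> M j" using PM zc by (auto intro!: subsetD[OF PM])
    then have "subgroup (range (\<lambda>k::int. z j [^] k)) (G\<lparr>carrier := M j\<rparr>)"
      by (intro subgroup_incl[OF subgroup_of_powers sM]) simp
    moreover have "x \<otimes> y \<otimes> inv x \<in> range (\<lambda>k::int. z j [^] k)" if x: "x \<in> M j" and y: "y \<in> range (\<lambda>k::int. z j [^] k)" for x y
    proof -
      obtain k :: int where k: "y = z j [^] k" using y by blast
      obtain s :: int where s: "x \<in> carrier G" "cj G x (z j) = z j [^] s" using x by (auto simp: M_def)
      have "cj G x y = z j [^] (s * k)" using s by (simp add: k cj_int_pow int_pow_pow)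
      then show ?thesis by (simp add: cj_def)
    qed
    ultimately show ?thesis by (simp add: R.normal_inv_iff subgroup_restrict[OF sM])
  qed
  have M_mono: "M j \<subseteq> M (Suc j)" for j
  proof
    fix x assume "x \<in> M j"
    then obtain s :: int where s: "x \<in> carrier G" "cj G x (z j) = z j [^] s" by (auto simp: M_def)
    have "cj G x (z (Suc j)) = (z j [^] s) [^] p" using s by (simp add: z_Suc cj_nat_pow)
    also have "\<dots> = z (Suc j) [^] s" by (simp add: z_Suc int_pow_pow mult.commute flip: int_pow_int)
    finally show "x \<in> M (Suc j)" using s(1) by (simp add: M_def)
  qed
  have mod_hom_restrict: "mod_hom p (G\<lparr>carrier := N\<rparr>) A f \<longleftrightarrow> mod_hom p G A f" for N A f by (simp add: mod_hom_def)
  have main: "\<exists>V y. mod_hom p G (M j) V \<and> y \<in> P \<and> \<not> int p dvd V y" for j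
  proof (induction j)
    case 0
    interpret R: metacyclic_sylow "G\<lparr>carrier := M 0\<rparr>" p a P n g by (rule metacyclic_sylow_restrict[OF sM PM])
    have z0: "z 0 = c" by (simp add: z_def)
    have "range (\<lambda>k::int. R.c [^]\<^bsub>G\<lparr>carrier := M 0\<rparr>\<^esub> k) \<lhd> G\<lparr>carrier := M 0\<rparr>"
      using normal[of 0] subgroup_restrict(2)[OF sM[of 0], of c] PM[of 0] by (simp add: restrict_c[OF sM PM] z0 subset_iff)
    then show ?case using R.base_case c1 by (simp add: restrict_c[OF sM PM] mod_hom_restrict)
  next
    case (Suc j)
    then obtain V y where V: "mod_hom p G (M j) V" "y \<in> P" "\<not> int p dvd V y" by blast
    show ?case
    proof (cases "z j = \<one>")
      case True
      \<comment> \<open>Weak closure needs a nontrivial \<open>z j\<close>; once the power of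
        \<open>c\<close> is trivial, the chain of normalisers has reached the whole group.\<close>
      have "M i = carrier G" if "z i = \<one>" for i
        using that by (auto simp: M_def)
      then have "M j = carrier G" "M (Suc j) = carrier G" using True z_Suc[of j] by simp_all
      then show ?thesis using V by auto
    next
      case False
      let ?G = "G\<lparr>carrier := M (Suc j)\<rparr>"
      interpret R: metacyclic_sylow ?G p a P n g by (rule metacyclic_sylow_restrict[OF sM PM])
      note Rc = restrict_c[OF sM PM, of "Suc j"]
      have zM: "z i \<in> M (Suc j)" for i using PM zc by blast
      have pow_eq: "R.c [^]\<^bsub>?G\<^esub> (p ^ j) = z j" by (simp add: Rc z_def subgroup_restrict(3)[OF sM])
      have N_eq: "{h \<in> carrier ?G. cj ?G h (z j) \<in> range (\<lambda>k::int. z j [^]\<^bsub>?G\<^esub> k)} = M j"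
        using M_mono[of j] subgroup_restrict(2)[OF sM zM, of j] subgroup_restrict(5)[OF sM, of _ "Suc j" "z j"]
        by (auto simp: M_def)
      have pz: "z j [^]\<^bsub>?G\<^esub> p = z (Suc j)" by (simp add: z_Suc subgroup_restrict(3)[OF sM])
      have Y: "range (\<lambda>k::int. (z j [^]\<^bsub>?G\<^esub> p) [^]\<^bsub>?G\<^esub> k) \<lhd> ?G"
        unfolding pz using normal[of "Suc j"] subgroup_restrict(2)[OF sM zM] by simp
      have "\<exists>W. mod_hom p ?G (carrier ?G) W \<and> (\<forall>x\<in>P. [W x = V x] (mod int p))"
        using R.step_up[of j V, unfolded pow_eq N_eq mod_hom_restrict] False Y V(1) by (simp add: mod_hom_restrict)
      then obtain W where W: "mod_hom p G (M (Suc j)) W" "[W y = V y] (mod int p)"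
        using V(2) by (auto simp: mod_hom_restrict)
      then have "\<not> int p dvd W y" using V(3) cong_dvd_iff by blast
      then show ?thesis using W(1) V(2) by blast
    qed
  qed
  have "M a = carrier G" using c_pa by (auto simp: M_def z_def)
  then show ?thesis using main[of a] by simp
qed

end

section \<open>Metacyclic 3-groups with a rotation\<close>

lemma (in group_hom) card_kernel_image:
  assumes fin: "finite (carrier G)"
  shows "card (kernel G H h) * card (h ` carrier G) = order G"
proof -
  have "card (rcosets (kernel G H h)) = card (h ` carrier G)"
  proof -
    let ?I = "H\<lparr>carrier := h ` carrier G\<rparr>"
    have sI: "subgroup (h ` carrier G) H" by (rule img_is_subgroup)
    interpret I: group ?I by (rule subgroup.subgroup_is_group[OF sI H.is_group])
    have "h \<in> hom G ?I" using homh by (auto simp: hom_def)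
    then interpret hI: group_hom G ?I h using I.is_group G.is_group by (simp add: group_hom_def group_hom_axioms_def)
    have k: "kernel G ?I h = kernel G H h" by (simp add: kernel_def)
    have "(\<lambda>X. the_elem (h ` X)) \<in> iso (G Mod kernel G ?I h) ?I" by (rule hI.FactGroup_iso_set) simp
    from iso_same_card[OF is_isoI[OF this]] show ?thesis by (simp add: FactGroup_def k)
  qed
  then show ?thesis using G.lagrange[OF subgroup_kernel] by (simp add: mult.commute)
qed

text \<open>The images under \<open>\<alpha>\<close> are forced by the cyclic shift of
  \<open>s0\<close>, \<open>s1\<close>, \<open>s2\<close> when
  \<open>a = s0\<^sup>-\<^sup>1 s1\<close> and \<open>b = s0\<^sup>-\<^sup>1 s2\<close>. The locale
  is separate because it is applied to a quotient of \<open>H\<close> before \<open>H\<close> itself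
  is known to satisfy it.\<close>

locale heis3 = group G for G (structure) +
  fixes a b \<alpha>
  assumes fin: "finite (carrier G)" and a [simp]: "a \<in> carrier G" and b [simp]: "b \<in> carrier G"
    and gen: "\<And>K. subgroup K G \<Longrightarrow> a \<in> K \<Longrightarrow> b \<in> K \<Longrightarrow> carrier G \<subseteq> K"
    and \<alpha>_hom: "\<alpha> \<in> hom G G" and \<alpha>_a: "\<alpha> a = inv a \<otimes> b" and \<alpha>_b: "\<alpha> b = inv a"
    and central: "\<And>x. x \<in> carrier G \<Longrightarrow> cmt G a b \<otimes> x = x \<otimes> cmt G a b"
    and k3: "cmt G a b [^] (3::nat) = \<one>" and k1: "cmt G a b \<noteq> \<one>"
begin

sublocale \<alpha>: group_hom G G \<alpha>
  using \<alpha>_hom is_group by (simp add: group_hom_def group_hom_axioms_def)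

definition k where "k = cmt G a b"

lemma k [simp]: "k \<in> carrier G" by (simp add: k_def)

lemma k_comm: "x \<in> carrier G \<Longrightarrow> k [^] (t::int) \<otimes> x = x \<otimes> k [^] t"
proof -
  assume x: "x \<in> carrier G"
  then have "cj G x k = k" using central[OF x] by (simp add: cj_eq_self_iff k_def)
  then have "cj G x (k [^] t) = k [^] t" using x by (simp add: cj_int_pow)
  then show ?thesis using x by (simp add: cj_eq_self_iff)
qed

lemma prime3: "Factorial_Ring.prime (3::nat)" by simp

lemma k_pow_eq_iff: "k [^] (s::int) = k [^] (t::int) \<longleftrightarrow> [s = t] (mod 3)"
proof -
  have "k [^] (s - t) \<otimes> k [^] t = k [^] s" by (simp add: int_pow_mult[symmetric])
  then have "k [^] s = k [^] t \<longleftrightarrow> k [^] (s - t) = \<one>" using r_cancel_one'[of "k [^] t" "k [^] (s - t)"] by auto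
  also have "\<dots> \<longleftrightarrow> [s = t] (mod 3)"
    using pow_eq_one_prime[OF prime3 k k3[folded k_def], of "s - t"] k1 by (simp add: k_def cong_iff_dvd_diff)
  finally show ?thesis .
qed

lemma k_pow_cong: "[s = t] (mod 3) \<Longrightarrow> k [^] (s::int) = k [^] (t::int)"
  by (simp add: k_pow_eq_iff)

lemma ba: "b [^] (n::int) \<otimes> a [^] (m::int) = a [^] m \<otimes> b [^] n \<otimes> k [^] (- (m * n))"
proof -
  have "cj G b a = inv k \<otimes> a" by (simp add: k_def cmt_inv) (simp add: cmt_def cj_def m_assoc)
  also have "\<dots> = a \<otimes> inv k" using k_comm[of a "-1"] by (simp add: int_pow_neg)
  finally have "cj G b (a [^] m) = (a \<otimes> inv k) [^] m" by (simp add: cj_int_pow)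
  also have "\<dots> = a [^] m \<otimes> inv k [^] m"
    using k_comm[of a "-1"] by (intro int_pow_mult_distrib) (simp_all add: int_pow_neg)
  also have "inv k [^] m = k [^] (- m)" by (simp add: int_pow_inv int_pow_neg)
  finally have "cj G b (a [^] m) \<otimes> b = a [^] m \<otimes> k [^] (- m) \<otimes> b" by simp
  then have "b \<otimes> a [^] m = a [^] m \<otimes> k [^] (- m) \<otimes> b" by (simp add: cj_def m_assoc)
  then have 1: "b \<otimes> a [^] m = a [^] m \<otimes> (b \<otimes> k [^] (- m))" by (simp add: m_assoc k_comm)
  have "cj G (inv (a [^] m)) b = inv (a [^] m) \<otimes> (b \<otimes> a [^] m)" by (simp add: cj_def m_assoc)
  also have "\<dots> = b \<otimes> k [^] (- m)" unfolding 1 by simp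
  finally have "cj G (inv (a [^] m)) (b [^] n) = (b \<otimes> k [^] (- m)) [^] n" by (simp add: cj_int_pow)
  also have "\<dots> = b [^] n \<otimes> (k [^] (- m)) [^] n" by (intro int_pow_mult_distrib) (simp_all add: k_comm)
  also have "(k [^] (- m)) [^] n = k [^] (- (m * n))" by (simp add: int_pow_pow)
  finally have "inv (a [^] m) \<otimes> (b [^] n \<otimes> a [^] m) = b [^] n \<otimes> k [^] (- (m * n))" by (simp add: cj_def m_assoc)
  then have "a [^] m \<otimes> (inv (a [^] m) \<otimes> (b [^] n \<otimes> a [^] m)) = a [^] m \<otimes> (b [^] n \<otimes> k [^] (- (m * n)))" by simp
  then show ?thesis by (simp add: m_assoc)
qed

text \<open>Heisenberg coordinates. Different triples may denote the same element, since
  \<open>a\<close> and \<open>b\<close> satisfy further relations.\<close>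

definition nf :: "int \<Rightarrow> int \<Rightarrow> int \<Rightarrow> 'a" where "nf m n t = a [^] m \<otimes> b [^] n \<otimes> k [^] t"

lemma nf_closed [simp]: "nf m n t \<in> carrier G" by (simp add: nf_def)

lemma nf_mult: "nf m n t \<otimes> nf m' n' t' = nf (m + m') (n + n') (t + t' - n * m')"
proof -
  have "nf m n t \<otimes> nf m' n' t' = a [^] m \<otimes> (b [^] n \<otimes> (k [^] t \<otimes> (a [^] m' \<otimes> b [^] n' \<otimes> k [^] t')))"
    by (simp add: nf_def m_assoc)
  also have "k [^] t \<otimes> (a [^] m' \<otimes> b [^] n' \<otimes> k [^] t') = a [^] m' \<otimes> b [^] n' \<otimes> k [^] t' \<otimes> k [^] t"
    by (rule k_comm) simp
  also have "a [^] m \<otimes> (b [^] n \<otimes> (a [^] m' \<otimes> b [^] n' \<otimes> k [^] t' \<otimes> k [^] t)) =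
      a [^] m \<otimes> ((b [^] n \<otimes> a [^] m') \<otimes> (b [^] n' \<otimes> k [^] (t' + t)))"
    by (simp add: m_assoc int_pow_mult)
  also have "\<dots> = a [^] m \<otimes> (a [^] m' \<otimes> b [^] n \<otimes> (k [^] (- (m' * n)) \<otimes> (b [^] n' \<otimes> k [^] (t' + t))))"
    unfolding ba by (simp add: m_assoc)
  also have "k [^] (- (m' * n)) \<otimes> (b [^] n' \<otimes> k [^] (t' + t)) = b [^] n' \<otimes> k [^] (t' + t) \<otimes> k [^] (- (m' * n))"
    by (rule k_comm) simp
  also have "a [^] m \<otimes> (a [^] m' \<otimes> b [^] n \<otimes> (b [^] n' \<otimes> k [^] (t' + t) \<otimes> k [^] (- (m' * n)))) =
      (a [^] m \<otimes> a [^] m') \<otimes> (b [^] n \<otimes> b [^] n') \<otimes> (k [^] (t' + t) \<otimes> k [^] (- (m' * n)))"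
    by (simp add: m_assoc)
  also have "\<dots> = nf (m + m') (n + n') (t' + t + - (m' * n))"
    by (simp only: nf_def int_pow_mult a b k)
  finally show ?thesis by (simp add: algebra_simps)
qed

lemma nf_zero [simp]: "nf 0 0 0 = \<one>" by (simp add: nf_def)

lemma nf_a: "nf 1 0 0 = a" and nf_b: "nf 0 1 0 = b" and nf_k: "nf 0 0 t = k [^] t" by (simp_all add: nf_def)

lemma nf_inv: "inv (nf m n t) = nf (- m) (- n) (- t - m * n)"
  by (rule inv_equality) (simp_all add: nf_mult)

lemma nf_all:
  assumes "x \<in> carrier G" obtains m n t where "x = nf m n t"
proof -
  have "subgroup (range (\<lambda>(m, n, t). nf m n t)) G"
  proof (rule finite_subgroupI[OF fin])
    fix x y assume "x \<in> range (\<lambda>(m, n, t). nf m n t)" "y \<in> range (\<lambda>(m, n, t). nf m n t)"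
    then obtain m n t m' n' t' where "x = nf m n t" "y = nf m' n' t'" by auto
    then have "x \<otimes> y = nf (m + m') (n + n') (t + t' - n * m')" by (simp add: nf_mult)
    then show "x \<otimes> y \<in> range (\<lambda>(m, n, t). nf m n t)" by (intro image_eqI[of _ _ "(m + m', n + n', t + t' - n * m')"]) simp_all
  qed auto
  moreover have "a \<in> range (\<lambda>(m, n, t). nf m n t)" by (rule image_eqI[of _ _ "(1, 0, 0)"]) (simp_all add: nf_a)
  moreover have "b \<in> range (\<lambda>(m, n, t). nf m n t)" by (rule image_eqI[of _ _ "(0, 1, 0)"]) (simp_all add: nf_b)
  ultimately have "carrier G \<subseteq> range (\<lambda>(m, n, t). nf m n t)" by (rule gen)
  then show ?thesis using assms that by auto
qed

lemma nf_cong: "[t = t'] (mod 3) \<Longrightarrow> nf m n t = nf m n t'"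
  by (simp add: nf_def k_pow_cong)

text \<open>The commutators collected in a cube occur in multiples of 3 and cancel.\<close>

lemma nf_cube: "nf m n t [^] (3::nat) = nf (3 * m) (3 * n) 0"
proof -
  have "nf m n t [^] (3::nat) = nf m n t \<otimes> nf m n t \<otimes> nf m n t" by (simp add: numeral_3_eq_3)
  also have "\<dots> = nf (3 * m) (3 * n) (3 * t - 3 * (m * n))" by (simp add: nf_mult algebra_simps)
  also have "\<dots> = nf (3 * m) (3 * n) 0" by (rule nf_cong) (simp add: cong_iff_dvd_diff)
  finally show ?thesis .
qed

lemma nf_cube_mult: "nf (3 * m) (3 * n) t \<otimes> nf (3 * m') (3 * n') t' = nf (3 * (m + m')) (3 * (n + n')) (t + t')"
  unfolding nf_mult by (rule trans[OF _ nf_cong[of "t + t' - 3 * n * (3 * m')"]]) (simp_all add: algebra_simps cong_iff_dvd_diff)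

lemma \<alpha>_k: "\<alpha> k = k"
proof -
  have "\<alpha> k = (inv a \<otimes> b) \<otimes> inv a \<otimes> inv (inv a \<otimes> b) \<otimes> inv (inv a)"
    by (simp add: k_def cmt_def \<alpha>_a \<alpha>_b)
  also have "\<dots> = (inv (nf 1 0 0) \<otimes> nf 0 1 0) \<otimes> inv (nf 1 0 0) \<otimes> inv (inv (nf 1 0 0) \<otimes> nf 0 1 0) \<otimes> inv (inv (nf 1 0 0))"
    by (simp only: nf_a nf_b)
  also have "\<dots> = nf 0 0 1" unfolding nf_inv nf_mult by simp
  finally have "\<alpha> k = nf 0 0 1" .
  then show ?thesis by (simp add: nf_k)
qed

lemma \<alpha>_nf_cube: "\<alpha> (nf (3 * m) (3 * n) t) = nf (3 * (- m - n)) (3 * m) t"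
proof -
  have p: "x [^] (3 * i) = (x [^] (3::nat)) [^] i" if "x \<in> carrier G" for x and i :: int
    using int_pow_pow[OF that, of 3 i] int_pow_int[of G x 3] by simp
  have "inv (nf 1 0 0) \<otimes> nf 0 1 0 = nf (- 1) 1 0" unfolding nf_inv nf_mult by simp
  then have "inv a \<otimes> b = nf (- 1) 1 0" by (simp only: nf_a nf_b)
  then have 1: "(inv a \<otimes> b) [^] (3::nat) = nf (- 3) 3 0" by (simp add: nf_cube)
  have "inv a = nf (- 1) 0 0" using nf_inv[of 1 0 0] by (simp add: nf_a)
  then have 2: "inv a [^] (3::nat) = nf (- 3) 0 0" by (simp add: nf_cube)
  have pw: "(nf (3 * u) (3 * v) 0) [^] (i::nat) = nf (3 * (int i * u)) (3 * (int i * v)) 0" for u v i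
  proof (induction i)
    case (Suc i)
    have "nf (3 * u) (3 * v) 0 [^] Suc i = nf (3 * (int i * u + u)) (3 * (int i * v + v)) 0"
      by (simp only: nat_pow_Suc Suc nf_cube_mult add_0)
    then show ?case by (simp add: distrib_right add.commute)
  qed simp
  have ipw: "(nf (3 * u) (3 * v) 0) [^] (i::int) = nf (3 * (i * u)) (3 * (i * v)) 0" for u v i
  proof (cases i)
    case (nonneg j) then show ?thesis by (simp add: int_pow_int pw)
  next
    case (neg j)
    have "(nf (3 * u) (3 * v) 0) [^] i = inv (nf (3 * (int (Suc j) * u)) (3 * (int (Suc j) * v)) 0)"
      unfolding neg by (simp only: int_pow_neg_int nf_closed pw)
    also have "\<dots> = nf (3 * (i * u)) (3 * (i * v)) 0"
      by (rule inv_equality) (simp_all only: nf_cube_mult nf_closed neg distrib_right[symmetric], simp)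
    finally show ?thesis .
  qed
  have "\<alpha> (nf (3 * m) (3 * n) t) = (inv a \<otimes> b) [^] (3 * m) \<otimes> inv a [^] (3 * n) \<otimes> k [^] t"
    by (simp add: nf_def \<alpha>.hom_int_pow \<alpha>_a \<alpha>_b \<alpha>_k)
  also have "\<dots> = nf (3 * (-1)) (3 * 1) 0 [^] m \<otimes> nf (3 * (-1)) (3 * 0) 0 [^] n \<otimes> nf (3 * 0) (3 * 0) t"
    using nf_k[of t] by (simp add: p 1 2)
  also have "\<dots> = nf (3 * (- m - n)) (3 * m) t" unfolding ipw nf_cube_mult by (simp add: algebra_simps)
  finally show ?thesis .
qed

text \<open>The cubes form a module over the Eisenstein integers generated by \<open>a\<^sup>3\<close>, with \<open>\<alpha>\<close> acting as a primitive
  cube root of unity; hence \<open>\<alpha>\<close> has at most three fixed points among them.\<close>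

lemma fixed_central_in_k:
  assumes root: "\<exists>x\<in>carrier G. x [^] (3::nat) = k"
    and e: "e \<in> carrier G" "e \<otimes> a = a \<otimes> e" "e \<otimes> b = b \<otimes> e" "\<alpha> e = e"
  shows "\<exists>t::int. e = k [^] t"
proof -
  define T where "T = (\<lambda>(m, n). nf (3 * m) (3 * n) 0) ` UNIV"
  have TI: "nf (3 * m) (3 * n) 0 \<in> T" for m n unfolding T_def by (rule image_eqI[of _ _ "(m, n)"]) simp_all
  have sT: "subgroup T G"
  proof (rule finite_subgroupI[OF fin])
    fix x y assume "x \<in> T" "y \<in> T"
    then obtain m n m' n' where "x = nf (3 * m) (3 * n) 0" "y = nf (3 * m') (3 * n') 0" by (auto simp: T_def)
    then have "x \<otimes> y = nf (3 * (m + m')) (3 * (n + n')) 0" by (simp only: nf_cube_mult add_0)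
    then show "x \<otimes> y \<in> T" using TI by (simp only:)
  qed (auto simp: T_def)
  let ?T = "G\<lparr>carrier := T\<rparr>"
  interpret T: group ?T by (rule subgroup.subgroup_is_group[OF sT is_group])
  \<comment> \<open>Multiplication by a primitive cube root of unity minus 1, an element of norm 3.
    So the image has index at most 3 in the module of cubes, and the kernel, which consists of the
    fixed points, has at most 3 elements.\<close>
  define \<tau> where "\<tau> x = inv x \<otimes> \<alpha> x" for x
  have \<tau>_nf: "\<tau> (nf (3 * m) (3 * n) 0) = nf (3 * (- 2 * m - n)) (3 * (m - n)) 0" for m n
  proof -
    have "inv (nf (3 * m) (3 * n) 0) = nf (3 * (- m)) (3 * (- n)) 0"
      by (rule inv_equality) (simp_all only: nf_cube_mult nf_closed, simp)
    then show ?thesis unfolding \<tau>_def by (simp only: \<alpha>_nf_cube nf_cube_mult) (simp add: algebra_simps)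
  qed
  have "\<tau> \<in> hom ?T ?T"
  proof (rule homI)
    fix x y assume x: "x \<in> carrier ?T"
    then obtain m n where mn: "x = nf (3 * m) (3 * n) 0" by (auto simp: T_def)
    show "\<tau> x \<in> carrier ?T" using TI[of "- 2 * m - n" "m - n"] unfolding mn \<tau>_nf by simp
    assume "y \<in> carrier ?T"
    then obtain m' n' where mn': "y = nf (3 * m') (3 * n') 0" by (auto simp: T_def)
    have "\<tau> (x \<otimes> y) = \<tau> x \<otimes> \<tau> y"
      unfolding mn mn' nf_cube_mult add_0 \<tau>_nf by (simp add: algebra_simps)
    then show "\<tau> (x \<otimes>\<^bsub>?T\<^esub> y) = \<tau> x \<otimes>\<^bsub>?T\<^esub> \<tau> y" by simp
  qed
  then interpret \<tau>: group_hom ?T ?T \<tau> using T.is_group by (simp add: group_hom_def group_hom_axioms_def)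
  have finT: "finite T" using fin sT by (rule subgroup_finite)
  let ?I = "\<tau> ` T" and ?F = "{x \<in> T. \<alpha> x = x}"
  have ker: "kernel ?T ?T \<tau> = ?F"
  proof -
    have "\<tau> x = \<one> \<longleftrightarrow> \<alpha> x = x" if "x \<in> T" for x
    proof -
      have x: "x \<in> carrier G" using that subgroup.mem_carrier[OF sT] by blast
      show ?thesis
      proof
        assume "\<tau> x = \<one>"
        then have "x \<otimes> (inv x \<otimes> \<alpha> x) = x" using x by (simp add: \<tau>_def)
        then show "\<alpha> x = x" using x by simp
      qed (use x in \<open>simp add: \<tau>_def\<close>)
    qed
    then show ?thesis by (auto simp: kernel_def)
  qed
  have cards: "card ?F * card ?I = card T" using \<tau>.card_kernel_image finT by (simp add: ker order_def)
  have "T \<subseteq> (\<lambda>(i, y). nf (3 * int i) 0 0 \<otimes> y) ` ({..<3} \<times> ?I)"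
  proof
    fix x assume "x \<in> T"
    then obtain m n where mn: "x = nf (3 * m) (3 * n) 0" by (auto simp: T_def)
    \<comment> \<open>Modulo the image of \<open>\<tau>\<close>, a cube with exponents
      \<open>3 m\<close> and \<open>3 n\<close> depends only on \<open>m - n\<close> modulo
      3.\<close>
    define i where "i = nat ((m - n) mod 3)"
    have i: "int i = (m - n) mod 3" by (simp add: i_def)
    have "3 dvd n + int i - m" unfolding i by presburger
    then obtain u where u: "n + int i - m = 3 * u" by blast
    have "nf (3 * int i) 0 0 \<otimes> \<tau> (nf (3 * u) (3 * (u - n)) 0) = x"
    proof -
      have z: "nf (3 * int i) 0 0 = nf (3 * int i) (3 * 0) 0" by simp
      have e: "int i + (- 2 * u - (u - n)) = m" "0 + (u - (u - n)) = n" using u by simp_all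
      show ?thesis unfolding z \<tau>_nf mn nf_cube_mult e by simp
    qed
    moreover have "\<tau> (nf (3 * u) (3 * (u - n)) 0) \<in> ?I" using TI by blast
    moreover have "i \<in> {..<3}" using i by simp
    ultimately show "x \<in> (\<lambda>(i, y). nf (3 * int i) 0 0 \<otimes> y) ` ({..<3} \<times> ?I)"
      by (intro image_eqI[of _ _ "(i, \<tau> (nf (3 * u) (3 * (u - n)) 0))"]) simp_all
  qed
  then have "card T \<le> card ((\<lambda>(i, y). nf (3 * int i) 0 0 \<otimes> y) ` ({..<3} \<times> ?I))"
    using finT by (intro card_mono) simp_all
  also have "\<dots> \<le> card ({..<3::nat} \<times> ?I)" by (rule card_image_le) (simp add: finT)
  finally have "card T \<le> 3 * card ?I" by (simp add: card_cartesian_product)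
  moreover have "0 < card ?I" using finT subgroup.one_closed[OF sT] by (auto simp: card_gt_0_iff)
  ultimately have cF: "card ?F \<le> 3" unfolding cards[symmetric] by simp
  \<comment> \<open>Being a cube, \<open>k\<close> is itself one of the fixed points, and its powers
    exhaust them.\<close>
  obtain r where r: "r \<in> carrier G" "r [^] (3::nat) = k" using root by blast
  then obtain m n t where "r = nf m n t" using nf_all by blast
  then have "k = nf (3 * m) (3 * n) 0" using r(2) by (simp add: nf_cube)
  then have kT: "k \<in> T" using TI by (simp only:)
  then have kF: "k [^] int i \<in> ?F" for i
    using subgroup_int_pow_mem[OF sT kT] by (simp add: \<alpha>.hom_int_pow \<alpha>_k)
  have "inj_on (\<lambda>i. k [^] int i) {..<3}"
    by (rule inj_onI) (simp add: k_pow_eq_iff cong_def)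
  then have "card ((\<lambda>i. k [^] int i) ` {..<3}) = 3" by (simp add: card_image)
  then have F_eq: "(\<lambda>i. k [^] int i) ` {..<3} = ?F" using kF cF finT by (intro card_seteq) auto
  obtain m n t where mnt: "e = nf m n t" using nf_all[OF e(1)] by blast
  \<comment> \<open>Commuting with \<open>a\<close> and \<open>b\<close> makes both exponents
    divisible by 3, so \<open>e\<close> is a cube times a power of \<open>k\<close>.\<close>
  have "nf m n t \<otimes> nf 1 0 0 = nf 1 0 0 \<otimes> nf m n t" using e(2) by (simp add: mnt nf_a)
  then have "nf (m + 1) n (t - n) \<otimes> inv (nf (m + 1) n t) = \<one>" by (simp add: nf_mult add.commute)
  then have "nf 0 0 (- n) = \<one>" by (simp add: nf_inv nf_mult algebra_simps)
  then have "k [^] (- n) = k [^] (0::int)" by (simp add: nf_k)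
  then have "3 dvd n" by (simp only: k_pow_eq_iff) (simp add: cong_iff_dvd_diff)
  have "nf m n t \<otimes> nf 0 1 0 = nf 0 1 0 \<otimes> nf m n t" using e(3) by (simp add: mnt nf_b)
  then have "nf m (n + 1) t \<otimes> inv (nf m (n + 1) (t - m)) = \<one>" by (simp add: nf_mult add.commute)
  then have "nf 0 0 m = \<one>" by (simp add: nf_inv nf_mult algebra_simps)
  then have "k [^] m = k [^] (0::int)" by (simp add: nf_k)
  then have "3 dvd m" by (simp only: k_pow_eq_iff) (simp add: cong_iff_dvd_diff)
  obtain m' n' where m': "m = 3 * m'" "n = 3 * n'" using \<open>3 dvd m\<close> \<open>3 dvd n\<close> by blast
  have fixed: "nf (3 * (- m' - n')) (3 * m') t = nf (3 * m') (3 * n') t"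
    using e(4) by (simp only: mnt m' \<alpha>_nf_cube)
  have "nf (3 * (- m' - n')) (3 * m') 0 = nf (3 * (- m' - n')) (3 * m') t \<otimes> nf (3 * 0) (3 * 0) (- t)"
    unfolding nf_cube_mult by simp
  also have "\<dots> = nf (3 * m') (3 * n') 0" unfolding fixed nf_cube_mult by simp
  finally have "nf (3 * m') (3 * n') 0 \<in> ?F" using TI by (simp only: \<alpha>_nf_cube mem_Collect_eq)
  then obtain i :: nat where i: "nf (3 * m') (3 * n') 0 = k [^] int i" using F_eq by blast
  have "e = nf (3 * m') (3 * n') 0 \<otimes> nf (3 * 0) (3 * 0) t" unfolding mnt m' nf_cube_mult by simp
  also have "\<dots> = k [^] (int i + t)" by (simp add: i nf_k int_pow_mult)
  finally show ?thesis by blast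
qed

end

section \<open>Generators, and the order of the commutator\<close>

lemma metacyclic_imp_gens:
  assumes p: "Factorial_Ring.prime p" "odd p" and pg: "p_group p H" and mc: "metacyclic H"
  shows "\<exists>a n g. metacyclic_p_group H p a n g"
proof -
  interpret group H using pg by (simp add: p_group_def)
  obtain a where a: "order H = p ^ a" using pg by (auto simp: p_group_def)
  obtain N where N: "N \<lhd> H" and c1: "cyclic_group (H\<lparr>carrier := N\<rparr>)" and c2: "cyclic_group (H Mod N)"
    using mc by (auto simp: metacyclic_def)
  have sN: "subgroup N H" using N by (rule normal_imp_subgroup)
  have gN: "group (H\<lparr>carrier := N\<rparr>)" by (rule subgroup.subgroup_is_group[OF sN is_group])
  have gM: "group (H Mod N)" by (rule normal.factorgroup_is_group[OF N])
  obtain n where n: "n \<in> N" "N = range (\<lambda>\<kappa>::int. n [^]\<^bsub>H\<lparr>carrier := N\<rparr>\<^esub> \<kappa>)"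
    using c1 group.cyclic_group[OF gN] by auto
  have N_eq: "N = range (\<lambda>\<kappa>::int. n [^]\<^bsub>H\<^esub> \<kappa>)" using n int_pow_consistent[OF sN n(1)] by simp
  have nc: "n \<in> carrier H" using n(1) subgroup.mem_carrier[OF sN] by blast
  obtain X where X: "X \<in> carrier (H Mod N)" "carrier (H Mod N) = range (\<lambda>\<kappa>::int. X [^]\<^bsub>H Mod N\<^esub> \<kappa>)"
    using c2 group.cyclic_group[OF gM] by auto
  obtain g where g: "g \<in> carrier H" "X = N #>\<^bsub>H\<^esub> g" using X(1) by (auto simp: carrier_FactGroup)
  have "metacyclic_gens H n g"
    unfolding metacyclic_gens_def
  proof (intro conjI ballI)
    fix x assume x: "x \<in> carrier H"
    have "inv\<^bsub>H\<^esub> x \<otimes>\<^bsub>H\<^esub> n \<otimes>\<^bsub>H\<^esub> inv\<^bsub>H\<^esub> (inv\<^bsub>H\<^esub> x) \<in> N" by (rule normal_conj[OF N]) (use x n in simp_all)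
    then show "\<exists>\<kappa>::int. inv\<^bsub>H\<^esub> x \<otimes>\<^bsub>H\<^esub> n \<otimes>\<^bsub>H\<^esub> x = n [^]\<^bsub>H\<^esub> \<kappa>" using x N_eq by auto
    have "N #>\<^bsub>H\<^esub> x \<in> carrier (H Mod N)" using x by (simp add: carrier_FactGroup)
    then obtain i :: int where "N #>\<^bsub>H\<^esub> x = N #>\<^bsub>H\<^esub> (g [^]\<^bsub>H\<^esub> i)"
      using X(2) g normal.FactGroup_int_pow[OF N g(1)] by auto
    then have "x \<otimes>\<^bsub>H\<^esub> inv\<^bsub>H\<^esub> (g [^]\<^bsub>H\<^esub> i) \<in> N" using rcos_eq_iff[OF sN x] g(1) by simp
    from normal_conj[OF N _ this, of "inv\<^bsub>H\<^esub> (g [^]\<^bsub>H\<^esub> i)"]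
    have "inv\<^bsub>H\<^esub> (g [^]\<^bsub>H\<^esub> i) \<otimes>\<^bsub>H\<^esub> x \<in> N" using g(1) x by (simp add: m_assoc)
    then obtain j :: int where "inv\<^bsub>H\<^esub> (g [^]\<^bsub>H\<^esub> i) \<otimes>\<^bsub>H\<^esub> x = n [^]\<^bsub>H\<^esub> j" using N_eq by auto
    then have "g [^]\<^bsub>H\<^esub> i \<otimes>\<^bsub>H\<^esub> (inv\<^bsub>H\<^esub> (g [^]\<^bsub>H\<^esub> i) \<otimes>\<^bsub>H\<^esub> x) = g [^]\<^bsub>H\<^esub> i \<otimes>\<^bsub>H\<^esub> n [^]\<^bsub>H\<^esub> j" by simp
    then have "x = g [^]\<^bsub>H\<^esub> i \<otimes>\<^bsub>H\<^esub> n [^]\<^bsub>H\<^esub> j" using g(1) x by simp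
    then show "\<exists>(i::int) (j::int). x = g [^]\<^bsub>H\<^esub> i \<otimes>\<^bsub>H\<^esub> n [^]\<^bsub>H\<^esub> j" by blast
  qed (use nc g in simp_all)
  then show ?thesis using p a is_group by (auto simp: metacyclic_p_group_def metacyclic_p_group_axioms_def)
qed

locale metacyclic_rotation = metacyclic_p_group G 3 r n g for G (structure) and r n g +
  fixes a b \<alpha>
  assumes a [simp]: "a \<in> carrier G" and b [simp]: "b \<in> carrier G"
    and gen: "\<And>K. subgroup K G \<Longrightarrow> a \<in> K \<Longrightarrow> b \<in> K \<Longrightarrow> carrier G \<subseteq> K"
    and \<alpha>_hom: "\<alpha> \<in> hom G G" and \<alpha>_a: "\<alpha> a = inv a \<otimes> b" and \<alpha>_b: "\<alpha> b = inv a"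
    and nonabelian: "\<not> comm_group G"
begin

sublocale \<alpha>: group_hom G G \<alpha>
  using \<alpha>_hom is_group by (simp add: group_hom_def group_hom_axioms_def)

abbreviation \<kappa> where "\<kappa> \<equiv> cmt G a b"

lemma power_dvd: "x \<in> carrier G \<Longrightarrow> x [^] (i::int) = \<one> \<Longrightarrow> x \<noteq> \<one> \<Longrightarrow> 3 dvd i"
  using coprime_power_one[OF p _ pow_card, of x i] by auto

text \<open>Conjugation acts on the derived subgroup by exponents that are 1 modulo 3.\<close>

lemma k_conj: "x \<in> carrier G \<Longrightarrow> \<exists>i::int. cj G x (\<kappa> [^] (m::int)) = \<kappa> [^] m \<otimes> (\<kappa> [^] m) [^] (3 * i)"
proof -
  assume x: "x \<in> carrier G"
  have "\<kappa> \<in> C" by (rule cmt_in_C) simp_all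
  then obtain j :: int where j: "\<kappa> = c [^] j" by (auto simp: C_def)
  obtain s where s: "cj G x c = c [^] (s::int)" "[s = 1] (mod int 3)" using c_conj[OF x] by blast
  obtain i where i: "s = 1 + 3 * i" using cong_sym[OF s(2)] by (auto simp: cong_iff_lin)
  have "cj G x (\<kappa> [^] m) = (\<kappa> [^] m) [^] s" using x by (simp add: j cj_int_pow s(1) int_pow_pow mult_ac)
  also have "\<dots> = \<kappa> [^] m \<otimes> (\<kappa> [^] m) [^] (3 * i)" by (simp add: i int_pow_mult)
  finally show ?thesis by blast
qed

lemma k_powers_normal: "range (\<lambda>i::int. (\<kappa> [^] m) [^] i) \<lhd> G" for m :: int
proof -
  have "x \<otimes> y \<otimes> inv x \<in> range (\<lambda>i::int. (\<kappa> [^] m) [^] i)"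
    if x: "x \<in> carrier G" and y: "y \<in> range (\<lambda>i::int. (\<kappa> [^] m) [^] i)" for x y
  proof -
    obtain l :: int where l: "y = (\<kappa> [^] m) [^] l" using y by blast
    obtain i :: int where "cj G x (\<kappa> [^] m) = \<kappa> [^] m \<otimes> (\<kappa> [^] m) [^] (3 * i)" using k_conj[OF x] by blast
    then have "cj G x (\<kappa> [^] m) = (\<kappa> [^] m) [^] (1 + 3 * i)" by (simp add: int_pow_mult)
    moreover have "cj G x y = (cj G x (\<kappa> [^] m)) [^] l" unfolding l using x by (simp add: cj_int_pow)
    ultimately have "cj G x y = (\<kappa> [^] m) [^] ((1 + 3 * i) * l)" by (simp only: int_pow_pow cmt_closed a b int_pow_closed mult.assoc)
    then show ?thesis by (simp add: cj_def)
  qed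
  then show ?thesis using subgroup_of_powers[of "\<kappa> [^] m"] by (simp add: normal_inv_iff)
qed

lemma cmt_k: "x \<in> carrier G \<Longrightarrow> y \<in> carrier G \<Longrightarrow> cmt G x y \<in> range (\<lambda>i::int. \<kappa> [^] i)"
proof -
  have n: "range (\<lambda>i::int. \<kappa> [^] i) \<lhd> G" using k_powers_normal[of 1] by simp
  have "\<kappa> \<in> range (\<lambda>i::int. \<kappa> [^] i)" by (rule range_eqI[of _ _ 1]) simp
  from cmt_in_normal[OF fin n a b gen this]
  show "x \<in> carrier G \<Longrightarrow> y \<in> carrier G \<Longrightarrow> cmt G x y \<in> range (\<lambda>i::int. \<kappa> [^] i)" by blast
qed

lemma k_ne_one: "\<kappa> \<noteq> \<one>"
proof
  assume "\<kappa> = \<one>"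
  then have "cmt G x y = \<one>" if "x \<in> carrier G" "y \<in> carrier G" for x y using cmt_k[OF that] by auto
  then show False using comm_groupI_cmt nonabelian by blast
qed

lemma \<alpha>_cube: "x \<in> carrier G \<Longrightarrow> \<alpha> (\<alpha> (\<alpha> x)) = x"
proof -
  have "subgroup {x \<in> carrier G. \<alpha> (\<alpha> (\<alpha> x)) = x} G"
    by (rule finite_subgroupI[OF fin]) auto
  moreover have "\<alpha> (\<alpha> (\<alpha> a)) = a" "\<alpha> (\<alpha> (\<alpha> b)) = b"
    by (simp_all add: \<alpha>_a \<alpha>_b inv_mult_group m_assoc)
  ultimately have "carrier G \<subseteq> {x \<in> carrier G. \<alpha> (\<alpha> (\<alpha> x)) = x}" using gen by simp
  then show "x \<in> carrier G \<Longrightarrow> \<alpha> (\<alpha> (\<alpha> x)) = x" by blast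
qed

lemma k_N: "\<kappa> [^] (i::int) \<in> N"
proof -
  have "\<kappa> \<in> C" by (rule cmt_in_C) simp_all
  then obtain j :: int where j: "\<kappa> = c [^] j" by (auto simp: C_def)
  obtain l :: int where "c = n [^] (int 3 * l)" using c_pow by blast
  then have "\<kappa> [^] i = n [^] (3 * l * j * i)" by (simp add: j int_pow_pow)
  then show ?thesis by (simp add: N_def)
qed

lemma k_cube_root: "\<exists>x\<in>carrier G. x [^] (3::nat) = \<kappa>"
proof -
  have "\<kappa> \<in> C" by (rule cmt_in_C) simp_all
  then obtain j :: int where j: "\<kappa> = c [^] j" by (auto simp: C_def)
  obtain l :: int where "c = n [^] (int 3 * l)" using c_pow by blast
  then have "(n [^] (l * j)) [^] (3::nat) = \<kappa>" unfolding j int_pow_int[symmetric] by (simp add: int_pow_pow mult_ac)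
  then show ?thesis by (intro bexI[of _ "n [^] (l * j)"]) simp_all
qed

text \<open>The commutator becomes central of order 3 in this quotient, and \<open>\<alpha>\<close>
  descends because it sends the commutator to another commutator, hence to a power of it.\<close>

lemma quotient_by_cube:
  defines "M \<equiv> range (\<lambda>i::int. (\<kappa> [^] (3::int)) [^] i)"
  shows "\<exists>\<beta>. heis3 (G Mod M) (M #> a) (M #> b) \<beta> \<and> (\<forall>x\<in>carrier G. \<beta> (M #> x) = M #> \<alpha> x)"
proof -
  have nM: "M \<lhd> G" unfolding M_def by (rule k_powers_normal)
  have sM: "subgroup M G" using nM by (rule normal_imp_subgroup)
  define Q where "Q = G Mod M"
  define q where "q = (\<lambda>x. M #> x)"
  have gQ: "group Q" unfolding Q_def by (rule normal.factorgroup_is_group[OF nM])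
  have qh: "q \<in> hom G Q" using normal.r_coset_hom_Mod[OF nM] by (simp add: Q_def q_def)
  have q_surj: "carrier Q = q ` carrier G" by (simp add: Q_def q_def carrier_FactGroup)
  interpret q: group_hom G Q q using qh gQ is_group by (simp add: group_hom_def group_hom_axioms_def)
  have q_eq: "q x = q y \<longleftrightarrow> x \<otimes> inv y \<in> M" if "x \<in> carrier G" "y \<in> carrier G" for x y
    using rcos_eq_iff[OF sM that] by (simp add: q_def)
  have q_one: "q x = \<one>\<^bsub>Q\<^esub> \<longleftrightarrow> x \<in> M" if "x \<in> carrier G" for x
    using q_eq[OF that, of \<one>] that by simp
  have kM: "\<kappa> [^] (3 * i) \<in> M" for i :: int unfolding M_def by (rule range_eqI[of _ _ i]) (simp add: int_pow_pow)
  have \<alpha>M: "\<alpha> x \<in> M" if xM: "x \<in> M" for x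
  proof -
    obtain i :: int where "x = (\<kappa> [^] (3::int)) [^] i" using xM unfolding M_def by blast
    then have i: "x = \<kappa> [^] (3 * i)" by (simp add: int_pow_pow)
    have "\<alpha> \<kappa> = cmt G (\<alpha> a) (\<alpha> b)" by (rule \<alpha>.hom_cmt) simp_all
    then obtain j :: int where "\<alpha> \<kappa> = \<kappa> [^] j" using cmt_k[of "\<alpha> a" "\<alpha> b"] by auto
    then have "\<alpha> x = \<kappa> [^] (3 * (j * i))" by (simp add: i \<alpha>.hom_int_pow int_pow_pow mult_ac)
    then show ?thesis using kM by simp
  qed
  have comp: "(\<lambda>x. q (\<alpha> x)) \<in> hom G Q" by (rule homI) simp_all
  obtain \<beta> where \<beta>: "\<beta> \<in> hom (G Mod M) Q" "\<And>x. x \<in> carrier G \<Longrightarrow> \<beta> (M #> x) = q (\<alpha> x)"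
  proof (rule FactGroup_universal[OF comp nM])
    fix x y assume xy: "x \<in> carrier G" "y \<in> carrier G" "M #> x = M #> y"
    then have "x \<otimes> inv y \<in> M" using q_eq[of x y] by (simp add: q_def)
    then have "\<alpha> (x \<otimes> inv y) \<in> M" by (rule \<alpha>M)
    moreover have "\<alpha> (x \<otimes> inv y) = \<alpha> x \<otimes> inv \<alpha> y" using xy by simp
    ultimately show "q (\<alpha> x) = q (\<alpha> y)" using xy q_eq by simp
  qed blast
  have qk: "cmt Q (q a) (q b) = q \<kappa>" by (simp add: q.hom_cmt)
  have "heis3 Q (q a) (q b) \<beta>"
  proof (intro heis3.intro heis3_axioms.intro gQ)
    show "finite (carrier Q)" using fin q_surj by simp
    show "carrier Q \<subseteq> K" if K: "subgroup K Q" "q a \<in> K" "q b \<in> K" for K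
    proof -
      have "subgroup {x \<in> carrier G. q x \<in> K} G"
        by (rule finite_subgroupI[OF fin]) (use K subgroup.m_closed[OF K(1)] bexI[OF _ a, of "\<lambda>x. q x \<in> K"] in auto)
      from gen[OF this] K show ?thesis using q_surj by auto
    qed
    show "\<beta> \<in> hom Q Q" using \<beta>(1) by (simp add: Q_def)
    show "\<beta> (q a) = inv\<^bsub>Q\<^esub> q a \<otimes>\<^bsub>Q\<^esub> q b" "\<beta> (q b) = inv\<^bsub>Q\<^esub> q a"
      using \<beta>(2)[of a] \<beta>(2)[of b] by (simp_all add: q_def[symmetric] \<alpha>_a \<alpha>_b)
    show "cmt Q (q a) (q b) \<otimes>\<^bsub>Q\<^esub> X = X \<otimes>\<^bsub>Q\<^esub> cmt Q (q a) (q b)" if X: "X \<in> carrier Q" for X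
    proof -
      obtain x where x: "x \<in> carrier G" "X = q x" using X q_surj by blast
      obtain i :: int where "cj G x (\<kappa> [^] (1::int)) = \<kappa> [^] (1::int) \<otimes> (\<kappa> [^] (1::int)) [^] (3 * i)" using k_conj[OF x(1)] by blast
      then have "cj G x \<kappa> = \<kappa> \<otimes> \<kappa> [^] (3 * i)" by simp
      then have "q (cj G x \<kappa> \<otimes> x) = q (\<kappa> \<otimes> \<kappa> [^] (3 * i) \<otimes> x)" by simp
      moreover have "cj G x \<kappa> \<otimes> x = x \<otimes> \<kappa>" using x(1) by (simp add: cj_def m_assoc)
      moreover have "q (\<kappa> [^] (3 * i)) = \<one>\<^bsub>Q\<^esub>" using q_one kM by simp
      ultimately show ?thesis unfolding qk using x by simp
    qed
    have "q (\<kappa> [^] (3 * (1::int))) = \<one>\<^bsub>Q\<^esub>" using q_one kM[of 1] by simp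
    then show "cmt Q (q a) (q b) [^]\<^bsub>Q\<^esub> (3::nat) = \<one>\<^bsub>Q\<^esub>" unfolding qk using int_pow_int[of G \<kappa> 3] by (simp add: q.hom_nat_pow)
    show "cmt Q (q a) (q b) \<noteq> \<one>\<^bsub>Q\<^esub>"
    proof
      assume "cmt Q (q a) (q b) = \<one>\<^bsub>Q\<^esub>"
      then have "\<kappa> \<in> M" using q_one by (simp add: qk)
      then obtain i :: int where "\<kappa> = (\<kappa> [^] (3::int)) [^] i" unfolding M_def by blast
      then have i: "\<kappa> = \<kappa> [^] (3 * i)" by (simp add: int_pow_pow)
      have "\<kappa> [^] (3 * i - 1) = \<kappa> [^] (3 * i) \<otimes> inv \<kappa>" by (simp add: int_pow_diff)
      also have "\<dots> = \<one>" by (simp flip: i)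
      finally have "3 dvd 3 * i - 1" by (rule power_dvd[rotated]) (simp_all add: k_ne_one)
      then show False by presburger
    qed
  qed simp_all
  then show ?thesis using \<beta>(2) by (auto simp: Q_def q_def)
qed

end

context metacyclic_rotation
begin

text \<open>Otherwise an element \<open>z\<close> of order 3 among the powers of
  \<open>\<kappa> [^] 3\<close> and an element \<open>e\<close> of order 3 outside \<open>N\<close>
  account for all nine elements of exponent 3. Conjugations and \<open>\<alpha>\<close> then map
  \<open>e\<close> to a power of \<open>e\<close> times a power of \<open>z\<close>, and modulo
  \<open>M\<close> they fix it. So the class of \<open>e\<close> is a central fixed point, hence a
  power of the commutator, and \<open>e\<close> would lie in \<open>N\<close>.\<close>

lemma k_cube: "\<kappa> [^] (3::nat) = \<one>"
proof (rule ccontr)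
  assume ne: "\<kappa> [^] (3::nat) \<noteq> \<one>"
  define q where "q = \<kappa> [^] (3::int)"
  have q_nat: "q = \<kappa> [^] (3::nat)" using int_pow_int[of G \<kappa> 3] by (simp add: q_def)
  have qc [simp]: "q \<in> carrier G" by (simp add: q_def)
  define M where "M = range (\<lambda>i::int. q [^] i)"
  have nM: "M \<lhd> G" unfolding M_def q_def by (rule k_powers_normal)
  have sM: "subgroup M G" using nM by (rule normal_imp_subgroup)
  have M_eq: "M = range (\<lambda>i::int. (\<kappa> [^] (3::int)) [^] i)" by (simp add: M_def q_def)
  obtain \<beta> where "heis3 (G Mod M) (M #> a) (M #> b) \<beta>" and \<beta>: "\<And>x. x \<in> carrier G \<Longrightarrow> \<beta> (M #> x) = M #> \<alpha> x"
    using quotient_by_cube unfolding M_eq[symmetric] by blast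
  then interpret Q: heis3 "G Mod M" "M #> a" "M #> b" \<beta> by simp
  have qh: "(\<lambda>x. M #> x) \<in> hom G (G Mod M)" by (rule normal.r_coset_hom_Mod[OF nM])
  interpret h: group_hom G "G Mod M" "\<lambda>x. M #> x"
    using qh is_group Q.is_group by (simp add: group_hom_def group_hom_axioms_def)
  have q_eq: "M #> x = M #> y \<longleftrightarrow> x \<otimes> inv y \<in> M" if "x \<in> carrier G" "y \<in> carrier G" for x y
    using rcos_eq_iff[OF sM that] .
  have MN: "M \<subseteq> N" using k_N unfolding M_def q_def by (auto simp: int_pow_pow)
  obtain d :: nat where d: "q [^] ((3::nat) ^ d) \<noteq> \<one>" "(q [^] ((3::nat) ^ d)) [^] (3::nat) = \<one>"
    using order_p_power[of q 3 r] pow_card[of q] ne by (auto simp: q_nat)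
  define z where "z = q [^] ((3::nat) ^ d)"
  have zc [simp]: "z \<in> carrier G" by (simp add: z_def)
  have z3: "z [^] (3::nat) = \<one>" and z1: "z \<noteq> \<one>" using d by (simp_all add: z_def)
  have z_k: "z = \<kappa> [^] (3 * (3::int) ^ d)"
    by (simp add: z_def q_def int_pow_pow flip: int_pow_int)
  have zM: "z [^] i \<in> M" for i :: int
    unfolding M_def z_def by (rule range_eqI[of _ _ "3 ^ d * i"]) (simp add: int_pow_pow flip: int_pow_int)
  have z_cj: "cj G x z = z" if x: "x \<in> carrier G" for x
  proof -
    obtain i :: int where "cj G x z = z \<otimes> z [^] (3 * i)" using k_conj[OF x] unfolding z_k by blast
    moreover have "z [^] (3 * i) = (z [^] (3::int)) [^] i" by (simp add: int_pow_pow)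
    moreover have "z [^] (3::int) = \<one>" using z3 int_pow_int[of G z 3] by simp
    ultimately show ?thesis by simp
  qed
  have z_comm: "z \<otimes> x = x \<otimes> z" if "x \<in> carrier G" for x
    using z_cj[OF that] cj_eq_self_iff[OF that zc] by simp
  have z_eq: "z [^] (i::int) = \<one> \<longleftrightarrow> 3 dvd i" for i
    using pow_eq_one_prime[OF p zc z3 z1] by simp
  obtain e where e: "e \<in> carrier G" "e [^] (3::nat) = \<one>" "e \<notin> N"
    by (rule exponent_p_outside[OF nonabelian])
  have e1: "e \<noteq> \<one>" using e(3) subgroup.one_closed[OF N] by auto
  have e_eq: "e [^] (i::int) = \<one> \<longleftrightarrow> 3 dvd i" for i
    using pow_eq_one_prime[OF p e(1,2) e1] by simp
  have e_N: "e [^] (i::int) \<in> N \<longleftrightarrow> 3 dvd i" for i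
  proof
    assume i: "e [^] i \<in> N"
    show "3 dvd i"
    proof (rule ccontr)
      assume "\<not> 3 dvd i"
      then obtain j where "[j * i = 1] (mod int 3)" using invert_mod_prime[OF p, of i] by auto
      then have "e [^] (j * i) = e [^] (1::int)" by (rule pow_cong_exponent[OF e(1,2)])
      then have "(e [^] i) [^] j = e" using e(1) by (simp add: int_pow_pow mult.commute)
      then show False using subgroup_int_pow_mem[OF N i, of j] e(3) by simp
    qed
  next
    assume "3 dvd i"
    then have "e [^] i = \<one>" using e_eq by blast
    then show "e [^] i \<in> N" using subgroup.one_closed[OF N] by simp
  qed
  define E where "E = {x \<in> carrier G. x [^] (3::nat) = \<one>}"
  define w where "w = (\<lambda>(i::nat, j::nat). e [^] int i \<otimes> z [^] int j)"
  have w_eq: "e [^] i \<otimes> z [^] j = e [^] i' \<otimes> z [^] j' \<longleftrightarrow> 3 dvd i - i' \<and> 3 dvd j - j'" for i j i' j' :: int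
  proof
    assume eq: "e [^] i \<otimes> z [^] j = e [^] i' \<otimes> z [^] j'"
    have "e [^] (i - i') = inv (e [^] i') \<otimes> (e [^] i \<otimes> z [^] j) \<otimes> inv (z [^] j)"
      using e(1) by (simp add: m_assoc int_pow_diff flip: int_pow_neg) (simp flip: int_pow_mult add: add.commute)
    also have "\<dots> = z [^] (j' - j)" unfolding eq using e(1) by (simp add: m_assoc int_pow_diff)
    finally have *: "e [^] (i - i') = z [^] (j' - j)" .
    then have "e [^] (i - i') \<in> N" using zM MN by auto
    then have 1: "3 dvd i - i'" by (simp only: e_N)
    then have "e [^] (i - i') = \<one>" using e_eq by blast
    then have "z [^] (j' - j) = \<one>" using * by simp
    then show "3 dvd i - i' \<and> 3 dvd j - j'" using 1 z_eq dvd_diff_commute by blast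
  next
    assume "3 dvd i - i' \<and> 3 dvd j - j'"
    then show "e [^] i \<otimes> z [^] j = e [^] i' \<otimes> z [^] j'"
      using pow_cong_exponent[OF e(1,2), of i i'] pow_cong_exponent[OF zc z3, of j j'] by (simp add: cong_iff_dvd_diff)
  qed
  have "inj_on w ({..<3} \<times> {..<3})"
  proof (rule inj_onI)
    fix x y assume xy: "x \<in> {..<3} \<times> {..<3}" "y \<in> {..<3} \<times> {..<3}" "w x = w y"
    obtain i j i' j' where s: "x = (i, j)" "y = (i', j')" by (cases x, cases y)
    have "3 dvd int i - int i' \<and> 3 dvd int j - int j'" using xy(3) w_eq by (simp add: w_def s)
    moreover have "i < 3" "j < 3" "i' < 3" "j' < 3" using xy(1,2) by (simp_all add: s)
    ultimately have "i = i'" "j = j'" by presburger+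
    then show "x = y" by (simp add: s)
  qed
  then have "card (w ` ({..<3} \<times> {..<3})) = 9" by (simp add: card_image)
  moreover have "w ` ({..<3} \<times> {..<3}) \<subseteq> E"
  proof -
    have "e [^] i \<otimes> z [^] j \<in> E" for i j :: int
    proof -
      have "z [^] j \<otimes> e [^] i = e [^] i \<otimes> z [^] j"
      proof -
        have "cj G (e [^] i) z = z" using e(1) by (intro z_cj) simp
        then have "cj G (e [^] i) (z [^] j) = z [^] j" using e(1) by (simp add: cj_int_pow)
        then show ?thesis using e(1) by (simp add: cj_eq_self_iff)
      qed
      then have "(e [^] i \<otimes> z [^] j) [^] (3::nat) = (e [^] i) [^] (3::nat) \<otimes> (z [^] j) [^] (3::nat)"
        using e(1) by (intro pow_mult_distrib) simp_all
      also have "(e [^] i) [^] (3::nat) = (e [^] (3::nat)) [^] i" using e(1) by (simp add: int_pow_pow mult.commute flip: int_pow_int)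
      also have "(z [^] j) [^] (3::nat) = (z [^] (3::nat)) [^] j" by (simp add: int_pow_pow mult.commute flip: int_pow_int)
      finally show ?thesis using e by (simp add: E_def z3)
    qed
    then show ?thesis by (auto simp: w_def)
  qed
  moreover have "card E \<le> 9" using card_exponent_p by (simp add: E_def)
  moreover have "finite E" using fin by (simp add: E_def)
  ultimately have "w ` ({..<3} \<times> {..<3}) = E" by (intro card_seteq) simp_all
  then have E_form: "\<exists>(i::int) (j::int). x = e [^] i \<otimes> z [^] j" if "x \<in> carrier G" "x [^] (3::nat) = \<one>" for x
  proof -
    have "x \<in> E" using that by (simp add: E_def)
    then have "x \<in> w ` ({..<3} \<times> {..<3})" using \<open>w ` _ = E\<close> by simp
    then show ?thesis by (auto simp: w_def)
  qed
  have Qz: "M #> (x \<otimes> z [^] (j::int)) = M #> x" if x: "x \<in> carrier G" for x j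
    using q_eq[of "x \<otimes> z [^] j" x] x zM[of j] z_cj[OF x] by (simp add: cj_int_pow flip: cj_def)
  have comm: "e \<otimes> x \<otimes> inv (x \<otimes> e) \<in> M" if x: "x \<in> carrier G" for x
  proof -
    have "(cj G x e) [^] (3::nat) = \<one>" using x e by (simp flip: cj_nat_pow)
    then obtain i j :: int where ij: "cj G x e = e [^] i \<otimes> z [^] j" using E_form[of "cj G x e"] x e(1) by auto
    \<comment> \<open>Commutators lie in \<open>N\<close> while \<open>e\<close> does not, which
      forces the exponent \<open>i\<close> to be 1 modulo 3.\<close>
    have "cmt G x e \<in> N" using cmt_k[OF x e(1)] k_N by auto
    then have "cj G x e \<otimes> inv e \<in> N" using x e(1) by (simp add: cmt_eq_cj)
    then have "e [^] i \<otimes> z [^] j \<otimes> inv e \<in> N" by (simp only: ij)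
    moreover have "e [^] i \<otimes> z [^] j \<otimes> inv e = e [^] (i - 1) \<otimes> z [^] j"
    proof -
      have "cj G (inv e) (z [^] j) = z [^] j" using z_cj[of "inv e"] e(1) by (simp add: cj_int_pow)
      then have "inv e \<otimes> z [^] j = z [^] j \<otimes> inv e" using e(1) by (simp add: cj_eq_self_iff)
      then show ?thesis using e(1) by (simp add: m_assoc int_pow_diff)
    qed
    moreover have "z [^] j \<in> N" using zM MN by blast
    ultimately have "e [^] (i - 1) \<otimes> z [^] j \<otimes> inv (z [^] j) \<in> N"
      using subgroup.m_closed[OF N] subgroup.m_inv_closed[OF N] by simp
    then have "3 dvd i - 1" using e(1) e_N[of "i - 1"] by (simp add: m_assoc)
    then have "e [^] i = e [^] (1::int)" by (intro pow_cong_exponent[OF e(1,2)]) (simp add: cong_iff_dvd_diff)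
    then have "cj G x e = e \<otimes> z [^] j" using ij e(1) by simp
    then have "cj G x e \<otimes> x = e \<otimes> z [^] j \<otimes> x" by simp
    moreover have "cj G x e \<otimes> x = x \<otimes> e" using x e(1) by (simp add: cj_def m_assoc)
    moreover have "cj G x (z [^] j) = z [^] j" using z_cj[OF x] x by (simp add: cj_int_pow)
    ultimately have "x \<otimes> e = e \<otimes> x \<otimes> z [^] j" using x e(1) by (simp add: cj_eq_self_iff m_assoc)
    then have "M #> (x \<otimes> e) = M #> (e \<otimes> x)" using x e(1) Qz[of "e \<otimes> x" j] by simp
    then show ?thesis using q_eq[of "e \<otimes> x" "x \<otimes> e"] x e(1) by auto
  qed
  have fix_e: "\<beta> (M #> e) = M #> e"
  proof -
    have "(\<alpha> e) [^] (3::nat) = \<one>" using e by (simp flip: \<alpha>.hom_nat_pow)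
    then obtain i j :: int where ij: "\<alpha> e = e [^] i \<otimes> z [^] j" using E_form[of "\<alpha> e"] e(1) by auto
    have b1: "\<beta> (M #> e) = (M #> e) [^]\<^bsub>G Mod M\<^esub> i"
      using e(1) Qz[of "e [^] i" j] by (simp add: \<beta>(1) ij h.hom_int_pow del: h.hom_mult)
    have Me: "M #> e \<in> carrier (G Mod M)" using e(1) by simp
    \<comment> \<open>The third power of \<open>\<alpha>\<close> is the identity, so the cube of
      \<open>i\<close> is 1 modulo 3; by Fermat's theorem so is \<open>i\<close>.\<close>
    have "\<beta> (\<beta> (\<beta> (M #> e))) = (M #> e) [^]\<^bsub>G Mod M\<^esub> (i * i * i)"
      using Me by (simp add: b1 Q.\<alpha>.hom_int_pow Q.int_pow_pow mult.assoc)
    also have "\<beta> (\<beta> (\<beta> (M #> e))) = M #> e" using e(1) by (simp add: \<beta> \<alpha>_cube)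
    finally have "M #> e = M #> (e [^] (i * i * i))" using e(1) by (simp add: h.hom_int_pow)
    then have "e [^] (i * i * i) \<otimes> inv e \<in> M" using q_eq[of "e [^] (i * i * i)" e] e(1) by simp
    then have "e [^] (i * i * i - 1) \<in> N" using MN e(1) by (auto simp: int_pow_diff)
    then have "3 dvd i * i * i - 1" by (simp only: e_N)
    moreover have "3 dvd i * i * i - i" 
    proof -
      have "[i ^ 3 = i] (mod int 3)" by (rule fermat_int) simp
      then show ?thesis by (simp add: cong_iff_dvd_diff power3_eq_cube)
    qed
    ultimately have "3 dvd (i * i * i - 1) - (i * i * i - i)" by (rule dvd_diff)
    then have "e [^] i = e [^] (1::int)" by (intro pow_cong_exponent[OF e(1,2)]) (simp add: cong_iff_dvd_diff)
    then show ?thesis using b1 e(1) by (simp flip: h.hom_int_pow)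
  qed
  have Qk: "Q.k = M #> \<kappa>" by (simp add: Q.k_def h.hom_cmt)
  have "\<exists>t::int. M #> e = Q.k [^]\<^bsub>G Mod M\<^esub> t"
  proof (rule Q.fixed_central_in_k[OF _ _ _ _ fix_e])
    obtain x where "x \<in> carrier G" "x [^] (3::nat) = \<kappa>" using k_cube_root by blast
    then show "\<exists>X\<in>carrier (G Mod M). X [^]\<^bsub>G Mod M\<^esub> (3::nat) = Q.k"
      unfolding Qk by (intro bexI[of _ "M #> x"]) (simp_all flip: h.hom_nat_pow)
    show "M #> e \<in> carrier (G Mod M)" using e(1) by simp
    show "(M #> e) \<otimes>\<^bsub>G Mod M\<^esub> (M #> a) = (M #> a) \<otimes>\<^bsub>G Mod M\<^esub> (M #> e)"
      using comm[OF a] q_eq[of "e \<otimes> a" "a \<otimes> e"] e(1) by simp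
    show "(M #> e) \<otimes>\<^bsub>G Mod M\<^esub> (M #> b) = (M #> b) \<otimes>\<^bsub>G Mod M\<^esub> (M #> e)"
      using comm[OF b] q_eq[of "e \<otimes> b" "b \<otimes> e"] e(1) by simp
  qed
  then obtain t :: int where "M #> e = M #> (\<kappa> [^] t)" unfolding Qk by (auto simp: h.hom_int_pow)
  then have "e \<otimes> inv (\<kappa> [^] t) \<in> N" using q_eq[of e "\<kappa> [^] t"] e(1) MN by auto
  then have "e \<otimes> inv (\<kappa> [^] t) \<otimes> \<kappa> [^] t \<in> N" using subgroup.m_closed[OF N _ k_N] by blast
  then show False using e(1,3) by (simp add: m_assoc)
qed

sublocale heis3 G a b \<alpha>
proof unfold_locales
  show "\<kappa> \<otimes> x = x \<otimes> \<kappa>" if x: "x \<in> carrier G" for x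
  proof -
    obtain i :: int where "cj G x (\<kappa> [^] (1::int)) = \<kappa> [^] (1::int) \<otimes> (\<kappa> [^] (1::int)) [^] (3 * i)" using k_conj[OF x] by blast
    then have "cj G x \<kappa> = \<kappa> \<otimes> \<kappa> [^] (3 * i)" by simp
    moreover have "\<kappa> [^] (3 * i) = (\<kappa> [^] (3::nat)) [^] i" by (simp add: int_pow_pow flip: int_pow_int)
    ultimately have "cj G x \<kappa> = \<kappa>" by (simp add: k_cube)
    then show ?thesis using x by (simp add: cj_eq_self_iff)
  qed
qed (use fin gen \<alpha>_hom \<alpha>_a \<alpha>_b k_cube k_ne_one in simp_all)

end

section \<open>Relations among the generators as an ideal\<close>

context heis3
begin

lemma nf_eq_iff: "nf m n t = nf m' n' t' \<longleftrightarrow> nf (m - m') (n - n') (t - t' + (n - n') * m') = \<one>" (is "?l \<longleftrightarrow> ?r = _")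
proof -
  have "?r \<otimes> nf m' n' t' = nf m n t" by (simp add: nf_mult algebra_simps)
  then show ?thesis using r_cancel_one'[of "nf m' n' t'" ?r] by (metis nf_closed)
qed

text \<open>The identity commutes with \<open>a\<close> and \<open>b\<close>, and commutation with
  these detects the exponents modulo 3.\<close>

lemma nf_one_dvd:
  assumes one: "nf m n t = \<one>" shows "3 dvd m" "3 dvd n"
proof -
  have "nf m n t \<otimes> nf 1 0 0 = nf 1 0 0 \<otimes> nf m n t" unfolding one by simp
  then have "nf (m + 1) n (t - n) = nf (m + 1) n t" by (simp add: nf_mult add.commute)
  then have "nf 0 0 (- n) = \<one>" by (simp add: nf_eq_iff[of "m + 1"])
  then have "k [^] (- n) = k [^] (0::int)" by (simp add: nf_k)
  then show "3 dvd n" by (simp only: k_pow_eq_iff) (simp add: cong_iff_dvd_diff)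
  have "nf m n t \<otimes> nf 0 1 0 = nf 0 1 0 \<otimes> nf m n t" unfolding one by simp
  then have "nf m (n + 1) t = nf m (n + 1) (t - m)" by (simp add: nf_mult add.commute)
  then have "nf 0 0 m = \<one>" by (simp add: nf_eq_iff[of m])
  then have "k [^] m = k [^] (0::int)" by (simp add: nf_k)
  then show "3 dvd m" by (simp only: k_pow_eq_iff) (simp add: cong_iff_dvd_diff)
qed

lemma k_pow_one_iff: "k [^] (t::int) = \<one> \<longleftrightarrow> 3 dvd t"
  using k_pow_eq_iff[of t 0] by (simp add: cong_iff_dvd_diff)

lemma nf_cubes: "nf (3 * m) (3 * n) t = (a [^] (3::int)) [^] m \<otimes> (b [^] (3::int)) [^] n \<otimes> k [^] t"
  by (simp add: nf_def int_pow_pow)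

end

context metacyclic_rotation
begin

text \<open>A metacyclic 3-group has at most nine elements of exponent 3; in this form the bound
  excludes degenerate relations.\<close>

lemma exponent_three_bound:
  assumes "inj_on f ({..<3::nat} \<times> {..<3::nat} \<times> {..<3::nat})"
    and "\<And>u v w. f (u, v, w) \<in> carrier G \<and> f (u, v, w) [^] (3::nat) = \<one>"
  shows False
proof -
  have "card (f ` ({..<3} \<times> {..<3} \<times> {..<3})) = 27" using assms(1) by (simp add: card_image)
  moreover have "card (f ` ({..<3} \<times> {..<3} \<times> {..<3})) \<le> card {x \<in> carrier G. x [^] (3::nat) = \<one>}"
    using assms(2) fin by (intro card_mono) auto
  ultimately show False using card_exponent_p by simp
qed

text \<open>Reading \<open>(m, n)\<close> as \<open>m + n (1 + \<omega>)\<close>, the rotation is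
  multiplication by the cube root of unity \<open>\<omega>\<close>, so \<open>L\<close> is an ideal
  of the Eisenstein integers. As it contains a power of 3, it is a power of the prime ideal
  \<open>(1 - \<omega>)\<close>, whose square is \<open>(3)\<close>. The alternatives are the
  exponents 0, 1 and at least 2.\<close>

lemma relation_lattice:
  fixes L :: "int \<Rightarrow> int \<Rightarrow> bool"
  assumes add: "\<And>m n m' n'. L m n \<Longrightarrow> L m' n' \<Longrightarrow> L (m + m') (n + n')"
    and neg: "\<And>m n. L m n \<Longrightarrow> L (- m) (- n)"
    and rot: "\<And>m n. L m n \<Longrightarrow> L (- m - n) m"
    and pow: "L (3 ^ s) 0" "L 0 (3 ^ s)"
  shows "(\<forall>m n. L m n) \<or> (\<forall>m n. L m n \<longleftrightarrow> 3 dvd m - n) \<or> (\<forall>m n. L m n \<longrightarrow> 3 dvd m \<and> 3 dvd n)"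
proof -
  have L0: "L 0 0" using add[OF pow(1) neg[OF pow(1)]] by simp
  have mulnat: "L (int i * m) (int i * n)" if "L m n" for i m n
    by (induction i) (use L0 that add[OF that] in \<open>simp_all add: distrib_right\<close>)
  have mul: "L (i * m) (i * n)" if "L m n" for i m n
  proof (cases i)
    case (nonneg j) then show ?thesis using mulnat[OF that] by simp
  next
    case (neg j) then show ?thesis using assms(2)[OF mulnat[OF that, of "Suc j"]] by (simp only: neg minus_mult_left)
  qed
  \<comment> \<open>The norm of \<open>(m, n)\<close>; an ideal contains the norms of its
    elements.\<close>
  let ?N = "\<lambda>m n. m * m + m * n + n * n :: int"
  have norm: "L (?N m n) 0 \<and> L 0 (?N m n)" if L: "L m n" for m n
  proof
    have "L ((m + n) * m + n * (- m - n)) ((m + n) * n + n * m) " by (rule add[OF mul[OF L] mul[OF rot[OF L]]])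
    from rot[OF this] have 1: "L (- ((m + n) * m + n * (- m - n)) - ((m + n) * n + n * m)) ((m + n) * m + n * (- m - n))" .
    have "L (m * m + - n * (- m - n)) (m * n + - n * m)" by (rule add[OF mul[OF L] mul[OF rot[OF L]]])
    then show *: "L (?N m n) 0" by (simp add: algebra_simps)
    show "L 0 (?N m n)" using rot[OF rot[OF *]] neg[OF rot[OF *]] add[OF rot[OF *] mul[OF *, of 1]] by simp
  qed
  have reduce: "L d 0 \<and> L 0 d" if d: "d = gcd (?N m n) (3 ^ s)" and L: "L m n" for m n d
  proof -
    obtain u v where uv: "u * ?N m n + v * 3 ^ s = d" using bezout_int[of "?N m n" "3 ^ s"] d by auto
    have "L (u * ?N m n + v * 3 ^ s) (u * 0 + v * 0)"
      using norm[OF L] by (intro add mul pow) simp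
    moreover have "L (u * 0 + v * 0) (u * ?N m n + v * 3 ^ s)"
      using norm[OF L] by (intro add mul pow) simp
    ultimately show ?thesis unfolding uv by simp
  qed
  show ?thesis
  proof (cases "\<exists>m n. L m n \<and> \<not> 3 dvd m - n")
    case True
    then obtain m n where mn: "L m n" "\<not> 3 dvd m - n" by blast
    \<comment> \<open>Modulo 3 the norm is the square of \<open>m - n\<close>.\<close>
    have "\<not> 3 dvd ?N m n"
    proof
      assume "3 dvd ?N m n"
      then have "3 dvd ?N m n - 3 * (m * n)" by (intro dvd_diff) simp_all
      moreover have "?N m n - 3 * (m * n) = (m - n) * (m - n)" by (simp add: algebra_simps)
      ultimately show False using mn(2) prime_dvd_mult_iff[of "3::int" "m - n" "m - n"] by simp
    qed
    then have "coprime 3 (?N m n)" by (intro prime_imp_coprime) simp_all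
    then have "gcd (?N m n) (3 ^ s) = 1" using coprime_power_left_iff[of 3 s "?N m n"] by (auto simp: gcd.commute coprime_iff_gcd_eq_1)
    then have 1: "L 1 0" "L 0 1" using reduce[OF refl mn(1)] by simp_all
    have "L m' n'" for m' n' using add[OF mul[OF 1(1), of m'] mul[OF 1(2), of n']] by simp
    then show ?thesis by blast
  next
    case False
    then have sub: "3 dvd m - n" if "L m n" for m n using that by blast
    show ?thesis
    proof (cases "\<exists>m n. L m n \<and> \<not> 3 dvd n")
      case True
      then obtain m n where mn: "L m n" "\<not> 3 dvd n" by blast
      obtain u where u: "m = n + 3 * u" using sub[OF mn(1)] by (auto simp: dvd_def algebra_simps)
      \<comment> \<open>An element of \<open>(1 - \<omega>)\<close> outside \<open>(3)\<close> has
        norm 3 times a number prime to 3, so 3 lies in the ideal.\<close>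
      define c where "c = n * n + 3 * (u * n) + 3 * (u * u)"
      have Nc: "?N m n = 3 * c" by (simp add: u c_def algebra_simps)
      have "\<not> 3 dvd c"
      proof
        assume "3 dvd c"
        then have "3 dvd c - 3 * (u * n + u * u)" by (intro dvd_diff) simp_all
        moreover have "c - 3 * (u * n + u * u) = n * n" by (simp add: c_def algebra_simps)
        ultimately show False using mn(2) prime_dvd_mult_iff[of "3::int" n n] by simp
      qed
      then have "coprime 3 c" by (intro prime_imp_coprime) simp_all
      then have cop: "coprime c (3 ^ s)" by (simp add: coprime_commute)
      have "gcd (?N m n) (3 ^ s) dvd 3"
        unfolding Nc using gcd_mult_right_right_cancel cop
        by (metis coprime_commute gcd.commute gcd_mult_left_right_cancel gcd_dvd1)
      then obtain q where q: "3 = gcd (?N m n) (3 ^ s) * q" by (auto simp: dvd_def)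
      have 3: "L 3 0" "L 0 3" using reduce[OF refl mn(1)] mul[of "gcd (?N m n) (3 ^ s)" 0 q] mul[of 0 "gcd (?N m n) (3 ^ s)" q] q
        by (simp_all add: mult.commute)
      obtain v w where "v * n + w * 3 = 1"
      proof -
        have "coprime 3 n" using mn(2) by (intro prime_imp_coprime) simp_all
        then show ?thesis using that bezout_int[of n 3] by (auto simp: gcd.commute coprime_iff_gcd_eq_1)
      qed
      then have vw: "v * m = 1 + 3 * (v * u - w)" "v * n = 1 + 3 * (- w)" by (simp_all add: u algebra_simps)
      have "L (v * m + (w - v * u) * 3 + w * 0) (v * n + (w - v * u) * 0 + w * 3)"
        by (intro add mul mn 3)
      then have 11: "L 1 1" unfolding vw by (simp add: algebra_simps)
      have "L m' n'" if "3 dvd m' - n'" for m' n'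
      proof -
        obtain x where "m' = n' + 3 * x" using \<open>3 dvd m' - n'\<close> by (auto simp: dvd_def algebra_simps)
        then show ?thesis using add[OF mul[OF 11, of n'] mul[OF 3(1), of x]] by (simp add: mult.commute)
      qed
      then show ?thesis using sub by blast
    next
      case no: False
      then have "3 dvd m \<and> 3 dvd n" if "L m n" for m n
        using that sub[OF that] by (metis dvd_add_left_iff diff_add_cancel)
      then show ?thesis by blast
    qed
  qed
qed

text \<open>For the ideals \<open>(1)\<close> and \<open>(1 - \<omega>)\<close> the relations are
  determined up to one parameter \<open>i\<close>, and \<open>3 dvd i\<close> would produce 27
  elements of exponent 3. For an ideal inside \<open>(3)\<close> only divisibility of the exponents
  by 9 is recorded: short walks cannot detect more.\<close>

lemma trichotomy:
  obtains (gray) i where "\<not> 3 dvd i" "\<And>m n t. nf m n t = \<one> \<longleftrightarrow> 3 dvd m \<and> 3 dvd n \<and> 3 dvd t + i * (m div 3) - i * (n div 3)"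
  | (mid) i where "\<not> 3 dvd i" "\<And>m n t. nf m n t = \<one> \<longleftrightarrow> 3 dvd m \<and> 9 dvd m - n \<and> 3 dvd t + i * (n div 3)"
  | (large) "\<And>m n t. nf m n t = \<one> \<Longrightarrow> 9 dvd m \<and> 9 dvd n"
proof -
  define L where "L = (\<lambda>m n. \<exists>t. nf (3 * m) (3 * n) t = \<one>)"
  have pw: "nf (3 * 3 ^ r) 0 0 = \<one>" "nf 0 (3 * 3 ^ r) 0 = \<one>"
  proof -
    have "x [^] (3 * 3 ^ r :: int) = \<one>" if "x \<in> carrier G" for x
    proof -
      have "x [^] ((3::nat) ^ r) = \<one>" using pow_card[OF that] by simp
      then have "x [^] (3 ^ r :: int) = \<one>" using int_pow_int[of G x "3 ^ r"] by simp
      then have "(x [^] (3 ^ r :: int)) [^] (3::int) = \<one>" by simp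
      then show ?thesis using that by (simp add: int_pow_pow mult.commute)
    qed
    then show "nf (3 * 3 ^ r) 0 0 = \<one>" "nf 0 (3 * 3 ^ r) 0 = \<one>" by (simp_all add: nf_def)
  qed
  have tri: "(\<forall>m n. L m n) \<or> (\<forall>m n. L m n \<longleftrightarrow> 3 dvd m - n) \<or> (\<forall>m n. L m n \<longrightarrow> 3 dvd m \<and> 3 dvd n)"
  proof (rule relation_lattice[where s = r])
    show "L (m + m') (n + n')" if L: "L m n" "L m' n'" for m n m' n'
    proof -
      obtain t t' where "nf (3 * m) (3 * n) t = \<one>" "nf (3 * m') (3 * n') t' = \<one>" using L by (auto simp: L_def)
      then have "nf (3 * (m + m')) (3 * (n + n')) (t + t') = \<one>" using nf_cube_mult[of m n t m' n' t'] by simp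
      then show ?thesis by (auto simp: L_def)
    qed
    show "L (- m) (- n)" if L: "L m n" for m n
    proof -
      obtain t where t: "nf (3 * m) (3 * n) t = \<one>" using L by (auto simp: L_def)
      have "nf (3 * m) (3 * n) t \<otimes> nf (3 * (- m)) (3 * (- n)) (- t) = \<one>" unfolding nf_cube_mult by simp
      then show ?thesis unfolding t by (auto simp: L_def)
    qed
    show "L (- m - n) m" if L: "L m n" for m n
    proof -
      obtain t where t: "nf (3 * m) (3 * n) t = \<one>" using L by (auto simp: L_def)
      then show ?thesis using \<alpha>_nf_cube[of m n t] unfolding L_def by (metis \<alpha>.hom_one)
    qed
    show "L (3 ^ r) 0" "L 0 (3 ^ r)" using pw by (auto simp: L_def)
  qed
  then consider "\<forall>m n. L m n" | "\<forall>m n. L m n \<longleftrightarrow> 3 dvd m - n" | "\<forall>m n. L m n \<longrightarrow> 3 dvd m \<and> 3 dvd n" by blast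
  then show thesis
  proof cases
    case 1
    then obtain t where "nf (3 * 1) (3 * 0) t = \<one>" unfolding L_def by blast
    then have "nf (3 * 1) (3 * 0) t \<otimes> nf (3 * 0) (3 * 0) (- t) = nf 0 0 (- t)" by simp
    then have a3: "nf (3 * 1) (3 * 0) 0 = k [^] (- t)" unfolding nf_cube_mult by (simp add: nf_k)
    \<comment> \<open>Applying \<open>\<alpha>\<close>, which fixes \<open>k\<close>, to the value
      of \<open>a [^] 3\<close> determines \<open>b [^] 3\<close>.\<close>
    have "\<alpha> (k [^] (- t)) = k [^] (- t)" by (simp add: \<alpha>.hom_int_pow \<alpha>_k)
    then have "nf (3 * (- 1 - 0)) (3 * 1) 0 = k [^] (- t)" by (simp only: a3[symmetric] \<alpha>_nf_cube)
    then have "nf (3 * 1) (3 * 0) 0 \<otimes> nf (3 * (- 1 - 0)) (3 * 1) 0 = k [^] (- t) \<otimes> k [^] (- t)"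
      by (simp only: a3)
    then have "nf 0 3 0 = k [^] (- t - t)" unfolding nf_cube_mult by (simp add: int_pow_mult[symmetric])
    also have "\<dots> = k [^] t" by (rule k_pow_cong) (simp add: cong_iff_dvd_diff)
    finally have b3: "b [^] (3::int) = k [^] t" by (simp add: nf_def)
    have a3: "a [^] (3::int) = k [^] (- t)" using a3 by (simp add: nf_def)
    have eq: "nf (3 * m) (3 * n) s = k [^] (s - t * m + t * n)" for m n s
      unfolding nf_cubes a3 b3 by (simp add: int_pow_pow int_pow_mult[symmetric] algebra_simps)
    have iff: "nf m n s = \<one> \<longleftrightarrow> 3 dvd m \<and> 3 dvd n \<and> 3 dvd s + (- t) * (m div 3) - (- t) * (n div 3)" for m n s
    proof (cases "3 dvd m \<and> 3 dvd n")
      case True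
      then obtain m' n' where "m = 3 * m'" "n = 3 * n'" by (auto simp: dvd_def)
      then show ?thesis by (simp add: eq k_pow_one_iff)
    qed (use nf_one_dvd in blast)
    have "\<not> 3 dvd - t"
    proof
      assume d: "3 dvd - t"
      let ?f = "\<lambda>(u::nat, v::nat, w::nat). nf (int u) (int v) (int w)"
      show False
      proof (rule exponent_three_bound[of ?f])
        show "inj_on ?f ({..<3} \<times> {..<3} \<times> {..<3})"
        proof (rule inj_onI, clarsimp)
          fix u v w u' v' w' :: nat assume lt: "u < 3" "v < 3" "w < 3" "u' < 3" "v' < 3" "w' < 3"
            and eq: "nf (int u) (int v) (int w) = nf (int u') (int v') (int w')"
          then have one: "nf (int u - int u') (int v - int v') (int w - int w' + (int v - int v') * int u') = \<one>"
            by (simp add: nf_eq_iff[of "int u"])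
          then have "3 dvd int u - int u'" "3 dvd int v - int v'" by (rule nf_one_dvd)+
          then have e: "u = u'" "v = v'" using lt by presburger+
          then have "3 dvd int w - int w'" using one by (simp add: nf_k k_pow_one_iff)
          then have "w = w'" using lt by presburger
          then show "u = u' \<and> v = v' \<and> w = w'" using e by simp
        qed
        show "?f (u, v, w) \<in> carrier G \<and> ?f (u, v, w) [^] (3::nat) = \<one>" for u v w
          using d by (simp add: nf_cube eq k_pow_one_iff dvd_diff)
      qed
    qed
    then show thesis using iff gray by blast
  next
    case 2
    have "L 1 1" using 2 by simp
    then obtain t where "nf (3 * 1) (3 * 1) t = \<one>" unfolding L_def by blast
    then have "nf (3 * 1) (3 * 1) t \<otimes> nf (3 * 0) (3 * 0) (- t) = nf 0 0 (- t)" by simp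
    then have ab: "nf (3 * 1) (3 * 1) 0 = k [^] (- t)" unfolding nf_cube_mult by (simp add: nf_k)
    have "nf (3 * (- 1 - 1)) (3 * 1) 0 = \<alpha> (nf (3 * 1) (3 * 1) 0)" by (rule \<alpha>_nf_cube[symmetric])
    also have "\<dots> = k [^] (- t)" unfolding ab by (simp add: \<alpha>.hom_int_pow \<alpha>_k)
    finally have "nf (3 * 2) (3 * 0) 0 \<otimes> nf (3 * (- 1 - 1)) (3 * 1) 0 = nf (3 * 2) (3 * 0) 0 \<otimes> nf (3 * 0) (3 * 0) (- t)"
      by (simp add: nf_k)
    then have b3: "nf (3 * 0) (3 * 1) 0 = nf (3 * 2) (3 * 0) (- t)" unfolding nf_cube_mult by simp
    have "nf (3 * 1) (3 * 0) 0 \<otimes> nf (3 * 0) (3 * 1) 0 = k [^] (- t)" using ab by (simp only: nf_cube_mult) simp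
    then have "nf (3 * 3) (3 * 0) (- t) = k [^] (- t)" unfolding b3 nf_cube_mult by simp
    then have "nf (3 * 3) (3 * 0) (- t) \<otimes> nf (3 * 0) (3 * 0) t = k [^] (- t) \<otimes> k [^] t" by (simp add: nf_k)
    then have a9: "nf (3 * 3) (3 * 0) 0 = \<one>" unfolding nf_cube_mult by (simp add: int_pow_mult[symmetric])
    have a9': "(a [^] (3::int)) [^] (3 * j) = \<one>" for j :: int
    proof -
      have "a [^] (9::int) = \<one>" using a9 by (simp add: nf_def)
      then have "(a [^] (9::int)) [^] j = \<one>" by simp
      then show ?thesis by (simp add: int_pow_pow)
    qed
    have b3': "b [^] (3::int) = (a [^] (3::int)) [^] (2::int) \<otimes> k [^] (- t)"
      using b3 by (simp add: nf_def int_pow_pow)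
    have eq: "nf (3 * m) (3 * n) s = (a [^] (3::int)) [^] (m + 2 * n) \<otimes> k [^] (s - t * n)" for m n s
    proof -
      have "(b [^] (3::int)) [^] n = ((a [^] (3::int)) [^] (2::int)) [^] n \<otimes> (k [^] (- t)) [^] n"
        unfolding b3' by (rule int_pow_mult_distrib) (simp_all add: k_comm)
      then have "(b [^] (3::int)) [^] n = (a [^] (3::int)) [^] (2 * n) \<otimes> k [^] (- t * n)" by (simp add: int_pow_pow)
      then show ?thesis unfolding nf_cubes by (simp add: m_assoc int_pow_mult[symmetric]) (simp add: m_assoc[symmetric] int_pow_mult[symmetric] add.commute)
    qed
    have iff: "nf m n s = \<one> \<longleftrightarrow> 3 dvd m \<and> 9 dvd m - n \<and> 3 dvd s + (- t) * (n div 3)" for m n s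
    proof (cases "3 dvd m \<and> 9 dvd m - n")
      case True
      then obtain m' j where m': "m = 3 * m'" "m - n = 9 * j" by (auto simp: dvd_def)
      then have n': "n = 3 * (m' - 3 * j)" by simp
      have "nf m n s = (a [^] (3::int)) [^] (3 * (m' - 2 * j)) \<otimes> k [^] (s - t * (m' - 3 * j))"
        unfolding m'(1) n' eq by (simp add: algebra_simps)
      also have "\<dots> = k [^] (s - t * (m' - 3 * j))" by (simp only: a9' l_one k int_pow_closed)
      finally show ?thesis using True by (simp add: k_pow_one_iff n')
    next
      case False
      have "nf m n s \<noteq> \<one>"
      proof
        assume one: "nf m n s = \<one>"
        obtain m' n' where mn: "m = 3 * m'" "n = 3 * n'" using nf_one_dvd[OF one] by (auto simp: dvd_def)
        then have "L m' n'" using one by (auto simp: L_def)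
        then have "3 dvd m' - n'" using 2 by blast
        then show False using False by (simp add: mn) presburger
      qed
      then show ?thesis using False by blast
    qed
    have "\<not> 3 dvd - t"
    proof
      assume d: "3 dvd - t"
      \<comment> \<open>These elements have exponents of \<open>a\<close> and \<open>b\<close> that
        are congruent modulo 3; if 3 divided \<open>t\<close>, their cubes would all be
        trivial.\<close>
      let ?f = "\<lambda>(u::nat, v::nat, w::nat). nf (int u + 3 * int v) (int u) (int w)"
      show False
      proof (rule exponent_three_bound[of ?f])
        show "inj_on ?f ({..<3} \<times> {..<3} \<times> {..<3})"
        proof (rule inj_onI, clarsimp)
          fix u v w u' v' w' :: nat assume lt: "u < 3" "v < 3" "w < 3" "u' < 3" "v' < 3" "w' < 3"
            and eq: "nf (int u + 3 * int v) (int u) (int w) = nf (int u' + 3 * int v') (int u') (int w')"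
          then have one: "nf (int u + 3 * int v - (int u' + 3 * int v')) (int u - int u') (int w - int w' + (int u - int u') * (int u' + 3 * int v')) = \<one>"
            by (simp add: nf_eq_iff[of "int u + 3 * int v"])
          then have "3 dvd int u + 3 * int v - (int u' + 3 * int v')" "9 dvd (int u + 3 * int v - (int u' + 3 * int v')) - (int u - int u')"
            using iff by blast+
          then have e: "u = u'" "v = v'" using lt by presburger+
          then have "3 dvd int w - int w'" using one by (simp add: nf_k k_pow_one_iff)
          then have "w = w'" using lt by presburger
          then show "u = u' \<and> v = v' \<and> w = w'" using e by simp
        qed
        show "?f (u, v, w) \<in> carrier G \<and> ?f (u, v, w) [^] (3::nat) = \<one>" for u v w
        proof -
          have "9 dvd 3 * (int u + 3 * int v) - 3 * int u" by simp
          then show ?thesis using d by (simp add: nf_cube iff)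
        qed
      qed
    qed
    then show thesis using iff mid by blast
  next
    case 3
    show thesis
    proof (rule large)
      fix m n t assume one: "nf m n t = \<one>"
      obtain m' n' where mn: "m = 3 * m'" "n = 3 * n'" using nf_one_dvd[OF one] by (auto simp: dvd_def)
      then have "L m' n'" using one by (auto simp: L_def)
      then have "3 dvd m' \<and> 3 dvd n'" using 3 by blast
      then show "9 dvd m \<and> 9 dvd n" by (simp add: mn) presburger
    qed
  qed
qed

end

section \<open>Cubic edge-transitive graphs\<close>

lemma group_aut_group: "group (aut_group G)"
proof -
  interpret B: group "BijGroup (pverts G)" by (rule group_BijGroup)
  have "subgroup (graph_aut G) (BijGroup (pverts G))"
  proof (rule B.subgroupI)
    show "graph_aut G \<subseteq> carrier (BijGroup (pverts G))" by (auto simp: graph_aut_def BijGroup_def)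
    have "(\<lambda>x\<in>pverts G. x) \<in> graph_aut G" using B.one_closed by (simp add: graph_aut_def BijGroup_def)
    then show "graph_aut G \<noteq> {}" by blast
    fix f assume f: "f \<in> graph_aut G"
    then have b: "f \<in> Bij (pverts G)" "bij_betw f (pverts G) (pverts G)" by (simp_all add: graph_aut_def Bij_def)
    have "restrict (inv_into (pverts G) f) (pverts G) \<in> Bij (pverts G)"
      using b(1) by (rule restrict_inv_into_Bij)
    moreover have "inv_into (pverts G) f u \<in> pverts G" "f (inv_into (pverts G) f u) = u" if "u \<in> pverts G" for u
      using that b(2) by (auto simp: bij_betw_def intro: inv_into_into f_inv_into_f)
    ultimately show "inv\<^bsub>BijGroup (pverts G)\<^esub> f \<in> graph_aut G"
      using f b(1) by (simp add: inv_BijGroup) (simp add: graph_aut_def)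
  next
    fix f g assume "f \<in> graph_aut G" "g \<in> graph_aut G"
    moreover from this have aut_fun: "g u \<in> pverts G" if "u \<in> pverts G" for u
      using that by (auto simp: graph_aut_def Bij_def bij_betw_def)
    ultimately show "f \<otimes>\<^bsub>BijGroup (pverts G)\<^esub> g \<in> graph_aut G"
      using aut_fun by (simp add: graph_aut_def BijGroup_def compose_Bij compose_eq)
  qed
  then show ?thesis unfolding aut_group_def by (rule subgroup.subgroup_is_group[OF _ B.is_group])
qed

lemma carrier_aut_group [simp]: "carrier (aut_group G) = graph_aut G"
  by (simp add: aut_group_def)

lemma aut_closed: "f \<in> graph_aut G \<Longrightarrow> v \<in> pverts G \<Longrightarrow> f v \<in> pverts G"
  by (auto simp: graph_aut_def Bij_def bij_betw_def)

lemma aut_bij: "f \<in> graph_aut G \<Longrightarrow> bij_betw f (pverts G) (pverts G)"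
  by (simp add: graph_aut_def Bij_def)

lemma aut_inj: "f \<in> graph_aut G \<Longrightarrow> u \<in> pverts G \<Longrightarrow> v \<in> pverts G \<Longrightarrow> f u = f v \<longleftrightarrow> u = v"
  using aut_bij by (auto simp: bij_betw_def inj_on_def)

lemma aut_arc: "f \<in> graph_aut G \<Longrightarrow> u \<in> pverts G \<Longrightarrow> v \<in> pverts G \<Longrightarrow> (f u, f v) \<in> parcs G \<longleftrightarrow> (u, v) \<in> parcs G"
  by (simp add: graph_aut_def)

lemma aut_ext: "f \<in> graph_aut G \<Longrightarrow> g \<in> graph_aut G \<Longrightarrow> (\<And>v. v \<in> pverts G \<Longrightarrow> f v = g v) \<Longrightarrow> f = g"
  by (rule extensionalityI[of _ "pverts G"]) (auto simp: graph_aut_def Bij_def)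

lemma aut_mult_app:
  "f \<in> graph_aut G \<Longrightarrow> g \<in> graph_aut G \<Longrightarrow> v \<in> pverts G \<Longrightarrow> (f \<otimes>\<^bsub>aut_group G\<^esub> g) v = f (g v)"
  by (simp add: aut_group_def graph_aut_def BijGroup_def compose_eq)

lemma aut_one_app: "v \<in> pverts G \<Longrightarrow> \<one>\<^bsub>aut_group G\<^esub> v = v"
  by (simp add: aut_group_def BijGroup_def)

lemma aut_inv_closed: "f \<in> graph_aut G \<Longrightarrow> inv\<^bsub>aut_group G\<^esub> f \<in> graph_aut G"
  using group.inv_closed[OF group_aut_group] by simp

lemma aut_mult_closed: "f \<in> graph_aut G \<Longrightarrow> g \<in> graph_aut G \<Longrightarrow> f \<otimes>\<^bsub>aut_group G\<^esub> g \<in> graph_aut G"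
  using monoid.m_closed[OF group.is_monoid[OF group_aut_group]] by simp

lemma aut_inv_app:
  assumes "f \<in> graph_aut G" "v \<in> pverts G"
  shows "(inv\<^bsub>aut_group G\<^esub> f) (f v) = v" "f ((inv\<^bsub>aut_group G\<^esub> f) v) = v"
proof -
  interpret A: group "aut_group G" by (rule group_aut_group)
  have "(inv\<^bsub>aut_group G\<^esub> f \<otimes>\<^bsub>aut_group G\<^esub> f) v = v" "(f \<otimes>\<^bsub>aut_group G\<^esub> inv\<^bsub>aut_group G\<^esub> f) v = v"
    using assms aut_one_app[of v G] by (simp_all only: A.l_inv A.r_inv carrier_aut_group)
  then show "(inv\<^bsub>aut_group G\<^esub> f) (f v) = v" "f ((inv\<^bsub>aut_group G\<^esub> f) v) = v"
    using assms aut_mult_app[of f G "inv\<^bsub>aut_group G\<^esub> f" v] aut_mult_app[of "inv\<^bsub>aut_group G\<^esub> f" G f v] aut_inv_closed[of f G]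
    by (simp_all only:)
qed

lemma aut_pow_app:
  assumes "f \<in> graph_aut G" "v \<in> pverts G"
  shows "(f [^]\<^bsub>aut_group G\<^esub> (k::nat)) v = (f ^^ k) v"
proof -
  interpret A: group "aut_group G" by (rule group_aut_group)
  have "f [^]\<^bsub>aut_group G\<^esub> k \<in> graph_aut G" for k :: nat using A.nat_pow_closed[of f k] assms by simp
  then show ?thesis using assms
    by (induction k arbitrary: v) (simp_all add: aut_one_app aut_mult_app aut_closed funpow_swap1)
qed

lemma finite_graph_aut: "finite (pverts G) \<Longrightarrow> finite (graph_aut G)"
  by (rule finite_subset[of _ "pverts G \<rightarrow>\<^sub>E pverts G"])
    (auto simp: graph_aut_def Bij_def bij_betw_def PiE_iff extensional_def intro!: finite_PiE)

text \<open>Connectedness is stated as an induction principle: a nonempty set of vertices closed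
  under adjacency is everything. In this form the assumptions are easily transported along a
  bijection of vertices.\<close>

locale cubic_edge_transitive =
  fixes G :: "'v pair_pre_digraph"
  assumes fin: "finite (pverts G)" and arcs: "parcs G \<subseteq> pverts G \<times> pverts G"
    and sym: "\<And>u v. (u, v) \<in> parcs G \<Longrightarrow> (v, u) \<in> parcs G" and irrefl: "\<And>u. (u, u) \<notin> parcs G"
    and deg: "\<And>v. v \<in> pverts G \<Longrightarrow> card (parcs G `` {v}) = 3"
    and conn: "\<And>U. U \<subseteq> pverts G \<Longrightarrow> U \<noteq> {} \<Longrightarrow> (\<And>u v. u \<in> U \<Longrightarrow> (u, v) \<in> parcs G \<Longrightarrow> v \<in> U) \<Longrightarrow> U = pverts G"
    and ne: "pverts G \<noteq> {}"
    and et: "edge_transitive G"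
begin

sublocale A: group "aut_group G" by (rule group_aut_group)

lemma arc_vert: "(u, v) \<in> parcs G \<Longrightarrow> u \<in> pverts G \<and> v \<in> pverts G"
  using arcs by blast

lemma finite_nbrs: "finite (parcs G `` {v})"
  by (rule finite_subset[OF _ fin]) (use arcs in blast)

lemma aut_nbrs:
  assumes "f \<in> graph_aut G" "v \<in> pverts G" shows "f ` (parcs G `` {v}) = parcs G `` {f v}"
proof
  show "f ` (parcs G `` {v}) \<subseteq> parcs G `` {f v}" using aut_arc[OF assms(1,2)] arc_vert by auto
  show "parcs G `` {f v} \<subseteq> f ` (parcs G `` {v})"
  proof
    fix w assume "w \<in> parcs G `` {f v}"
    then have w: "(f v, w) \<in> parcs G" by simp
    let ?w = "(inv\<^bsub>aut_group G\<^esub> f) w"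
    have "w \<in> pverts G" using w arc_vert by blast
    then have "f ?w = w" "?w \<in> pverts G" using assms by (simp_all add: aut_inv_app aut_closed aut_inv_closed)
    then show "w \<in> f ` (parcs G `` {v})" using w assms aut_arc[of f G v ?w] by (intro image_eqI[of _ _ ?w]) simp_all
  qed
qed

lemma ex_arc: "v \<in> pverts G \<Longrightarrow> \<exists>w. (v, w) \<in> parcs G"
  using deg[of v] by (metis Image_singleton_iff card.empty equals0I zero_neq_numeral)

text \<open>The moved neighbours of a fixed vertex come in multiples of \<open>p\<close>, and there
  are at most three of them, or two if some neighbour is fixed. So all neighbours are fixed, and the
  property spreads by connectedness; for \<open>p = 3\<close> the fixed neighbour is part of the
  property that spreads.\<close>

lemma prime_order_fix:
  fixes p :: nat
  assumes p: "Factorial_Ring.prime p" "odd p" and \<sigma>: "\<sigma> \<in> graph_aut G" "\<sigma> [^]\<^bsub>aut_group G\<^esub> p = \<one>\<^bsub>aut_group G\<^esub>"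
    and v: "v \<in> pverts G" "\<sigma> v = v" and or: "5 \<le> p \<or> (\<exists>w. (v, w) \<in> parcs G \<and> \<sigma> w = w)"
  shows "\<sigma> = \<one>\<^bsub>aut_group G\<^esub>"
proof -
  have nbrs: "\<sigma> w = w" if v: "v \<in> pverts G" "\<sigma> v = v" and or: "5 \<le> p \<or> (\<exists>w. (v, w) \<in> parcs G \<and> \<sigma> w = w)"
    and w: "(v, w) \<in> parcs G" for v w
  proof (rule ccontr)
    assume ne: "\<sigma> w \<noteq> w"
    let ?S = "parcs G `` {v}" let ?N = "{x \<in> ?S. \<sigma> x \<noteq> x}"
    have "inj_on \<sigma> ?S" by (rule inj_on_subset[of _ "pverts G"]) (use aut_bij[OF \<sigma>(1)] arcs in \<open>auto simp: bij_betw_def\<close>)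
    then have "bij_betw \<sigma> ?S ?S" using aut_nbrs[OF \<sigma>(1) v(1)] v(2) by (simp add: bij_betw_def)
    moreover have "(\<sigma> ^^ p) x = x" if "x \<in> ?S" for x
      using aut_pow_app[OF \<sigma>(1), of x p] \<sigma>(2) that arc_vert by (simp add: aut_one_app)
    ultimately have d: "p dvd card ?N" by (rule card_fixed_order_prime_cong[OF p(1) finite_nbrs])
    have "w \<in> ?N" "finite ?N" using w ne finite_subset[OF _ finite_nbrs[of v], of ?N] by auto
    then have "card ?N > 0" by (auto simp: card_gt_0_iff simp del: mem_Collect_eq)
    then have le: "p \<le> card ?N" using d dvd_imp_le by blast
    have "card ?N \<le> card ?S" by (rule card_mono) (use finite_nbrs in auto)
    then have "p \<le> 3" using le deg[OF v(1)] by linarith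
    then obtain u where u: "(v, u) \<in> parcs G" "\<sigma> u = u" using or by auto
    have "card ?N < card ?S" by (rule psubset_card_mono) (use finite_nbrs u in auto)
    then have "p \<le> 2" using le deg[OF v(1)] by linarith
    then show False using p prime_ge_2_nat[OF p(1)] by auto
  qed
  let ?U = "{v \<in> pverts G. \<sigma> v = v \<and> (5 \<le> p \<or> (\<exists>w. (v, w) \<in> parcs G \<and> \<sigma> w = w))}"
  have "?U = pverts G"
  proof (rule conn)
    show "?U \<noteq> {}" using v or by blast
    fix u w assume "u \<in> ?U" and uw: "(u, w) \<in> parcs G"
    then have u: "u \<in> pverts G" "\<sigma> u = u" "5 \<le> p \<or> (\<exists>w. (u, w) \<in> parcs G \<and> \<sigma> w = w)" by blast+
    then have "\<sigma> w = w" using nbrs[OF u uw] by blast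
    then show "w \<in> ?U" using sym[OF uw] arc_vert[OF uw] u by blast
  qed blast
  then have "\<sigma> v = v" if "v \<in> pverts G" for v using that by blast
  then show ?thesis using \<sigma>(1) A.one_closed by (intro aut_ext[of _ G]) (simp_all add: aut_one_app)
qed

text \<open>If no automorphism reverses an edge, an orbit of arcs orients the graph; unless all arcs at a vertex
  agree in direction, in- and outdegree are constant and equal, although they sum up to 3.\<close>

lemma locally_transitive:
  assumes uv: "(u, v) \<in> parcs G" and uw: "(u, w) \<in> parcs G"
  shows "\<exists>f\<in>graph_aut G. f u = u \<and> f v = w"
proof -
  obtain x y where xy: "(x, y) \<in> parcs G" using ne ex_arc by blast
  have xyV: "x \<in> pverts G" "y \<in> pverts G" using arc_vert[OF xy] by blast+
  \<comment> \<open>The orbit of one arc; edge-transitivity puts at least one direction of every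
    edge into it.\<close>
  define D where "D = (\<lambda>f. (f x, f y)) ` graph_aut G"
  have trans: "\<exists>h\<in>graph_aut G. h a = a' \<and> h b = b'" if ab: "(a, b) \<in> D" "(a', b') \<in> D" for a b a' b'
  proof -
    obtain f g where fg: "f \<in> graph_aut G" "g \<in> graph_aut G" "a = f x" "b = f y" "a' = g x" "b' = g y"
      using ab by (auto simp: D_def)
    let ?h = "g \<otimes>\<^bsub>aut_group G\<^esub> inv\<^bsub>aut_group G\<^esub> f"
    have "?h (f z) = g z" if "z \<in> pverts G" for z
      using fg(1,2) that by (simp add: aut_mult_app aut_inv_closed aut_inv_app aut_closed)
    moreover have "?h \<in> graph_aut G" using fg(1,2) by (simp add: aut_inv_closed aut_mult_closed)
    ultimately show ?thesis using fg xyV by blast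
  qed
  have closed: "(h a, h b) \<in> D" if ab: "(a, b) \<in> D" "h \<in> graph_aut G" for h a b
  proof -
    obtain f where f: "f \<in> graph_aut G" "(a, b) = (f x, f y)" using ab(1) unfolding D_def by blast
    have "(h a, h b) = ((h \<otimes>\<^bsub>aut_group G\<^esub> f) x, (h \<otimes>\<^bsub>aut_group G\<^esub> f) y)"
      using f ab(2) xyV by (simp add: aut_mult_app)
    then show ?thesis using aut_mult_closed[OF ab(2) f(1)] unfolding D_def by (rule image_eqI[where f = "\<lambda>f. (f x, f y)"])
  qed
  have xyD: "(x, y) \<in> D" unfolding D_def using A.one_closed xyV by (intro image_eqI[of _ _ "\<one>\<^bsub>aut_group G\<^esub>"]) (simp_all add: aut_one_app)
  have DE: "D \<subseteq> parcs G" using xy xyV by (auto simp: D_def aut_arc)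
  have orient: "(a, b) \<in> D \<or> (b, a) \<in> D" if ab: "(a, b) \<in> parcs G" for a b
  proof -
    obtain f where "f \<in> graph_aut G" "{f x, f y} = {a, b}" using et xy ab unfolding edge_transitive_def by blast
    then show ?thesis unfolding D_def by (auto simp: doubleton_eq_iff)
  qed
  show ?thesis
  proof (cases "\<exists>a b. (a, b) \<in> D \<and> (b, a) \<in> D")
    case True
    then obtain a b h where ab: "(a, b) \<in> D" "h \<in> graph_aut G" "h a = b" "h b = a" using trans by blast
    \<comment> \<open>One reversible edge makes all edges reversible, so \<open>D\<close> contains
      every arc.\<close>
    have "(c, d) \<in> D" if "(d, c) \<in> D" for c d
    proof -
      obtain f where f: "f \<in> graph_aut G" "f a = d" "f b = c" using trans[OF ab(1) \<open>(d, c) \<in> D\<close>] by blast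
      from closed[OF closed[OF ab(1,2)] f(1)] show ?thesis using f ab by simp
    qed
    then have "(u, v) \<in> D" "(u, w) \<in> D" using orient[OF uv] orient[OF uw] by blast+
    then show ?thesis by (rule trans)
  next
    case False
    let ?o = "\<lambda>v. card (D `` {v})" let ?i = "\<lambda>v. card (D\<inverse> `` {v})"
    have finD: "finite (D `` {v})" "finite (D\<inverse> `` {v})" for v
      by (rule finite_subset[OF _ fin], use DE arcs in blast)+
    have sum3: "?o v + ?i v = 3" if v: "v \<in> pverts G" for v
    proof -
      have "parcs G `` {v} = D `` {v} \<union> D\<inverse> `` {v}" using orient DE sym by blast
      moreover have "D `` {v} \<inter> D\<inverse> `` {v} = {}" using False by blast
      ultimately show ?thesis using deg[OF v] finD by (simp add: card_Un_disjoint)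
    qed
    have img: "?o (h v) = ?o v" "?i (h v) = ?i v" if h: "h \<in> graph_aut G" and v: "v \<in> pverts G" for h v
    proof -
      have sub: "?o v \<le> ?o (h v) \<and> ?i v \<le> ?i (h v)" if h: "h \<in> graph_aut G" and v: "v \<in> pverts G" for h v
      proof
        have V: "D `` {v} \<subseteq> pverts G" "D\<inverse> `` {v} \<subseteq> pverts G" using DE arcs by blast+
        have inj: "inj_on h (pverts G)" using aut_bij[OF h] by (simp add: bij_betw_def)
        show "?o v \<le> ?o (h v)"
          by (rule card_inj_on_le[of h]) (use closed h finD inj_on_subset[OF inj V(1)] in auto)
        show "?i v \<le> ?i (h v)"
          by (rule card_inj_on_le[of h]) (use closed h finD inj_on_subset[OF inj V(2)] in auto)
      qed
      from sub[OF h v] sub[OF aut_inv_closed[OF h] aut_closed[OF h v]]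
      show "?o (h v) = ?o v" "?i (h v) = ?i v" using h v by (simp_all add: aut_inv_app)
    qed
    have oconst: "?o a = ?o a'" if "?o a > 0" "?o a' > 0" for a a'
    proof -
      obtain b b' where b: "(a, b) \<in> D" "(a', b') \<in> D" using \<open>?o a > 0\<close> \<open>?o a' > 0\<close> by (auto simp: card_gt_0_iff)
      obtain h where h: "h \<in> graph_aut G" "h a = a'" using trans[OF b] by blast
      have "(a, b) \<in> parcs G" using b(1) DE by blast
      then have "a \<in> pverts G" using arc_vert by blast
      from img(1)[OF h(1) this] show ?thesis using h(2) by simp
    qed
    have iconst: "?i a = ?i a'" if "?i a > 0" "?i a' > 0" for a a'
    proof -
      obtain b b' where b: "(b, a) \<in> D" "(b', a') \<in> D" using \<open>?i a > 0\<close> \<open>?i a' > 0\<close> by (auto simp: card_gt_0_iff)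
      obtain h where h: "h \<in> graph_aut G" "h a = a'" using trans[OF b] by blast
      have "(b, a) \<in> parcs G" using b(1) DE by blast
      then have "a \<in> pverts G" using arc_vert by blast
      from img(2)[OF h(1) this] show ?thesis using h(2) by simp
    qed
    have "?o a = 0 \<or> ?i a = 0" if a: "a \<in> pverts G" for a
    proof (rule ccontr)
      assume "\<not> (?o a = 0 \<or> ?i a = 0)"
      then have pos: "?o a > 0" "?i a > 0" by simp_all
      have all: "?o v = ?o a" if v: "v \<in> pverts G" for v
      proof (cases "?o v = 0")
        case True
        then have "?i v = 3" using sum3[OF v] by simp
        then show ?thesis using iconst[OF _ pos(2), of v] sum3[OF a] pos by simp
      qed (use oconst[OF _ pos(1)] in simp)
      then have all': "?i v = ?i a" if "v \<in> pverts G" for v using that sum3[OF that] sum3[OF a] by fastforce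
      have "D = Sigma (pverts G) (\<lambda>v. D `` {v})" using DE arcs by auto
      then have "card D = (\<Sum>v\<in>pverts G. ?o v)" using card_SigmaI[OF fin, of "\<lambda>v. D `` {v}"] finD by simp
      moreover have "D\<inverse> = Sigma (pverts G) (\<lambda>v. D\<inverse> `` {v})" using DE arcs by auto
      then have "card (D\<inverse>) = (\<Sum>v\<in>pverts G. ?i v)" using card_SigmaI[OF fin, of "\<lambda>v. D\<inverse> `` {v}"] finD by simp
      moreover have "card (D\<inverse>) = card D" by (rule card_inverse)
      ultimately have "card (pverts G) * ?o a = card (pverts G) * ?i a" using all all' by simp
      then have "?o a = ?i a" using ne fin by (simp add: card_gt_0_iff)
      then show False using sum3[OF a] by presburger
    qed
    then have "D `` {u} = {} \<or> D\<inverse> `` {u} = {}" using finD arc_vert[OF uv] by auto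
    then consider "(u, v) \<in> D" "(u, w) \<in> D" | "(v, u) \<in> D" "(w, u) \<in> D" using orient[OF uv] orient[OF uw] by blast
    then show ?thesis by cases (use trans in blast)+
  qed
qed

end

section \<open>Bi-Cayley graphs\<close>

locale bicay = group H for H :: "('h, 'm) monoid_scheme" (structure) +
  fixes R L S
  assumes data: "bicay_data H R L S" and cet: "cubic_edge_transitive (BiCay H R L S)"
begin

abbreviation B where "B \<equiv> BiCay H R L S"

sublocale cubic_edge_transitive B by (rule cet)

lemma vert_iff [simp]: "Inl h \<in> pverts B \<longleftrightarrow> h \<in> carrier H" "Inr h \<in> pverts B \<longleftrightarrow> h \<in> carrier H"
  by (auto simp: BiCay_def)

lemma vertE:
  assumes "v \<in> pverts B" obtains h where "h \<in> carrier H" "v = Inl h" | h where "h \<in> carrier H" "v = Inr h"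
  using assms by (cases v) auto

lemma arc_iff:
  "(Inl h, Inl g) \<in> parcs B \<longleftrightarrow> h \<in> carrier H \<and> g \<in> carrier H \<and> g \<otimes> inv h \<in> R"
  "(Inr h, Inr g) \<in> parcs B \<longleftrightarrow> h \<in> carrier H \<and> g \<in> carrier H \<and> g \<otimes> inv h \<in> L"
  "(Inl h, Inr g) \<in> parcs B \<longleftrightarrow> h \<in> carrier H \<and> g \<in> carrier H \<and> g \<otimes> inv h \<in> S"
  "(Inr g, Inl h) \<in> parcs B \<longleftrightarrow> h \<in> carrier H \<and> g \<in> carrier H \<and> g \<otimes> inv h \<in> S"
  by (auto simp: BiCay_def)

lemma finH: "finite (carrier H)"
  using fin by (simp add: BiCay_def)

lemma card_verts: "card (pverts B) = 2 * order H"
  using finH by (simp add: BiCay_def card_Plus order_def)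

abbreviation rt where "rt \<equiv> right_translation H"

lemma rt_app [simp]:
  "h \<in> carrier H \<Longrightarrow> rt g (Inl h) = Inl (h \<otimes> g)" "h \<in> carrier H \<Longrightarrow> rt g (Inr h) = Inr (h \<otimes> g)"
  by (auto simp: right_translation_def)

lemma rt_aut: assumes g: "g \<in> carrier H" shows "rt g \<in> graph_aut B"
proof -
  have 1: "x \<otimes> g \<otimes> inv (y \<otimes> g) = x \<otimes> inv y" if "x \<in> carrier H" "y \<in> carrier H" for x y
    using that g by (simp add: inv_mult_group m_assoc)
  have arc: "(u, v) \<in> parcs B \<longleftrightarrow> (rt g u, rt g v) \<in> parcs B" if "u \<in> pverts B" "v \<in> pverts B" for u v
    using that g by (auto elim!: vertE simp: arc_iff 1)
  have inj: "inj_on (rt g) (pverts B)" using g by (auto elim!: vertE intro!: inj_onI)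
  have "rt g ` pverts B \<subseteq> pverts B" using g by (auto elim!: vertE)
  then have "rt g ` pverts B = pverts B" using inj fin by (intro endo_inj_surj) auto
  moreover have "rt g \<in> extensional (pverts B)" by (simp add: right_translation_def BiCay_def)
  ultimately show ?thesis using inj arc by (auto simp: graph_aut_def Bij_def bij_betw_def)
qed

lemma rt_eqI: "f \<in> graph_aut B \<Longrightarrow> g \<in> carrier H \<Longrightarrow> (\<And>v. v \<in> pverts B \<Longrightarrow> f v = rt g v) \<Longrightarrow> f = rt g"
  using aut_ext rt_aut by blast

text \<open>Composition reverses the order, so the embedding of \<open>H\<close> has to send
  \<open>g\<close> to \<open>rt (inv g)\<close>.\<close>

lemma rt_mult:
  assumes "g \<in> carrier H" "h \<in> carrier H" shows "rt g \<otimes>\<^bsub>aut_group B\<^esub> rt h = rt (h \<otimes> g)"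
proof (rule rt_eqI)
  fix v assume "v \<in> pverts B"
  then show "(rt g \<otimes>\<^bsub>aut_group B\<^esub> rt h) v = rt (h \<otimes> g) v"
    using assms by (auto simp: aut_mult_app rt_aut m_assoc elim: vertE)
qed (use assms in \<open>simp_all add: rt_aut aut_mult_closed\<close>)

lemma rt_one: "rt \<one> = \<one>\<^bsub>aut_group B\<^esub>"
proof (rule rt_eqI[symmetric])
  fix v assume "v \<in> pverts B"
  then show "\<one>\<^bsub>aut_group B\<^esub> v = rt \<one> v" by (auto simp: aut_one_app elim!: vertE)
qed (use A.one_closed in simp_all)

lemma rt_inv: assumes "g \<in> carrier H" shows "inv\<^bsub>aut_group B\<^esub> rt g = rt (inv g)"
  by (rule A.inv_equality) (use assms in \<open>simp_all add: rt_mult rt_one rt_aut\<close>)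

lemma rt_inject: assumes "g \<in> carrier H" "h \<in> carrier H" shows "rt g = rt h \<longleftrightarrow> g = h"
proof
  assume "rt g = rt h"
  then have "rt g (Inl \<one>) = rt h (Inl \<one>)" by simp
  then show "g = h" using assms by simp
qed simp

abbreviation RT where "RT \<equiv> right_translations H"

lemma RT_subgroup: "subgroup RT (aut_group B)"
proof (rule A.subgroupI)
  fix f assume "f \<in> RT"
  then show "inv\<^bsub>aut_group B\<^esub> f \<in> RT" by (auto simp: right_translations_def rt_inv)
next
  fix f f' assume "f \<in> RT" "f' \<in> RT"
  then show "f \<otimes>\<^bsub>aut_group B\<^esub> f' \<in> RT" by (auto simp: right_translations_def rt_mult)
qed (auto simp: right_translations_def rt_aut)

lemma card_RT: "card RT = order H"
  unfolding right_translations_def order_def by (rule card_image) (simp add: inj_on_def rt_inject)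

lemma finA: "finite (carrier (aut_group B))"
  using finite_graph_aut[OF fin] by simp

lemma rt_inv_hom: "(\<lambda>g. rt (inv g)) \<in> hom H (aut_group B)"
  by (rule homI) (simp_all add: rt_aut rt_mult inv_mult_group)

lemma free_subgroup_card:
  assumes Q: "subgroup Q (aut_group B)" and v: "v \<in> pverts B"
    and free: "\<And>f. f \<in> Q \<Longrightarrow> f v = v \<Longrightarrow> f = \<one>\<^bsub>aut_group B\<^esub>"
  shows "card Q \<le> 2 * order H"
proof -
  have Qa: "f \<in> graph_aut B" if "f \<in> Q" for f using subgroup.mem_carrier[OF Q that] by simp
  have "inj_on (\<lambda>f. f v) Q"
  proof (rule inj_onI)
    fix f g assume fg: "f \<in> Q" "g \<in> Q" "f v = g v"
    have "(inv\<^bsub>aut_group B\<^esub> f \<otimes>\<^bsub>aut_group B\<^esub> g) v = v"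
      using fg v Qa by (simp add: aut_mult_app aut_inv_closed) (simp add: fg(3)[symmetric] aut_inv_app)
    then have "inv\<^bsub>aut_group B\<^esub> f \<otimes>\<^bsub>aut_group B\<^esub> g = \<one>\<^bsub>aut_group B\<^esub>"
      using fg Q by (intro free) (simp_all add: subgroup.m_closed subgroup.m_inv_closed)
    then have "f \<otimes>\<^bsub>aut_group B\<^esub> (inv\<^bsub>aut_group B\<^esub> f \<otimes>\<^bsub>aut_group B\<^esub> g) = f" using Qa[OF fg(1)] by simp
    then show "f = g" using Qa fg(1,2) A.m_inv_cancel(1)[of f g] by simp
  qed
  then have "card Q = card ((\<lambda>f. f v) ` Q)" by (simp add: card_image)
  also have "\<dots> \<le> card (pverts B)" using v Qa by (intro card_mono fin) (auto intro: aut_closed)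
  finally show ?thesis by (simp add: card_verts)
qed

text \<open>Otherwise some power of \<open>f\<close> has order \<open>p\<close> and fixes
  \<open>v\<close>. So the order of a stabiliser element is prime to \<open>p\<close>.\<close>

lemma exponent_stabiliser:
  fixes p m :: nat
  assumes p: "Factorial_Ring.prime p" "5 \<le> p" and f: "f \<in> graph_aut B" "v \<in> pverts B" "f v = v"
    and pow: "f [^]\<^bsub>aut_group B\<^esub> (p ^ b * m) = \<one>\<^bsub>aut_group B\<^esub>"
  shows "f [^]\<^bsub>aut_group B\<^esub> m = \<one>\<^bsub>aut_group B\<^esub>"
proof (rule ccontr)
  let ?x = "f [^]\<^bsub>aut_group B\<^esub> m"
  assume ne: "?x \<noteq> \<one>\<^bsub>aut_group B\<^esub>"
  have fc: "f \<in> carrier (aut_group B)" using f by simp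
  have xc: "?x \<in> carrier (aut_group B)" using fc by (rule A.nat_pow_closed)
  have "?x [^]\<^bsub>aut_group B\<^esub> (p ^ b) = \<one>\<^bsub>aut_group B\<^esub>" using pow A.nat_pow_pow[OF fc, of m "p ^ b"] by (simp add: mult.commute)
  then obtain d :: nat where d: "?x [^]\<^bsub>aut_group B\<^esub> (p ^ d) \<noteq> \<one>\<^bsub>aut_group B\<^esub>"
      "(?x [^]\<^bsub>aut_group B\<^esub> (p ^ d)) [^]\<^bsub>aut_group B\<^esub> p = \<one>\<^bsub>aut_group B\<^esub>"
    using A.order_p_power[OF xc _ ne] by metis
  let ?y = "?x [^]\<^bsub>aut_group B\<^esub> (p ^ d)"
  have "?y = f [^]\<^bsub>aut_group B\<^esub> (m * p ^ d)" using A.nat_pow_pow[OF fc] by simp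
  moreover have "(f ^^ k) v = v" for k by (induction k) (simp_all add: f)
  ultimately have "?y v = v" using aut_pow_app[OF f(1,2)] by simp
  moreover have "?y \<in> graph_aut B" using A.nat_pow_closed[OF xc, of "p ^ d"] by simp
  moreover have "odd p" using p prime_odd_nat[of p] by auto
  ultimately have "?y = \<one>\<^bsub>aut_group B\<^esub>" using prime_order_fix[OF p(1) _ _ d(2) f(2)] p(2) by blast
  then show False using d(1) by simp
qed

lemma no_large_prime:
  assumes H: "metacyclic_p_group H p a n g" and na: "\<not> comm_group H" and p5: "5 \<le> p"
  shows False
proof -
  interpret M: metacyclic_p_group H p a n g by (rule H)
  note p = M.p M.odd
  let ?A = "aut_group B"
  obtain m b where m: "order ?A = p ^ b * m" "\<not> p dvd m"
  proof -
    have "0 < order ?A" using finA A.order_gt_0_iff_finite by blast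
    then have "order ?A \<noteq> 0" "\<not> is_unit p" using p5 by simp_all
    then obtain m where "order ?A = p ^ multiplicity p (order ?A) * m" "\<not> p dvd m" by (rule multiplicity_decompose')
    then show ?thesis using that by blast
  qed
  have pow: "f [^]\<^bsub>?A\<^esub> (p ^ b * m) = \<one>\<^bsub>?A\<^esub>" if "f \<in> graph_aut B" for f
    using A.pow_order_eq_1[of f] that m by simp
  have stab: "f [^]\<^bsub>?A\<^esub> m = \<one>\<^bsub>?A\<^esub>" if "f \<in> graph_aut B" "v \<in> pverts B" "f v = v" for f v
    by (rule exponent_stabiliser[OF p(1) p5 that pow[OF that(1)]])
  obtain Q where Q: "subgroup Q ?A" "card Q = p ^ b"
    using sylow_thm[OF p(1) A.is_group m(1) finA] by blast
  have v1: "Inl \<one> \<in> pverts B" by simp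
  \<comment> \<open>A Sylow subgroup \<open>Q\<close> moves the vertices freely, so it has at most
    as many elements as there are vertices. As \<open>p > 2\<close>, a power of \<open>p\<close>
    bounded by \<open>2 * p ^ a\<close> does not exceed \<open>p ^ a\<close>.\<close>
  have "card Q \<le> 2 * order H"
  proof (rule free_subgroup_card[OF Q(1) v1])
    fix f assume f: "f \<in> Q" "f (Inl \<one>) = Inl \<one>"
    have fa: "f \<in> graph_aut B" using subgroup.mem_carrier[OF Q(1) f(1)] by simp
    have "f [^]\<^bsub>?A\<^esub> m = \<one>\<^bsub>?A\<^esub>" by (rule stab[OF fa v1 f(2)])
    moreover have "f [^]\<^bsub>?A\<^esub> (p ^ b) = \<one>\<^bsub>?A\<^esub>"
    proof -
      interpret Q: group "?A\<lparr>carrier := Q\<rparr>" by (rule subgroup.subgroup_is_group[OF Q(1) A.is_group])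
      have "f [^]\<^bsub>?A\<lparr>carrier := Q\<rparr>\<^esub> order (?A\<lparr>carrier := Q\<rparr>) = \<one>\<^bsub>?A\<^esub>" using Q.pow_order_eq_1[of f] f(1) by simp
      then show ?thesis using Q(2) by (simp add: order_def nat_pow_def)
    qed
    ultimately show "f = \<one>\<^bsub>?A\<^esub>"
      using A.coprime_power_one[OF p(1), of f b "int m"] fa m(2) by (simp add: int_pow_int)
  qed
  then have le: "p ^ b \<le> 2 * p ^ a" using Q(2) M.ord by simp
  have "b \<le> a"
  proof (rule ccontr)
    assume "\<not> b \<le> a"
    then have "p ^ Suc a \<le> p ^ b" using p5 by (intro power_increasing) auto
    then have "p * p ^ a \<le> p ^ b" by (simp only: power_Suc)
    moreover have "2 * p ^ a < p * p ^ a" using p5 by simp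
    ultimately show False using le by linarith
  qed
  have "p ^ a dvd p ^ b * m"
    using A.card_subgroup_dvd(1)[OF finA RT_subgroup A.subgroup_self subgroup.subset[OF RT_subgroup]] card_RT M.ord m(1)
    by (simp add: order_def)
  moreover have "coprime (p ^ a) m" using m(2) p(1) by (simp add: prime_imp_coprime coprime_power_left_iff)
  ultimately have "p ^ a dvd p ^ b" by (simp add: coprime_dvd_mult_left_iff)
  then have "a \<le> b" using p5 by (metis power_dvd_imp_le leI le_antisym less_le_trans one_less_numeral_iff semiring_norm(76) numeral_le_one_iff prime_gt_1_nat p(1))
  then have ab: "a = b" using \<open>b \<le> a\<close> by simp
  have sy: "sylow_sub p ?A RT"
    unfolding sylow_sub_def using RT_subgroup card_RT M.ord m ab p5 by auto
  let ?P = "?A\<lparr>carrier := RT\<rparr>" let ?h = "\<lambda>g. rt (inv g)"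
  have img: "?h ` carrier H = RT"
  proof
    show "RT \<subseteq> ?h ` carrier H"
    proof
      fix f assume "f \<in> RT"
      then obtain g where "g \<in> carrier H" "f = rt g" by (auto simp: right_translations_def)
      then show "f \<in> ?h ` carrier H" by (intro image_eqI[of _ _ "inv g"]) simp_all
    qed
  qed (auto simp: right_translations_def)
  have hP: "?h \<in> hom H ?P" using rt_inv_hom img by (auto simp: hom_def)
  have gP: "group ?P" by (rule subgroup.subgroup_is_group[OF RT_subgroup A.is_group])
  obtain b' where b': "metacyclic_p_group ?P p b' (?h n) (?h g)"
    using M.metacyclic_image[OF hP gP] img by auto
  interpret P: metacyclic_sylow ?A p b' RT "?h n" "?h g"
    by (intro metacyclic_sylow.intro metacyclic_sylow_axioms.intro A.is_group finA sy b')
  interpret h: group_hom H ?P ?h using hP gP is_group by (simp add: group_hom_def group_hom_axioms_def)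
  have "P.c = ?h M.c" by (simp add: P.c_def M.c_def h.hom_cmt P.P_restrict)
  moreover have "M.c \<noteq> \<one>"
  proof
    assume "M.c = \<one>"
    then have "M.C = {\<one>}" by (auto simp: M.C_def)
    then show False using comm_groupI_cmt na M.cmt_in_C by blast
  qed
  ultimately have "P.c \<noteq> \<one>\<^bsub>?A\<^esub>" using rt_inject[of "inv M.c" \<one>] by (simp add: rt_one inv_eq_1_iff)
  then obtain V y where V: "mod_hom p ?A (carrier ?A) V" and y: "y \<in> RT" "\<not> int p dvd V y"
    using P.p_quotient by blast
  have ya: "y \<in> graph_aut B" using y(1) subgroup.mem_carrier[OF RT_subgroup] by simp
  let ?K = "{f \<in> graph_aut B. int p dvd V f}"
  have Vmult: "[V (f \<otimes>\<^bsub>?A\<^esub> f') = V f + V f'] (mod int p)" if "f \<in> graph_aut B" "f' \<in> graph_aut B" for f f'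
    using mod_homD[OF V] that by simp
  have Kiff: "int p dvd V (f \<otimes>\<^bsub>?A\<^esub> f') \<longleftrightarrow> int p dvd V f + V f'" if "f \<in> graph_aut B" "f' \<in> graph_aut B" for f f'
    using cong_dvd_iff[OF Vmult[OF that]] .
  have Vinv: "int p dvd V (inv\<^bsub>?A\<^esub> f) + V f" if "f \<in> graph_aut B" for f
    using A.mod_hom_inv[OF A.subgroup_self V, of f] that by (simp add: cong_iff_dvd_diff)
  \<comment> \<open>The \<open>m\<close>-th power of a stabiliser element is trivial, and
    \<open>m\<close> is prime to \<open>p\<close>.\<close>
  have stabK: "int p dvd V f" if f: "f \<in> graph_aut B" "v \<in> pverts B" "f v = v" for f v
  proof -
    have "[V (f [^]\<^bsub>?A\<^esub> m) = int m * V f] (mod int p)" using A.mod_hom_pow[OF A.subgroup_self V, of f m] f(1) by simp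
    then have "[V \<one>\<^bsub>?A\<^esub> = int m * V f] (mod int p)" by (simp only: stab[OF f])
    from cong_trans[OF cong_sym[OF this] A.mod_hom_one[OF A.subgroup_self V]]
    have "int p dvd int m * V f" by (simp add: cong_iff_dvd_diff)
    then show ?thesis using m(2) p(1) prime_dvd_mult_iff[of "int p" "int m" "V f"] by simp
  qed
  obtain w where w: "(Inl \<one>, w) \<in> parcs B" using ex_arc[OF v1] by blast
  have wV: "w \<in> pverts B" using arc_vert[OF w] by blast
  \<comment> \<open>The orbits of \<open>1\<^sub>0\<close> and of its neighbour \<open>w\<close>
    under the kernel of \<open>V\<close>. The kernel contains the stabilisers, and these are
    transitive on neighbours, so the union is closed under adjacency.\<close>
  let ?U = "(\<lambda>f. f (Inl \<one>)) ` ?K \<union> (\<lambda>f. f w) ` ?K"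
  have stepU: "x \<in> (\<lambda>f. f v') ` ?K" if vv: "(v, v') \<in> parcs B" and f: "f \<in> ?K" and x: "(f v, x) \<in> parcs B" for v v' f x
  proof -
    let ?x = "(inv\<^bsub>?A\<^esub> f) x"
    have xV: "x \<in> pverts B" and vV: "v \<in> pverts B" "v' \<in> pverts B" using arc_vert x vv by blast+
    have fx: "f ?x = x" "?x \<in> pverts B" using f xV by (simp_all add: aut_inv_app aut_closed aut_inv_closed)
    then have "(v, ?x) \<in> parcs B" using x aut_arc[of f B v ?x] f vV(1) by simp
    then obtain h where h: "h \<in> graph_aut B" "h v = v" "h v' = ?x" using locally_transitive[OF vv] by blast
    have "int p dvd V h" by (rule stabK[OF h(1) vV(1) h(2)])
    then have fh: "f \<otimes>\<^bsub>?A\<^esub> h \<in> ?K" using f h(1) Kiff[of f h] by (simp add: aut_mult_closed)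
    have "x = (f \<otimes>\<^bsub>?A\<^esub> h) v'" using f h fx(1) vV by (simp add: aut_mult_app)
    then show ?thesis using fh by (rule image_eqI[where f = "\<lambda>f. f v'"])
  qed
  have U: "?U = pverts B"
  proof (rule conn)
    show "?U \<subseteq> pverts B" using v1 wV by (auto intro: aut_closed)
    have "\<one>\<^bsub>?A\<^esub> \<in> ?K" using stabK[OF _ v1, of "\<one>\<^bsub>?A\<^esub>"] A.one_closed v1 by (simp add: aut_one_app)
    then show "?U \<noteq> {}" by blast
    fix u x assume u: "u \<in> ?U" and x: "(u, x) \<in> parcs B"
    from u consider f where "f \<in> ?K" "u = f (Inl \<one>)" | f where "f \<in> ?K" "u = f w" by blast
    then show "x \<in> ?U" using stepU[OF w] stepU[OF sym[OF w]] x by cases blast+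
  qed
  have key: "int p dvd V f - V f'" if "f \<in> graph_aut B" "f' \<in> graph_aut B" "v \<in> pverts B" "f v = f' v" for f f' v
  proof -
    have i: "inv\<^bsub>?A\<^esub> f' \<in> graph_aut B" using that(2) by (rule aut_inv_closed)
    have "(inv\<^bsub>?A\<^esub> f' \<otimes>\<^bsub>?A\<^esub> f) v = v" using that i by (simp add: aut_mult_app) (simp add: aut_inv_app)
    then have "int p dvd V (inv\<^bsub>?A\<^esub> f' \<otimes>\<^bsub>?A\<^esub> f)" using stabK[OF aut_mult_closed[OF i that(1)] that(3)] by blast
    then have "int p dvd V (inv\<^bsub>?A\<^esub> f') + V f" using Kiff[OF i that(1)] by blast
    from dvd_diff[OF this Vinv[OF that(2)]] show ?thesis by simp
  qed
  have notK: "y v \<noteq> f v" if "f \<in> ?K" "v \<in> pverts B" for f v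
  proof
    assume "y v = f v"
    then have "int p dvd V y - V f" using key[OF ya _ that(2)] that(1) by blast
    then have "int p dvd (V y - V f) + V f" using that(1) by (intro dvd_add) auto
    then show False using y(2) by simp
  qed
  \<comment> \<open>An element outside the kernel agrees with no kernel element at any vertex, so
    \<open>y\<close> exchanges the two orbits. Applying it twice, with a kernel element in between,
    shows that \<open>p\<close> divides \<open>2 * V y\<close>.\<close>
  have "y (Inl \<one>) \<in> ?U" "y w \<in> ?U" using U aut_closed[OF ya] v1 wV by blast+
  then obtain f f' where f: "f \<in> ?K" "y (Inl \<one>) = f w" and f': "f' \<in> ?K" "y w = f' (Inl \<one>)"
    using notK v1 wV by blast
  have fa: "f \<in> graph_aut B" "f' \<in> graph_aut B" using f f' by blast+
  have "(y \<otimes>\<^bsub>?A\<^esub> (inv\<^bsub>?A\<^esub> f \<otimes>\<^bsub>?A\<^esub> y)) (Inl \<one>) = y ((inv\<^bsub>?A\<^esub> f) (f w))"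
    using ya fa v1 by (simp add: aut_mult_app aut_inv_closed aut_mult_closed f(2))
  also have "\<dots> = f' (Inl \<one>)" using fa wV f'(2) by (simp add: aut_inv_app)
  finally have "int p dvd V (y \<otimes>\<^bsub>?A\<^esub> (inv\<^bsub>?A\<^esub> f \<otimes>\<^bsub>?A\<^esub> y)) - V f'"
    using ya fa v1 by (intro key) (simp_all add: aut_inv_closed aut_mult_closed)
  from dvd_add[OF this, of "V f'"] have "int p dvd V (y \<otimes>\<^bsub>?A\<^esub> (inv\<^bsub>?A\<^esub> f \<otimes>\<^bsub>?A\<^esub> y))"
    using f'(1) by simp
  then have d1: "int p dvd V y + V (inv\<^bsub>?A\<^esub> f \<otimes>\<^bsub>?A\<^esub> y)"
    using Kiff[OF ya aut_mult_closed[OF aut_inv_closed[OF fa(1)] ya]] by blast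
  have d2: "int p dvd V (inv\<^bsub>?A\<^esub> f \<otimes>\<^bsub>?A\<^esub> y) - (V (inv\<^bsub>?A\<^esub> f) + V y)"
    using Vmult[OF aut_inv_closed[OF fa(1)] ya] by (simp add: cong_iff_dvd_diff)
  have d3: "int p dvd V (inv\<^bsub>?A\<^esub> f)" using dvd_diff[OF Vinv[OF fa(1)], of "V f"] f(1) by simp
  have "int p dvd (V y + V (inv\<^bsub>?A\<^esub> f \<otimes>\<^bsub>?A\<^esub> y)) - (V (inv\<^bsub>?A\<^esub> f \<otimes>\<^bsub>?A\<^esub> y) - (V (inv\<^bsub>?A\<^esub> f) + V y)) - V (inv\<^bsub>?A\<^esub> f)"
    by (intro dvd_diff d1 d2 d3)
  then have "int p dvd 2 * V y" by simp
  then have "int p dvd 2" using y(2) p(1) prime_dvd_mult_iff[of "int p" 2 "V y"] by simp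
  then show False using p5 zdvd_imp_le[of "int p" 2] by simp
qed

end

lemma card_image_same_fibres:
  assumes eq: "\<And>x y. x \<in> C \<Longrightarrow> y \<in> C \<Longrightarrow> F x = F y \<longleftrightarrow> K x = K y"
  shows "card (F ` C) = card (K ` C)"
proof -
  let ?g = "\<lambda>X. K (inv_into C F X)"
  have k: "?g (F c) = K c" if c: "c \<in> C" for c
    using eq[of "inv_into C F (F c)" c] c inv_into_into[of "F c" F C] f_inv_into_f[of "F c" F C] by simp
  have "inj_on ?g (F ` C)"
  proof (rule inj_onI)
    fix X Y assume X: "X \<in> F ` C" and Y: "Y \<in> F ` C" and g: "?g X = ?g Y"
    obtain c d where "c \<in> C" "d \<in> C" "X = F c" "Y = F d" using X Y by blast
    then show "X = Y" using g k eq by simp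
  qed
  then have "card (F ` C) = card (?g ` F ` C)" by (simp add: card_image)
  also have "?g ` F ` C = K ` C" unfolding image_image using k by (intro image_cong) simp_all
  finally show ?thesis .
qed

section \<open>The normaliser of the translation group\<close>

context bicay
begin

text \<open>A right coset of the stabiliser is determined by where the inverses of its elements send
  \<open>v\<close>.\<close>

lemma orbit_stabiliser:
  assumes C: "subgroup C (aut_group B)" and v: "v \<in> pverts B"
  shows "card ((\<lambda>f. f v) ` C) * card {f \<in> C. f v = v} = card C"
proof -
  let ?A = "aut_group B" let ?P = "{f \<in> C. f v = v}"
  have Ca: "f \<in> graph_aut B" if "f \<in> C" for f using subgroup.mem_carrier[OF C that] by simp
  have P: "subgroup ?P ?A"
  proof (rule A.finite_subgroupI[OF finA])
    have "\<one>\<^bsub>?A\<^esub> \<in> ?P" using subgroup.one_closed[OF C] v by (simp add: aut_one_app)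
    then show "?P \<noteq> {}" by blast
  qed (use Ca v subgroup.m_closed[OF C] in \<open>auto simp: aut_mult_app\<close>)
  have eq: "?P #>\<^bsub>?A\<^esub> f = ?P #>\<^bsub>?A\<^esub> g \<longleftrightarrow> (inv\<^bsub>?A\<^esub> f) v = (inv\<^bsub>?A\<^esub> g) v" if fg: "f \<in> C" "g \<in> C" for f g
  proof -
    have a: "f \<in> graph_aut B" "g \<in> graph_aut B" "inv\<^bsub>?A\<^esub> g \<in> graph_aut B" using Ca fg by (simp_all add: aut_inv_closed)
    have "?P #>\<^bsub>?A\<^esub> f = ?P #>\<^bsub>?A\<^esub> g \<longleftrightarrow> f \<otimes>\<^bsub>?A\<^esub> inv\<^bsub>?A\<^esub> g \<in> ?P" using A.rcos_eq_iff[OF P] a by simp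
    also have "\<dots> \<longleftrightarrow> f ((inv\<^bsub>?A\<^esub> g) v) = v"
      using a v fg subgroup.m_closed[OF C] subgroup.m_inv_closed[OF C] by (simp add: aut_mult_app)
    also have "\<dots> \<longleftrightarrow> (inv\<^bsub>?A\<^esub> f) (f ((inv\<^bsub>?A\<^esub> g) v)) = (inv\<^bsub>?A\<^esub> f) v"
      using a v aut_inj[OF aut_inv_closed[OF a(1)], of "f ((inv\<^bsub>?A\<^esub> g) v)" v] by (simp add: aut_closed)
    finally show ?thesis using a v by (simp add: aut_inv_app aut_closed eq_commute)
  qed
  let ?F = "\<lambda>f. ?P #>\<^bsub>?A\<^esub> f" let ?K = "\<lambda>f. (inv\<^bsub>?A\<^esub> f) v"
  have "card (?F ` C) = card (?K ` C)" by (rule card_image_same_fibres) (rule eq)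
  moreover have "?K ` C = (\<lambda>f. f v) ` C"
  proof
    show "?K ` C \<subseteq> (\<lambda>f. f v) ` C" using subgroup.m_inv_closed[OF C] by blast
    show "(\<lambda>f. f v) ` C \<subseteq> ?K ` C"
    proof
      fix u assume "u \<in> (\<lambda>f. f v) ` C"
      then obtain f where "f \<in> C" "u = f v" by blast
      then show "u \<in> ?K ` C" using subgroup.m_inv_closed[OF C] Ca by (intro image_eqI[of _ _ "inv\<^bsub>?A\<^esub> f"]) simp_all
    qed
  qed
  moreover have "card (?F ` C) * card ?P = card C"
    by (rule A.card_subgroup_dvd(2)[OF finA P C]) blast
  ultimately show ?thesis by simp
qed

text \<open>An orbit of a group containing the translations is a union of halves
  \<open>H\<^sub>0\<close>, \<open>H\<^sub>1\<close>.\<close>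

lemma orbit_card:
  assumes C: "subgroup C (aut_group B)" "RT \<subseteq> C"
  shows "card ((\<lambda>f. f (Inl \<one>)) ` C) = order H \<or> card ((\<lambda>f. f (Inl \<one>)) ` C) = 2 * order H"
proof -
  let ?O = "(\<lambda>f. f (Inl \<one>)) ` C"
  have Ca: "f \<in> graph_aut B" if "f \<in> C" for f using subgroup.mem_carrier[OF C(1) that] by simp
  have rtC: "rt g \<in> C" if "g \<in> carrier H" for g using C(2) that by (auto simp: right_translations_def)
  have "?O \<subseteq> pverts B" using Ca by (auto intro: aut_closed)
  have rtO: "rt g u \<in> ?O" if u: "u \<in> ?O" and g: "g \<in> carrier H" for g u
  proof -
    obtain f where f: "f \<in> C" "u = f (Inl \<one>)" using u by blast
    have "rt g u = (rt g \<otimes>\<^bsub>aut_group B\<^esub> f) (Inl \<one>)" using f Ca g by (simp add: aut_mult_app rt_aut)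
    moreover have "rt g \<otimes>\<^bsub>aut_group B\<^esub> f \<in> C" using subgroup.m_closed[OF C(1)] rtC[OF g] f(1) by blast
    ultimately show ?thesis by (rule image_eqI)
  qed
  have "Inl \<one> \<in> ?O" using rtC[of \<one>] by (intro image_eqI[of _ _ "rt \<one>"]) simp_all
  from rtO[OF this] have l: "Inl h \<in> ?O" if "h \<in> carrier H" for h using that by fastforce
  show ?thesis
  proof (cases "\<exists>h. Inr h \<in> ?O")
    case True
    then obtain h where h: "Inr h \<in> ?O" by blast
    have "Inr h \<in> pverts B" using h \<open>?O \<subseteq> pverts B\<close> by blast
    then have hH: "h \<in> carrier H" by simp
    have "Inr x \<in> ?O" if x: "x \<in> carrier H" for x
      using rtO[OF h, of "inv h \<otimes> x"] x hH by simp
    then have "pverts B \<subseteq> ?O" using l by (blast elim: vertE)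
    then have "?O = pverts B" using \<open>?O \<subseteq> pverts B\<close> by blast
    then show ?thesis using card_verts by simp
  next
    case False
    have "?O = Inl ` carrier H"
    proof
      show "?O \<subseteq> Inl ` carrier H"
      proof
        fix u assume u: "u \<in> ?O"
        then have "u \<in> pverts B" using \<open>?O \<subseteq> pverts B\<close> by blast
        then show "u \<in> Inl ` carrier H"
        proof (cases rule: vertE)
          case (2 h) then show ?thesis using False u by blast
        qed blast
      qed
    qed (use l in blast)
    then show ?thesis by (simp add: card_image order_def)
  qed
qed

text \<open>The translation group is a 3-group acting on its own cosets in the automorphism group,
  and the fixed cosets are those in its normaliser. Local transitivity makes the number of all
  cosets divisible by 3, hence also the index in the normaliser. The orbit of
  \<open>1\<^sub>0\<close> has length \<open>|H|\<close> or \<open>2 |H|\<close>, so a factor 3 is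
  left for the stabiliser in the normaliser.\<close>

lemma normalising_rotation:
  assumes ord: "order H = 3 ^ r"
  obtains x where "x \<in> graph_aut B" "x (Inl \<one>) = Inl \<one>" "x [^]\<^bsub>aut_group B\<^esub> (3::nat) = \<one>\<^bsub>aut_group B\<^esub>"
    "x \<noteq> \<one>\<^bsub>aut_group B\<^esub>" "\<And>g. g \<in> carrier H \<Longrightarrow> \<exists>g'\<in>carrier H. x \<otimes>\<^bsub>aut_group B\<^esub> rt g = rt g' \<otimes>\<^bsub>aut_group B\<^esub> x"
proof -
  let ?A = "aut_group B"
  have v1: "Inl \<one> \<in> pverts B" by simp
  have RTa: "f \<in> graph_aut B" if "f \<in> RT" for f using subgroup.mem_carrier[OF RT_subgroup that] by simp
  have H0: "0 < order H" using ord by simp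
  have three_stab: "3 dvd card {f \<in> graph_aut B. f (Inl \<one>) = Inl \<one>}"
  proof -
    let ?C = "{f \<in> graph_aut B. f (Inl \<one>) = Inl \<one>}"
    have C: "subgroup ?C ?A"
    proof (rule A.finite_subgroupI[OF finA])
      have "\<one>\<^bsub>?A\<^esub> \<in> ?C" using A.one_closed v1 by (simp add: aut_one_app)
      then show "?C \<noteq> {}" by blast
    qed (auto simp: aut_mult_app aut_mult_closed)
    obtain w where w: "(Inl \<one>, w) \<in> parcs B" using ex_arc[OF v1] by blast
    have "(\<lambda>f. f w) ` ?C = parcs B `` {Inl \<one>}"
    proof
      show "(\<lambda>f. f w) ` ?C \<subseteq> parcs B `` {Inl \<one>}"
      proof
        fix u assume "u \<in> (\<lambda>f. f w) ` ?C"
        then obtain f where f: "f \<in> graph_aut B" "f (Inl \<one>) = Inl \<one>" "u = f w" by blast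
        have "(f (Inl \<one>), f w) \<in> parcs B" using aut_arc[OF f(1)] w arc_vert[OF w] by blast
        then show "u \<in> parcs B `` {Inl \<one>}" using f by simp
      qed
      show "parcs B `` {Inl \<one>} \<subseteq> (\<lambda>f. f w) ` ?C" using locally_transitive[OF w] by auto
    qed
    then have "card ((\<lambda>f. f w) ` ?C) = 3" using deg[OF v1] by simp
    moreover have "w \<in> pverts B" using arc_vert[OF w] by blast
    ultimately have three: "3 * card {f \<in> ?C. f w = w} = card ?C" using orbit_stabiliser[OF C, of w] by simp
    show ?thesis unfolding three[symmetric] by (rule dvd_triv_left)
  qed
  have three_orb: "3 * order H dvd card C" if C: "subgroup C ?A" "RT \<subseteq> C" and 3: "3 dvd card {f \<in> C. f (Inl \<one>) = Inl \<one>}" for C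
  proof -
    have "order H dvd card ((\<lambda>f. f (Inl \<one>)) ` C)" using orbit_card[OF C] by auto
    then have "3 * order H dvd card {f \<in> C. f (Inl \<one>) = Inl \<one>} * card ((\<lambda>f. f (Inl \<one>)) ` C)" using 3 by (intro mult_dvd_mono)
    then show ?thesis using orbit_stabiliser[OF C(1) v1] by (simp add: mult.commute)
  qed
  let ?F = "\<lambda>f. RT #>\<^bsub>?A\<^esub> f"
  let ?X = "?F ` carrier ?A"
  have "card ?X * card RT = card (carrier ?A)"
    by (rule A.card_subgroup_dvd(2)[OF finA RT_subgroup A.subgroup_self subgroup.subset[OF RT_subgroup]])
  moreover have "3 * order H dvd card (carrier ?A)"
    by (rule three_orb[OF A.subgroup_self]) (use three_stab RTa in auto)
  ultimately have "3 * order H dvd card ?X * order H" by (simp only: card_RT)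
  then have "3 dvd card ?X" using H0 by simp
  let ?N = "{f \<in> graph_aut B. \<forall>s\<in>RT. f \<otimes>\<^bsub>?A\<^esub> s \<otimes>\<^bsub>?A\<^esub> inv\<^bsub>?A\<^esub> f \<in> RT}"
  have N: "subgroup ?N ?A"
  proof (rule A.finite_subgroupI[OF finA])
    have "\<one>\<^bsub>?A\<^esub> \<in> ?N" using A.one_closed RTa by simp
    then show "?N \<noteq> {}" by blast
    fix f f' assume f: "f \<in> ?N" and f': "f' \<in> ?N"
    have "f \<otimes>\<^bsub>?A\<^esub> f' \<otimes>\<^bsub>?A\<^esub> s \<otimes>\<^bsub>?A\<^esub> inv\<^bsub>?A\<^esub> (f \<otimes>\<^bsub>?A\<^esub> f') \<in> RT" if s: "s \<in> RT" for s
    proof -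
      have "f \<otimes>\<^bsub>?A\<^esub> (f' \<otimes>\<^bsub>?A\<^esub> s \<otimes>\<^bsub>?A\<^esub> inv\<^bsub>?A\<^esub> f') \<otimes>\<^bsub>?A\<^esub> inv\<^bsub>?A\<^esub> f \<in> RT" using f f' s by blast
      then show ?thesis using f f' RTa[OF s] by (simp add: A.m_assoc A.inv_mult_group aut_mult_closed aut_inv_closed)
    qed
    then show "f \<otimes>\<^bsub>?A\<^esub> f' \<in> ?N" using f f' by (simp add: aut_mult_closed)
  qed auto
  have RTN: "RT \<subseteq> ?N"
    using RTa subgroup.m_closed[OF RT_subgroup] subgroup.m_inv_closed[OF RT_subgroup] by blast
  interpret T: group "?A\<lparr>carrier := RT\<rparr>" by (rule subgroup.subgroup_is_group[OF RT_subgroup A.is_group])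
  let ?\<phi> = "\<lambda>s X. X #>\<^bsub>?A\<^esub> inv\<^bsub>?A\<^esub> s"
  have RTsub: "RT \<subseteq> carrier ?A" by (rule subgroup.subset[OF RT_subgroup])
  have phi: "?\<phi> s (?F f) = ?F (f \<otimes>\<^bsub>?A\<^esub> inv\<^bsub>?A\<^esub> s)" if "s \<in> RT" "f \<in> graph_aut B" for s f
    by (rule A.coset_mult_assoc[OF RTsub]) (use that RTa in \<open>simp_all add: aut_inv_closed\<close>)
  have "[card {X \<in> ?X. \<forall>s\<in>carrier (?A\<lparr>carrier := RT\<rparr>). ?\<phi> s X = X} = card ?X] (mod 3)"
  proof (rule T.card_fixed_points_cong[where n = r])
    show "order (?A\<lparr>carrier := RT\<rparr>) = 3 ^ r" using card_RT ord by (simp add: order_def)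
    show "finite ?X" using finA by simp
    fix s X assume sX: "s \<in> carrier (?A\<lparr>carrier := RT\<rparr>)" "X \<in> ?X"
    then obtain f where f: "f \<in> graph_aut B" "X = ?F f" by auto
    show "?\<phi> s X \<in> ?X" using phi[of s f] f sX(1) RTa[of s] by (simp add: aut_mult_closed aut_inv_closed)
  next
    fix X assume "X \<in> ?X"
    then obtain f where f: "f \<in> graph_aut B" "X = ?F f" by auto
    have "\<one>\<^bsub>?A\<^esub> \<in> RT" by (rule subgroup.one_closed[OF RT_subgroup])
    from phi[OF this f(1)] show "?\<phi> \<one>\<^bsub>?A\<lparr>carrier := RT\<rparr>\<^esub> X = X" using f by simp
  next
    fix s t X assume sX: "s \<in> carrier (?A\<lparr>carrier := RT\<rparr>)" "t \<in> carrier (?A\<lparr>carrier := RT\<rparr>)" "X \<in> ?X"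
    then obtain f where f: "f \<in> graph_aut B" "X = ?F f" by auto
    have st: "s \<in> RT" "t \<in> RT" using sX by simp_all
    have a: "s \<in> graph_aut B" "t \<in> graph_aut B" using st RTa by blast+
    have "s \<otimes>\<^bsub>?A\<^esub> t \<in> RT" using subgroup.m_closed[OF RT_subgroup] st by blast
    from phi[OF this f(1)] have "?\<phi> (s \<otimes>\<^bsub>?A\<^esub> t) X = ?F (f \<otimes>\<^bsub>?A\<^esub> inv\<^bsub>?A\<^esub> t \<otimes>\<^bsub>?A\<^esub> inv\<^bsub>?A\<^esub> s)"
      using a f by (simp add: A.inv_mult_group A.m_assoc aut_inv_closed)
    also have "\<dots> = ?\<phi> s (?\<phi> t X)" using phi st f a by (simp add: aut_mult_closed aut_inv_closed)
    finally show "?\<phi> (s \<otimes>\<^bsub>?A\<lparr>carrier := RT\<rparr>\<^esub> t) X = ?\<phi> s (?\<phi> t X)" by simp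
  qed simp
  moreover have "{X \<in> ?X. \<forall>s\<in>carrier (?A\<lparr>carrier := RT\<rparr>). ?\<phi> s X = X} = ?F ` ?N"
  proof -
    have "(\<forall>s\<in>RT. ?\<phi> s (?F f) = ?F f) \<longleftrightarrow> f \<in> ?N" if f: "f \<in> graph_aut B" for f
    proof -
      have "?\<phi> s (?F f) = ?F f \<longleftrightarrow> f \<otimes>\<^bsub>?A\<^esub> inv\<^bsub>?A\<^esub> s \<otimes>\<^bsub>?A\<^esub> inv\<^bsub>?A\<^esub> f \<in> RT" if s: "s \<in> RT" for s
        using phi[OF s f] A.rcos_eq_iff[OF RT_subgroup, of "f \<otimes>\<^bsub>?A\<^esub> inv\<^bsub>?A\<^esub> s" f] f RTa[OF s]
        by (simp add: aut_mult_closed aut_inv_closed)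
      moreover have "(\<forall>s\<in>RT. Q (inv\<^bsub>?A\<^esub> s)) \<longleftrightarrow> (\<forall>s\<in>RT. Q s)" for Q
        using subgroup.m_inv_closed[OF RT_subgroup] RTa by (metis A.inv_inv carrier_aut_group)
      ultimately show ?thesis using f by simp
    qed
    then show ?thesis by auto
  qed
  ultimately have "[card (?F ` ?N) = card ?X] (mod 3)" by simp
  then have d3: "3 dvd card (?F ` ?N)" using \<open>3 dvd card ?X\<close> cong_dvd_iff by blast
  have cN: "card (?F ` ?N) * card RT = card ?N" by (rule A.card_subgroup_dvd(2)[OF finA RT_subgroup N RTN])
  have dN: "3 * order H dvd card ?N" unfolding cN[symmetric] card_RT by (rule mult_dvd_mono[OF d3 dvd_refl])
  let ?S = "{f \<in> ?N. f (Inl \<one>) = Inl \<one>}"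
  have "3 dvd card ?S"
  proof -
    have os: "card ((\<lambda>f. f (Inl \<one>)) ` ?N) * card ?S = card ?N" by (rule orbit_stabiliser[OF N v1])
    from orbit_card[OF N RTN] show ?thesis
    proof
      assume "card ((\<lambda>f. f (Inl \<one>)) ` ?N) = order H"
      then have "3 * order H dvd order H * card ?S" using os dN by simp
      then show ?thesis using H0 by (simp add: mult.commute)
    next
      assume "card ((\<lambda>f. f (Inl \<one>)) ` ?N) = 2 * order H"
      then have "order H * 3 dvd order H * (2 * card ?S)" using os dN by (simp add: mult_ac)
      then have "3 dvd 2 * card ?S" using H0 by simp
      then show ?thesis using coprime_dvd_mult_right_iff[of 3 2 "card ?S"] by simp
    qed
  qed
  \<comment> \<open>With the exponent 1, Sylow's theorem yields a subgroup of order exactly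
    3.\<close>
  then obtain q where q: "card ?S = 3 ^ 1 * q" by (auto simp: dvd_def)
  have Ss: "subgroup ?S ?A"
  proof (rule A.finite_subgroupI[OF finA])
    have "\<one>\<^bsub>?A\<^esub> \<in> ?S" using subgroup.one_closed[OF N] v1 by (simp add: aut_one_app)
    then show "?S \<noteq> {}" by blast
  qed (use subgroup.m_closed[OF N] in \<open>auto simp: aut_mult_app\<close>)
  interpret S: group "?A\<lparr>carrier := ?S\<rparr>" by (rule subgroup.subgroup_is_group[OF Ss A.is_group])
  have "order (?A\<lparr>carrier := ?S\<rparr>) = 3 ^ 1 * q" using q by (simp add: order_def)
  from sylow_thm[OF _ S.is_group this] A.subgroup_finite[OF finA Ss]
  obtain Q where Q: "subgroup Q (?A\<lparr>carrier := ?S\<rparr>)" "card Q = 3" by auto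
  have "\<exists>x\<in>Q. x \<noteq> \<one>\<^bsub>?A\<^esub>"
  proof (rule ccontr)
    assume "\<not> (\<exists>x\<in>Q. x \<noteq> \<one>\<^bsub>?A\<^esub>)"
    then have "Q \<subseteq> {\<one>\<^bsub>?A\<^esub>}" by blast
    then have "card Q \<le> card {\<one>\<^bsub>?A\<^esub>}" by (rule card_mono[rotated]) simp
    then show False using Q(2) by simp
  qed
  then obtain x where x: "x \<in> Q" "x \<noteq> \<one>\<^bsub>?A\<^esub>" by blast
  interpret Q: group "?A\<lparr>carrier := Q\<rparr>"
    using subgroup.subgroup_is_group[OF Q(1) S.is_group] by simp
  have "x [^]\<^bsub>?A\<lparr>carrier := Q\<rparr>\<^esub> order (?A\<lparr>carrier := Q\<rparr>) = \<one>\<^bsub>?A\<^esub>" using Q.pow_order_eq_1[of x] x(1) by simp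
  then have x3: "x [^]\<^bsub>?A\<^esub> (3::nat) = \<one>\<^bsub>?A\<^esub>" using Q(2) by (simp add: order_def nat_pow_def)
  have "x \<in> ?S" using subgroup.mem_carrier[OF Q(1) x(1)] by simp
  then have xN: "x \<in> ?N" "x (Inl \<one>) = Inl \<one>" by blast+
  have xa: "x \<in> graph_aut B" using xN(1) by blast
  show ?thesis
  proof (rule that[OF xa xN(2) x3 x(2)])
    fix g assume g: "g \<in> carrier H"
    have "rt g \<in> RT" using g by (auto simp: right_translations_def)
    then have "x \<otimes>\<^bsub>?A\<^esub> rt g \<otimes>\<^bsub>?A\<^esub> inv\<^bsub>?A\<^esub> x \<in> RT" using xN(1) by blast
    then obtain g' where g': "g' \<in> carrier H" "x \<otimes>\<^bsub>?A\<^esub> rt g \<otimes>\<^bsub>?A\<^esub> inv\<^bsub>?A\<^esub> x = rt g'"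
      by (auto simp: right_translations_def)
    have "x \<otimes>\<^bsub>?A\<^esub> rt g = x \<otimes>\<^bsub>?A\<^esub> rt g \<otimes>\<^bsub>?A\<^esub> inv\<^bsub>?A\<^esub> x \<otimes>\<^bsub>?A\<^esub> x"
      using xa g by (simp add: A.m_assoc rt_aut aut_mult_closed aut_inv_closed)
    then show "\<exists>g'\<in>carrier H. x \<otimes>\<^bsub>?A\<^esub> rt g = rt g' \<otimes>\<^bsub>?A\<^esub> x" using g' by auto
  qed
qed

text \<open>The rotation \<open>x\<close> induces on the translations an automorphism
  \<open>\<alpha>\<close>, read off from its action on \<open>H\<^sub>0\<close>, and permutes the
  neighbours of \<open>1\<^sub>0\<close> cyclically. As it preserves both halves, these neighbours
  lie in one half. They are not in \<open>H\<^sub>0\<close>: in a group of odd order inversion has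
  no fixed points on \<open>R\<close>, so \<open>R\<close> has an even number of elements.\<close>

lemma rotation_structure:
  assumes M: "metacyclic_p_group H 3 r n g" and na: "\<not> comm_group H"
  obtains s0 s1 s2 \<alpha> where "R = {}" "L = {}" "S = {s0, s1, s2}" "s0 \<noteq> s1" "s0 \<noteq> s2" "s1 \<noteq> s2"
    "metacyclic_rotation H r n g (inv s0 \<otimes> s1) (inv s0 \<otimes> s2) \<alpha>"
proof -
  interpret M: metacyclic_p_group H 3 r n g by (rule M)
  obtain x where x: "x \<in> graph_aut B" "x (Inl \<one>) = Inl \<one>" "x [^]\<^bsub>aut_group B\<^esub> (3::nat) = \<one>\<^bsub>aut_group B\<^esub>"
    "x \<noteq> \<one>\<^bsub>aut_group B\<^esub>" and norm: "\<And>g. g \<in> carrier H \<Longrightarrow> \<exists>g'\<in>carrier H. x \<otimes>\<^bsub>aut_group B\<^esub> rt g = rt g' \<otimes>\<^bsub>aut_group B\<^esub> x"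
    using normalising_rotation[OF M.ord] by blast
  have xV: "x v \<in> pverts B" if "v \<in> pverts B" for v using aut_closed[OF x(1) that] .
  have ex: "\<exists>h'. h' \<in> carrier H \<and> x (Inl h) = Inl h' \<and> (\<forall>v\<in>pverts B. x (rt h v) = rt h' (x v))" if h: "h \<in> carrier H" for h
  proof -
    obtain h' where h': "h' \<in> carrier H" "x \<otimes>\<^bsub>aut_group B\<^esub> rt h = rt h' \<otimes>\<^bsub>aut_group B\<^esub> x" using norm[OF h] by blast
    have c: "x (rt h v) = rt h' (x v)" if "v \<in> pverts B" for v
      using fun_cong[OF h'(2), of v] that h h'(1) x(1) by (simp add: aut_mult_app rt_aut)
    from c[of "Inl \<one>"] have "x (Inl h) = Inl h'" using h h'(1) x(2) by simp
    then show ?thesis using c h'(1) by blast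
  qed
  define \<alpha> where "\<alpha> h = (SOME h'. h' \<in> carrier H \<and> x (Inl h) = Inl h' \<and> (\<forall>v\<in>pverts B. x (rt h v) = rt h' (x v)))" for h
  have \<alpha>: "\<alpha> h \<in> carrier H \<and> x (Inl h) = Inl (\<alpha> h) \<and> (\<forall>v\<in>pverts B. x (rt h v) = rt (\<alpha> h) (x v))" if "h \<in> carrier H" for h
    unfolding \<alpha>_def by (rule someI_ex[OF ex[OF that]])
  have \<alpha>c [simp]: "\<alpha> h \<in> carrier H" and xl: "x (Inl h) = Inl (\<alpha> h)" if "h \<in> carrier H" for h using \<alpha>[OF that] by blast+
  have xrt: "x (rt h v) = rt (\<alpha> h) (x v)" if "h \<in> carrier H" "v \<in> pverts B" for h v using \<alpha>[OF that(1)] that(2) by blast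
  have \<alpha>_mult: "\<alpha> (h \<otimes> h') = \<alpha> h \<otimes> \<alpha> h'" if "h \<in> carrier H" "h' \<in> carrier H" for h h'
    using xrt[OF that(2), of "Inl h"] xl[of "h \<otimes> h'"] xl[of h] that by simp
  have \<alpha>_hom: "\<alpha> \<in> hom H H" by (rule homI) (simp_all add: \<alpha>_mult)
  interpret \<alpha>: group_hom H H \<alpha> using \<alpha>_hom is_group by (simp add: group_hom_def group_hom_axioms_def)
  have \<alpha>_inj: "inj_on \<alpha> (carrier H)"
  proof (rule inj_onI)
    fix h h' assume h: "h \<in> carrier H" "h' \<in> carrier H" "\<alpha> h = \<alpha> h'"
    then have "x (Inl h) = x (Inl h')" by (simp add: xl)
    then show "h = h'" using aut_inj[OF x(1), of "Inl h" "Inl h'"] h by simp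
  qed
  have "\<alpha> ` carrier H = carrier H" by (rule endo_inj_surj[OF finH _ \<alpha>_inj]) auto
  \<comment> \<open>\<open>\<alpha>\<close> is onto, so \<open>x\<close> maps
    \<open>H\<^sub>0\<close> onto itself.\<close>
  have not_inl: "x (Inr h) \<noteq> Inl u" if h: "h \<in> carrier H" for h u
  proof
    assume eq: "x (Inr h) = Inl u"
    then have "u \<in> carrier H" using xV[of "Inr h"] h by simp
    then obtain h' where h': "h' \<in> carrier H" "u = \<alpha> h'" using \<open>\<alpha> ` carrier H = carrier H\<close> by blast
    then have "x (Inr h) = x (Inl h')" using eq xl by simp
    then show False using aut_inj[OF x(1), of "Inr h" "Inl h'"] h h'(1) by simp
  qed
  obtain d where d: "d \<in> carrier H" "x (Inr \<one>) = Inr d"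
  proof (cases rule: vertE[OF xV[of "Inr \<one>"]])
    case (2 h) then show ?thesis using not_inl[of \<one> h] by simp
  qed (use that in simp_all)
  have xr: "x (Inr h) = Inr (d \<otimes> \<alpha> h)" if "h \<in> carrier H" for h
    using xrt[OF that, of "Inr \<one>"] d that by simp
  let ?M = "parcs B `` {Inl \<one>}"
  have v1: "Inl \<one> \<in> pverts B" by simp
  have "x ` ?M = ?M" using aut_nbrs[OF x(1) v1] by (simp only: x(2))
  then have xM: "x w \<in> ?M" if "w \<in> ?M" for w using that by blast
  have nofix: "x w \<noteq> w" if w: "w \<in> ?M" for w
  proof
    assume "x w = w"
    then have "\<exists>w. (Inl \<one>, w) \<in> parcs B \<and> x w = w" using w by blast
    then have "x = \<one>\<^bsub>aut_group B\<^esub>"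
      using prime_order_fix[OF M.p _ x(1,3) v1 x(2)] by simp
    then show False using x(4) by simp
  qed
  have x3: "x (x (x w)) = w" if "w \<in> ?M" for w
  proof -
    have "w \<in> pverts B" using that arc_vert by blast
    then show ?thesis using aut_pow_app[OF x(1), of w 3] x(3) by (simp add: aut_one_app numeral_3_eq_3)
  qed
  obtain w where w: "w \<in> ?M" using ex_arc[OF v1] by blast
  have MV: "?M \<subseteq> pverts B" using arc_vert by blast
  have dist: "w \<noteq> x w" "x w \<noteq> x (x w)" "w \<noteq> x (x w)"
  proof -
    show "w \<noteq> x w" "x w \<noteq> x (x w)" using nofix[OF w] nofix[OF xM[OF w]] by auto
    show "w \<noteq> x (x w)"
    proof
      assume "w = x (x w)"
      then have "x w = x (x (x w))" by simp
      then show False using x3[OF w] nofix[OF w] by simp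
    qed
  qed
  have M_eq: "?M = {w, x w, x (x w)}"
    by (rule card_seteq[OF finite_nbrs, symmetric]) (use w xM deg[OF v1] dist in auto)
  have wV: "w \<in> pverts B" using w MV by blast
  have subs: "R \<subseteq> carrier H" "L \<subseteq> carrier H" "S \<subseteq> carrier H" and invR: "(\<lambda>x. inv x) ` R = R" and one: "\<one> \<notin> R"
    using data by (auto simp: bicay_data_def)
  have Rin: "Inl q \<in> ?M \<longleftrightarrow> q \<in> R" and Sin: "Inr q \<in> ?M \<longleftrightarrow> q \<in> S" for q using subs by (auto simp: arc_iff)
  obtain s0 where s0: "s0 \<in> carrier H" "w = Inr s0"
  proof (cases rule: vertE[OF wV])
    case (1 q)
    have "?M \<subseteq> Inl ` carrier H" unfolding M_eq using 1 by (simp add: xl)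
    then have "?M = Inl ` R" using Rin subs(1) by blast
    then have cR: "card R = 3" using deg[OF v1] by (simp add: card_image)
    have finR: "finite R" using cR by (intro card_ge_0_finite) simp
    have bij: "bij_betw (\<lambda>x. inv x) R R" using invR finR by (metis bij_betw_imageI eq_card_imp_inj_on)
    have "2 dvd card {x \<in> R. inv x \<noteq> x}"
      by (rule card_fixed_order_prime_cong[OF two_is_prime_nat finR bij]) (use subs(1) in \<open>auto simp: numeral_2_eq_2\<close>)
    moreover have "{x \<in> R. inv x \<noteq> x} = R"
    proof -
      have "inv y \<noteq> y" if y: "y \<in> R" for y
      proof
        assume "inv y = y"
        have yc: "y \<in> carrier H" using y subs(1) by blast
        then have "y \<otimes> y = \<one>" using \<open>inv y = y\<close> r_inv[OF yc] by simp
        then have "y [^] (2::int) = \<one>" using int_pow_int[of H y 2] yc by (simp add: numeral_2_eq_2)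
        then have "y = \<one>" using coprime_power_one[OF M.p yc M.pow_card[OF yc], of 2] by simp
        then show False using y one by simp
      qed
      then show ?thesis by blast
    qed
    ultimately show ?thesis using cR by simp
  qed (use that in blast)
  define s1 where "s1 = d \<otimes> \<alpha> s0"
  define s2 where "s2 = d \<otimes> \<alpha> s1"
  have s1: "s1 \<in> carrier H" "x w = Inr s1" using s0 d(1) xr by (simp_all add: s1_def)
  have s2: "s2 \<in> carrier H" "x (x w) = Inr s2" using s1 d(1) xr by (simp_all add: s2_def)
  have s3: "d \<otimes> \<alpha> s2 = s0" using x3[OF w] xr[OF s2(1)] s2 s0 by simp
  have s2': "x (Inr s1) = Inr s2" using s2(2) by (simp only: s1(2))
  have M3: "?M = {Inr s0, Inr s1, Inr s2}" unfolding M_eq s1(2) s2' unfolding s0(2) ..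
  have R: "R = {}" using Rin unfolding M3 by blast
  have S: "S = {s0, s1, s2}" using Sin unfolding M3 by blast
  have sd: "s0 \<noteq> s1" "s0 \<noteq> s2" "s1 \<noteq> s2" using dist[unfolded s1(2) s2'] by (simp_all add: s0(2))
  \<comment> \<open>The inverses of the elements of \<open>S\<close> already give three neighbours
    of \<open>1\<^sub>1\<close>, so the degree leaves no room for \<open>L\<close>.\<close>
  have L: "L = {}"
  proof -
    have fL: "finite L" using subs(2) finH finite_subset by blast
    have "Inr ` L \<union> Inl ` (\<lambda>x. inv x) ` S \<subseteq> parcs B `` {Inr \<one>}" using subs by (auto simp: arc_iff)
    then have "card (Inr ` L \<union> Inl ` (\<lambda>x. inv x) ` S :: ('h + 'h) set) \<le> 3"
      using card_mono[OF finite_nbrs[of "Inr \<one>"]] deg[of "Inr \<one>"] by simp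
    moreover have "card (Inr ` L \<union> Inl ` (\<lambda>x. inv x) ` S :: ('h + 'h) set) = card (Inr ` L :: ('h + 'h) set) + card (Inl ` (\<lambda>x. inv x) ` S :: ('h + 'h) set)"
      by (rule card_Un_disjoint) (use fL S in auto)
    moreover have "card (Inl ` (\<lambda>x. inv x) ` S :: ('h + 'h) set) = 3"
    proof -
      have "inj_on (\<lambda>x. inv x) S" using subs(3) by (auto simp: inj_on_def)
      then show ?thesis using sd by (simp add: card_image S)
    qed
    ultimately show ?thesis using fL by (simp add: card_image)
  qed
  have noR: "q \<notin> R" and noL: "q \<notin> L" for q using R L by simp_all
  note sc = s0(1) s1(1) s2(1)
  have \<alpha>s: "\<alpha> s0 = inv d \<otimes> s1" "\<alpha> s1 = inv d \<otimes> s2" "\<alpha> s2 = inv d \<otimes> s0"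
  proof -
    show "\<alpha> s0 = inv d \<otimes> s1" "\<alpha> s1 = inv d \<otimes> s2" using sc d(1) by (simp_all add: s1_def s2_def)
    show "\<alpha> s2 = inv d \<otimes> s0" unfolding s3[symmetric] using sc d(1) by simp
  qed
  have "metacyclic_rotation H r n g (inv s0 \<otimes> s1) (inv s0 \<otimes> s2) \<alpha>"
  proof (intro metacyclic_rotation.intro metacyclic_rotation_axioms.intro M \<alpha>_hom na)
    show "inv s0 \<otimes> s1 \<in> carrier H" "inv s0 \<otimes> s2 \<in> carrier H" using sc by simp_all
    show "\<alpha> (inv s0 \<otimes> s1) = inv (inv s0 \<otimes> s1) \<otimes> (inv s0 \<otimes> s2)" "\<alpha> (inv s0 \<otimes> s2) = inv (inv s0 \<otimes> s1)"
      using sc d(1) by (simp_all add: \<alpha>s inv_mult_group m_assoc)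
    fix K assume K: "subgroup K H" "inv s0 \<otimes> s1 \<in> K" "inv s0 \<otimes> s2 \<in> K"
    have Kc: "h \<in> carrier H" if "h \<in> K" for h using subgroup.mem_carrier[OF K(1) that] .
    have t: "inv s0 \<otimes> s \<in> K" if "s \<in> S" for s
      using that K subgroup.one_closed[OF K(1)] s0(1) unfolding S by auto
    \<comment> \<open>The set \<open>K\<close> in one half and \<open>s0 K\<close> in the other:
      closed under adjacency as soon as \<open>K\<close> contains both generators.\<close>
    let ?U = "Inl ` K \<union> (\<lambda>h. Inr (s0 \<otimes> h)) ` K"
    have "?U = pverts B"
    proof (rule conn)
      show "?U \<subseteq> pverts B" using Kc s0(1) by auto
      show "?U \<noteq> {}" using subgroup.one_closed[OF K(1)] by blast
      fix u v assume u: "u \<in> ?U" and uv: "(u, v) \<in> parcs B"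
      from u consider h where "h \<in> K" "u = Inl h" | h where "h \<in> K" "u = Inr (s0 \<otimes> h)" by blast
      then show "v \<in> ?U"
      proof cases
        case (1 h)
        obtain q where q: "v = Inr q" "q \<in> carrier H" "q \<otimes> inv h \<in> S"
          using uv unfolding 1(2) by (cases v) (auto simp: arc_iff noR)
        have "inv s0 \<otimes> (q \<otimes> inv h) \<otimes> h \<in> K" using subgroup.m_closed[OF K(1) t[OF q(3)] 1(1)] .
        then have "inv s0 \<otimes> q \<in> K" using q(2) Kc[OF 1(1)] s0(1) by (simp add: m_assoc)
        moreover have "v = Inr (s0 \<otimes> (inv s0 \<otimes> q))" using q s0(1) by simp
        ultimately show ?thesis by blast
      next
        case (2 h)
        obtain q where q: "v = Inl q" "q \<in> carrier H" "s0 \<otimes> h \<otimes> inv q \<in> S"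
          using uv unfolding 2(2) by (cases v) (auto simp: arc_iff noL)
        have "inv (inv s0 \<otimes> (s0 \<otimes> h \<otimes> inv q)) \<otimes> h \<in> K"
          using subgroup.m_closed[OF K(1) subgroup.m_inv_closed[OF K(1) t[OF q(3)]] 2(1)] .
        then have "q \<in> K" using q(2) Kc[OF 2(1)] s0(1) by (simp add: m_assoc inv_mult_group)
        then show ?thesis using q(1) by blast
      qed
    qed
    then show "carrier H \<subseteq> K" using vert_iff(1) by blast
  qed
  then show thesis using that R L S sd by blast
qed

end

section \<open>Labelled walks and normality\<close>

datatype label = L0 | L1 | L2

lemma UNIV_label: "UNIV = {L0, L1, L2}"
  using label.exhaust by blast

instance label :: finite by standard (simp add: UNIV_label)

locale labelled_bicay = bicay H R L S for H :: "('h, 'm) monoid_scheme" (structure) and R L S +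
  fixes s :: "label \<Rightarrow> 'h"
  assumes R_empty: "R = {}" and L_empty: "L = {}" and S_eq: "S = range s" and s_inj: "inj s"
begin

lemma s [simp]: "s l \<in> carrier H"
  using data by (auto simp: bicay_data_def S_eq)

text \<open>Each edge class is a perfect matching; a step moves along its edge and is therefore an
  involution on the vertices.\<close>

fun step :: "label \<Rightarrow> 'h + 'h \<Rightarrow> 'h + 'h" where
  "step l (Inl h) = Inr (s l \<otimes> h)"
| "step l (Inr g) = Inl (inv (s l) \<otimes> g)"

lemma step_closed [simp]: "v \<in> pverts B \<Longrightarrow> step l v \<in> pverts B"
  by (cases v) auto

lemma step_step [simp]: "v \<in> pverts B \<Longrightarrow> step l (step l v) = v"
  by (cases v) auto

lemma step_eq_iff [simp]: "v \<in> pverts B \<Longrightarrow> step l v = step l' v \<longleftrightarrow> l = l'"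
  using s_inj by (cases v) (auto simp: inj_def)

lemma noR: "q \<notin> R" and noL: "q \<notin> L"
  using R_empty L_empty by simp_all

lemma arc_step: "v \<in> pverts B \<Longrightarrow> (v, w) \<in> parcs B \<longleftrightarrow> (\<exists>l. w = step l v)"
proof
  assume v: "v \<in> pverts B" and vw: "(v, w) \<in> parcs B"
  then have w: "w \<in> pverts B" using arc_vert by blast
  show "\<exists>l. w = step l v"
  proof (cases v)
    case (Inl h)
    then obtain q where q: "w = Inr q" using vw by (cases w) (auto simp: arc_iff noR)
    then have "q \<otimes> inv h \<in> S" using vw Inl by (simp add: arc_iff)
    then obtain l where l: "q \<otimes> inv h = s l" unfolding S_eq by blast
    then have "q = s l \<otimes> h" using v w Inl q by (simp add: inv_solve_right'[symmetric])
    then show ?thesis using Inl q by (intro exI[of _ l]) simp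
  next
    case (Inr g)
    then obtain q where q: "w = Inl q" using vw by (cases w) (auto simp: arc_iff noL)
    then have "g \<otimes> inv q \<in> S" using vw Inr by (simp add: arc_iff)
    then obtain l where l: "g \<otimes> inv q = s l" unfolding S_eq by blast
    have qg: "q \<in> carrier H" "g \<in> carrier H" using v w Inr q by simp_all
    have "inv (s l) \<otimes> g = inv (g \<otimes> inv q) \<otimes> g" by (simp only: l)
    also have "\<dots> = q" using qg by (simp add: inv_mult_group m_assoc)
    finally show ?thesis using Inr q by (intro exI[of _ l]) simp
  qed
next
  assume v: "v \<in> pverts B" and "\<exists>l. w = step l v"
  then obtain l where l: "w = step l v" by blast
  have "s l \<in> S" by (simp add: S_eq)
  then show "(v, w) \<in> parcs B" using v unfolding l
    by (cases v) (simp_all add: arc_iff m_assoc inv_mult_group)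
qed

lemma rt_step: "g \<in> carrier H \<Longrightarrow> v \<in> pverts B \<Longrightarrow> rt g (step l v) = step l (rt g v)"
  by (cases v) (auto simp: m_assoc)

lemma step_conn:
  assumes "U \<subseteq> pverts B" "U \<noteq> {}" "\<And>u l. u \<in> U \<Longrightarrow> step l u \<in> U" shows "U = pverts B"
proof (rule conn[OF assms(1,2)])
  fix u v assume u: "u \<in> U" and "(u, v) \<in> parcs B"
  then obtain l where "v = step l u" using arc_step assms(1) by blast
  then show "v \<in> U" using assms(3)[OF u] by simp
qed

text \<open>Counts nonbacktracking walks from \<open>v\<close> to \<open>t\<close>; \<open>l\<close> is the label of the edge along which \<open>v\<close> was reached.\<close>

primrec walks :: "nat \<Rightarrow> label \<Rightarrow> 'h + 'h \<Rightarrow> 'h + 'h \<Rightarrow> nat" where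
  "walks 0 l v t = (if v = t then 1 else 0)"
| "walks (Suc k) l v t = (\<Sum>l'\<in>UNIV - {l}. walks k l' (step l' v) t)"

text \<open>For an automorphism \<open>f\<close>, this is the permutation of edge classes that it
  induces at \<open>v\<close>.\<close>

definition perm :: "('h + 'h \<Rightarrow> 'h + 'h) \<Rightarrow> 'h + 'h \<Rightarrow> label \<Rightarrow> label" where
  "perm f v l = (SOME l'. f (step l v) = step l' (f v))"

lemma perm:
  assumes "f \<in> graph_aut B" "v \<in> pverts B" shows "f (step l v) = step (perm f v l) (f v)"
proof -
  have "(v, step l v) \<in> parcs B" using arc_step[OF assms(2)] by blast
  then have "(f v, f (step l v)) \<in> parcs B" using aut_arc[OF assms(1)] assms(2) by simp
  then have "\<exists>l'. f (step l v) = step l' (f v)" using arc_step[OF aut_closed[OF assms]] by blast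
  then show ?thesis unfolding perm_def by (rule someI_ex)
qed

lemma perm_inj:
  assumes "f \<in> graph_aut B" "v \<in> pverts B" shows "inj (perm f v)"
proof (rule injI)
  fix l l' assume "perm f v l = perm f v l'"
  then have "f (step l v) = f (step l' v)" using perm[OF assms] by simp
  then show "l = l'" using aut_inj[OF assms(1), of "step l v" "step l' v"] assms(2) by simp
qed

text \<open>An edge has the same class seen from either end.\<close>

lemma perm_step:
  assumes f: "f \<in> graph_aut B" and v: "v \<in> pverts B" shows "perm f (step l v) l = perm f v l"
proof -
  have "f v = step (perm f (step l v) l) (f (step l v))" using perm[OF f step_closed[OF v], of l l] v by simp
  then have "step (perm f (step l v) l) (step (perm f v l) (f v)) = step (perm f v l) (step (perm f v l) (f v))"
    using perm[OF f v, of l] aut_closed[OF f v] by simp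
  then show ?thesis using step_eq_iff[OF step_closed[OF aut_closed[OF f v]]] by blast
qed

lemma walks_aut:
  assumes f: "f \<in> graph_aut B" and t: "t \<in> pverts B"
  shows "v \<in> pverts B \<Longrightarrow> walks k l v t = walks k (perm f v l) (f v) (f t)"
proof (induction k arbitrary: l v)
  case 0
  then show ?case using aut_inj[OF f _ t] by simp
next
  case (Suc k)
  have bij: "bij_betw (perm f v) (UNIV - {l}) (UNIV - {perm f v l})"
  proof -
    have "perm f v ` UNIV = UNIV" using perm_inj[OF f Suc.prems] by (simp add: finite_UNIV_inj_surj)
    then have "bij_betw (perm f v) UNIV UNIV" using perm_inj[OF f Suc.prems] by (simp add: bij_betw_def)
    then show ?thesis by (rule bij_betw_DiffI) (simp_all add: bij_betw_def)
  qed
  have "walks (Suc k) l v t = (\<Sum>l'\<in>UNIV - {l}. walks k (perm f v l') (step (perm f v l') (f v)) (f t))"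
    using Suc by (simp add: perm_step[OF f] perm[OF f])
  also have "\<dots> = (\<Sum>l'\<in>UNIV - {perm f v l}. walks k l' (step l' (f v)) (f t))"
    by (rule sum.reindex_bij_betw[OF bij])
  finally show ?case by simp
qed

text \<open>Applied to a path with classes \<open>x\<close>, \<open>y\<close>, \<open>x\<close>, the
  counts show that an automorphism induces the same permutation of classes at both ends of an edge,
  hence everywhere. Conjugating a translation by it therefore gives an automorphism preserving every
  class and both halves. By connectedness such an automorphism is determined by the image of
  \<open>1\<^sub>0\<close>, so it is a translation.\<close>

lemma normal_if_walks_distinguish:
  assumes W: "\<And>v x y z. v \<in> pverts B \<Longrightarrow> x \<noteq> y \<Longrightarrow> y \<noteq> z \<Longrightarrow>
      walks k z (step z (step y (step x v))) v = (if z = x then c else d)" and cd: "c \<noteq> d"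
  shows "RT \<lhd> aut_group B"
proof -
  have local_perm: "perm f (step y w) = perm f w" if f: "f \<in> graph_aut B" and w: "w \<in> pverts B" for f y w
  proof
    fix x
    show "perm f (step y w) x = perm f w x"
    proof (cases "x = y")
      case True then show ?thesis using perm_step[OF f w] by simp
    next
      case False
      \<comment> \<open>Starting one step back makes the edge between \<open>w\<close> and
        \<open>step y w\<close> the middle edge of the path.\<close>
      let ?v = "step x w"
      have v: "?v \<in> pverts B" using w by simp
      let ?x = "perm f w x" and ?y = "perm f w y" and ?z = "perm f (step y w) x"
      have xy: "?x \<noteq> ?y" using injD[OF perm_inj[OF f w], of x y] False by blast
      have yz: "?y \<noteq> ?z" using perm_step[OF f w, of y] injD[OF perm_inj[OF f step_closed[OF w]], of y y x] False by auto
      have "c = walks k x (step x (step y w)) ?v" using W[OF v, of x y x] False w by simp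
      also have "\<dots> = walks k (perm f (step x (step y w)) x) (f (step x (step y w))) (f ?v)"
        using w by (intro walks_aut[OF f v]) simp
      also have "perm f (step x (step y w)) x = ?z" using perm_step[OF f step_closed[OF w]] .
      also have "f (step x (step y w)) = step ?z (step ?y (step ?x (f ?v)))"
        using w aut_closed[OF f w] by (simp add: perm[OF f])
      also have "walks k ?z \<dots> (f ?v) = (if ?z = ?x then c else d)"
        using W[OF aut_closed[OF f v] xy yz] .
      finally show ?thesis using cd by (simp split: if_splits)
    qed
  qed
  have glob: "perm f v = perm f (Inl \<one>)" if f: "f \<in> graph_aut B" and v: "v \<in> pverts B" for f v
  proof -
    have "{v \<in> pverts B. perm f v = perm f (Inl \<one>)} = pverts B"
    proof (rule step_conn)
      have "Inl \<one> \<in> {v \<in> pverts B. perm f v = perm f (Inl \<one>)}" by simp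
      then show "{v \<in> pverts B. perm f v = perm f (Inl \<one>)} \<noteq> {}" by blast
    qed (use local_perm[OF f] in auto)
    then show ?thesis using v by blast
  qed
  \<comment> \<open>The graph is bipartite, so an automorphism preserves both halves or exchanges
    them.\<close>
  have sides: "(isl (f v) = isl v) = isl (f (Inl \<one>))" if f: "f \<in> graph_aut B" and v: "v \<in> pverts B" for f v
  proof -
    have isl_step: "isl (step l u) \<longleftrightarrow> \<not> isl u" for l u by (cases u) simp_all
    have "{v \<in> pverts B. (isl (f v) = isl v) = isl (f (Inl \<one>))} = pverts B"
    proof (rule step_conn)
      have "Inl \<one> \<in> {v \<in> pverts B. (isl (f v) = isl v) = isl (f (Inl \<one>))}" by simp
      then show "{v \<in> pverts B. (isl (f v) = isl v) = isl (f (Inl \<one>))} \<noteq> {}" by blast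
    qed (auto simp: perm[OF f] isl_step)
    then show ?thesis using v by blast
  qed
  have "f \<otimes>\<^bsub>aut_group B\<^esub> r \<otimes>\<^bsub>aut_group B\<^esub> inv\<^bsub>aut_group B\<^esub> f \<in> RT" if f: "f \<in> graph_aut B" and "r \<in> RT" for f r
  proof -
    obtain g where g: "g \<in> carrier H" "r = rt g" using \<open>r \<in> RT\<close> by (auto simp: right_translations_def)
    let ?f' = "inv\<^bsub>aut_group B\<^esub> f" let ?\<sigma> = "f \<otimes>\<^bsub>aut_group B\<^esub> r \<otimes>\<^bsub>aut_group B\<^esub> ?f'"
    have f': "?f' \<in> graph_aut B" by (rule aut_inv_closed[OF f])
    have \<sigma>: "?\<sigma> \<in> graph_aut B" using f f' rt_aut g by (simp add: aut_mult_closed)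
    have app: "?\<sigma> v = f (rt g (?f' v))" if "v \<in> pverts B" for v
      using that f f' g rt_aut by (simp add: aut_mult_app aut_mult_closed aut_closed)
    have comm: "?\<sigma> (step m v) = step m (?\<sigma> v)" if v: "v \<in> pverts B" for m v
    proof -
      let ?\<pi> = "perm f (Inl \<one>)"
      have "surj ?\<pi>" using perm_inj[OF f, of "Inl \<one>"] by (simp add: finite_UNIV_inj_surj)
      then obtain l where l: "m = ?\<pi> l" by blast
      let ?u = "?f' v"
      have u: "?u \<in> pverts B" "f ?u = v" using v f f' by (simp_all add: aut_closed aut_inv_app)
      have fs: "f (step l w) = step m (f w)" if "w \<in> pverts B" for w using perm[OF f that] glob[OF f that] l by simp
      have "step m v = f (step l ?u)" using fs[OF u(1)] u(2) by simp
      then have "?f' (step m v) = step l ?u" using f u(1) by (simp add: aut_inv_app)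
      then have "?\<sigma> (step m v) = f (rt g (step l ?u))" using app v by simp
      also have "\<dots> = f (step l (rt g ?u))" using rt_step g(1) u(1) by simp
      also have "\<dots> = step m (f (rt g ?u))" using fs aut_closed[OF rt_aut[OF g(1)] u(1)] .
      finally show ?thesis using app v by simp
    qed
    let ?u = "?f' (Inl \<one>)"
    have u: "?u \<in> pverts B" "f ?u = Inl \<one>" using f f' by (simp_all add: aut_closed aut_inv_app)
    have ru: "rt g ?u \<in> pverts B" using aut_closed[OF rt_aut[OF g(1)] u(1)] .
    have "isl (rt g ?u) = isl ?u" using u(1) by (auto elim!: vertE)
    then have "isl (f (rt g ?u)) = isl (f ?u)" using sides[OF f ru] sides[OF f u(1)] by blast
    then have "isl (?\<sigma> (Inl \<one>))" using app u(2) by simp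
    moreover have "?\<sigma> (Inl \<one>) \<in> pverts B" using aut_closed[OF \<sigma>] by simp
    ultimately obtain h where h: "h \<in> carrier H" "?\<sigma> (Inl \<one>) = Inl h" by (auto elim: vertE)
    have "{v \<in> pverts B. ?\<sigma> v = rt h v} = pverts B"
    proof (rule step_conn)
      have "Inl \<one> \<in> {v \<in> pverts B. ?\<sigma> v = rt h v}" using h by simp
      then show "{v \<in> pverts B. ?\<sigma> v = rt h v} \<noteq> {}" by blast
    qed (use comm rt_step h in auto)
    then have "?\<sigma> = rt h" using h \<sigma> by (intro rt_eqI) auto
    then show ?thesis using h by (auto simp: right_translations_def)
  qed
  then show ?thesis using RT_subgroup by (simp add: A.normal_inv_iff)
qed

end

text \<open>A state \<open>(m, n, t)\<close> stands for \<open>a\<^sup>m b\<^sup>n k\<^sup>t\<close>, which a step multiplies from the left by \<open>1\<close>, \<open>a\<close> or \<open>b\<close>, or by the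
  inverse if the Boolean holds, that is, for a step from \<open>H\<^sub>1\<close> to \<open>H\<^sub>0\<close>.\<close>

fun next_state :: "label \<Rightarrow> bool \<Rightarrow> int \<times> int \<times> int \<Rightarrow> int \<times> int \<times> int" where
  "next_state L0 b (m, n, t) = (m, n, t)"
| "next_state L1 b (m, n, t) = (if b then (m - 1, n, t) else (m + 1, n, t))"
| "next_state L2 b (m, n, t) = (if b then (m, n - 1, t + m) else (m, n + 1, t - m))"

text \<open>The counterpart of \<open>walks\<close> on exponents, with the closing condition as a
  parameter. The two admissible labels are written out so that the count can be evaluated
  symbolically.\<close>

primrec closures :: "(int \<times> int \<times> int \<Rightarrow> bool) \<Rightarrow> nat \<Rightarrow> label \<Rightarrow> bool \<Rightarrow> int \<times> int \<times> int \<Rightarrow> nat" where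
  "closures D 0 l b w = (if D w then 1 else 0)"
| "closures D (Suc k) l b w = (case l of
      L0 \<Rightarrow> closures D k L1 (\<not> b) (next_state L1 b w) + closures D k L2 (\<not> b) (next_state L2 b w)
    | L1 \<Rightarrow> closures D k L0 (\<not> b) (next_state L0 b w) + closures D k L2 (\<not> b) (next_state L2 b w)
    | L2 \<Rightarrow> closures D k L0 (\<not> b) (next_state L0 b w) + closures D k L1 (\<not> b) (next_state L1 b w))"

text \<open>A closed walk of length 12 has nine steps after a path of length 3.\<close>

definition nine :: nat where "nine = Suc (Suc (Suc (Suc (Suc (Suc (Suc (Suc (Suc 0))))))))"

definition state3 :: "label \<Rightarrow> label \<Rightarrow> label \<Rightarrow> bool \<Rightarrow> int \<times> int \<times> int" where
  "state3 x y z b = next_state z b (next_state y (\<not> b) (next_state x b (0, 0, 0)))"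

definition distinguishes :: "(int \<times> int \<times> int \<Rightarrow> bool) \<Rightarrow> nat \<Rightarrow> nat \<Rightarrow> bool \<Rightarrow> bool" where
  "distinguishes D c d b \<longleftrightarrow>
     list_all (\<lambda>x. list_all (\<lambda>y. list_all (\<lambda>z. x = y \<or> y = z \<or>
       closures D nine z (\<not> b) (state3 x y z b) = (if z = x then c else d)) [L0, L1, L2]) [L0, L1, L2]) [L0, L1, L2]"

lemma distinguishesD:
  "distinguishes D c d b \<Longrightarrow> x \<noteq> y \<Longrightarrow> y \<noteq> z \<Longrightarrow>
    closures D nine z (\<not> b) (state3 x y z b) = (if z = x then c else d)"
  unfolding distinguishes_def list_all_iff set_simps UNIV_label[symmetric] by blast

text \<open>The relations common to all groups of the kind considered: \<open>k\<close> has order 3,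
  and nothing else is assumed about \<open>a\<close> and \<open>b\<close>.\<close>

definition rel_large :: "int \<times> int \<times> int \<Rightarrow> bool" where
  "rel_large w = (case w of (m, n, t) \<Rightarrow> m = 0 \<and> n = 0 \<and> t mod 3 = 0)"

definition rel_mid :: "int \<Rightarrow> int \<times> int \<times> int \<Rightarrow> bool" where
  "rel_mid i w = (case w of (m, n, t) \<Rightarrow> m mod 3 = 0 \<and> (m - n) mod 9 = 0 \<and> (t + i * (n div 3)) mod 3 = 0)"

text \<open>The counts 3 and 7 are found by evaluation; what matters is that they differ.\<close>

lemma distinguishes_large: "distinguishes rel_large 3 7 True" "distinguishes rel_large 3 7 False"
  by code_simp+

lemma distinguishes_mid:
  "distinguishes (rel_mid 1) 7 9 True" "distinguishes (rel_mid 1) 7 9 False"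
  "distinguishes (rel_mid 2) 7 9 True" "distinguishes (rel_mid 2) 7 9 False"
  by code_simp+

text \<open>The possible changes of an exponent within \<open>k\<close> steps, doubled to avoid
  halving an odd \<open>k\<close>. The extra 1 is on the side of the direction of the next
  step.\<close>

definition drift :: "nat \<Rightarrow> bool \<Rightarrow> int \<Rightarrow> bool" where
  "drift k b x \<longleftrightarrow> (if b then - (int k + 1) \<le> 2 * x \<and> 2 * x \<le> int k
     else - int k \<le> 2 * x \<and> 2 * x \<le> int k + 1)"

lemma drift_Suc: "drift k (\<not> b) (x - y) \<Longrightarrow> (y = 0 \<or> y = (if b then - 1 else 1)) \<Longrightarrow> drift (Suc k) b x"
  unfolding drift_def by (cases b) auto

text \<open>Forward and backward steps alternate, so only about half of the steps can move an exponent in a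
  given direction.\<close>

lemma closures_cong:
  assumes "\<And>m' n' t'. drift k b (m' - m) \<Longrightarrow> drift k b (n' - n) \<Longrightarrow> D (m', n', t') = D' (m', n', t')"
  shows "closures D k l b (m, n, t) = closures D' k l b (m, n, t)"
  using assms
proof (induction k arbitrary: l b m n t)
  case 0
  then show ?case by (simp add: drift_def)
next
  case (Suc k)
  have "closures D k l' (\<not> b) (next_state l' b (m, n, t)) = closures D' k l' (\<not> b) (next_state l' b (m, n, t))" for l'
  proof -
    obtain m1 n1 t1 where e: "next_state l' b (m, n, t) = (m1, n1, t1)" by (cases "next_state l' b (m, n, t)")
    have m1: "m1 - m = 0 \<or> m1 - m = (if b then - 1 else 1)" "n1 - n = 0 \<or> n1 - n = (if b then - 1 else 1)"
      using e by (cases l'; auto split: if_splits)+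
    have "D (m', n', t') = D' (m', n', t')" if "drift k (\<not> b) (m' - m1)" "drift k (\<not> b) (n' - n1)" for m' n' t'
      using Suc.prems drift_Suc[of k b "m' - m" "m1 - m"] drift_Suc[of k b "n' - n" "n1 - n"] m1 that by simp
    then show ?thesis unfolding e by (rule Suc.IH)
  qed
  then show ?case by (cases l) (simp_all del: next_state.simps)
qed

section \<open>Walks in Heisenberg coordinates\<close>

locale rotation_graph = labelled_bicay H R L S s + M: metacyclic_rotation H r n g a b \<alpha>
  for H :: "('h, 'm) monoid_scheme" (structure) and R L S s r n g a b \<alpha> +
  assumes a_eq: "inv (s L0) \<otimes> s L1 = a" and b_eq: "inv (s L0) \<otimes> s L2 = b"
begin

definition elt :: "int \<times> int \<times> int \<Rightarrow> 'h" where
  "elt w = (case w of (m, n, t) \<Rightarrow> M.nf m n t)"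

lemma elt_closed [simp]: "elt w \<in> carrier H" by (cases w) (simp add: elt_def)

text \<open>The half \<open>H\<^sub>1\<close> is shifted by \<open>s L0\<close>, so that edges of
  class \<open>L0\<close> join equal coordinates and the other classes multiply by \<open>a\<close>
  and \<open>b\<close>.\<close>

definition pos :: "bool \<Rightarrow> 'h \<Rightarrow> 'h + 'h" where
  "pos e h = (if e then Inr (s L0 \<otimes> h) else Inl h)"

lemma pos_closed [simp]: "h \<in> carrier H \<Longrightarrow> pos e h \<in> pverts B" by (simp add: pos_def)

lemma elt_next: "elt (next_state l d w) = (if d then inv (inv (s L0) \<otimes> s l) else inv (s L0) \<otimes> s l) \<otimes> elt w"
proof -
  obtain m n t where w: "w = (m, n, t)" by (cases w)
  show ?thesis
  proof (cases l)
    case L0 then show ?thesis by (simp add: w)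
  next
    case L1
    have "M.nf 1 0 0 \<otimes> M.nf m n t = M.nf (m + 1) n t" "inv (M.nf 1 0 0) \<otimes> M.nf m n t = M.nf (m - 1) n t"
      unfolding M.nf_inv M.nf_mult by (simp_all add: add.commute)
    then show ?thesis by (simp add: L1 w elt_def a_eq M.nf_a)
  next
    case L2
    have "M.nf 0 1 0 \<otimes> M.nf m n t = M.nf m (n + 1) (t - m)" "inv (M.nf 0 1 0) \<otimes> M.nf m n t = M.nf m (n - 1) (t + m)"
      unfolding M.nf_inv M.nf_mult by (simp_all add: add.commute)
    then show ?thesis by (simp add: L2 w elt_def b_eq M.nf_b)
  qed
qed

lemma step_pos:
  assumes "h \<in> carrier H" shows "step l (pos e (elt w \<otimes> h)) = pos (\<not> e) (elt (next_state l e w) \<otimes> h)"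
  using assms by (cases e) (simp_all add: pos_def elt_next m_assoc inv_mult_group)

text \<open>Steps multiply from the left and \<open>h\<close> stands on the right, so the count does
  not depend on the base point. The half of the target follows from the parity of
  \<open>k\<close>.\<close>

lemma walks_closures:
  assumes h: "h \<in> carrier H"
  shows "walks k l (pos e (elt w \<otimes> h)) (pos (if even k then e else \<not> e) h) = closures (\<lambda>w. elt w = \<one>) k l e w"
proof (induction k arbitrary: l e w)
  case 0
  then show ?case using h by (auto simp: pos_def)
next
  case (Suc k)
  have "walks k l' (pos (\<not> e) (elt (next_state l' e w) \<otimes> h)) (pos (if even (Suc k) then e else \<not> e) h) =
      closures (\<lambda>w. elt w = \<one>) k l' (\<not> e) (next_state l' e w)" for l'
    using Suc[of l' "\<not> e" "next_state l' e w"] by (cases "even k") simp_all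
  then show ?case using h by (cases l) (simp_all add: UNIV_label insert_Diff_if step_pos)
qed

text \<open>\<open>D\<close> stands in for triviality in \<open>H\<close>: a decidable condition
  that gives the same counts and can be evaluated without knowing the group.\<close>

lemma normal_if_distinguishes:
  assumes D: "\<And>e x y z. closures (\<lambda>w. elt w = \<one>) nine z (\<not> e) (state3 x y z e) = closures D nine z (\<not> e) (state3 x y z e)"
    and d: "distinguishes D c d True" "distinguishes D c d False" and cd: "c \<noteq> d"
  shows "RT \<lhd> aut_group B"
proof (rule normal_if_walks_distinguish[where k = nine])
  fix v and x y z :: label assume v: "v \<in> pverts B" and xy: "x \<noteq> y" and yz: "y \<noteq> z"
  obtain e h where h: "h \<in> carrier H" "v = pos e h"
  proof (cases rule: vertE[OF v])
    case (1 h) then show ?thesis using that[of h False] by (simp add: pos_def)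
  next
    case (2 h) then show ?thesis using that[of "inv (s L0) \<otimes> h" True] by (simp add: pos_def)
  qed
  have v0: "v = pos e (elt (0, 0, 0) \<otimes> h)" using h by (simp add: elt_def)
  have "step z (step y (step x v)) = pos (\<not> e) (elt (state3 x y z e) \<otimes> h)"
    unfolding v0 using h(1) by (simp add: step_pos state3_def)
  then have "walks nine z (step z (step y (step x v))) v = closures (\<lambda>w. elt w = \<one>) nine z (\<not> e) (state3 x y z e)"
    using walks_closures[OF h(1), of nine z "\<not> e" "state3 x y z e"] h(2) by (simp add: nine_def)
  also have "\<dots> = (if z = x then c else d)"
    unfolding D using distinguishesD[OF _ xy yz, of D c d e] d by (cases e) simp_all
  finally show "walks nine z (step z (step y (step x v))) v = (if z = x then c else d)" .
qed (rule cd)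

lemma normal_if_mid:
  assumes i: "\<not> 3 dvd i" and rel: "\<And>m n t. M.nf m n t = \<one> \<longleftrightarrow> 3 dvd m \<and> 9 dvd m - n \<and> 3 dvd t + i * (n div 3)"
  shows "RT \<lhd> aut_group B"
proof -
  have eq: "(\<lambda>w. elt w = \<one>) = rel_mid (i mod 3)"
  proof
    fix w :: "int \<times> int \<times> int"
    obtain m n t where w: "w = (m, n, t)" by (cases w)
    have "(t + i mod 3 * (n div 3)) mod 3 = (t + i * (n div 3)) mod 3" by (intro mod_add_cong mod_mult_cong) simp_all
    then show "(elt w = \<one>) = rel_mid (i mod 3) w" unfolding w elt_def rel_mid_def prod.case rel dvd_eq_mod_eq_0 by (simp only:)
  qed
  have "i mod 3 = 1 \<or> i mod 3 = 2" using i by presburger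
  then show ?thesis
  proof
    assume "i mod 3 = 1"
    then show ?thesis by (intro normal_if_distinguishes[of "rel_mid 1" 7 9]) (simp_all add: eq distinguishes_mid)
  next
    assume "i mod 3 = 2"
    then show ?thesis by (intro normal_if_distinguishes[of "rel_mid 2" 7 9]) (simp_all add: eq distinguishes_mid)
  qed
qed

text \<open>No exponent reaches 9 in absolute value: it is at most 3 after the path and changes by
  at most 5 in the nine remaining steps. So the only relations met are those with both exponents
  zero, whatever the group.\<close>

lemma normal_if_large:
  assumes rel: "\<And>m n t. M.nf m n t = \<one> \<Longrightarrow> 9 dvd m \<and> 9 dvd n"
  shows "RT \<lhd> aut_group B"
proof (rule normal_if_distinguishes[of rel_large 3 7])
  fix e and x y z :: label
  obtain m n t where w: "state3 x y z e = (m, n, t)" by (cases "state3 x y z e")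
  have mn: "\<bar>m\<bar> \<le> 3" "\<bar>n\<bar> \<le> 3"
    using w unfolding state3_def by (cases x; cases y; cases z; cases e; auto)+
  show "closures (\<lambda>w. elt w = \<one>) nine z (\<not> e) (state3 x y z e) = closures rel_large nine z (\<not> e) (state3 x y z e)"
    unfolding w
  proof (rule closures_cong)
    fix m' n' t' assume "drift nine (\<not> e) (m' - m)" "drift nine (\<not> e) (n' - n)"
    then have "\<bar>m'\<bar> < 9" "\<bar>n'\<bar> < 9" using mn by (auto simp: drift_def nine_def split: if_splits)
    then have z: "9 dvd m' \<longleftrightarrow> m' = 0" "9 dvd n' \<longleftrightarrow> n' = 0" by presburger+
    show "(elt (m', n', t') = \<one>) = rel_large (m', n', t')"
    proof (cases "m' = 0 \<and> n' = 0")
      case True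
      then show ?thesis by (simp add: elt_def rel_large_def M.nf_k M.k_pow_one_iff dvd_eq_mod_eq_0)
    next
      case False
      then show ?thesis using rel[of m' n' t'] z by (auto simp: elt_def rel_large_def)
    qed
  qed
qed (simp_all add: distinguishes_large)

end

section \<open>Isomorphisms and presentations\<close>

text \<open>An arc is the pair of its ends, so a vertex map determines all components of an
  isomorphism.\<close>

lemma digraph_iso_pairI:
  assumes "parcs G \<subseteq> pverts G \<times> pverts G" "parcs G' \<subseteq> pverts G' \<times> pverts G'" and f: "bij_betw f (pverts G) (pverts G')"
    and arc: "\<And>u v. u \<in> pverts G \<Longrightarrow> v \<in> pverts G \<Longrightarrow> (u, v) \<in> parcs G \<longleftrightarrow> (f u, f v) \<in> parcs G'"
  shows "digraph_iso (with_proj G) (with_proj G')"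
proof -
  let ?h = "\<lparr>iso_verts = f, iso_arcs = map_prod f f, iso_head = snd, iso_tail = fst\<rparr>"
  have inj: "inj_on f (pverts G)" and im: "f ` pverts G = pverts G'" using f by (auto simp: bij_betw_def)
  have "wf_digraph (with_proj G)" using assms(1) by unfold_locales auto
  moreover have "inj_on (map_prod f f) (parcs G)"
    using map_prod_inj_on[OF inj inj] assms(1) by (rule inj_on_subset)
  ultimately have "pre_digraph.digraph_isomorphism (with_proj G) ?h"
    using inj by (simp add: pre_digraph.digraph_isomorphism_def)
  moreover have "map_prod f f ` parcs G = parcs G'"
  proof
    show "map_prod f f ` parcs G \<subseteq> parcs G'" using assms(1) arc by auto
    show "parcs G' \<subseteq> map_prod f f ` parcs G"
    proof clarify
      fix x y assume xy: "(x, y) \<in> parcs G'"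
      then have "x \<in> f ` pverts G" "y \<in> f ` pverts G" using assms(2) im by auto
      then obtain u v where "u \<in> pverts G" "v \<in> pverts G" "x = f u" "y = f v" by blast
      then show "(x, y) \<in> map_prod f f ` parcs G" using arc xy by (intro image_eqI[of _ _ "(u, v)"]) simp_all
    qed
  qed
  then have "with_proj G' = app_iso ?h (with_proj G)"
    using im by (simp add: app_iso_def with_proj_def)
  ultimately show ?thesis unfolding digraph_iso_def by blast
qed

lemma digraph_iso_pairE:
  assumes "digraph_iso (with_proj G) (with_proj G')"
  obtains f where "bij_betw f (pverts G) (pverts G')"
    "\<And>u v. u \<in> pverts G \<Longrightarrow> v \<in> pverts G \<Longrightarrow> (u, v) \<in> parcs G \<longleftrightarrow> (f u, f v) \<in> parcs G'"
proof -
  obtain h where h: "pre_digraph.digraph_isomorphism (with_proj G) h" "with_proj G' = app_iso h (with_proj G)"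
    using assms by (auto simp: digraph_iso_def)
  let ?f = "iso_verts h"
  have wf: "wf_digraph (with_proj G)" and inj: "inj_on ?f (pverts G)"
    and ht: "\<And>a. a \<in> parcs G \<Longrightarrow> ?f (fst a) = iso_tail h (iso_arcs h a)" "\<And>a. a \<in> parcs G \<Longrightarrow> ?f (snd a) = iso_head h (iso_arcs h a)"
    using h(1) by (simp_all add: pre_digraph.digraph_isomorphism_def)
  have V: "pverts G' = ?f ` pverts G" and E: "parcs G' = iso_arcs h ` parcs G" and hd: "iso_tail h = fst" "iso_head h = snd"
    using h(2) by (simp_all add: app_iso_def with_proj_def)
  have arcs: "iso_arcs h a = (?f (fst a), ?f (snd a))" if "a \<in> parcs G" for a
    using ht[OF that] by (simp add: hd)
  have "(u, v) \<in> parcs G \<longleftrightarrow> (?f u, ?f v) \<in> parcs G'" if uv: "u \<in> pverts G" "v \<in> pverts G" for u v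
  proof
    assume "(u, v) \<in> parcs G"
    then show "(?f u, ?f v) \<in> parcs G'" unfolding E using arcs by force
  next
    assume "(?f u, ?f v) \<in> parcs G'"
    then obtain a where a: "a \<in> parcs G" "(?f u, ?f v) = iso_arcs h a" unfolding E by blast
    have "fst a \<in> pverts G" "snd a \<in> pverts G"
      using wf_digraph.tail_in_verts[OF wf, of a] wf_digraph.head_in_verts[OF wf, of a] a(1) by simp_all
    moreover have "?f u = ?f (fst a)" "?f v = ?f (snd a)" using a(2) arcs[OF a(1)] by simp_all
    ultimately have "u = fst a" "v = snd a" using inj uv by (simp_all add: inj_on_eq_iff)
    then show "(u, v) \<in> parcs G" using a(1) by simp
  qed
  moreover have "bij_betw ?f (pverts G) (pverts G')" using inj V by (simp add: bij_betw_def)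
  ultimately show ?thesis using that by blast
qed

section \<open>Transport of the assumptions and presentations over \<open>H\<close>\<close>

lemma cubic_edge_transitiveI:
  assumes g: "pair_graph G" and c: "Digraph_Component.connected (with_proj G)" and cub: "cubic G" and et: "edge_transitive G"
  shows "cubic_edge_transitive G"
proof -
  interpret pair_graph G by (rule g)
  show ?thesis
  proof
    show "finite (pverts G)" by (rule pair_finite_verts)
    show "parcs G \<subseteq> pverts G \<times> pverts G" using in_arcsD1 in_arcsD2 by auto
    show "(v, u) \<in> parcs G" if "(u, v) \<in> parcs G" for u v using that pair_sym_arcs by (auto simp: symmetric_def sym_def)
    show "(u, u) \<notin> parcs G" for u using pair_no_loops[of "(u, u)"] by auto
    show "pverts G \<noteq> {}" using c by (auto simp: connected_def strongly_connected_def)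
    show "edge_transitive G" by (rule et)
    show "card (parcs G `` {v}) = 3" if "v \<in> pverts G" for v
    proof -
      have "out_arcs (with_proj G) v = Pair v ` (parcs G `` {v})" by (auto simp: out_arcs_def)
      then have "out_degree (with_proj G) v = card (parcs G `` {v})" by (simp add: out_degree_def card_image inj_on_def)
      then show ?thesis using cub that by (simp add: cubic_def)
    qed
    fix U assume U: "U \<subseteq> pverts G" "U \<noteq> {}" and cl: "\<And>u v. u \<in> U \<Longrightarrow> (u, v) \<in> parcs G \<Longrightarrow> v \<in> U"
    obtain u where u: "u \<in> U" using U(2) by blast
    have "v \<in> U" if v: "v \<in> pverts G" for v
    proof -
      have "u \<rightarrow>\<^sup>*\<^bsub>with_proj (mk_symmetric (with_proj G))\<^esub> v"
        using c u v U(1) by (auto simp: connected_def strongly_connected_def)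
      then have "u \<rightarrow>\<^sup>*\<^bsub>with_proj G\<^esub> v" using reachable_mk_symmetric_eq[OF pair_sym_arcs] by simp
      then show ?thesis
      proof (induction rule: reachable_induct)
        case base show ?case by (rule u)
      next
        case (step x y) then show ?case using cl[of x y] by simp
      qed
    qed
    then show "U = pverts G" using U(1) by blast
  qed
qed

lemma edge_transitive_transport:
  assumes f: "bij_betw f (pverts G) (pverts G')"
    and arc: "\<And>u v. u \<in> pverts G \<Longrightarrow> v \<in> pverts G \<Longrightarrow> (u, v) \<in> parcs G \<longleftrightarrow> (f u, f v) \<in> parcs G'"
    and sub: "parcs G' \<subseteq> pverts G' \<times> pverts G'" and et: "edge_transitive G"
  shows "edge_transitive G'"
proof -
  let ?i = "inv_into (pverts G) f"
  have inv: "?i v \<in> pverts G" "f (?i v) = v" if "v \<in> pverts G'" for v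
    using f that by (auto simp: bij_betw_def intro: inv_into_into f_inv_into_f)
  have inv2: "?i (f v) = v" if "v \<in> pverts G" for v using f that by (simp add: bij_betw_def)
  have fV: "f v \<in> pverts G'" if "v \<in> pverts G" for v using f that by (auto simp: bij_betw_def)
  show ?thesis unfolding edge_transitive_def
  proof clarify
    fix u v x y assume uv: "(u, v) \<in> parcs G'" and xy: "(x, y) \<in> parcs G'"
    have V: "u \<in> pverts G'" "v \<in> pverts G'" "x \<in> pverts G'" "y \<in> pverts G'" using sub uv xy by auto
    have "(?i u, ?i v) \<in> parcs G" "(?i x, ?i y) \<in> parcs G" using arc uv xy inv V by simp_all
    then obtain a where a: "a \<in> graph_aut G" "{a (?i u), a (?i v)} = {?i x, ?i y}"
      using et unfolding edge_transitive_def by fastforce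
    let ?a = "restrict (\<lambda>w. f (a (?i w))) (pverts G')"
    have aV: "a w \<in> pverts G" if "w \<in> pverts G" for w using aut_closed[OF a(1) that] .
    have "bij_betw (f \<circ> (a \<circ> ?i)) (pverts G') (pverts G')"
      by (intro bij_betw_trans[OF _ f] bij_betw_trans[OF bij_betw_inv_into[OF f]] aut_bij[OF a(1)])
    then have "bij_betw ?a (pverts G') (pverts G')" by (subst bij_betw_restrict_eq) (simp add: comp_def)
    moreover have "(w, z) \<in> parcs G' \<longleftrightarrow> (?a w, ?a z) \<in> parcs G'" if "w \<in> pverts G'" "z \<in> pverts G'" for w z
    proof -
      have "(?a w, ?a z) \<in> parcs G' \<longleftrightarrow> (a (?i w), a (?i z)) \<in> parcs G" using that inv aV arc by simp
      also have "\<dots> \<longleftrightarrow> (?i w, ?i z) \<in> parcs G" using aut_arc[OF a(1)] inv that by blast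
      also have "\<dots> \<longleftrightarrow> (w, z) \<in> parcs G'" using arc[of "?i w" "?i z"] inv that by simp
      finally show ?thesis by simp
    qed
    ultimately have "?a \<in> graph_aut G'" by (simp add: graph_aut_def Bij_def)
    moreover have "{?a u, ?a v} = {x, y}"
    proof -
      have "{?a u, ?a v} = f ` {a (?i u), a (?i v)}" using V by simp
      also have "\<dots> = {x, y}" unfolding a(2) using inv V by simp
      finally show ?thesis .
    qed
    ultimately show "\<exists>f\<in>graph_aut G'. {f u, f v} = {x, y}" by blast
  qed
qed

lemma cubic_edge_transitive_transport:
  assumes G: "cubic_edge_transitive G" and f: "bij_betw f (pverts G) (pverts G')"
    and arc: "\<And>u v. u \<in> pverts G \<Longrightarrow> v \<in> pverts G \<Longrightarrow> (u, v) \<in> parcs G \<longleftrightarrow> (f u, f v) \<in> parcs G'"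
    and sub: "parcs G' \<subseteq> pverts G' \<times> pverts G'"
  shows "cubic_edge_transitive G'"
proof -
  interpret cubic_edge_transitive G by (rule G)
  have inj: "inj_on f (pverts G)" and im: "f ` pverts G = pverts G'" using f by (auto simp: bij_betw_def)
  have pre: "\<exists>u v. u \<in> pverts G \<and> v \<in> pverts G \<and> x = f u \<and> y = f v \<and> (u, v) \<in> parcs G" if xy: "(x, y) \<in> parcs G'" for x y
  proof -
    have "x \<in> f ` pverts G" "y \<in> f ` pverts G" using xy sub im by auto
    then obtain u v where "u \<in> pverts G" "v \<in> pverts G" "x = f u" "y = f v" by blast
    then show ?thesis using arc xy by blast
  qed
  show ?thesis
  proof
    show "finite (pverts G')" using fin im by (metis finite_imageI)
    show "parcs G' \<subseteq> pverts G' \<times> pverts G'" by (rule sub)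
    show "(y, x) \<in> parcs G'" if xy: "(x, y) \<in> parcs G'" for x y
    proof -
      obtain u v where uv: "u \<in> pverts G" "v \<in> pverts G" "x = f u" "y = f v" "(u, v) \<in> parcs G" using pre[OF xy] by blast
      then have "(v, u) \<in> parcs G" using sym by blast
      then show ?thesis using arc[of v u] uv by simp
    qed
    show "(x, x) \<notin> parcs G'" for x
    proof
      assume "(x, x) \<in> parcs G'"
      then obtain u v where "u \<in> pverts G" "v \<in> pverts G" "x = f u" "x = f v" "(u, v) \<in> parcs G" using pre by blast
      then show False using inj irrefl by (auto simp: inj_on_def)
    qed
    show "pverts G' \<noteq> {}" using ne im by blast
    show "edge_transitive G'" by (rule edge_transitive_transport[OF f arc sub et])
    show "card (parcs G' `` {x}) = 3" if x: "x \<in> pverts G'" for x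
    proof -
      obtain v where v: "v \<in> pverts G" "x = f v" using x im by blast
      have "parcs G' `` {x} = f ` (parcs G `` {v})"
      proof
        show "parcs G' `` {x} \<subseteq> f ` (parcs G `` {v})"
        proof
          fix y assume "y \<in> parcs G' `` {x}"
          then have "(x, y) \<in> parcs G'" by simp
          then obtain u w where "u \<in> pverts G" "w \<in> pverts G" "x = f u" "y = f w" "(u, w) \<in> parcs G" using pre by blast
          moreover from this have "u = v" using inj v by (simp add: inj_on_eq_iff)
          ultimately show "y \<in> f ` (parcs G `` {v})" by blast
        qed
        have "(f v, f w) \<in> parcs G'" if "(v, w) \<in> parcs G" for w using arc[of v w] arc_vert[OF that] that by simp
        then show "f ` (parcs G `` {v}) \<subseteq> parcs G' `` {x}" unfolding v(2) by blast
      qed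
      moreover have "inj_on f (parcs G `` {v})" by (rule inj_on_subset[OF inj]) (use arc_vert in blast)
      ultimately show ?thesis using deg[OF v(1)] by (simp add: card_image)
    qed
    fix U assume U: "U \<subseteq> pverts G'" "U \<noteq> {}" and cl: "\<And>u v. u \<in> U \<Longrightarrow> (u, v) \<in> parcs G' \<Longrightarrow> v \<in> U"
    have "{v \<in> pverts G. f v \<in> U} = pverts G"
    proof (rule conn)
      obtain x where "x \<in> U" using U(2) by blast
      moreover then obtain v where "v \<in> pverts G" "x = f v" using U(1) im by blast
      ultimately show "{v \<in> pverts G. f v \<in> U} \<noteq> {}" by blast
      fix u v assume u: "u \<in> {v \<in> pverts G. f v \<in> U}" and uv: "(u, v) \<in> parcs G"
      have v: "v \<in> pverts G" using arc_vert[OF uv] by blast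
      have "(f u, f v) \<in> parcs G'" using arc[of u v] u v uv by simp
      then show "v \<in> {v \<in> pverts G. f v \<in> U}" using cl[of "f u" "f v"] u v by simp
    qed blast
    then have "f ` pverts G \<subseteq> U" by blast
    then show "U = pverts G'" using U(1) im by simp
  qed
qed

lemma BiCay_arcs_subset:
  "parcs (BiCay H R L S) \<subseteq> pverts (BiCay H R L S) \<times> pverts (BiCay H R L S)"
  by (auto simp: BiCay_def)

text \<open>Base points \<open>u0\<close> and \<open>u1\<close> of the two orbits identify the
  vertices with two copies of \<open>H\<close>. Automorphisms act from the left but translations
  from the right, so \<open>h\<^sub>0\<close> and \<open>h\<^sub>1\<close> correspond to the images
  of the base points under the inverse of \<open>h\<close>.\<close>

lemma bi_cayley_presentation:
  assumes H: "group H" and G: "cubic_edge_transitive G" and bc: "bi_cayley_graph H G"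
  shows "\<exists>R L S. bicay_data H R L S \<and> digraph_iso (with_proj G) (with_proj (BiCay H R L S))"
proof -
  interpret H: group H by (rule H)
  interpret cubic_edge_transitive G by (rule G)
  let ?A = "aut_group G"
  obtain K where K: "subgroup K ?A" "?A\<lparr>carrier := K\<rparr> \<cong> H" "semiregular_two_orbits G K"
    using bc by (auto simp: bi_cayley_graph_def)
  let ?K = "?A\<lparr>carrier := K\<rparr>"
  have gK: "group ?K" by (rule subgroup.subgroup_is_group[OF K(1) A.is_group])
  have "H \<cong> ?K" using group.iso_sym[OF gK K(2)] .
  then obtain \<psi> where \<psi>: "\<psi> \<in> hom H ?K" "bij_betw \<psi> (carrier H) K" by (auto simp: is_iso_def iso_def)
  have \<psi>_one: "\<psi> \<one>\<^bsub>H\<^esub> = \<one>\<^bsub>?A\<^esub>"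
    using group_hom.hom_one[of H ?K \<psi>] \<psi>(1) gK H by (simp add: group_hom_def group_hom_axioms_def)
  have \<psi>K: "\<psi> h \<in> K" if "h \<in> carrier H" for h using that \<psi>(2) by (auto simp: bij_betw_def)
  have \<psi>a: "\<psi> h \<in> graph_aut G" if "h \<in> carrier H" for h using subgroup.mem_carrier[OF K(1) \<psi>K[OF that]] by simp
  have \<psi>mult: "\<psi> (g \<otimes>\<^bsub>H\<^esub> h) v = \<psi> g (\<psi> h v)" if "g \<in> carrier H" "h \<in> carrier H" "v \<in> pverts G" for g h v
    using that hom_mult[OF \<psi>(1), of g h] \<psi>a by (simp add: aut_mult_app)
  have \<psi>one: "\<psi> \<one>\<^bsub>H\<^esub> v = v" if "v \<in> pverts G" for v using that by (simp add: \<psi>_one aut_one_app)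
  have \<psi>V: "\<psi> h v \<in> pverts G" if "h \<in> carrier H" "v \<in> pverts G" for h v using aut_closed[OF \<psi>a] that by blast
  have \<psi>inv: "\<psi> (inv\<^bsub>H\<^esub> h) (\<psi> h v) = v" "\<psi> h (\<psi> (inv\<^bsub>H\<^esub> h) v) = v" if "h \<in> carrier H" "v \<in> pverts G" for h v
    using that \<psi>one by (simp_all flip: \<psi>mult)
  have free: "h = \<one>\<^bsub>H\<^esub>" if h: "h \<in> carrier H" "v \<in> pverts G" "\<psi> h v = v" for h v
  proof -
    have "\<psi> h \<in> stabilizer ?K (\<lambda>f. f) v" using h \<psi>K by (simp add: stabilizer_def)
    then have "\<psi> h = \<one>\<^bsub>?A\<^esub>" using K(3) h(2) by (auto simp: semiregular_two_orbits_def)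
    then have "\<psi> h = \<psi> \<one>\<^bsub>H\<^esub>" using \<psi>_one by simp
    then show ?thesis using \<psi>(2) h(1) by (auto simp: bij_betw_def inj_on_def)
  qed
  define Orb where "Orb v = Group_Action.orbit ?K (\<lambda>f. f) v" for v
  have Orb: "Orb v = (\<lambda>h. \<psi> h v) ` carrier H" for v
    using \<psi>(2) by (auto simp: Orb_def Group_Action.orbit_def bij_betw_def)
  have orbs: "orbits ?K (pverts G) (\<lambda>f. f) = Orb ` pverts G" by (auto simp: orbits_def Orb_def)
  have "card (Orb ` pverts G) = 2" using K(3) orbs by (simp add: semiregular_two_orbits_def)
  then obtain O0 O1 where O: "Orb ` pverts G = {O0, O1}" "O0 \<noteq> O1" by (meson card_2_iff)
  have "O0 \<in> Orb ` pverts G" "O1 \<in> Orb ` pverts G" using O by auto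
  then obtain u0 u1 where u: "u0 \<in> pverts G" "u1 \<in> pverts G" "O0 = Orb u0" "O1 = Orb u1" by blast
  have self: "v \<in> Orb v" if "v \<in> pverts G" for v unfolding Orb using \<psi>one[OF that] by (intro image_eqI[of _ _ "\<one>\<^bsub>H\<^esub>"]) simp_all
  have same: "Orb v = Orb w" if v: "v \<in> Orb w" and w: "w \<in> pverts G" for v w
  proof -
    obtain h where h: "h \<in> carrier H" "v = \<psi> h w" using v by (auto simp: Orb)
    have "\<psi> g v \<in> Orb w" if "g \<in> carrier H" for g
      unfolding Orb h(2) using h(1) w that \<psi>mult by (intro image_eqI[of _ _ "g \<otimes>\<^bsub>H\<^esub> h"]) simp_all
    moreover have "\<psi> g w \<in> Orb v" if g: "g \<in> carrier H" for g
    proof -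
      have "\<psi> g w = \<psi> (g \<otimes>\<^bsub>H\<^esub> inv\<^bsub>H\<^esub> h) v" using h g w \<psi>V by (simp add: \<psi>mult \<psi>inv)
      then show ?thesis unfolding Orb using g h(1) by (intro image_eqI[of _ _ "g \<otimes>\<^bsub>H\<^esub> inv\<^bsub>H\<^esub> h"]) simp_all
    qed
    ultimately show ?thesis unfolding Orb by blast
  qed
  define F where "F x = (case x of Inl h \<Rightarrow> \<psi> (inv\<^bsub>H\<^esub> h) u0 | Inr h \<Rightarrow> \<psi> (inv\<^bsub>H\<^esub> h) u1)" for x
  define R where "R = {r \<in> carrier H. (u0, \<psi> (inv\<^bsub>H\<^esub> r) u0) \<in> parcs G}"
  define L where "L = {r \<in> carrier H. (u1, \<psi> (inv\<^bsub>H\<^esub> r) u1) \<in> parcs G}"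
  define S where "S = {r \<in> carrier H. (u0, \<psi> (inv\<^bsub>H\<^esub> r) u1) \<in> parcs G}"
  have shift: "(\<psi> (inv\<^bsub>H\<^esub> h) x, \<psi> (inv\<^bsub>H\<^esub> g) y) \<in> parcs G \<longleftrightarrow> (x, \<psi> (inv\<^bsub>H\<^esub> (g \<otimes>\<^bsub>H\<^esub> inv\<^bsub>H\<^esub> h)) y) \<in> parcs G"
    if "h \<in> carrier H" "g \<in> carrier H" "x \<in> pverts G" "y \<in> pverts G" for g h x y
  proof -
    have "(\<psi> (inv\<^bsub>H\<^esub> h) x, \<psi> (inv\<^bsub>H\<^esub> g) y) \<in> parcs G \<longleftrightarrow>
        (\<psi> h (\<psi> (inv\<^bsub>H\<^esub> h) x), \<psi> h (\<psi> (inv\<^bsub>H\<^esub> g) y)) \<in> parcs G"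
      using aut_arc[OF \<psi>a[OF that(1)]] that \<psi>V by simp
    also have "\<psi> h (\<psi> (inv\<^bsub>H\<^esub> h) x) = x" using that by (simp add: \<psi>inv)
    also have "\<psi> h (\<psi> (inv\<^bsub>H\<^esub> g) y) = \<psi> (inv\<^bsub>H\<^esub> (g \<otimes>\<^bsub>H\<^esub> inv\<^bsub>H\<^esub> h)) y" using that by (simp add: H.inv_mult_group \<psi>mult)
    finally show ?thesis .
  qed
  have invc: "r \<in> carrier H \<Longrightarrow> (x, \<psi> (inv\<^bsub>H\<^esub> r) x) \<in> parcs G \<Longrightarrow> (x, \<psi> r x) \<in> parcs G" if x: "x \<in> pverts G" for r x
    using shift[of r "\<one>\<^bsub>H\<^esub>" x x] x sym \<psi>one[OF x] by simp
  have sym_set: "(\<lambda>x. inv\<^bsub>H\<^esub> x) ` {r \<in> carrier H. (x, \<psi> (inv\<^bsub>H\<^esub> r) x) \<in> parcs G} = {r \<in> carrier H. (x, \<psi> (inv\<^bsub>H\<^esub> r) x) \<in> parcs G}" (is "_ ` ?X = _") if x: "x \<in> pverts G" for x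
  proof -
    have m: "inv\<^bsub>H\<^esub> r \<in> ?X" if "r \<in> ?X" for r using that invc[OF x, of r] by simp
    have "r \<in> (\<lambda>x. inv\<^bsub>H\<^esub> x) ` ?X" if r: "r \<in> ?X" for r
    proof (rule image_eqI)
      show "r = inv\<^bsub>H\<^esub> (inv\<^bsub>H\<^esub> r)" using r by simp
    qed (rule m[OF r])
    moreover have "(\<lambda>x. inv\<^bsub>H\<^esub> x) ` ?X \<subseteq> ?X" by (rule image_subsetI) (rule m)
    ultimately show ?thesis by (intro equalityI subsetI) (erule subsetD)
  qed
  have data: "bicay_data H R L S"
    unfolding bicay_data_def using sym_set[OF u(1)] sym_set[OF u(2)] irrefl u \<psi>one by (auto simp: R_def L_def S_def)
  let ?B = "BiCay H R L S"
  have VB: "pverts ?B = carrier H <+> carrier H" by (simp add: BiCay_def)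
  have FV: "F x \<in> pverts G" if "x \<in> pverts ?B" for x using that u \<psi>V by (auto simp: VB F_def)
  have disj: "\<psi> h u0 \<noteq> \<psi> g u1" if hg: "h \<in> carrier H" "g \<in> carrier H" for h g
  proof
    assume "\<psi> h u0 = \<psi> g u1"
    then have "\<psi> h u0 \<in> Orb u1" unfolding Orb using hg(2) by (rule image_eqI)
    moreover have "\<psi> h u0 \<in> Orb u0" unfolding Orb using hg(1) by (rule imageI)
    ultimately have "Orb u0 = Orb u1" using same u by blast
    then show False using O u by simp
  qed
  have injH: "h = g" if hg: "h \<in> carrier H" "g \<in> carrier H" "x \<in> pverts G" "\<psi> (inv\<^bsub>H\<^esub> h) x = \<psi> (inv\<^bsub>H\<^esub> g) x" for h g x
  proof -
    have "\<psi> (g \<otimes>\<^bsub>H\<^esub> inv\<^bsub>H\<^esub> h) x = x" using hg by (simp add: \<psi>mult \<psi>inv)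
    then have "g \<otimes>\<^bsub>H\<^esub> inv\<^bsub>H\<^esub> h = \<one>\<^bsub>H\<^esub>" using free[OF _ hg(3)] hg by simp
    then show ?thesis using hg H.inv_equality[of g "inv\<^bsub>H\<^esub> h"] by simp
  qed
  have "inj_on F (pverts ?B)"
  proof (rule inj_onI)
    fix x y assume "x \<in> pverts ?B" "y \<in> pverts ?B" "F x = F y"
    then show "x = y" using injH u disj disj[symmetric] by (auto simp: VB F_def)
  qed
  moreover have "F ` pverts ?B = pverts G"
  proof
    show "F ` pverts ?B \<subseteq> pverts G" using FV by blast
    show "pverts G \<subseteq> F ` pverts ?B"
    proof
      fix v assume v: "v \<in> pverts G"
      then have "Orb v \<in> {O0, O1}" using O(1) by blast
      then have "v \<in> Orb u0 \<or> v \<in> Orb u1" using self[OF v] u by auto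
      then consider h where "h \<in> carrier H" "v = \<psi> h u0" | h where "h \<in> carrier H" "v = \<psi> h u1" by (auto simp: Orb)
      then show "v \<in> F ` pverts ?B"
      proof cases
        case (1 h) then show ?thesis by (intro image_eqI[of _ _ "Inl (inv\<^bsub>H\<^esub> h)"]) (simp_all add: VB F_def InlI)
      next
        case (2 h) then show ?thesis by (intro image_eqI[of _ _ "Inr (inv\<^bsub>H\<^esub> h)"]) (simp_all add: VB F_def InrI)
      qed
    qed
  qed
  ultimately have bij: "bij_betw F (pverts ?B) (pverts G)" by (simp add: bij_betw_def)
  have arc: "(x, y) \<in> parcs ?B \<longleftrightarrow> (F x, F y) \<in> parcs G" if xy: "x \<in> pverts ?B" "y \<in> pverts ?B" for x y
  proof -
    have s: "(a, b) \<in> parcs G \<longleftrightarrow> (b, a) \<in> parcs G" for a b using sym by blast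
    show ?thesis
    proof (cases x; cases y)
      fix h g assume e: "x = Inl h" "y = Inl g"
      then show ?thesis using xy u shift[of h g u0 u0] by (simp add: VB F_def) (auto simp: BiCay_def R_def)
    next
      fix h g assume e: "x = Inr h" "y = Inr g"
      then show ?thesis using xy u shift[of h g u1 u1] by (simp add: VB F_def) (auto simp: BiCay_def L_def)
    next
      fix h g assume e: "x = Inl h" "y = Inr g"
      then show ?thesis using xy u shift[of h g u0 u1] by (simp add: VB F_def) (auto simp: BiCay_def S_def)
    next
      fix h g assume e: "x = Inr h" "y = Inl g"
      then show ?thesis using xy u shift[of g h u0 u1] s[of "F x" "F y"] by (simp add: VB F_def) (auto simp: BiCay_def S_def)
    qed
  qed
  have "digraph_iso (with_proj ?B) (with_proj G)"
    by (rule digraph_iso_pairI[OF BiCay_arcs_subset arcs bij arc])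
  moreover have "wf_digraph (with_proj ?B)" using BiCay_arcs_subset[of H R L S] by unfold_locales auto
  ultimately have "digraph_iso (with_proj G) (with_proj ?B)" by (rule digraph_iso_swap[rotated])
  then show ?thesis using data by blast
qed

section \<open>The Gray graph and the main theorem\<close>

lemma ex_label: "(\<exists>l. Q l) \<longleftrightarrow> Q L0 \<or> Q L1 \<or> Q L2"
  by (metis label.exhaust)

text \<open>Normal form of a state under the relations \<open>a\<^sup>3 = k\<^sup>i\<close>,
  \<open>b\<^sup>3 = k\<^sup>-\<^sup>i\<close> and \<open>k\<^sup>3 = 1\<close>, which define the
  group of order 27.\<close>

definition canon :: "int \<Rightarrow> int \<times> int \<times> int \<Rightarrow> int \<times> int \<times> int" where
  "canon i w = (case w of (m, n, t) \<Rightarrow> (m mod 3, n mod 3, (t + i * (m div 3) - i * (n div 3)) mod 3))"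

definition triples :: "(int \<times> int \<times> int) list" where
  "triples = List.product [0, 1, 2] (List.product [0, 1, 2] [0, 1, 2])"

text \<open>A line is coded by its direction and its two constant coordinates. Direction 3 is an
  error value for points that do not fill a line.\<close>

definition line_form :: "int \<times> int \<times> int \<Rightarrow> int \<times> int \<times> int \<Rightarrow> int \<times> int \<times> int \<Rightarrow> int \<times> int \<times> int" where
  "line_form p q r = (case (p, q, r) of ((p1, p2, p3), (q1, q2, q3), (r1, r2, r3)) \<Rightarrow>
     if p2 = q2 \<and> q2 = r2 \<and> p3 = q3 \<and> q3 = r3 \<and> p1 \<noteq> q1 \<and> q1 \<noteq> r1 \<and> p1 \<noteq> r1 then (0, p2, p3)
     else if p1 = q1 \<and> q1 = r1 \<and> p3 = q3 \<and> q3 = r3 \<and> p2 \<noteq> q2 \<and> q2 \<noteq> r2 \<and> p2 \<noteq> r2 then (1, p1, p3)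
     else if p1 = q1 \<and> q1 = r1 \<and> p2 = q2 \<and> q2 = r2 \<and> p3 \<noteq> q3 \<and> q3 \<noteq> r3 \<and> p3 \<noteq> r3 then (2, p1, p2)
     else (3, 0, 0))"

definition point_on :: "(int \<times> int \<times> int \<Rightarrow> int \<times> int \<times> int) \<Rightarrow> int \<Rightarrow> int \<times> int \<times> int \<Rightarrow> int \<times> int \<times> int" where
  "point_on X i w = (case X (canon i w) of (x, y, z) \<Rightarrow> (x mod 3, y mod 3, z mod 3))"

text \<open>A vertex of the half without points is sent to the line filled by its three neighbours,
  so incidence holds by construction.\<close>

definition line_on :: "(int \<times> int \<times> int \<Rightarrow> int \<times> int \<times> int) \<Rightarrow> int \<Rightarrow> bool \<Rightarrow> int \<times> int \<times> int \<Rightarrow> int \<times> int \<times> int" where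
  "line_on X i e w = line_form (point_on X i (next_state L0 (\<not> e) w))
     (point_on X i (next_state L1 (\<not> e) w)) (point_on X i (next_state L2 (\<not> e) w))"

text \<open>Injectivity on points and on lines and the absence of the error value; by counting,
  nothing more has to be checked for an isomorphism.\<close>

definition gray_coordinates :: "(int \<times> int \<times> int \<Rightarrow> int \<times> int \<times> int) \<Rightarrow> int \<Rightarrow> bool \<Rightarrow> bool" where
  "gray_coordinates X i e \<longleftrightarrow> distinct (map (point_on X i) triples) \<and> distinct (map (line_on X i e) triples) \<and>
     list_all (\<lambda>w. fst (line_on X i e w) \<noteq> 3) triples"

text \<open>The two coordinate systems were found by a computer search for an isomorphism and interpolation;
  in the first one the points of the grid are the vertices in \<open>H\<^sub>0\<close>, in the second one those in \<open>H\<^sub>1\<close>.\<close>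

definition coords0 :: "int \<times> int \<times> int \<Rightarrow> int \<times> int \<times> int" where
  "coords0 w = (case w of (m, n, t) \<Rightarrow>
    (2 * t + m * n + 2 * m * n * n + m * m * n,
     2 * t + 2 * n + n * n + 2 * m * n + 2 * m * n * n + m * m + m * m * n,
     t + n * n + 2 * m + m * n * n + m * m + 2 * m * m * n))"

definition coords1 :: "int \<times> int \<times> int \<Rightarrow> int \<times> int \<times> int" where
  "coords1 w = (case w of (m, n, t) \<Rightarrow>
    (t + 2 * n * n + 2 * m * n + 2 * m * n * n + m * m + m * m * n,
     t + m + 2 * m * n * n + 2 * m * m + m * m * n,
     2 * t + n + 2 * n * n + 2 * m * n + m * n * n + 2 * m * m * n))"

lemma gray_coordinates: "gray_coordinates coords0 2 False" "gray_coordinates coords1 1 True"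
  by code_simp+

text \<open>The grid has coordinates in the numeral type \<open>3\<close>, whereas evaluation runs
  on the integers 0, 1, 2; this is the passage between them.\<close>

definition residue3 :: "int \<Rightarrow> 3" where
  "residue3 x = (if x = 0 then 0 else if x = 1 then 1 else 2)"

definition grid_point :: "int \<times> int \<times> int \<Rightarrow> gray_point" where
  "grid_point p = (case p of (x, y, z) \<Rightarrow> (residue3 x, residue3 y, residue3 z))"

definition grid_line :: "int \<times> int \<times> int \<Rightarrow> gray_point set" where
  "grid_line l = (case l of (d, y, z) \<Rightarrow>
     if d = 0 then lineX (residue3 y) (residue3 z) else if d = 1 then lineY (residue3 y) (residue3 z)
     else lineZ (residue3 y) (residue3 z))"

lemma residue3_inject: "x \<in> {0, 1, 2} \<Longrightarrow> y \<in> {0, 1, 2} \<Longrightarrow> residue3 x = residue3 y \<longleftrightarrow> x = y"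
  by (auto simp: residue3_def)

lemma residue3_surj: "{x, y, z} \<subseteq> {0, 1, 2} \<Longrightarrow> x \<noteq> y \<Longrightarrow> y \<noteq> z \<Longrightarrow> x \<noteq> z \<Longrightarrow> {residue3 x, residue3 y, residue3 z} = UNIV"
proof -
  assume a: "{x, y, z} \<subseteq> {0, 1, 2}" "x \<noteq> y" "y \<noteq> z" "x \<noteq> z"
  then have "card {residue3 x, residue3 y, residue3 z} = 3" by (simp add: residue3_inject)
  then show ?thesis by (intro card_eq_UNIV_imp_eq_UNIV) simp_all
qed

lemma triples_iff: "(x, y, z) \<in> set triples \<longleftrightarrow> x \<in> {0, 1, 2} \<and> y \<in> {0, 1, 2} \<and> z \<in> {0, 1, 2}"
  by (simp only: triples_def set_product mem_Sigma_iff list.set)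

lemma mod3_mem: "x mod 3 \<in> {0, 1, 2 :: int}"
  by simp presburger

lemma point_on_mem: "point_on X i w \<in> set triples"
proof -
  obtain x y z where "X (canon i w) = (x, y, z)" by (cases "X (canon i w)")
  then show ?thesis using mod3_mem by (simp only: point_on_def prod.case triples_iff)
qed

lemma grid_point_inject: "p \<in> set triples \<Longrightarrow> q \<in> set triples \<Longrightarrow> grid_point p = grid_point q \<longleftrightarrow> p = q"
  by (cases p; cases q) (simp only: triples_iff grid_point_def prod.case prod.inject residue3_inject)

lemma line_form:
  assumes "p \<in> set triples" "q \<in> set triples" "r \<in> set triples" and "fst (line_form p q r) \<noteq> 3"
  shows "grid_line (line_form p q r) = grid_point ` {p, q, r}"
    and "line_form p q r \<in> set triples"
proof -
  obtain p1 p2 p3 q1 q2 q3 r1 r2 r3 where e: "p = (p1, p2, p3)" "q = (q1, q2, q3)" "r = (r1, r2, r3)"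
    by (cases p, cases q, cases r)
  note m = assms(1-3)[unfolded e triples_iff]
  have LX: "lineX y z = {(x, y, z), (x', y, z), (x'', y, z)}" "lineY y z = {(y, x, z), (y, x', z), (y, x'', z)}"
    "lineZ y z = {(y, z, x), (y, z, x'), (y, z, x'')}" if U: "{x, x', x''} = UNIV" for x x' x'' y z
  proof -
    have "t = x \<or> t = x' \<or> t = x''" for t using UNIV_I[of t] unfolding U[symmetric] by blast
    then show "lineX y z = {(x, y, z), (x', y, z), (x'', y, z)}" "lineY y z = {(y, x, z), (y, x', z), (y, x'', z)}"
      "lineZ y z = {(y, z, x), (y, z, x'), (y, z, x'')}"
      by (auto simp: lineX_def lineY_def lineZ_def)
  qed
  consider (X) "p2 = q2" "q2 = r2" "p3 = q3" "q3 = r3" "p1 \<noteq> q1" "q1 \<noteq> r1" "p1 \<noteq> r1" "line_form p q r = (0, p2, p3)"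
    | (Y) "p1 = q1" "q1 = r1" "p3 = q3" "q3 = r3" "p2 \<noteq> q2" "q2 \<noteq> r2" "p2 \<noteq> r2" "line_form p q r = (1, p1, p3)"
    | (Z) "p1 = q1" "q1 = r1" "p2 = q2" "q2 = r2" "p3 \<noteq> q3" "q3 \<noteq> r3" "p3 \<noteq> r3" "line_form p q r = (2, p1, p2)"
    using assms(4) unfolding e line_form_def prod.case by (simp split: if_splits)
  then have "grid_line (line_form p q r) = grid_point ` {p, q, r} \<and> line_form p q r \<in> set triples"
  proof cases
    case X
    then have "{residue3 p1, residue3 q1, residue3 r1} = UNIV" using m by (intro residue3_surj) simp_all
    from LX(1)[OF this] show ?thesis using m X by (simp add: e grid_line_def grid_point_def triples_iff)
  next
    case Y
    then have "{residue3 p2, residue3 q2, residue3 r2} = UNIV" using m by (intro residue3_surj) simp_all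
    from LX(2)[OF this] show ?thesis using m Y by (simp add: e grid_line_def grid_point_def triples_iff)
  next
    case Z
    then have "{residue3 p3, residue3 q3, residue3 r3} = UNIV" using m by (intro residue3_surj) simp_all
    from LX(3)[OF this] show ?thesis using m Z by (simp add: e grid_line_def grid_point_def triples_iff)
  qed
  then show "grid_line (line_form p q r) = grid_point ` {p, q, r}"
    and "line_form p q r \<in> set triples" by blast+
qed

lemma grid_line_inject:
  assumes "l \<in> set triples" "l' \<in> set triples" and "grid_line l = grid_line l'"
  shows "l = l'"
proof -
  obtain d y z d' y' z' where l: "l = (d, y, z)" "l' = (d', y', z')" by (cases l, cases l')
  note m = assms(1,2)[unfolded l triples_iff]
  have "d = d' \<and> residue3 y = residue3 y' \<and> residue3 z = residue3 z'"
    using m assms(3) unfolding l grid_line_def by (auto split: if_splits)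
  then show ?thesis using m residue3_inject[of y y'] residue3_inject[of z z'] unfolding l by (simp only: prod.inject)
qed

lemma grid_line_mem: "grid_line l \<in> gray_lines"
  by (simp add: grid_line_def split: prod.split)

context rotation_graph
begin

lemma pos_inject: "h \<in> carrier H \<Longrightarrow> h' \<in> carrier H \<Longrightarrow> pos e h = pos e' h' \<longleftrightarrow> e = e' \<and> h = h'"
  by (auto simp: pos_def)

text \<open>The relations make elements of \<open>H\<close> correspond to normalised states, so the
  finite check carries over to the vertices. Each line vertex is adjacent to exactly the points of
  its line, because the line was defined through its neighbours.\<close>

lemma gray_iso:
  assumes rel: "\<And>m n t. M.nf m n t = \<one> \<longleftrightarrow> 3 dvd m \<and> 3 dvd n \<and> 3 dvd t + i * (m div 3) - i * (n div 3)"
    and coords: "gray_coordinates X i e"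
  shows "digraph_iso (with_proj B) (with_proj gray_graph)"
proof -
  let ?P = "point_on X i" and ?L = "line_on X i e"
  have elt_eq: "elt w = elt w' \<longleftrightarrow> canon i w = canon i w'" for w w'
  proof -
    obtain m n t m' n' t' where w: "w = (m, n, t)" "w' = (m', n', t')" by (cases w, cases w')
    have el: "elt w = elt w' \<longleftrightarrow> 3 dvd m - m' \<and> 3 dvd n - n' \<and>
        3 dvd t - t' + (n - n') * m' + i * ((m - m') div 3) - i * ((n - n') div 3)"
      unfolding w elt_def prod.case M.nf_eq_iff[of m] rel ..
    have cn: "canon i w = canon i w' \<longleftrightarrow> 3 dvd m - m' \<and> 3 dvd n - n' \<and>
        3 dvd (t + i * (m div 3) - i * (n div 3)) - (t' + i * (m' div 3) - i * (n' div 3))"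
      by (simp only: w canon_def prod.case prod.inject mod_eq_dvd_iff)
    have "(3 dvd m - m' \<and> 3 dvd n - n' \<and> 3 dvd t - t' + (n - n') * m' + i * ((m - m') div 3) - i * ((n - n') div 3))
        \<longleftrightarrow> canon i w = canon i w'"
    proof (cases "3 dvd m - m' \<and> 3 dvd n - n'")
      case True
      then obtain u v where uv: "m = m' + 3 * u" "n = n' + 3 * v" by (auto simp: dvd_def algebra_simps)
      have "t - t' + (n - n') * m' + i * ((m - m') div 3) - i * ((n - n') div 3) = t - t' + i * u - i * v + 3 * (v * m')"
        by (simp add: uv)
      moreover have "(t + i * (m div 3) - i * (n div 3)) - (t' + i * (m' div 3) - i * (n' div 3)) = t - t' + i * u - i * v"
        by (simp add: uv distrib_left)
      moreover have "3 dvd t - t' + i * u - i * v + 3 * (v * m') \<longleftrightarrow> 3 dvd t - t' + i * u - i * v"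
        by (rule dvd_add_left_iff) simp
      ultimately show ?thesis using True by (simp only: cn)
    next
      case False
      then show ?thesis using cn by blast
    qed
    then show ?thesis using el by (simp only:)
  qed
  have canon_mem: "canon i w \<in> set triples" for w
  proof -
    obtain m n t where "w = (m, n, t)" by (cases w)
    then show ?thesis using mod3_mem by (simp only: canon_def prod.case triples_iff)
  qed
  have canon_id: "canon i w = w" if "w \<in> set triples" for w
  proof -
    obtain m n t where w: "w = (m, n, t)" by (cases w)
    have "x mod 3 = x \<and> x div 3 = 0" if "x \<in> {0, 1, 2}" for x :: int using that by auto
    then show ?thesis using \<open>w \<in> set triples\<close> unfolding w triples_iff by (simp add: canon_def)
  qed
  have P_canon: "?P (canon i w) = ?P w" for w by (simp add: point_on_def canon_id canon_mem)
  have dP: "distinct (map ?P triples)" and dL: "distinct (map ?L triples)" and L3: "\<And>w. w \<in> set triples \<Longrightarrow> fst (?L w) \<noteq> 3"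
    using coords by (auto simp: gray_coordinates_def list_all_iff)
  have P_inj: "?P w = ?P w' \<longleftrightarrow> elt w = elt w'" for w w'
    using inj_onD[OF distinct_map[THEN iffD1, OF dP, THEN conjunct2], OF _ canon_mem canon_mem, of w w']
    by (auto simp: P_canon elt_eq) (metis P_canon)
  have L_inj: "w = w'" if "?L w = ?L w'" "w \<in> set triples" "w' \<in> set triples" for w w'
    using dL that by (auto simp: distinct_map inj_on_def)
  note Lp = line_form[OF point_on_mem point_on_mem point_on_mem, OF L3[unfolded line_on_def], folded line_on_def]
  \<comment> \<open>The normalised state of a group element.\<close>
  define rp where "rp h = (SOME w. w \<in> set triples \<and> elt w = h)" for h
  have rp: "rp h \<in> set triples \<and> elt (rp h) = h" if h: "h \<in> carrier H" for h
  proof -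
    obtain m n t where "h = M.nf m n t" using M.nf_all[OF h] by blast
    then have "h = elt (canon i (m, n, t))" using elt_eq[of "(m, n, t)" "canon i (m, n, t)"] by (simp add: canon_id canon_mem elt_def)
    then have "canon i (m, n, t) \<in> set triples \<and> elt (canon i (m, n, t)) = h" using canon_mem by simp
    then show ?thesis unfolding rp_def by (rule someI)
  qed
  have rp_elt: "rp (elt w) = w" if "w \<in> set triples" for w
    using rp[of "elt w"] elt_eq[of "rp (elt w)" w] canon_id[OF that] canon_id[of "rp (elt w)"] by simp
  define F where "F v = (let w = rp (case v of Inl h \<Rightarrow> h | Inr g \<Rightarrow> inv (s L0) \<otimes> g) in
    if isl v = (\<not> e) then Inl (grid_point (?P w)) else Inr (grid_line (?L w)))" for v
  have F: "F (pos e' (elt w)) = (if e' = e then Inl (grid_point (?P w)) else Inr (grid_line (?L w)))"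
    if "w \<in> set triples" for e' w
    using rp_elt[OF that] by (auto simp: F_def pos_def)
  have V: "\<exists>e' w. w \<in> set triples \<and> v = pos e' (elt w)" if v: "v \<in> pverts B" for v
  proof (cases rule: vertE[OF v])
    case (1 h)
    then show ?thesis using rp[of h] by (intro exI[of _ False] exI[of _ "rp h"]) (simp add: pos_def)
  next
    case (2 h)
    then show ?thesis using rp[of "inv (s L0) \<otimes> h"] by (intro exI[of _ True] exI[of _ "rp (inv (s L0) \<otimes> h)"]) (simp add: pos_def)
  qed
  have FV: "F v \<in> pverts gray_graph" if v: "v \<in> pverts B" for v
  proof -
    obtain e' w where "w \<in> set triples" "v = pos e' (elt w)" using V[OF v] by blast
    then show ?thesis using F grid_line_mem by simp
  qed
  have inj: "inj_on F (pverts B)"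
  proof (rule inj_onI)
    fix v v' assume v: "v \<in> pverts B" and v': "v' \<in> pverts B" and eq: "F v = F v'"
    obtain d w where w: "w \<in> set triples" "v = pos d (elt w)" using V[OF v] by blast
    obtain d' w' where w': "w' \<in> set triples" "v' = pos d' (elt w')" using V[OF v'] by blast
    have eq: "(if d = e then Inl (grid_point (?P w)) else Inr (grid_line (?L w))) =
        (if d' = e then Inl (grid_point (?P w')) else Inr (grid_line (?L w')))"
      using eq F w w' by simp
    then have "d = d'" by (auto split: if_splits)
    show "v = v'"
    proof (cases "d = e")
      case True
      then have "grid_point (?P w) = grid_point (?P w')" using eq \<open>d = d'\<close> by simp
      then have "elt w = elt w'" using grid_point_inject[OF point_on_mem point_on_mem] P_inj by blast
      then show ?thesis using w w' \<open>d = d'\<close> by simp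
    next
      case False
      then have "grid_line (?L w) = grid_line (?L w')" using eq \<open>d = d'\<close> by simp
      then have "?L w = ?L w'"
        using grid_line_inject[OF Lp(2)[OF w(1)] Lp(2)[OF w'(1)]] by blast
      then have "w = w'" using L_inj w w' by blast
      then show ?thesis using w w' \<open>d = d'\<close> by simp
    qed
  qed
  \<comment> \<open>This gives \<open>|H| = 27\<close>; with 54 vertices on both sides, injectivity
    of \<open>F\<close> makes it bijective.\<close>
  have "carrier H = elt ` set triples"
  proof
    show "carrier H \<subseteq> elt ` set triples" using rp by (metis imageI subsetI)
  qed auto
  moreover have "inj_on elt (set triples)" using elt_eq by (auto simp: inj_on_def canon_id)
  moreover have "distinct triples" "length triples = 27" by (simp_all add: triples_def distinct_product)
  then have "card (set triples) = 27" using distinct_card by fastforce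
  ultimately have "order H = 27" by (simp add: order_def card_image)
  then have "card (F ` pverts B) = card (pverts gray_graph)" using inj by (simp add: card_image card_verts card_gray_verts)
  then have "F ` pverts B = pverts gray_graph" using FV finite_gray(1) by (intro card_subset_eq) auto
  then have bij: "bij_betw F (pverts B) (pverts gray_graph)" using inj by (simp add: bij_betw_def)
  have pl: "(pos e (elt w), pos (\<not> e) (elt w')) \<in> parcs B \<longleftrightarrow> grid_point (?P w) \<in> grid_line (?L w')"
    if w: "w \<in> set triples" and w': "w' \<in> set triples" for w w'
  proof -
    have "(pos e (elt w), pos (\<not> e) (elt w')) \<in> parcs B \<longleftrightarrow> (pos (\<not> e) (elt w'), pos e (elt w)) \<in> parcs B"
      using sym by blast
    also have "\<dots> \<longleftrightarrow> (\<exists>l. pos e (elt w) = step l (pos (\<not> e) (elt w' \<otimes> \<one>)))" by (simp add: arc_step)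
    also have "\<dots> \<longleftrightarrow> (\<exists>l. elt w = elt (next_state l (\<not> e) w'))" by (simp only: step_pos one_closed) (simp add: pos_inject)
    also have "\<dots> \<longleftrightarrow> (\<exists>l. grid_point (?P w) = grid_point (?P (next_state l (\<not> e) w')))"
      unfolding P_inj[symmetric] grid_point_inject[OF point_on_mem point_on_mem] ..
    also have "\<dots> \<longleftrightarrow> grid_point (?P w) \<in> grid_line (?L w')"
      by (simp only: Lp(1)[OF w'] ex_label image_insert image_empty insert_iff empty_iff simp_thms)
    finally show ?thesis .
  qed
  have arc: "(v, v') \<in> parcs B \<longleftrightarrow> (F v, F v') \<in> parcs gray_graph" if vv: "v \<in> pverts B" "v' \<in> pverts B" for v v'
  proof -
    obtain d w where w: "w \<in> set triples" "v = pos d (elt w)" using V[OF vv(1)] by blast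
    obtain d' w' where w': "w' \<in> set triples" "v' = pos d' (elt w')" using V[OF vv(2)] by blast
    have same: "(pos c (elt w), pos c (elt w')) \<notin> parcs B" for c by (cases c) (simp_all add: pos_def arc_iff noR noL)
    show ?thesis
    proof (cases "d = d'")
      case True
      then show ?thesis using same F w w' by simp
    next
      case False
      then consider "d = e" "d' = (\<not> e)" | "d = (\<not> e)" "d' = e" by blast
      then show ?thesis
      proof cases
        case 1
        then show ?thesis using pl[OF w(1) w'(1)] F w w' by (simp add: grid_line_mem)
      next
        case 2
        have "(v, v') \<in> parcs B \<longleftrightarrow> (v', v) \<in> parcs B" using sym by blast
        then show ?thesis using 2 pl[OF w'(1) w(1)] F w w' by (simp add: grid_line_mem)
      qed
    qed
  qed
  show ?thesis
    by (rule digraph_iso_pairI[OF arcs _ bij arc]) (auto simp: gray_graph_def)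
qed

lemma gray_or_normal:
  "digraph_iso (with_proj B) (with_proj gray_graph) \<or> RT \<lhd> aut_group B"
proof (rule M.trichotomy)
  fix i assume i: "\<not> 3 dvd i"
    and rel: "\<And>m n t. M.nf m n t = \<one> \<longleftrightarrow> 3 dvd m \<and> 3 dvd n \<and> 3 dvd t + i * (m div 3) - i * (n div 3)"
  have rel': "M.nf m n t = \<one> \<longleftrightarrow> 3 dvd m \<and> 3 dvd n \<and> 3 dvd t + (i mod 3) * (m div 3) - (i mod 3) * (n div 3)" for m n t
  proof -
    have "(t + (i mod 3) * (m div 3) - (i mod 3) * (n div 3)) mod 3 = (t + i * (m div 3) - i * (n div 3)) mod 3"
      by (intro mod_add_cong mod_diff_cong mod_mult_cong) simp_all
    then show ?thesis unfolding rel dvd_eq_mod_eq_0 by (simp only:)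
  qed
  \<comment> \<open>The Gray graph is not vertex-transitive, so the half that carries the points is
    determined by \<open>i\<close>: it is \<open>H\<^sub>1\<close> for residue 1 and
    \<open>H\<^sub>0\<close> for residue 2.\<close>
  have "i mod 3 = 1 \<or> i mod 3 = 2" using i by presburger
  then show ?thesis
  proof
    assume "i mod 3 = 1"
    from gray_iso[OF rel'[unfolded this] gray_coordinates(2)] show ?thesis by (rule disjI1)
  next
    assume "i mod 3 = 2"
    from gray_iso[OF rel'[unfolded this] gray_coordinates(1)] show ?thesis by (rule disjI1)
  qed
next
  fix i assume "\<not> 3 dvd i" "\<And>m n t. M.nf m n t = \<one> \<longleftrightarrow> 3 dvd m \<and> 9 dvd m - n \<and> 3 dvd t + i * (n div 3)"
  from normal_if_mid[OF this] show ?thesis by (rule disjI2)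
next
  assume "\<And>m n t. M.nf m n t = \<one> \<Longrightarrow> 9 dvd m \<and> 9 dvd n"
  from normal_if_large[OF this] show ?thesis by (rule disjI2)
qed

end

lemma (in bicay) gray_or_normal_BiCay:
  assumes M: "metacyclic_p_group H p r n g" and na: "\<not> comm_group H"
  shows "p = 3 \<and> (digraph_iso (with_proj B) (with_proj gray_graph) \<or> normal_BiCay H R L S)"
proof -
  have p: "Factorial_Ring.prime p" "odd p" using M by (simp_all add: metacyclic_p_group_def metacyclic_p_group_axioms_def)
  have "\<not> 5 \<le> p" using no_large_prime[OF M na] by blast
  then have "p = 2 \<or> p = 3 \<or> p = 4" using prime_ge_2_nat[OF p(1)] by linarith
  then have p3: "p = 3" using p(2) by auto
  obtain s0 s1 s2 \<alpha> where s: "R = {}" "L = {}" "S = {s0, s1, s2}" "s0 \<noteq> s1" "s0 \<noteq> s2" "s1 \<noteq> s2"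
    and rot: "metacyclic_rotation H r n g (inv s0 \<otimes> s1) (inv s0 \<otimes> s2) \<alpha>"
    by (rule rotation_structure[OF M[unfolded p3] na])
  define s' where "s' l = (case l of L0 \<Rightarrow> s0 | L1 \<Rightarrow> s1 | L2 \<Rightarrow> s2)" for l
  have "labelled_bicay H R L S s'"
  proof (intro labelled_bicay.intro labelled_bicay_axioms.intro bicay_axioms s(1,2))
    show "S = range s'" unfolding s(3) UNIV_label by (simp add: s'_def)
    show "inj s'"
    proof (rule injI)
      fix x y assume "s' x = s' y"
      then show "x = y" using s by (cases x; cases y) (simp_all add: s'_def)
    qed
  qed
  then interpret rotation_graph H R L S s' r n g "inv s0 \<otimes> s1" "inv s0 \<otimes> s2" \<alpha>
    using rot by (intro rotation_graph.intro rotation_graph_axioms.intro) (simp_all add: s'_def)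
  show ?thesis using gray_or_normal p3 by (simp add: normal_BiCay_def)
qed

theorem theorem1p1:
  fixes p :: nat
    and H :: "('h, 'm) monoid_scheme"
    and \<Gamma> :: "'v pair_pre_digraph"
  assumes "Factorial_Ring.prime p" and "odd p"
    and "p_group p H" and "\<not> comm_group H" and "metacyclic H"
    and "pair_graph \<Gamma>" and "Digraph_Component.connected (with_proj \<Gamma>)" and "cubic \<Gamma>"
    and "edge_transitive \<Gamma>" and "bi_cayley_graph H \<Gamma>"
  shows "p = 3 \<and>
    (digraph_iso (with_proj \<Gamma>) (with_proj gray_graph) \<or> normal_bi_cayley_graph H \<Gamma>)"
proof -
  have H: "group H" using assms(3) by (simp add: p_group_def)
  obtain r n g where M: "metacyclic_p_group H p r n g"
    using metacyclic_imp_gens[OF assms(1,2,3,5)] by blast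
  have cet: "cubic_edge_transitive \<Gamma>" by (rule cubic_edge_transitiveI[OF assms(6-9)])
  \<comment> \<open>Stated for an arbitrary presentation, because normality of the abstract graph is
    required in all of them. If any one presentation leads to the Gray graph, the first alternative
    holds for \<open>\<Gamma>\<close> itself.\<close>
  have main: "p = 3 \<and> (digraph_iso (with_proj \<Gamma>) (with_proj gray_graph) \<or> normal_BiCay H R L S)"
    if RLS: "bicay_data H R L S" and iso: "digraph_iso (with_proj \<Gamma>) (with_proj (BiCay H R L S))" for R L S
  proof -
    obtain f where f: "bij_betw f (pverts \<Gamma>) (pverts (BiCay H R L S))"
      "\<And>u v. u \<in> pverts \<Gamma> \<Longrightarrow> v \<in> pverts \<Gamma> \<Longrightarrow> (u, v) \<in> parcs \<Gamma> \<longleftrightarrow> (f u, f v) \<in> parcs (BiCay H R L S)"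
      using digraph_iso_pairE[OF iso] by blast
    have "cubic_edge_transitive (BiCay H R L S)"
      by (rule cubic_edge_transitive_transport[OF cet f BiCay_arcs_subset])
    then interpret bicay H R L S using H RLS by (simp add: bicay_def bicay_axioms_def)
    show ?thesis using gray_or_normal_BiCay[OF M assms(4)] digraph_iso_trans[OF iso] by blast
  qed
  obtain R L S where RLS: "bicay_data H R L S" "digraph_iso (with_proj \<Gamma>) (with_proj (BiCay H R L S))"
    using bi_cayley_presentation[OF H cet assms(10)] by blast
  show ?thesis
    using main[OF RLS] main RLS unfolding normal_bi_cayley_graph_def by blast
qed

end
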